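(* Let $\mathrm{EQ}=\mathrm E'\circ\mathrm Q:\mathbf{RD}\to\mathbf{EQRD}$, $R\mapsto R^{eq}=(R^q)^e$, and let $\mathrm U_{eq}:\mathbf{EQRD}\to\mathbf{RD}$ be the forgetful (inclusion) 2-functor. Then the 2-adjunction $\mathrm{EQ}\dashv\mathrm U_{eq}$ is 2-monadic for the lax idempotent 2-monad $\mathrm T_{eq}=\mathrm T_e\circ\mathrm T_q$ on $\mathbf{RD}$. (That is, $\mathrm T_{eq}$ is lax idempotent and $\mathbf{EQRD}$ is equivalent to the 2-category $\mathrm T_{eq}\text{-}\mathbf{Alg}^{ps}$ of pseudoalgebras and pseudomorphisms.)
   Context: $\mathbf{Pos}$ is the category of posets and monotone maps. A relational doctrine consists of a category $\mathcal C$ (its base); a functor $R:(\mathcal C\times\mathcal C)^{op}\to\mathbf{Pos}$ (for $f:X\to A$, $g:Y\to B$ write $R_{f,g}:R(A,B)\to R(X,Y)$); elements $d_X\in R(X,X)$ with $d_X\le R_{f,f}(d_Y)$ for all $f:X\to Y$; monotone maps $;:R(X,Y)\times R(Y,Z)\to R(X,Z)$ with $R_{f,g}(\alpha);R_{g,h}(\beta)\le R_{f,h}(\alpha;\beta)$; monotone maps $(-)^\bot:R(X,Y)\to R(Y,X)$ with $(R_{f,g}(\alpha))^\bot\le R_{g,f}(\alpha^\bot)$; such that $;$ is associative with units $d$, $(\alpha;\beta)^\bot=\beta^\bot;\alpha^\bot$, $d_X^\bot=d_X$, $\alpha^{\bot\bot}=\alpha$. The graph of $f:X\to Y$ is $\Gamma_f=R_{f,\mathrm{id}_Y}(d_Y)\in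 R(X,Y)$. An $R$-equivalence relation on $X$ is $\rho\in R(X,X)$ with $d_X\le\rho$, $\rho^\bot\le\rho$, $\rho;\rho\le\rho$. A quotient arrow of $\rho$ is $q:X\to W$ with $\rho\le\Gamma_q;\Gamma_q^\bot$ such that for every $f:X\to Z$ with $\rho\le\Gamma_f;\Gamma_f^\bot$ there is a unique $h:W\to Z$ with $f=h\circ q$. It is effective if $\rho=\Gamma_q;\Gamma_q^\bot$, and descent if $d_W\le\Gamma_q^\bot;\Gamma_q$. $R$ has quotients if every $R$-equivalence relation admits an effective descent quotient arrow. The 2-category $\mathbf{RD}$: objects are relational doctrines; a 1-arrow $F:R\to S$ (bases $\mathcal C,\mathcal D$) is a pair of a functor $\widehat F:\mathcal C\to\mathcal D$ and a natural transformation with components $\overline F_{X,Y}:R(X,Y)\to S(\widehat FX,\widehat FY)$ strictly preserving $d$, $;$ and $(-)^\bot$; a 2-arrow $\theta:F\Rightarrow G$ is a natural transformation $\theta:\widehat F\to\widehat G$ with $\overline F_{X,Y}(\alpha)\le S_{\theta_X,\theta_Y}(\overline G_{X,Y}(\alpha))$. $\mathbf{QRD}$ is the sub-2-category (full on 2-arrows) of relational doctrines with quotients and 1-arrows $F$ preserving quotient arrows: if $q$ is a quotient arrow of $\rho$ on $X$ then $\widehat Fq$ is a quotient arrow of $\overline F_{X,X}(\rho)$. For parallel $f,g:X\to Y$ in the base of $R$, write $f\approx g$ if $d_X\le R_{f,g}(d_Y)$; $R$ is extensional if $f\approx g$ implies $f=g$. $\mathbf{EQRD}$ is the full sub-2-category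 of $\mathbf{QRD}$ on extensional relational doctrines with quotients. Intensional quotient completion: $\mathrm Q:\mathbf{RD}\to\mathbf{QRD}$ sends $R$ (base $\mathcal C$) to $R^q$, whose base has objects the pairs $(X,\rho)$ with $\rho$ an $R$-equivalence relation on $X$, and arrows $(X,\rho)\to(Y,\sigma)$ the arrows $f:X\to Y$ of $\mathcal C$ with $\rho\le R_{f,f}(\sigma)$; $R^q((X,\rho),(Y,\sigma))=\{\alpha\in R(X,Y)\mid\rho^\bot;\alpha;\sigma\le\alpha\}$; reindexing, composition and converse are those of $R$, and $d_{(X,\rho)}=\rho$. On 1-arrows, $\widehat{F^q}(X,\rho)=(\widehat FX,\overline F_{X,X}(\rho))$, $\widehat{F^q}f=\widehat Ff$, $\overline{F^q}(\alpha)=\overline F(\alpha)$; on 2-arrows $\theta^q_{(X,\rho)}=\theta_X$. $\mathrm Q$ is left (pseudo) 2-adjoint to the inclusion $\mathrm U_q:\mathbf{QRD}\to\mathbf{RD}$, with unit $E^R:R\to R^q$, $X\mapsto(X,d_X)$, $f\mapsto f$, $\alpha\mapsto\alpha$; it induces the 2-monad $\mathrm T_q=\mathrm U_q\circ\mathrm Q$. Extensional collapse: $R^e$ has base $\mathcal C/\!\approx$ (same objects, arrows are $\approx$-classes $[f]$), $R^e(X,Y)=R(X,Y)$, $R^e_{[f],[g]}=R_{f,g}$, with the relational operations of $R$; $\widehat{F^e}X=\widehat FX$, $\widehat{F^e}[f]=[\widehat Ff]$, $\overline{F^e}=\overline F$, $\theta^e_X=[\theta_X]$. This defines the 2-monad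 $\mathrm T_e$ on $\mathbf{RD}$ ($R\mapsto R^e$, unit $C^R:X\mapsto X,f\mapsto[f],\alpha\mapsto\alpha$), and restricts to $\mathrm E':\mathbf{QRD}\to\mathbf{EQRD}$, left 2-adjoint to the inclusion $\mathrm U_e'$. So $\mathrm U_{eq}=\mathrm U_q\circ\mathrm U_e'$, and $\mathrm T_{eq}$ carries the 2-monad structure induced by the composite 2-adjunction. A 2-monad $\mathrm T$ with unit $\eta$ and multiplication $\mu$ is lax idempotent if there are 2-arrows $\lambda^R:\mathrm T(\eta_R)\Rightarrow\eta_{\mathrm T R}$, natural in $R$, with $\lambda^R\eta_R=\mathrm{id}$ and $\mu_R\lambda^R=\mathrm{id}$ (whiskering). *)

theory Defs
  imports Main "HOL-Library.FuncSet"
begin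

section \<open>Strict 2-categories, 2-functors, 2-natural transformations\<close>

text \<open>1-cells and 2-cells carry their boundaries. \<open>Ob\<close>, \<open>Ar\<close>, \<open>Ce\<close> are carrier sets; all the
  operations are meaningful only on composable elements of the carriers.\<close>

record ('o, 'm, 'c) twocat =
  Ob :: "'o set"
  Ar :: "'m set"
  Dm :: "'m \<Rightarrow> 'o"
  Cd :: "'m \<Rightarrow> 'o"
  Ce :: "'c set"
  Src :: "'c \<Rightarrow> 'm"
  Trg :: "'c \<Rightarrow> 'm"
  One :: "'o \<Rightarrow> 'm"
  Cmp :: "'m \<Rightarrow> 'm \<Rightarrow> 'm"  (infixl "\<cdot>\<index>" 75)
  IdC :: "'m \<Rightarrow> 'c"
  VC :: "'c \<Rightarrow> 'c \<Rightarrow> 'c"  (infixl "\<bullet>\<index>" 65)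
  HC :: "'c \<Rightarrow> 'c \<Rightarrow> 'c"  (infixl "\<star>\<index>" 70)

definition hom1 :: "('o, 'm, 'c) twocat \<Rightarrow> 'o \<Rightarrow> 'o \<Rightarrow> 'm set" where
  "hom1 C X Y = {f \<in> Ar C. Dm C f = X \<and> Cd C f = Y}"

definition hom2 :: "('o, 'm, 'c) twocat \<Rightarrow> 'm \<Rightarrow> 'm \<Rightarrow> 'c set" where
  "hom2 C f g = {a \<in> Ce C. Src C a = f \<and> Trg C a = g}"

definition lwhisk :: "('o, 'm, 'c) twocat \<Rightarrow> 'm \<Rightarrow> 'c \<Rightarrow> 'c"  (infixr "\<rhd>\<index>" 72) where
  "lwhisk C g a = HC C (IdC C g) a"

definition rwhisk :: "('o, 'm, 'c) twocat \<Rightarrow> 'c \<Rightarrow> 'm \<Rightarrow> 'c"  (infixl "\<lhd>\<index>" 73) where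
  "rwhisk C a f = HC C a (IdC C f)"

locale two_category =
  fixes C :: "('o, 'm, 'c) twocat" (structure)
  assumes ar_bd: "f \<in> Ar C \<Longrightarrow> Dm C f \<in> Ob C \<and> Cd C f \<in> Ob C"
    and one_hom: "X \<in> Ob C \<Longrightarrow> One C X \<in> hom1 C X X"
    and cmp_hom: "f \<in> hom1 C X Y \<Longrightarrow> g \<in> hom1 C Y Z \<Longrightarrow> g \<cdot> f \<in> hom1 C X Z"
    and cmp_one: "f \<in> hom1 C X Y \<Longrightarrow> f \<cdot> One C X = f"
    and one_cmp: "f \<in> hom1 C X Y \<Longrightarrow> One C Y \<cdot> f = f"
    and cmp_assoc: "f \<in> hom1 C W X \<Longrightarrow> g \<in> hom1 C X Y \<Longrightarrow> h \<in> hom1 C Y Z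
        \<Longrightarrow> h \<cdot> (g \<cdot> f) = h \<cdot> g \<cdot> f"
    and ce_bd: "a \<in> Ce C \<Longrightarrow> Src C a \<in> Ar C \<and> Trg C a \<in> Ar C
        \<and> Dm C (Src C a) = Dm C (Trg C a) \<and> Cd C (Src C a) = Cd C (Trg C a)"
    and idc_hom: "f \<in> Ar C \<Longrightarrow> IdC C f \<in> hom2 C f f"
    and vc_hom: "a \<in> hom2 C f g \<Longrightarrow> b \<in> hom2 C g h \<Longrightarrow> b \<bullet> a \<in> hom2 C f h"
    and vc_idc: "a \<in> hom2 C f g \<Longrightarrow> a \<bullet> IdC C f = a"
    and idc_vc: "a \<in> hom2 C f g \<Longrightarrow> IdC C g \<bullet> a = a"
    and vc_assoc: "a \<in> hom2 C f g \<Longrightarrow> b \<in> hom2 C g h \<Longrightarrow> c \<in> hom2 C h k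
        \<Longrightarrow> c \<bullet> (b \<bullet> a) = c \<bullet> b \<bullet> a"
    and hc_hom: "a \<in> hom2 C f f' \<Longrightarrow> b \<in> hom2 C g g' \<Longrightarrow> f \<in> hom1 C X Y \<Longrightarrow> g \<in> hom1 C Y Z
        \<Longrightarrow> b \<star> a \<in> hom2 C (g \<cdot> f) (g' \<cdot> f')"
    and hc_one: "a \<in> hom2 C f f' \<Longrightarrow> f \<in> hom1 C X Y \<Longrightarrow> a \<star> IdC C (One C X) = a"
    and one_hc: "a \<in> hom2 C f f' \<Longrightarrow> f \<in> hom1 C X Y \<Longrightarrow> IdC C (One C Y) \<star> a = a"
    and hc_assoc: "a \<in> hom2 C f f' \<Longrightarrow> b \<in> hom2 C g g' \<Longrightarrow> c \<in> hom2 C h h'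
        \<Longrightarrow> f \<in> hom1 C W X \<Longrightarrow> g \<in> hom1 C X Y \<Longrightarrow> h \<in> hom1 C Y Z
        \<Longrightarrow> c \<star> (b \<star> a) = c \<star> b \<star> a"
    and hc_idc: "f \<in> hom1 C X Y \<Longrightarrow> g \<in> hom1 C Y Z \<Longrightarrow> IdC C g \<star> IdC C f = IdC C (g \<cdot> f)"
    and interchange: "a \<in> hom2 C f f' \<Longrightarrow> a' \<in> hom2 C f' f'' \<Longrightarrow> b \<in> hom2 C g g'
        \<Longrightarrow> b' \<in> hom2 C g' g'' \<Longrightarrow> f \<in> hom1 C X Y \<Longrightarrow> g \<in> hom1 C Y Z
        \<Longrightarrow> (b' \<bullet> b) \<star> (a' \<bullet> a) = b' \<star> a' \<bullet> b \<star> a"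

definition iso1 :: "('o, 'm, 'c) twocat \<Rightarrow> 'm \<Rightarrow> bool" where
  "iso1 C f \<longleftrightarrow> f \<in> Ar C \<and> (\<exists>g \<in> hom1 C (Cd C f) (Dm C f).
     g \<cdot>\<^bsub>C\<^esub> f = One C (Dm C f) \<and> f \<cdot>\<^bsub>C\<^esub> g = One C (Cd C f))"

definition iso2 :: "('o, 'm, 'c) twocat \<Rightarrow> 'c \<Rightarrow> bool" where
  "iso2 C a \<longleftrightarrow> a \<in> Ce C \<and> (\<exists>b \<in> hom2 C (Trg C a) (Src C a).
     b \<bullet>\<^bsub>C\<^esub> a = IdC C (Src C a) \<and> a \<bullet>\<^bsub>C\<^esub> b = IdC C (Trg C a))"

record ('o, 'm, 'c, 'o', 'm', 'c') twofun =
  F0 :: "'o \<Rightarrow> 'o'"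
  F1 :: "'m \<Rightarrow> 'm'"
  F2 :: "'c \<Rightarrow> 'c'"

definition fun_id :: "('o, 'm, 'c, 'o, 'm, 'c) twofun" where
  "fun_id = \<lparr>F0 = (\<lambda>X. X), F1 = (\<lambda>f. f), F2 = (\<lambda>a. a)\<rparr>"

definition fun_comp :: "('o', 'm', 'c', 'o'', 'm'', 'c'') twofun
    \<Rightarrow> ('o, 'm, 'c, 'o', 'm', 'c') twofun \<Rightarrow> ('o, 'm, 'c, 'o'', 'm'', 'c'') twofun" where
  "fun_comp G F =
     \<lparr>F0 = (\<lambda>X. F0 G (F0 F X)), F1 = (\<lambda>f. F1 G (F1 F f)), F2 = (\<lambda>a. F2 G (F2 F a))\<rparr>"

locale two_functor = C: two_category C + D: two_category D
  for C :: "('o, 'm, 'c) twocat" and D :: "('o', 'm', 'c') twocat" +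
  fixes F :: "('o, 'm, 'c, 'o', 'm', 'c') twofun"
  assumes F0_ob: "X \<in> Ob C \<Longrightarrow> F0 F X \<in> Ob D"
    and F1_hom: "f \<in> hom1 C X Y \<Longrightarrow> F1 F f \<in> hom1 D (F0 F X) (F0 F Y)"
    and F1_one: "X \<in> Ob C \<Longrightarrow> F1 F (One C X) = One D (F0 F X)"
    and F1_cmp: "f \<in> hom1 C X Y \<Longrightarrow> g \<in> hom1 C Y Z \<Longrightarrow> F1 F (g \<cdot>\<^bsub>C\<^esub> f) = F1 F g \<cdot>\<^bsub>D\<^esub> F1 F f"
    and F2_hom: "a \<in> hom2 C f g \<Longrightarrow> F2 F a \<in> hom2 D (F1 F f) (F1 F g)"
    and F2_idc: "f \<in> Ar C \<Longrightarrow> F2 F (IdC C f) = IdC D (F1 F f)"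
    and F2_vc: "a \<in> hom2 C f g \<Longrightarrow> b \<in> hom2 C g h \<Longrightarrow> F2 F (b \<bullet>\<^bsub>C\<^esub> a) = F2 F b \<bullet>\<^bsub>D\<^esub> F2 F a"
    and F2_hc: "a \<in> hom2 C f f' \<Longrightarrow> b \<in> hom2 C g g' \<Longrightarrow> f \<in> hom1 C X Y \<Longrightarrow> g \<in> hom1 C Y Z
        \<Longrightarrow> F2 F (b \<star>\<^bsub>C\<^esub> a) = F2 F b \<star>\<^bsub>D\<^esub> F2 F a"

locale two_natural = F: two_functor C D F + G: two_functor C D G
  for C :: "('o, 'm, 'c) twocat" and D :: "('o', 'm', 'c') twocat" and F and G +
  fixes n :: "'o \<Rightarrow> 'm'"
  assumes n_hom: "X \<in> Ob C \<Longrightarrow> n X \<in> hom1 D (F0 F X) (F0 G X)"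
    and n_nat1: "f \<in> hom1 C X Y \<Longrightarrow> F1 G f \<cdot>\<^bsub>D\<^esub> n X = n Y \<cdot>\<^bsub>D\<^esub> F1 F f"
    and n_nat2: "a \<in> hom2 C f g \<Longrightarrow> f \<in> hom1 C X Y
        \<Longrightarrow> F2 G a \<lhd>\<^bsub>D\<^esub> n X = n Y \<rhd>\<^bsub>D\<^esub> F2 F a"

definition two_natural_iso where
  "two_natural_iso C D F G n \<longleftrightarrow> two_natural C D F G n \<and> (\<forall>X \<in> Ob C. iso1 D (n X))"

definition two_equivalence where
  "two_equivalence C D K \<longleftrightarrow> two_functor C D K \<and>
     (\<exists>L u v. two_functor D C L
        \<and> two_natural_iso C C fun_id (fun_comp L K) u
        \<and> two_natural_iso D D (fun_comp K L) fun_id v)"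

section \<open>2-monads, lax idempotence, pseudoalgebras\<close>

locale two_monad = T: two_functor C C T
    + unit: two_natural C C fun_id T \<eta>
    + mult: two_natural C C "fun_comp T T" T \<mu>
  for C :: "('o, 'm, 'c) twocat" (structure) and T and \<eta> and \<mu> +
  assumes mult_assoc: "X \<in> Ob C \<Longrightarrow> \<mu> X \<cdot> F1 T (\<mu> X) = \<mu> X \<cdot> \<mu> (F0 T X)"
    and mult_unit: "X \<in> Ob C \<Longrightarrow> \<mu> X \<cdot> \<eta> (F0 T X) = One C (F0 T X)"
    and mult_T_unit: "X \<in> Ob C \<Longrightarrow> \<mu> X \<cdot> F1 T (\<eta> X) = One C (F0 T X)"

definition lax_idempotent where
  "lax_idempotent C T \<eta> \<mu> \<longleftrightarrow> two_monad C T \<eta> \<mu> \<and>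
     (\<exists>\<Lambda>. (\<forall>X \<in> Ob C. \<Lambda> X \<in> hom2 C (F1 T (\<eta> X)) (\<eta> (F0 T X)))
        \<and> (\<forall>X Y. \<forall>f \<in> hom1 C X Y. F1 T (F1 T f) \<rhd>\<^bsub>C\<^esub> \<Lambda> X = \<Lambda> Y \<lhd>\<^bsub>C\<^esub> F1 T f)
        \<and> (\<forall>X \<in> Ob C. \<Lambda> X \<lhd>\<^bsub>C\<^esub> \<eta> X = IdC C (\<eta> (F0 T X) \<cdot>\<^bsub>C\<^esub> \<eta> X))
        \<and> (\<forall>X \<in> Ob C. \<mu> X \<rhd>\<^bsub>C\<^esub> \<Lambda> X = IdC C (One C (F0 T X))))"

text \<open>A pseudoalgebra is \<open>a : T A \<rightarrow> A\<close> with invertible \<open>asc : a \<cdot> T a \<Rightarrow> a \<cdot> \<mu>\<close> and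
  \<open>unt : 1 \<Rightarrow> a \<cdot> \<eta>\<close>. A pseudomorphism is \<open>f : A \<rightarrow> B\<close> with invertible \<open>sq : b \<cdot> T f \<Rightarrow> f \<cdot> a\<close>.\<close>

record ('o, 'm, 'c) psalg =
  carr :: 'o
  str :: 'm
  asc :: 'c
  unt :: 'c

record ('o, 'm, 'c) psmor =
  pdom :: "('o, 'm, 'c) psalg"
  pcod :: "('o, 'm, 'c) psalg"
  und :: 'm
  sq :: 'c

record ('o, 'm, 'c) pscell =
  csrc :: "('o, 'm, 'c) psmor"
  ctrg :: "('o, 'm, 'c) psmor"
  ucell :: 'c

locale pseudoalgebra = two_monad C T \<eta> \<mu>
  for C :: "('o, 'm, 'c) twocat" (structure) and T and \<eta> and \<mu> +
  fixes A :: "('o, 'm, 'c) psalg"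
  assumes carr_ob: "carr A \<in> Ob C"
    and str_hom: "str A \<in> hom1 C (F0 T (carr A)) (carr A)"
    and asc_hom: "asc A \<in> hom2 C (str A \<cdot> F1 T (str A)) (str A \<cdot> \<mu> (carr A))"
    and asc_iso: "iso2 C (asc A)"
    and unt_hom: "unt A \<in> hom2 C (One C (carr A)) (str A \<cdot> \<eta> (carr A))"
    and unt_iso: "iso2 C (unt A)"
    and asc_coherence:
      "asc A \<lhd> F1 T (\<mu> (carr A)) \<bullet> str A \<rhd> F2 T (asc A)
         = asc A \<lhd> \<mu> (F0 T (carr A)) \<bullet> asc A \<lhd> F1 T (F1 T (str A))"
    and unt_coherence_T: "asc A \<lhd> F1 T (\<eta> (carr A)) \<bullet> str A \<rhd> F2 T (unt A) = IdC C (str A)"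
    and unt_coherence: "asc A \<lhd> \<eta> (F0 T (carr A)) \<bullet> unt A \<lhd> str A = IdC C (str A)"

locale pseudomorphism = dom: pseudoalgebra C T \<eta> \<mu> "pdom f" + cod: pseudoalgebra C T \<eta> \<mu> "pcod f"
  for C :: "('o, 'm, 'c) twocat" (structure) and T and \<eta> and \<mu>
    and f :: "('o, 'm, 'c) psmor" +
  assumes und_hom: "und f \<in> hom1 C (carr (pdom f)) (carr (pcod f))"
    and sq_hom: "sq f \<in> hom2 C (str (pcod f) \<cdot> F1 T (und f)) (und f \<cdot> str (pdom f))"
    and sq_iso: "iso2 C (sq f)"
    and sq_asc:
      "und f \<rhd> asc (pdom f) \<bullet> (sq f \<lhd> F1 T (str (pdom f)) \<bullet> str (pcod f) \<rhd> F2 T (sq f))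
         = sq f \<lhd> \<mu> (carr (pdom f)) \<bullet> asc (pcod f) \<lhd> F1 T (F1 T (und f))"
    and sq_unt: "sq f \<lhd> \<eta> (carr (pdom f)) \<bullet> unt (pcod f) \<lhd> und f = und f \<rhd> unt (pdom f)"

locale pseudocell = src: pseudomorphism C T \<eta> \<mu> "csrc t" + trg: pseudomorphism C T \<eta> \<mu> "ctrg t"
  for C :: "('o, 'm, 'c) twocat" (structure) and T and \<eta> and \<mu>
    and t :: "('o, 'm, 'c) pscell" +
  assumes parallel: "pdom (csrc t) = pdom (ctrg t)" "pcod (csrc t) = pcod (ctrg t)"
    and ucell_hom: "ucell t \<in> hom2 C (und (csrc t)) (und (ctrg t))"
    and ucell_sq: "sq (ctrg t) \<bullet> str (pcod (csrc t)) \<rhd> F2 T (ucell t)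
                     = ucell t \<lhd> str (pdom (csrc t)) \<bullet> sq (csrc t)"

definition psmor_id where
  "psmor_id C A = \<lparr>pdom = A, pcod = A, und = One C (carr A), sq = IdC C (str A)\<rparr>"

definition psmor_comp where
  "psmor_comp C T g f = \<lparr>pdom = pdom f, pcod = pcod g, und = und g \<cdot>\<^bsub>C\<^esub> und f,
     sq = und g \<rhd>\<^bsub>C\<^esub> sq f \<bullet>\<^bsub>C\<^esub> sq g \<lhd>\<^bsub>C\<^esub> F1 T (und f)\<rparr>"

definition PsAlg :: "('o, 'm, 'c) twocat \<Rightarrow> ('o, 'm, 'c, 'o, 'm, 'c) twofun
    \<Rightarrow> ('o \<Rightarrow> 'm) \<Rightarrow> ('o \<Rightarrow> 'm)
    \<Rightarrow> (('o, 'm, 'c) psalg, ('o, 'm, 'c) psmor, ('o, 'm, 'c) pscell) twocat" where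
  "PsAlg C T \<eta> \<mu> = \<lparr>
     Ob = {A. pseudoalgebra C T \<eta> \<mu> A},
     Ar = {f. pseudomorphism C T \<eta> \<mu> f}, Dm = pdom, Cd = pcod,
     Ce = {t. pseudocell C T \<eta> \<mu> t}, Src = csrc, Trg = ctrg,
     One = psmor_id C,
     Cmp = psmor_comp C T,
     IdC = (\<lambda>f. \<lparr>csrc = f, ctrg = f, ucell = IdC C (und f)\<rparr>),
     VC = (\<lambda>b a. \<lparr>csrc = csrc a, ctrg = ctrg b, ucell = ucell b \<bullet>\<^bsub>C\<^esub> ucell a\<rparr>),
     HC = (\<lambda>b a. \<lparr>csrc = psmor_comp C T (csrc b) (csrc a),
                   ctrg = psmor_comp C T (ctrg b) (ctrg a),
                   ucell = ucell b \<star>\<^bsub>C\<^esub> ucell a\<rparr>)\<rparr>"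

section \<open>Pseudo 2-adjunctions and 2-monadicity\<close>

text \<open>\<open>L\<close> is left pseudo 2-adjoint to \<open>U\<close> with 2-natural unit \<open>\<eta>\<close>: precomposition with \<open>\<eta> X\<close>
  is an equivalence of categories from \<open>D(L X, Y)\<close> to \<open>C(X, U Y)\<close>.\<close>

definition pseudo_adjunction where
  "pseudo_adjunction C D L U \<eta> \<longleftrightarrow>
     two_functor C D L \<and> two_functor D C U \<and> two_natural C C fun_id (fun_comp U L) \<eta> \<and>
     (\<forall>X \<in> Ob C. \<forall>Y \<in> Ob D.
        (\<forall>f \<in> hom1 C X (F0 U Y). \<exists>g \<in> hom1 D (F0 L X) Y.
           \<exists>i \<in> hom2 C (F1 U g \<cdot>\<^bsub>C\<^esub> \<eta> X) f. iso2 C i) \<and>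
        (\<forall>g \<in> hom1 D (F0 L X) Y. \<forall>g' \<in> hom1 D (F0 L X) Y.
           \<forall>a \<in> hom2 C (F1 U g \<cdot>\<^bsub>C\<^esub> \<eta> X) (F1 U g' \<cdot>\<^bsub>C\<^esub> \<eta> X).
             \<exists>!b. b \<in> hom2 D g g' \<and> F2 U b \<lhd>\<^bsub>C\<^esub> \<eta> X = a))"

text \<open>The counit of a pseudo 2-adjunction at \<open>Y\<close> is, up to a unique invertible 2-cell, a 1-cell
  \<open>e : L (U Y) \<rightarrow> Y\<close> of \<open>D\<close> with an invertible 2-cell \<open>1 \<Rightarrow> U e \<cdot> \<eta>\<close>. So a 2-monad on \<open>U L\<close> with
  unit \<open>\<eta>\<close> is induced by the adjunction when \<open>\<mu> X\<close> is \<open>U\<close> of a 1-cell of \<open>D\<close>: the 2-monad law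
  \<open>\<mu> X \<cdot> \<eta> (T X) = 1\<close> makes that 1-cell the counit at \<open>L X\<close>.\<close>

definition induced_two_monad where
  "induced_two_monad C D L U T \<eta> \<mu> \<longleftrightarrow>
     pseudo_adjunction C D L U \<eta> \<and> T = fun_comp U L \<and> two_monad C T \<eta> \<mu> \<and>
     (\<forall>X \<in> Ob C. \<exists>e \<in> hom1 D (F0 L (F0 U (F0 L X))) (F0 L X). \<mu> X = F1 U e)"

text \<open>Comparison 2-functors: \<open>K\<close> lies over \<open>C\<close>, the structure map of \<open>K Y\<close> is \<open>U\<close> of a counit
  at \<open>Y\<close> (with \<open>unt (K Y)\<close> as the invertible 2-cell above), and the remaining structure
  2-cells are images under \<open>U\<close> of 2-cells of \<open>D\<close>; the coherence axioms then determine them.\<close>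

definition comparison where
  "comparison C D L U T \<eta> \<mu> K \<longleftrightarrow>
     two_functor D (PsAlg C T \<eta> \<mu>) K \<and>
     (\<forall>Y \<in> Ob D. carr (F0 K Y) = F0 U Y
        \<and> str (F0 K Y) \<in> F1 U ` hom1 D (F0 L (F0 U Y)) Y
        \<and> asc (F0 K Y) \<in> F2 U ` Ce D) \<and>
     (\<forall>f \<in> Ar D. und (F1 K f) = F1 U f \<and> sq (F1 K f) \<in> F2 U ` Ce D) \<and>
     (\<forall>a \<in> Ce D. ucell (F2 K a) = F2 U a)"

definition two_monadic where
  "two_monadic C D L U T \<eta> \<mu> \<longleftrightarrow>
     induced_two_monad C D L U T \<eta> \<mu> \<and>
     (\<exists>K. comparison C D L U T \<eta> \<mu> K \<and> two_equivalence D (PsAlg C T \<eta> \<mu>) K)"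

section \<open>Relational doctrines\<close>

text \<open>Hom-sets and fibres are families of sets that need not be disjoint, so every operation takes
  the objects involved as arguments. \<open>Comp C X Y Z g f\<close> is \<open>g \<circ> f\<close> for
  \<open>f : X \<rightarrow> Y\<close>, \<open>g : Y \<rightarrow> Z\<close>.\<close>

record ('o, 'a) cat =
  Obj :: "'o set"
  Hom :: "'o \<Rightarrow> 'o \<Rightarrow> 'a set"
  Idn :: "'o \<Rightarrow> 'a"
  Comp :: "'o \<Rightarrow> 'o \<Rightarrow> 'o \<Rightarrow> 'a \<Rightarrow> 'a \<Rightarrow> 'a"

locale category =
  fixes C :: "('o, 'a, 'z) cat_scheme"
  assumes Hom_Obj: "f \<in> Hom C X Y \<Longrightarrow> X \<in> Obj C \<and> Y \<in> Obj C"
    and Idn_Hom: "X \<in> Obj C \<Longrightarrow> Idn C X \<in> Hom C X X"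
    and Comp_Hom: "f \<in> Hom C X Y \<Longrightarrow> g \<in> Hom C Y Z \<Longrightarrow> Comp C X Y Z g f \<in> Hom C X Z"
    and Comp_Idn: "f \<in> Hom C X Y \<Longrightarrow> Comp C X X Y f (Idn C X) = f"
    and Idn_Comp: "f \<in> Hom C X Y \<Longrightarrow> Comp C X Y Y (Idn C Y) f = f"
    and Comp_assoc: "f \<in> Hom C W X \<Longrightarrow> g \<in> Hom C X Y \<Longrightarrow> h \<in> Hom C Y Z
        \<Longrightarrow> Comp C W Y Z h (Comp C W X Y g f) = Comp C W X Z (Comp C X Y Z h g) f"

text \<open>\<open>Reix R X Y A B f g : R(A,B) \<rightarrow> R(X,Y)\<close> is reindexing along \<open>f : X \<rightarrow> A\<close>, \<open>g : Y \<rightarrow> B\<close>;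
  \<open>Seq R X Y Z \<alpha> \<beta>\<close> is \<open>\<alpha> ; \<beta>\<close> in diagrammatic order; \<open>Conv R X Y : R(X,Y) \<rightarrow> R(Y,X)\<close>.\<close>

record ('o, 'a, 'r) doctrine = "('o, 'a) cat" +
  Rel :: "'o \<Rightarrow> 'o \<Rightarrow> 'r set"
  Leq :: "'o \<Rightarrow> 'o \<Rightarrow> 'r \<Rightarrow> 'r \<Rightarrow> bool"
  Reix :: "'o \<Rightarrow> 'o \<Rightarrow> 'o \<Rightarrow> 'o \<Rightarrow> 'a \<Rightarrow> 'a \<Rightarrow> 'r \<Rightarrow> 'r"
  Diag :: "'o \<Rightarrow> 'r"
  Seq :: "'o \<Rightarrow> 'o \<Rightarrow> 'o \<Rightarrow> 'r \<Rightarrow> 'r \<Rightarrow> 'r"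
  Conv :: "'o \<Rightarrow> 'o \<Rightarrow> 'r \<Rightarrow> 'r"

locale relational_doctrine = category R
  for R :: "('o, 'a, 'r) doctrine" +
  assumes Rel_Obj: "\<alpha> \<in> Rel R X Y \<Longrightarrow> X \<in> Obj R \<and> Y \<in> Obj R"
    and Leq_refl: "\<alpha> \<in> Rel R X Y \<Longrightarrow> Leq R X Y \<alpha> \<alpha>"
    and Leq_trans: "\<alpha> \<in> Rel R X Y \<Longrightarrow> \<beta> \<in> Rel R X Y \<Longrightarrow> \<gamma> \<in> Rel R X Y
        \<Longrightarrow> Leq R X Y \<alpha> \<beta> \<Longrightarrow> Leq R X Y \<beta> \<gamma> \<Longrightarrow> Leq R X Y \<alpha> \<gamma>"
    and Leq_antisym: "\<alpha> \<in> Rel R X Y \<Longrightarrow> \<beta> \<in> Rel R X Y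
        \<Longrightarrow> Leq R X Y \<alpha> \<beta> \<Longrightarrow> Leq R X Y \<beta> \<alpha> \<Longrightarrow> \<alpha> = \<beta>"
    and Reix_Rel: "f \<in> Hom R X A \<Longrightarrow> g \<in> Hom R Y B \<Longrightarrow> \<alpha> \<in> Rel R A B
        \<Longrightarrow> Reix R X Y A B f g \<alpha> \<in> Rel R X Y"
    and Reix_mono: "f \<in> Hom R X A \<Longrightarrow> g \<in> Hom R Y B \<Longrightarrow> \<alpha> \<in> Rel R A B \<Longrightarrow> \<beta> \<in> Rel R A B
        \<Longrightarrow> Leq R A B \<alpha> \<beta> \<Longrightarrow> Leq R X Y (Reix R X Y A B f g \<alpha>) (Reix R X Y A B f g \<beta>)"
    and Reix_Idn: "\<alpha> \<in> Rel R X Y \<Longrightarrow> Reix R X Y X Y (Idn R X) (Idn R Y) \<alpha> = \<alpha>"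
    and Reix_Comp: "f \<in> Hom R X A \<Longrightarrow> f' \<in> Hom R A A' \<Longrightarrow> g \<in> Hom R Y B \<Longrightarrow> g' \<in> Hom R B B'
        \<Longrightarrow> \<alpha> \<in> Rel R A' B'
        \<Longrightarrow> Reix R X Y A' B' (Comp R X A A' f' f) (Comp R Y B B' g' g) \<alpha>
          = Reix R X Y A B f g (Reix R A B A' B' f' g' \<alpha>)"
    and Diag_Rel: "X \<in> Obj R \<Longrightarrow> Diag R X \<in> Rel R X X"
    and Diag_lax: "f \<in> Hom R X Y \<Longrightarrow> Leq R X X (Diag R X) (Reix R X X Y Y f f (Diag R Y))"
    and Seq_Rel: "\<alpha> \<in> Rel R X Y \<Longrightarrow> \<beta> \<in> Rel R Y Z \<Longrightarrow> Seq R X Y Z \<alpha> \<beta> \<in> Rel R X Z"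
    and Seq_mono: "\<alpha> \<in> Rel R X Y \<Longrightarrow> \<alpha>' \<in> Rel R X Y \<Longrightarrow> \<beta> \<in> Rel R Y Z \<Longrightarrow> \<beta>' \<in> Rel R Y Z
        \<Longrightarrow> Leq R X Y \<alpha> \<alpha>' \<Longrightarrow> Leq R Y Z \<beta> \<beta>'
        \<Longrightarrow> Leq R X Z (Seq R X Y Z \<alpha> \<beta>) (Seq R X Y Z \<alpha>' \<beta>')"
    and Seq_lax: "f \<in> Hom R X A \<Longrightarrow> g \<in> Hom R Y B \<Longrightarrow> h \<in> Hom R Z C
        \<Longrightarrow> \<alpha> \<in> Rel R A B \<Longrightarrow> \<beta> \<in> Rel R B C
        \<Longrightarrow> Leq R X Z (Seq R X Y Z (Reix R X Y A B f g \<alpha>) (Reix R Y Z B C g h \<beta>))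
                      (Reix R X Z A C f h (Seq R A B C \<alpha> \<beta>))"
    and Conv_Rel: "\<alpha> \<in> Rel R X Y \<Longrightarrow> Conv R X Y \<alpha> \<in> Rel R Y X"
    and Conv_mono: "\<alpha> \<in> Rel R X Y \<Longrightarrow> \<beta> \<in> Rel R X Y \<Longrightarrow> Leq R X Y \<alpha> \<beta>
        \<Longrightarrow> Leq R Y X (Conv R X Y \<alpha>) (Conv R X Y \<beta>)"
    and Conv_lax: "f \<in> Hom R X A \<Longrightarrow> g \<in> Hom R Y B \<Longrightarrow> \<alpha> \<in> Rel R A B
        \<Longrightarrow> Leq R Y X (Conv R X Y (Reix R X Y A B f g \<alpha>)) (Reix R Y X B A g f (Conv R A B \<alpha>))"
    and Seq_assoc: "\<alpha> \<in> Rel R W X \<Longrightarrow> \<beta> \<in> Rel R X Y \<Longrightarrow> \<gamma> \<in> Rel R Y Z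
        \<Longrightarrow> Seq R W X Z \<alpha> (Seq R X Y Z \<beta> \<gamma>) = Seq R W Y Z (Seq R W X Y \<alpha> \<beta>) \<gamma>"
    and Diag_Seq: "\<alpha> \<in> Rel R X Y \<Longrightarrow> Seq R X X Y (Diag R X) \<alpha> = \<alpha>"
    and Seq_Diag: "\<alpha> \<in> Rel R X Y \<Longrightarrow> Seq R X Y Y \<alpha> (Diag R Y) = \<alpha>"
    and Conv_Seq: "\<alpha> \<in> Rel R X Y \<Longrightarrow> \<beta> \<in> Rel R Y Z
        \<Longrightarrow> Conv R X Z (Seq R X Y Z \<alpha> \<beta>) = Seq R Z Y X (Conv R Y Z \<beta>) (Conv R X Y \<alpha>)"
    and Conv_Diag: "X \<in> Obj R \<Longrightarrow> Conv R X X (Diag R X) = Diag R X"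
    and Conv_Conv: "\<alpha> \<in> Rel R X Y \<Longrightarrow> Conv R Y X (Conv R X Y \<alpha>) = \<alpha>"

definition graph :: "('o, 'a, 'r) doctrine \<Rightarrow> 'o \<Rightarrow> 'o \<Rightarrow> 'a \<Rightarrow> 'r" where
  "graph R X Y f = Reix R X Y Y Y f (Idn R Y) (Diag R Y)"

definition kernel :: "('o, 'a, 'r) doctrine \<Rightarrow> 'o \<Rightarrow> 'o \<Rightarrow> 'a \<Rightarrow> 'r" where
  "kernel R X Y f = Seq R X Y X (graph R X Y f) (Conv R X Y (graph R X Y f))"

definition eqrel :: "('o, 'a, 'r) doctrine \<Rightarrow> 'o \<Rightarrow> 'r \<Rightarrow> bool" where
  "eqrel R X \<rho> \<longleftrightarrow> \<rho> \<in> Rel R X X \<and> Leq R X X (Diag R X) \<rho>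
     \<and> Leq R X X (Conv R X X \<rho>) \<rho> \<and> Leq R X X (Seq R X X X \<rho> \<rho>) \<rho>"

definition quotient_arrow :: "('o, 'a, 'r) doctrine \<Rightarrow> 'o \<Rightarrow> 'r \<Rightarrow> 'o \<Rightarrow> 'a \<Rightarrow> bool" where
  "quotient_arrow R X \<rho> W q \<longleftrightarrow> q \<in> Hom R X W \<and> Leq R X X \<rho> (kernel R X W q)
     \<and> (\<forall>Z. \<forall>f \<in> Hom R X Z. Leq R X X \<rho> (kernel R X Z f)
          \<longrightarrow> (\<exists>!h. h \<in> Hom R W Z \<and> f = Comp R X W Z h q))"

definition effective :: "('o, 'a, 'r) doctrine \<Rightarrow> 'o \<Rightarrow> 'r \<Rightarrow> 'o \<Rightarrow> 'a \<Rightarrow> bool" where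
  "effective R X \<rho> W q \<longleftrightarrow> \<rho> = kernel R X W q"

definition descent :: "('o, 'a, 'r) doctrine \<Rightarrow> 'o \<Rightarrow> 'o \<Rightarrow> 'a \<Rightarrow> bool" where
  "descent R X W q \<longleftrightarrow>
     Leq R W W (Diag R W) (Seq R W X W (Conv R X W (graph R X W q)) (graph R X W q))"

definition has_quotients :: "('o, 'a, 'r) doctrine \<Rightarrow> bool" where
  "has_quotients R \<longleftrightarrow> (\<forall>X \<rho>. eqrel R X \<rho>
     \<longrightarrow> (\<exists>W q. quotient_arrow R X \<rho> W q \<and> effective R X \<rho> W q \<and> descent R X W q))"

definition approx :: "('o, 'a, 'r) doctrine \<Rightarrow> 'o \<Rightarrow> 'o \<Rightarrow> 'a \<Rightarrow> 'a \<Rightarrow> bool" where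
  "approx R X Y f g \<longleftrightarrow> Leq R X X (Diag R X) (Reix R X X Y Y f g (Diag R Y))"

definition extensional_doctrine :: "('o, 'a, 'r) doctrine \<Rightarrow> bool" where
  "extensional_doctrine R \<longleftrightarrow>
     (\<forall>X Y. \<forall>f \<in> Hom R X Y. \<forall>g \<in> Hom R X Y. approx R X Y f g \<longrightarrow> f = g)"

section \<open>The 2-categories RD, QRD, EQRD\<close>

text \<open>The maps constituting 1-arrows and 2-arrows are \<open>undefined\<close> off their domains, so that HOL
  equality of the records is equality of 1-arrows and of 2-arrows.\<close>

record ('o, 'a, 'r) rd1 =
  Dom :: "('o, 'a, 'r) doctrine"
  Cod :: "('o, 'a, 'r) doctrine"
  omap :: "'o \<Rightarrow> 'o"
  amap :: "'o \<Rightarrow> 'o \<Rightarrow> 'a \<Rightarrow> 'a"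
  rmap :: "'o \<Rightarrow> 'o \<Rightarrow> 'r \<Rightarrow> 'r"

record ('o, 'a, 'r) rd2 =
  Sarr :: "('o, 'a, 'r) rd1"
  Tarr :: "('o, 'a, 'r) rd1"
  cpt :: "'o \<Rightarrow> 'a"

locale rd_arrow = R: relational_doctrine "Dom F" + S: relational_doctrine "Cod F"
  for F :: "('o, 'a, 'r) rd1" +
  assumes omap_ext: "omap F \<in> extensional (Obj (Dom F))"
    and amap_ext: "amap F X Y \<in> extensional (Hom (Dom F) X Y)"
    and rmap_ext: "rmap F X Y \<in> extensional (Rel (Dom F) X Y)"
    and omap_Obj: "X \<in> Obj (Dom F) \<Longrightarrow> omap F X \<in> Obj (Cod F)"
    and amap_Hom: "f \<in> Hom (Dom F) X Y \<Longrightarrow> amap F X Y f \<in> Hom (Cod F) (omap F X) (omap F Y)"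
    and amap_Idn: "X \<in> Obj (Dom F) \<Longrightarrow> amap F X X (Idn (Dom F) X) = Idn (Cod F) (omap F X)"
    and amap_Comp: "f \<in> Hom (Dom F) X Y \<Longrightarrow> g \<in> Hom (Dom F) Y Z
        \<Longrightarrow> amap F X Z (Comp (Dom F) X Y Z g f)
          = Comp (Cod F) (omap F X) (omap F Y) (omap F Z) (amap F Y Z g) (amap F X Y f)"
    and rmap_Rel: "\<alpha> \<in> Rel (Dom F) X Y \<Longrightarrow> rmap F X Y \<alpha> \<in> Rel (Cod F) (omap F X) (omap F Y)"
    and rmap_mono: "\<alpha> \<in> Rel (Dom F) X Y \<Longrightarrow> \<beta> \<in> Rel (Dom F) X Y \<Longrightarrow> Leq (Dom F) X Y \<alpha> \<beta>
        \<Longrightarrow> Leq (Cod F) (omap F X) (omap F Y) (rmap F X Y \<alpha>) (rmap F X Y \<beta>)"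
    and rmap_Reix: "f \<in> Hom (Dom F) X A \<Longrightarrow> g \<in> Hom (Dom F) Y B \<Longrightarrow> \<alpha> \<in> Rel (Dom F) A B
        \<Longrightarrow> rmap F X Y (Reix (Dom F) X Y A B f g \<alpha>)
          = Reix (Cod F) (omap F X) (omap F Y) (omap F A) (omap F B)
              (amap F X A f) (amap F Y B g) (rmap F A B \<alpha>)"
    and rmap_Diag: "X \<in> Obj (Dom F) \<Longrightarrow> rmap F X X (Diag (Dom F) X) = Diag (Cod F) (omap F X)"
    and rmap_Seq: "\<alpha> \<in> Rel (Dom F) X Y \<Longrightarrow> \<beta> \<in> Rel (Dom F) Y Z
        \<Longrightarrow> rmap F X Z (Seq (Dom F) X Y Z \<alpha> \<beta>)
          = Seq (Cod F) (omap F X) (omap F Y) (omap F Z) (rmap F X Y \<alpha>) (rmap F Y Z \<beta>)"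
    and rmap_Conv: "\<alpha> \<in> Rel (Dom F) X Y
        \<Longrightarrow> rmap F Y X (Conv (Dom F) X Y \<alpha>) = Conv (Cod F) (omap F X) (omap F Y) (rmap F X Y \<alpha>)"

locale rd_cell = F: rd_arrow "Sarr \<theta>" + G: rd_arrow "Tarr \<theta>"
  for \<theta> :: "('o, 'a, 'r) rd2" +
  assumes same_Dom: "Dom (Tarr \<theta>) = Dom (Sarr \<theta>)"
    and same_Cod: "Cod (Tarr \<theta>) = Cod (Sarr \<theta>)"
    and cpt_ext: "cpt \<theta> \<in> extensional (Obj (Dom (Sarr \<theta>)))"
    and cpt_Hom: "X \<in> Obj (Dom (Sarr \<theta>))
        \<Longrightarrow> cpt \<theta> X \<in> Hom (Cod (Sarr \<theta>)) (omap (Sarr \<theta>) X) (omap (Tarr \<theta>) X)"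
    and cpt_natural: "f \<in> Hom (Dom (Sarr \<theta>)) X Y
        \<Longrightarrow> Comp (Cod (Sarr \<theta>)) (omap (Sarr \<theta>) X) (omap (Sarr \<theta>) Y) (omap (Tarr \<theta>) Y)
              (cpt \<theta> Y) (amap (Sarr \<theta>) X Y f)
          = Comp (Cod (Sarr \<theta>)) (omap (Sarr \<theta>) X) (omap (Tarr \<theta>) X) (omap (Tarr \<theta>) Y)
              (amap (Tarr \<theta>) X Y f) (cpt \<theta> X)"
    and cpt_lax: "\<alpha> \<in> Rel (Dom (Sarr \<theta>)) X Y
        \<Longrightarrow> Leq (Cod (Sarr \<theta>)) (omap (Sarr \<theta>) X) (omap (Sarr \<theta>) Y) (rmap (Sarr \<theta>) X Y \<alpha>)
              (Reix (Cod (Sarr \<theta>)) (omap (Sarr \<theta>) X) (omap (Sarr \<theta>) Y)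
                 (omap (Tarr \<theta>) X) (omap (Tarr \<theta>) Y) (cpt \<theta> X) (cpt \<theta> Y) (rmap (Tarr \<theta>) X Y \<alpha>))"

definition rd1_id :: "('o, 'a, 'r) doctrine \<Rightarrow> ('o, 'a, 'r) rd1" where
  "rd1_id R = \<lparr>Dom = R, Cod = R,
     omap = (\<lambda>X \<in> Obj R. X),
     amap = (\<lambda>X Y. \<lambda>f \<in> Hom R X Y. f),
     rmap = (\<lambda>X Y. \<lambda>\<alpha> \<in> Rel R X Y. \<alpha>)\<rparr>"

definition rd1_comp :: "('o, 'a, 'r) rd1 \<Rightarrow> ('o, 'a, 'r) rd1 \<Rightarrow> ('o, 'a, 'r) rd1" where
  "rd1_comp G F = \<lparr>Dom = Dom F, Cod = Cod G,
     omap = (\<lambda>X \<in> Obj (Dom F). omap G (omap F X)),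
     amap = (\<lambda>X Y. \<lambda>f \<in> Hom (Dom F) X Y. amap G (omap F X) (omap F Y) (amap F X Y f)),
     rmap = (\<lambda>X Y. \<lambda>\<alpha> \<in> Rel (Dom F) X Y. rmap G (omap F X) (omap F Y) (rmap F X Y \<alpha>))\<rparr>"

definition rd2_id :: "('o, 'a, 'r) rd1 \<Rightarrow> ('o, 'a, 'r) rd2" where
  "rd2_id F = \<lparr>Sarr = F, Tarr = F, cpt = (\<lambda>X \<in> Obj (Dom F). Idn (Cod F) (omap F X))\<rparr>"

definition rd2_vcomp :: "('o, 'a, 'r) rd2 \<Rightarrow> ('o, 'a, 'r) rd2 \<Rightarrow> ('o, 'a, 'r) rd2" where
  "rd2_vcomp \<phi> \<theta> = \<lparr>Sarr = Sarr \<theta>, Tarr = Tarr \<phi>,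
     cpt = (\<lambda>X \<in> Obj (Dom (Sarr \<theta>)).
       Comp (Cod (Sarr \<theta>)) (omap (Sarr \<theta>) X) (omap (Tarr \<theta>) X) (omap (Tarr \<phi>) X)
         (cpt \<phi> X) (cpt \<theta> X))\<rparr>"

text \<open>For \<open>\<theta> : F \<Rightarrow> F'\<close> and \<open>\<phi> : G \<Rightarrow> G'\<close> the component at \<open>X\<close> is \<open>\<phi>\<^bsub>F' X\<^esub> \<circ> G \<theta>\<^bsub>X\<^esub>\<close>.\<close>

definition rd2_hcomp :: "('o, 'a, 'r) rd2 \<Rightarrow> ('o, 'a, 'r) rd2 \<Rightarrow> ('o, 'a, 'r) rd2" where
  "rd2_hcomp \<phi> \<theta> = \<lparr>Sarr = rd1_comp (Sarr \<phi>) (Sarr \<theta>), Tarr = rd1_comp (Tarr \<phi>) (Tarr \<theta>),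
     cpt = (\<lambda>X \<in> Obj (Dom (Sarr \<theta>)).
       Comp (Cod (Sarr \<phi>)) (omap (Sarr \<phi>) (omap (Sarr \<theta>) X))
         (omap (Sarr \<phi>) (omap (Tarr \<theta>) X)) (omap (Tarr \<phi>) (omap (Tarr \<theta>) X))
         (cpt \<phi> (omap (Tarr \<theta>) X))
         (amap (Sarr \<phi>) (omap (Sarr \<theta>) X) (omap (Tarr \<theta>) X) (cpt \<theta> X)))\<rparr>"

type_synonym ('o, 'a, 'r) rdcat =
  "(('o, 'a, 'r) doctrine, ('o, 'a, 'r) rd1, ('o, 'a, 'r) rd2) twocat"

type_synonym ('o, 'a, 'r) rdfun =
  "(('o, 'a, 'r) doctrine, ('o, 'a, 'r) rd1, ('o, 'a, 'r) rd2,
    ('o, 'a, 'r) doctrine, ('o, 'a, 'r) rd1, ('o, 'a, 'r) rd2) twofun"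

text \<open>The types \<open>'o\<close>, \<open>'a\<close>, \<open>'r\<close> play the role of the universe from which objects, arrows and
  relations of the doctrines are drawn.\<close>

definition RD :: "('o, 'a, 'r) rdcat" where
  "RD = \<lparr>Ob = {R. relational_doctrine R},
     Ar = {F. rd_arrow F}, Dm = Dom, Cd = Cod,
     Ce = {\<theta>. rd_cell \<theta>}, Src = Sarr, Trg = Tarr,
     One = rd1_id, Cmp = rd1_comp, IdC = rd2_id, VC = rd2_vcomp, HC = rd2_hcomp\<rparr>"

definition preserves_quotients :: "('o, 'a, 'r) rd1 \<Rightarrow> bool" where
  "preserves_quotients F \<longleftrightarrow> (\<forall>X \<rho> W q. eqrel (Dom F) X \<rho> \<and> quotient_arrow (Dom F) X \<rho> W q
     \<longrightarrow> quotient_arrow (Cod F) (omap F X) (rmap F X X \<rho>) (omap F W) (amap F X W q))"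

definition QRD :: "('o, 'a, 'r) rdcat" where
  "QRD = RD\<lparr>Ob := {R \<in> Ob RD. has_quotients R},
     Ar := {F \<in> Ar RD. has_quotients (Dom F) \<and> has_quotients (Cod F) \<and> preserves_quotients F},
     Ce := {\<theta> \<in> Ce RD. has_quotients (Dom (Sarr \<theta>)) \<and> has_quotients (Cod (Sarr \<theta>))
              \<and> preserves_quotients (Sarr \<theta>) \<and> preserves_quotients (Tarr \<theta>)}\<rparr>"

definition EQRD :: "('o, 'a, 'r) rdcat" where
  "EQRD = QRD\<lparr>Ob := {R \<in> Ob QRD. extensional_doctrine R},
     Ar := {F \<in> Ar QRD. extensional_doctrine (Dom F) \<and> extensional_doctrine (Cod F)},
     Ce := {\<theta> \<in> Ce QRD. extensional_doctrine (Dom (Sarr \<theta>)) \<and> extensional_doctrine (Cod (Sarr \<theta>))}\<rparr>"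

section \<open>Intensional quotient completion\<close>

text \<open>For the completion to stay in the same universe, pairs \<open>(X, \<rho>)\<close> are coded as objects by
  an injective \<open>pr :: 'o \<times> 'r \<Rightarrow> 'o\<close>, which is a parameter; \<open>ob pr\<close> and \<open>eqv pr\<close> decode.\<close>

definition ob :: "('o \<times> 'r \<Rightarrow> 'o) \<Rightarrow> 'o \<Rightarrow> 'o" where
  "ob pr P = fst (inv pr P)"

definition eqv :: "('o \<times> 'r \<Rightarrow> 'o) \<Rightarrow> 'o \<Rightarrow> 'r" where
  "eqv pr P = snd (inv pr P)"

definition qObj :: "('o \<times> 'r \<Rightarrow> 'o) \<Rightarrow> ('o, 'a, 'r) doctrine \<Rightarrow> 'o set" where
  "qObj pr R = {pr (X, \<rho>) | X \<rho>. X \<in> Obj R \<and> eqrel R X \<rho>}"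

definition Q0 :: "('o \<times> 'r \<Rightarrow> 'o) \<Rightarrow> ('o, 'a, 'r) doctrine \<Rightarrow> ('o, 'a, 'r) doctrine" where
  "Q0 pr R = \<lparr>
     Obj = qObj pr R,
     Hom = (\<lambda>P Q. {f \<in> Hom R (ob pr P) (ob pr Q). P \<in> qObj pr R \<and> Q \<in> qObj pr R
        \<and> Leq R (ob pr P) (ob pr P) (eqv pr P)
            (Reix R (ob pr P) (ob pr P) (ob pr Q) (ob pr Q) f f (eqv pr Q))}),
     Idn = (\<lambda>P. Idn R (ob pr P)),
     Comp = (\<lambda>P Q S. Comp R (ob pr P) (ob pr Q) (ob pr S)),
     Rel = (\<lambda>P Q. {\<alpha> \<in> Rel R (ob pr P) (ob pr Q). P \<in> qObj pr R \<and> Q \<in> qObj pr R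
        \<and> Leq R (ob pr P) (ob pr Q)
            (Seq R (ob pr P) (ob pr Q) (ob pr Q)
              (Seq R (ob pr P) (ob pr P) (ob pr Q) (Conv R (ob pr P) (ob pr P) (eqv pr P)) \<alpha>)
              (eqv pr Q))
            \<alpha>}),
     Leq = (\<lambda>P Q. Leq R (ob pr P) (ob pr Q)),
     Reix = (\<lambda>P Q A B. Reix R (ob pr P) (ob pr Q) (ob pr A) (ob pr B)),
     Diag = eqv pr,
     Seq = (\<lambda>P Q S. Seq R (ob pr P) (ob pr Q) (ob pr S)),
     Conv = (\<lambda>P Q. Conv R (ob pr P) (ob pr Q))\<rparr>"

definition Q1 :: "('o \<times> 'r \<Rightarrow> 'o) \<Rightarrow> ('o, 'a, 'r) rd1 \<Rightarrow> ('o, 'a, 'r) rd1" where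
  "Q1 pr F = \<lparr>Dom = Q0 pr (Dom F), Cod = Q0 pr (Cod F),
     omap = (\<lambda>P \<in> Obj (Q0 pr (Dom F)). pr (omap F (ob pr P), rmap F (ob pr P) (ob pr P) (eqv pr P))),
     amap = (\<lambda>P Q. \<lambda>f \<in> Hom (Q0 pr (Dom F)) P Q. amap F (ob pr P) (ob pr Q) f),
     rmap = (\<lambda>P Q. \<lambda>\<alpha> \<in> Rel (Q0 pr (Dom F)) P Q. rmap F (ob pr P) (ob pr Q) \<alpha>)\<rparr>"

definition Q2 :: "('o \<times> 'r \<Rightarrow> 'o) \<Rightarrow> ('o, 'a, 'r) rd2 \<Rightarrow> ('o, 'a, 'r) rd2" where
  "Q2 pr \<theta> = \<lparr>Sarr = Q1 pr (Sarr \<theta>), Tarr = Q1 pr (Tarr \<theta>),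
     cpt = (\<lambda>P \<in> Obj (Q0 pr (Dom (Sarr \<theta>))). cpt \<theta> (ob pr P))\<rparr>"

definition Qf :: "('o \<times> 'r \<Rightarrow> 'o) \<Rightarrow> ('o, 'a, 'r) rdfun" where
  "Qf pr = \<lparr>F0 = Q0 pr, F1 = Q1 pr, F2 = Q2 pr\<rparr>"

definition unit_q :: "('o \<times> 'r \<Rightarrow> 'o) \<Rightarrow> ('o, 'a, 'r) doctrine \<Rightarrow> ('o, 'a, 'r) rd1" where
  "unit_q pr R = \<lparr>Dom = R, Cod = Q0 pr R,
     omap = (\<lambda>X \<in> Obj R. pr (X, Diag R X)),
     amap = (\<lambda>X Y. \<lambda>f \<in> Hom R X Y. f),
     rmap = (\<lambda>X Y. \<lambda>\<alpha> \<in> Rel R X Y. \<alpha>)\<rparr>"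

section \<open>Extensional collapse\<close>

text \<open>The universe \<open>'a\<close> of arrows cannot contain all its subsets, so the class \<open>[f]\<close> of \<open>f\<close> under
  \<open>approx\<close> is coded by a member chosen from the class: \<open>cls R X Y f = cls R X Y g\<close> iff
  \<open>f\<close> and \<open>g\<close> are equivalent. Reindexing along \<open>[f]\<close> and \<open>[g]\<close>, which does not depend on
  representatives, is reindexing along the codes.\<close>

definition cls :: "('o, 'a, 'r) doctrine \<Rightarrow> 'o \<Rightarrow> 'o \<Rightarrow> 'a \<Rightarrow> 'a" where
  "cls R X Y f = (SOME g. g \<in> {g \<in> Hom R X Y. approx R X Y f g})"

definition E0 :: "('o, 'a, 'r) doctrine \<Rightarrow> ('o, 'a, 'r) doctrine" where
  "E0 R = R\<lparr>Hom := (\<lambda>X Y. cls R X Y ` Hom R X Y),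
     Idn := (\<lambda>X. cls R X X (Idn R X)),
     Comp := (\<lambda>X Y Z g f. cls R X Z (Comp R X Y Z g f))\<rparr>"

definition E1 :: "('o, 'a, 'r) rd1 \<Rightarrow> ('o, 'a, 'r) rd1" where
  "E1 F = \<lparr>Dom = E0 (Dom F), Cod = E0 (Cod F),
     omap = omap F,
     amap = (\<lambda>X Y. \<lambda>f \<in> Hom (E0 (Dom F)) X Y. cls (Cod F) (omap F X) (omap F Y) (amap F X Y f)),
     rmap = rmap F\<rparr>"

definition E2 :: "('o, 'a, 'r) rd2 \<Rightarrow> ('o, 'a, 'r) rd2" where
  "E2 \<theta> = \<lparr>Sarr = E1 (Sarr \<theta>), Tarr = E1 (Tarr \<theta>),
     cpt = (\<lambda>X \<in> Obj (Dom (Sarr \<theta>)).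
       cls (Cod (Sarr \<theta>)) (omap (Sarr \<theta>) X) (omap (Tarr \<theta>) X) (cpt \<theta> X))\<rparr>"

definition Ef :: "('o, 'a, 'r) rdfun" where
  "Ef = \<lparr>F0 = E0, F1 = E1, F2 = E2\<rparr>"

definition unit_e :: "('o, 'a, 'r) doctrine \<Rightarrow> ('o, 'a, 'r) rd1" where
  "unit_e R = \<lparr>Dom = R, Cod = E0 R,
     omap = (\<lambda>X \<in> Obj R. X),
     amap = (\<lambda>X Y. \<lambda>f \<in> Hom R X Y. cls R X Y f),
     rmap = (\<lambda>X Y. \<lambda>\<alpha> \<in> Rel R X Y. \<alpha>)\<rparr>"

section \<open>The composite adjunction and its 2-monad\<close>

text \<open>\<open>Qf\<close> is the data both of Q : RD \<open>\<rightarrow>\<close> QRD and of the endo-2-functor \<open>T\<^sub>q\<close> on RD, and \<open>Ef\<close>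
  the data both of E' : QRD \<open>\<rightarrow>\<close> EQRD and of \<open>T\<^sub>e\<close> on RD; the inclusions have identity data.\<close>

definition EQ :: "('o \<times> 'r \<Rightarrow> 'o) \<Rightarrow> ('o, 'a, 'r) rdfun" where
  "EQ pr = fun_comp Ef (Qf pr)"

definition U_eq :: "('o, 'a, 'r) rdfun" where
  "U_eq = fun_id"

definition T_q :: "('o \<times> 'r \<Rightarrow> 'o) \<Rightarrow> ('o, 'a, 'r) rdfun" where
  "T_q pr = Qf pr"

definition T_e :: "('o, 'a, 'r) rdfun" where
  "T_e = Ef"

definition T_eq :: "('o \<times> 'r \<Rightarrow> 'o) \<Rightarrow> ('o, 'a, 'r) rdfun" where
  "T_eq pr = fun_comp T_e (T_q pr)"

definition unit_eq :: "('o \<times> 'r \<Rightarrow> 'o) \<Rightarrow> ('o, 'a, 'r) doctrine \<Rightarrow> ('o, 'a, 'r) rd1" where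
  "unit_eq pr R = rd1_comp (unit_e (Q0 pr R)) (unit_q pr R)"

text \<open>The counit of the composite adjunction at \<open>T\<^sub>e\<^sub>q R\<close>, for the canonical choice of quotients there:
  \<open>((X, \<rho>), \<sigma>) \<mapsto> (X, \<sigma>)\<close>, \<open>[[f]] \<mapsto> [f]\<close>, \<open>\<alpha> \<mapsto> \<alpha>\<close>.\<close>

definition mult_eq :: "('o \<times> 'r \<Rightarrow> 'o) \<Rightarrow> ('o, 'a, 'r) doctrine \<Rightarrow> ('o, 'a, 'r) rd1" where
  "mult_eq pr R =
     (let T = F0 (T_eq pr); m = (\<lambda>P. pr (ob pr (ob pr P), eqv pr P))
      in \<lparr>Dom = T (T R), Cod = T R,
           omap = (\<lambda>P \<in> Obj (T (T R)). m P),
           amap = (\<lambda>P Q. \<lambda>f \<in> Hom (T (T R)) P Q. cls (Q0 pr R) (m P) (m Q) f),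
           rmap = (\<lambda>P Q. \<lambda>\<alpha> \<in> Rel (T (T R)) P Q. \<alpha>)\<rparr>)"

end

theory Submission
  imports Defs
begin

text \<open>Write \<open>T\<close> for \<open>T_eq pr\<close> and \<open>\<eta>\<close> for its unit. An object of \<open>T R\<close> is a pair \<open>(X, \<rho>)\<close>, an arrow is the
  class \<open>[f]\<close> of an arrow respecting the equivalence relations, and a relation from \<open>(X, \<rho>)\<close> to \<open>(Y, \<sigma>)\<close>
  is a relation of \<open>R\<close> that absorbs \<open>\<rho>\<close> and \<open>\<sigma>\<close>. Two observations about these pairs carry the proof.

  An equivalence relation on \<open>(X, \<rho>)\<close> in \<open>T R\<close> is an equivalence relation \<open>\<sigma>\<close> on \<open>X\<close> above \<open>\<rho>\<close>, and its
  quotient is the identity of \<open>X\<close> read as an arrow \<open>[id] : (X, \<rho>) \<rightarrow> (X, \<sigma>)\<close> (\<open>canonical_quotient\<close>). So \<open>T R\<close>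
  is an object of EQRD, \<open>T F\<close> preserves quotients, and every object \<open>(X, \<rho>)\<close> of \<open>T R\<close> is the quotient
  by \<open>\<rho>\<close> of the object \<open>\<eta> X = (X, d)\<close> coming from \<open>R\<close>. Hence 1-arrows out of \<open>T R\<close> that preserve quotients
  are governed by their restriction along \<open>\<eta>\<close>: a 2-arrow between two restrictions extends uniquely, by
  the universal property of quotients (\<open>extend_cell\<close>), and for \<open>S\<close> in EQRD the identity of \<open>S\<close> extends to
  a counit \<open>T S \<rightarrow> S\<close>, which sends \<open>(X, \<rho>)\<close> to a quotient of \<open>X\<close> by \<open>\<rho>\<close> (\<open>counit_map\<close>).

  Conversely, let \<open>a : T R \<rightarrow> R\<close> be any 1-arrow with \<open>1 \<cong> a \<eta>\<close>. Then \<open>a\<close> carries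
  \<open>[id] : \<eta> X \<rightarrow> (X, \<rho>)\<close> to an effective descent quotient of \<open>X\<close> by \<open>\<rho>\<close>, and \<open>R\<close> is extensional because
  \<open>\<eta>\<close> identifies arrows that are equal up to \<open>\<approx>\<close>. So \<open>R\<close> is in EQRD, \<open>a\<close> preserves quotients, and a
  1-arrow \<open>f\<close> out of \<open>R\<close> preserves quotients as soon as \<open>f a\<close> does (locale \<open>unital_structure\<close>). The
  property of being an object or an arrow of EQRD is thus forced by the unit isomorphism alone.

  What remains is formal (locale \<open>lax_reflection\<close>). All structure 2-cells and all coherence equations
  of pseudoalgebras, pseudomorphisms and their 2-cells live between 1-cells of EQRD that start
  at some \<open>T X\<close>, so they exist, or hold, as soon as they do after whiskering with \<open>\<eta>\<close>. There the unit axioms leave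
  no freedom: the associator restricts to the inverse of the unit isomorphism, and the square of a
  pseudomorphism restricts to a composite of unit isomorphisms. Consequently a pseudoalgebra
  is an object of EQRD with a structure map and a unit isomorphism, every 1-arrow of EQRD is a pseudomorphism in
  exactly one way, and every 2-arrow between them is a 2-cell of pseudomorphisms. The comparison
  2-functor is therefore bijective on hom-categories, and two structures on the same object are isomorphic
  over its identity (\<open>equivalence_comparison_functor\<close>).

  For lax idempotence, the 2-arrow \<open>T \<eta> \<Rightarrow> \<eta> T\<close> has the identity of \<open>X\<close> as its component
  \<open>((X, d), \<rho>) \<rightarrow> ((X, \<rho>), \<rho>)\<close>. The multiplication \<open>((X, \<rho>), \<sigma>) \<mapsto> (X, \<sigma>)\<close> is faithful and
  the identity on relations, and it sends this component to an identity; every law required of the 2-arrow can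
  be checked after applying it.\<close>

section \<open>Calculus of 1-cells and whiskered 2-cells\<close>

context two_category
begin

lemma ar_ob [simp]: "f \<in> Ar C \<Longrightarrow> Dm C f \<in> Ob C" "f \<in> Ar C \<Longrightarrow> Cd C f \<in> Ob C"
  using ar_bd by auto

lemma one_bd [simp]: "X \<in> Ob C \<Longrightarrow> One C X \<in> Ar C" "X \<in> Ob C \<Longrightarrow> Dm C (One C X) = X"
    "X \<in> Ob C \<Longrightarrow> Cd C (One C X) = X"
  using one_hom unfolding hom1_def by auto

lemma cmp_bd [simp]:
  assumes "f \<in> Ar C" "g \<in> Ar C" "Dm C g = Cd C f"
  shows "g \<cdot> f \<in> Ar C" "Dm C (g \<cdot> f) = Dm C f" "Cd C (g \<cdot> f) = Cd C g"
  using cmp_hom[of f "Dm C f" "Cd C f" g "Cd C g"] assms unfolding hom1_def by auto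

lemma cmp_unit [simp]: "f \<in> Ar C \<Longrightarrow> X = Dm C f \<Longrightarrow> f \<cdot> One C X = f"
    "f \<in> Ar C \<Longrightarrow> Y = Cd C f \<Longrightarrow> One C Y \<cdot> f = f"
  using cmp_one[of f "Dm C f" "Cd C f"] one_cmp[of f "Dm C f" "Cd C f"] unfolding hom1_def by auto

lemma cmp_asc: "f \<in> Ar C \<Longrightarrow> g \<in> Ar C \<Longrightarrow> h \<in> Ar C \<Longrightarrow> Dm C g = Cd C f \<Longrightarrow> Dm C h = Cd C g
    \<Longrightarrow> h \<cdot> (g \<cdot> f) = h \<cdot> g \<cdot> f"
  using cmp_assoc[of f "Dm C f" "Cd C f" g "Cd C g" h "Cd C h"] unfolding hom1_def by auto

lemma ce_ar [simp]: "a \<in> Ce C \<Longrightarrow> Src C a \<in> Ar C" "a \<in> Ce C \<Longrightarrow> Trg C a \<in> Ar C"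
    "a \<in> Ce C \<Longrightarrow> Dm C (Trg C a) = Dm C (Src C a)" "a \<in> Ce C \<Longrightarrow> Cd C (Trg C a) = Cd C (Src C a)"
  using ce_bd by auto

lemma idc_bd [simp]: "f \<in> Ar C \<Longrightarrow> IdC C f \<in> Ce C" "f \<in> Ar C \<Longrightarrow> Src C (IdC C f) = f"
    "f \<in> Ar C \<Longrightarrow> Trg C (IdC C f) = f"
  using idc_hom unfolding hom2_def by auto

lemma vc_bd [simp]:
  assumes "a \<in> Ce C" "b \<in> Ce C" "Src C b = Trg C a"
  shows "b \<bullet> a \<in> Ce C" "Src C (b \<bullet> a) = Src C a" "Trg C (b \<bullet> a) = Trg C b"
  using vc_hom[of a "Src C a" "Trg C a" b "Trg C b"] assms unfolding hom2_def by auto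

lemma vc_unit [simp]: "a \<in> Ce C \<Longrightarrow> f = Src C a \<Longrightarrow> a \<bullet> IdC C f = a"
    "a \<in> Ce C \<Longrightarrow> f = Trg C a \<Longrightarrow> IdC C f \<bullet> a = a"
  using vc_idc[of a "Src C a" "Trg C a"] idc_vc[of a "Src C a" "Trg C a"] unfolding hom2_def by auto

lemma vc_asc: "a \<in> Ce C \<Longrightarrow> b \<in> Ce C \<Longrightarrow> c \<in> Ce C \<Longrightarrow> Src C b = Trg C a \<Longrightarrow> Src C c = Trg C b
    \<Longrightarrow> c \<bullet> (b \<bullet> a) = c \<bullet> b \<bullet> a"
  using vc_assoc[of a "Src C a" "Trg C a" b "Trg C b" c "Trg C c"] unfolding hom2_def by auto

lemma hc_bd [simp]:
  assumes "a \<in> Ce C" "b \<in> Ce C" "Dm C (Src C b) = Cd C (Src C a)"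
  shows "b \<star> a \<in> Ce C" "Src C (b \<star> a) = Src C b \<cdot> Src C a" "Trg C (b \<star> a) = Trg C b \<cdot> Trg C a"
  using hc_hom[of a "Src C a" "Trg C a" b "Src C b" "Trg C b" "Dm C (Src C a)" "Cd C (Src C a)" "Cd C (Src C b)"]
    assms unfolding hom2_def hom1_def by auto

lemma hc_unit: "a \<in> Ce C \<Longrightarrow> X = Dm C (Src C a) \<Longrightarrow> a \<star> IdC C (One C X) = a"
    "a \<in> Ce C \<Longrightarrow> Y = Cd C (Src C a) \<Longrightarrow> IdC C (One C Y) \<star> a = a"
  using hc_one[of a "Src C a" "Trg C a" "Dm C (Src C a)" "Cd C (Src C a)"]
    one_hc[of a "Src C a" "Trg C a" "Dm C (Src C a)" "Cd C (Src C a)"] unfolding hom2_def hom1_def by auto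

lemma hc_asc: "a \<in> Ce C \<Longrightarrow> b \<in> Ce C \<Longrightarrow> c \<in> Ce C \<Longrightarrow> Dm C (Src C b) = Cd C (Src C a)
    \<Longrightarrow> Dm C (Src C c) = Cd C (Src C b) \<Longrightarrow> c \<star> (b \<star> a) = c \<star> b \<star> a"
  using hc_assoc[of a "Src C a" "Trg C a" b "Src C b" "Trg C b" c "Src C c" "Trg C c"
      "Dm C (Src C a)" "Cd C (Src C a)" "Cd C (Src C b)" "Cd C (Src C c)"]
  unfolding hom2_def hom1_def by auto

lemma hc_idc_idc: "f \<in> Ar C \<Longrightarrow> g \<in> Ar C \<Longrightarrow> Dm C g = Cd C f \<Longrightarrow> IdC C g \<star> IdC C f = IdC C (g \<cdot> f)"
  using hc_idc[of f "Dm C f" "Cd C f" g "Cd C g"] unfolding hom1_def by auto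

lemma hc_vc: "a \<in> Ce C \<Longrightarrow> a' \<in> Ce C \<Longrightarrow> b \<in> Ce C \<Longrightarrow> b' \<in> Ce C \<Longrightarrow> Src C a' = Trg C a
    \<Longrightarrow> Src C b' = Trg C b \<Longrightarrow> Dm C (Src C b) = Cd C (Src C a)
    \<Longrightarrow> (b' \<bullet> b) \<star> (a' \<bullet> a) = b' \<star> a' \<bullet> b \<star> a"
  using interchange[of a "Src C a" "Trg C a" a' "Trg C a'" b "Src C b" "Trg C b" b' "Trg C b'"
      "Dm C (Src C a)" "Cd C (Src C a)" "Cd C (Src C b)"]
  unfolding hom2_def hom1_def by auto

lemma lwhisk_bd [simp]:
  assumes "a \<in> Ce C" "g \<in> Ar C" "Dm C g = Cd C (Src C a)"
  shows "g \<rhd> a \<in> Ce C" "Src C (g \<rhd> a) = g \<cdot> Src C a" "Trg C (g \<rhd> a) = g \<cdot> Trg C a"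
  using assms unfolding lwhisk_def by auto

lemma rwhisk_bd [simp]:
  assumes "a \<in> Ce C" "f \<in> Ar C" "Dm C (Src C a) = Cd C f"
  shows "a \<lhd> f \<in> Ce C" "Src C (a \<lhd> f) = Src C a \<cdot> f" "Trg C (a \<lhd> f) = Trg C a \<cdot> f"
  using assms unfolding rwhisk_def by auto

lemma lwhisk_vc: "a \<in> Ce C \<Longrightarrow> b \<in> Ce C \<Longrightarrow> Src C b = Trg C a \<Longrightarrow> g \<in> Ar C \<Longrightarrow> Dm C g = Cd C (Src C a)
    \<Longrightarrow> g \<rhd> (b \<bullet> a) = g \<rhd> b \<bullet> g \<rhd> a"
  using hc_vc[of a b "IdC C g" "IdC C g"] unfolding lwhisk_def by auto

lemma rwhisk_vc: "a \<in> Ce C \<Longrightarrow> b \<in> Ce C \<Longrightarrow> Src C b = Trg C a \<Longrightarrow> f \<in> Ar C \<Longrightarrow> Dm C (Src C a) = Cd C f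
    \<Longrightarrow> (b \<bullet> a) \<lhd> f = b \<lhd> f \<bullet> a \<lhd> f"
  using hc_vc[of "IdC C f" "IdC C f" a b] unfolding rwhisk_def by auto

lemma lwhisk_cmp: "a \<in> Ce C \<Longrightarrow> g \<in> Ar C \<Longrightarrow> h \<in> Ar C \<Longrightarrow> Dm C g = Cd C (Src C a) \<Longrightarrow> Dm C h = Cd C g
    \<Longrightarrow> h \<rhd> g \<rhd> a = (h \<cdot> g) \<rhd> a"
  unfolding lwhisk_def by (simp add: hc_asc hc_idc_idc)

lemma rwhisk_cmp: "a \<in> Ce C \<Longrightarrow> f \<in> Ar C \<Longrightarrow> g \<in> Ar C \<Longrightarrow> Dm C (Src C a) = Cd C g \<Longrightarrow> Dm C g = Cd C f
    \<Longrightarrow> a \<lhd> g \<lhd> f = a \<lhd> (g \<cdot> f)"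
  unfolding rwhisk_def by (simp add: hc_asc[symmetric] hc_idc_idc)

lemma whisk_asc: "a \<in> Ce C \<Longrightarrow> f \<in> Ar C \<Longrightarrow> g \<in> Ar C \<Longrightarrow> Dm C (Src C a) = Cd C f \<Longrightarrow> Dm C g = Cd C (Src C a)
    \<Longrightarrow> (g \<rhd> a) \<lhd> f = g \<rhd> (a \<lhd> f)"
  unfolding lwhisk_def rwhisk_def by (simp add: hc_asc)

lemma whisk_one [simp]: "a \<in> Ce C \<Longrightarrow> X = Dm C (Src C a) \<Longrightarrow> a \<lhd> One C X = a"
    "a \<in> Ce C \<Longrightarrow> Y = Cd C (Src C a) \<Longrightarrow> One C Y \<rhd> a = a"
  unfolding lwhisk_def rwhisk_def by (simp_all add: hc_unit)

lemma whisk_idc [simp]: "f \<in> Ar C \<Longrightarrow> g \<in> Ar C \<Longrightarrow> Dm C g = Cd C f \<Longrightarrow> g \<rhd> IdC C f = IdC C (g \<cdot> f)"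
    "f \<in> Ar C \<Longrightarrow> g \<in> Ar C \<Longrightarrow> Dm C g = Cd C f \<Longrightarrow> IdC C g \<lhd> f = IdC C (g \<cdot> f)"
  unfolding lwhisk_def rwhisk_def by (simp_all add: hc_idc_idc)

text \<open>Horizontal composition is recovered from the two whiskerings, so the coherence axioms, which are
  stated by whiskering, can be handled with the interchange law in the form \<open>whisk_exchange\<close> only.\<close>

lemma hc_whisk:
  assumes "a \<in> Ce C" "b \<in> Ce C" "Dm C (Src C b) = Cd C (Src C a)"
  shows "b \<star> a = b \<lhd> Trg C a \<bullet> Src C b \<rhd> a" "b \<star> a = Trg C b \<rhd> a \<bullet> b \<lhd> Src C a"
  using hc_vc[of a "IdC C (Trg C a)" "IdC C (Src C b)" b] hc_vc[of "IdC C (Src C a)" a b "IdC C (Trg C b)"] assms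
  unfolding lwhisk_def rwhisk_def by simp_all

lemma whisk_exchange:
  assumes "a \<in> Ce C" "b \<in> Ce C" "Dm C (Src C b) = Cd C (Src C a)"
  shows "b \<lhd> Trg C a \<bullet> Src C b \<rhd> a = Trg C b \<rhd> a \<bullet> b \<lhd> Src C a"
  using hc_whisk[OF assms] by simp

lemma iso2E:
  assumes "iso2 C a"
  obtains b where "b \<in> Ce C" "Src C b = Trg C a" "Trg C b = Src C a"
    "b \<bullet> a = IdC C (Src C a)" "a \<bullet> b = IdC C (Trg C a)"
  using assms unfolding iso2_def hom2_def by auto

lemma iso2_Ce: "iso2 C a \<Longrightarrow> a \<in> Ce C"
  unfolding iso2_def by simp

lemma iso2I: "a \<in> Ce C \<Longrightarrow> b \<in> Ce C \<Longrightarrow> Src C b = Trg C a \<Longrightarrow> Trg C b = Src C a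
    \<Longrightarrow> b \<bullet> a = IdC C (Src C a) \<Longrightarrow> a \<bullet> b = IdC C (Trg C a) \<Longrightarrow> iso2 C a"
  unfolding iso2_def hom2_def by auto

lemma iso2_idc: "f \<in> Ar C \<Longrightarrow> iso2 C (IdC C f)"
  by (intro iso2I[of _ "IdC C f"]) auto

lemma iso2_epi:
  assumes "iso2 C e" "a \<in> Ce C" "b \<in> Ce C" "Src C a = Trg C e" "Src C b = Trg C e" "a \<bullet> e = b \<bullet> e"
  shows "a = b"
proof -
  obtain e' where e': "e' \<in> Ce C" "Src C e' = Trg C e" "Trg C e' = Src C e"
    "e' \<bullet> e = IdC C (Src C e)" "e \<bullet> e' = IdC C (Trg C e)" by (rule iso2E[OF assms(1)])
  have "a \<bullet> e \<bullet> e' = b \<bullet> e \<bullet> e'" using assms by simp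
  then have "a \<bullet> (e \<bullet> e') = b \<bullet> (e \<bullet> e')" using assms(2-5) e'(1-3) iso2_Ce[OF assms(1)] by (simp add: vc_asc)
  then show ?thesis using assms e' by simp
qed

lemma iso2_vc:
  assumes "iso2 C a" "iso2 C b" "Src C b = Trg C a"
  shows "iso2 C (b \<bullet> a)"
proof -
  note [simp] = iso2_Ce[OF assms(1)] iso2_Ce[OF assms(2)]
  obtain a' where a' [simp]: "a' \<in> Ce C" "Src C a' = Trg C a" "Trg C a' = Src C a"
    "a' \<bullet> a = IdC C (Src C a)" "a \<bullet> a' = IdC C (Trg C a)" by (rule iso2E[OF assms(1)])
  obtain b' where b' [simp]: "b' \<in> Ce C" "Src C b' = Trg C b" "Trg C b' = Src C b"
    "b' \<bullet> b = IdC C (Src C b)" "b \<bullet> b' = IdC C (Trg C b)" by (rule iso2E[OF assms(2)])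
  have "b' \<bullet> (b \<bullet> a) = a" "a \<bullet> (a' \<bullet> b') = b'"
    using vc_asc[of a b b'] vc_asc[of b' a' a] assms(3) by simp_all
  then show ?thesis using assms(3) vc_asc[of "b \<bullet> a" b' a'] vc_asc[of "a' \<bullet> b'" a b]
    by (intro iso2I[of _ "a' \<bullet> b'"]) simp_all
qed

lemma iso2_rwhisk:
  assumes "iso2 C a" "f \<in> Ar C" "Dm C (Src C a) = Cd C f"
  shows "iso2 C (a \<lhd> f)"
proof -
  note [simp] = iso2_Ce[OF assms(1)] assms(2,3)
  obtain a' where a' [simp]: "a' \<in> Ce C" "Src C a' = Trg C a" "Trg C a' = Src C a"
    "a' \<bullet> a = IdC C (Src C a)" "a \<bullet> a' = IdC C (Trg C a)" by (rule iso2E[OF assms(1)])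
  have "Dm C (Src C a') = Cd C f" by simp
  then show ?thesis by (intro iso2I[of _ "a' \<lhd> f"]) (simp_all add: rwhisk_vc[symmetric])
qed

lemma iso2_lwhisk:
  assumes "iso2 C a" "g \<in> Ar C" "Dm C g = Cd C (Src C a)"
  shows "iso2 C (g \<rhd> a)"
proof -
  note [simp] = iso2_Ce[OF assms(1)] assms(2,3)
  obtain a' where a' [simp]: "a' \<in> Ce C" "Src C a' = Trg C a" "Trg C a' = Src C a"
    "a' \<bullet> a = IdC C (Src C a)" "a \<bullet> a' = IdC C (Trg C a)" by (rule iso2E[OF assms(1)])
  show ?thesis by (intro iso2I[of _ "g \<rhd> a'"]) (simp_all add: lwhisk_vc[symmetric])
qed

end

section \<open>Locally full sub-2-categories\<close>

definition full_sub :: "('o, 'm, 'c) twocat \<Rightarrow> 'o set \<Rightarrow> 'm set \<Rightarrow> ('o, 'm, 'c) twocat" where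
  "full_sub C obs ars = C\<lparr>Ob := obs, Ar := ars, Ce := {a \<in> Ce C. Src C a \<in> ars \<and> Trg C a \<in> ars}\<rparr>"

locale sub_two_category = two_category C
  for C :: "('o, 'm, 'c) twocat" (structure) +
  fixes obs :: "'o set" and ars :: "'m set"
  assumes obs_Ob: "X \<in> obs \<Longrightarrow> X \<in> Ob C"
    and ars_Ar: "f \<in> ars \<Longrightarrow> f \<in> Ar C"
    and ars_Dm: "f \<in> ars \<Longrightarrow> Dm C f \<in> obs" and ars_Cd: "f \<in> ars \<Longrightarrow> Cd C f \<in> obs"
    and one_ars: "X \<in> obs \<Longrightarrow> One C X \<in> ars"
    and cmp_ars: "f \<in> ars \<Longrightarrow> g \<in> ars \<Longrightarrow> Dm C g = Cd C f \<Longrightarrow> g \<cdot> f \<in> ars"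
begin

lemma full_sub_simps [simp]:
  "Ob (full_sub C obs ars) = obs" "Ar (full_sub C obs ars) = ars" "Dm (full_sub C obs ars) = Dm C"
  "Cd (full_sub C obs ars) = Cd C" "Ce (full_sub C obs ars) = {a \<in> Ce C. Src C a \<in> ars \<and> Trg C a \<in> ars}"
  "Src (full_sub C obs ars) = Src C" "Trg (full_sub C obs ars) = Trg C" "One (full_sub C obs ars) = One C"
  "Cmp (full_sub C obs ars) = Cmp C" "IdC (full_sub C obs ars) = IdC C" "VC (full_sub C obs ars) = VC C"
  "HC (full_sub C obs ars) = HC C"
  "lwhisk (full_sub C obs ars) = lwhisk C" "rwhisk (full_sub C obs ars) = rwhisk C"
  unfolding full_sub_def lwhisk_def fun_eq_iff rwhisk_def by simp_all

lemma two_category_full_sub: "two_category (full_sub C obs ars)"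
  by unfold_locales
    (auto simp: hom1_def hom2_def obs_Ob ars_Ar ars_Dm ars_Cd one_ars cmp_ars
      cmp_asc vc_asc hc_asc hc_unit hc_idc_idc hc_vc)

lemma two_functor_into:
  assumes "two_functor B C F" "\<And>X. X \<in> Ob B \<Longrightarrow> F0 F X \<in> obs" "\<And>f. f \<in> Ar B \<Longrightarrow> F1 F f \<in> ars"
  shows "two_functor B (full_sub C obs ars) F"
proof -
  interpret F: two_functor B C F by fact
  interpret D: two_category "full_sub C obs ars" by (rule two_category_full_sub)
  show ?thesis
  proof
    fix a f g assume "a \<in> hom2 B f g"
    then show "F2 F a \<in> hom2 (full_sub C obs ars) (F1 F f) (F1 F g)"
      using F.F2_hom[of a f g] assms(3) F.C.ce_ar[of a] by (auto simp: hom2_def)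
  next
    fix f X Y assume "f \<in> hom1 B X Y"
    then show "F1 F f \<in> hom1 (full_sub C obs ars) (F0 F X) (F0 F Y)"
      using F.F1_hom[of f X Y] assms(3) by (auto simp: hom1_def)
  qed (simp_all add: assms F.F1_one F.F1_cmp F.F2_idc F.F2_vc F.F2_hc)
qed

lemma two_functor_inclusion: "two_functor (full_sub C obs ars) C fun_id"
proof -
  interpret D: two_category "full_sub C obs ars" by (rule two_category_full_sub)
  show ?thesis by unfold_locales (auto simp: fun_id_def hom1_def hom2_def obs_Ob ars_Ar)
qed

end

context two_functor
begin

lemma F0_Ob [simp]: "X \<in> Ob C \<Longrightarrow> F0 F X \<in> Ob D"
  by (rule F0_ob)

lemma F1_bd [simp]: "f \<in> Ar C \<Longrightarrow> F1 F f \<in> Ar D" "f \<in> Ar C \<Longrightarrow> Dm D (F1 F f) = F0 F (Dm C f)"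
    "f \<in> Ar C \<Longrightarrow> Cd D (F1 F f) = F0 F (Cd C f)"
  using F1_hom[of f "Dm C f" "Cd C f"] unfolding hom1_def by auto

lemma F1_Cmp: "f \<in> Ar C \<Longrightarrow> g \<in> Ar C \<Longrightarrow> Dm C g = Cd C f \<Longrightarrow> F1 F (g \<cdot>\<^bsub>C\<^esub> f) = F1 F g \<cdot>\<^bsub>D\<^esub> F1 F f"
  using F1_cmp[of f "Dm C f" "Cd C f" g "Cd C g"] unfolding hom1_def by auto

lemma F2_bd [simp]: "a \<in> Ce C \<Longrightarrow> F2 F a \<in> Ce D" "a \<in> Ce C \<Longrightarrow> Src D (F2 F a) = F1 F (Src C a)"
    "a \<in> Ce C \<Longrightarrow> Trg D (F2 F a) = F1 F (Trg C a)"
  using F2_hom[of a "Src C a" "Trg C a"] unfolding hom2_def by auto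

end

lemma two_functor_comp:
  assumes "two_functor B C F" "two_functor C D G"
  shows "two_functor B D (fun_comp G F)"
proof -
  interpret F: two_functor B C F by fact
  interpret G: two_functor C D G by fact
  show ?thesis
  proof
    fix f g X Y Z assume "f \<in> hom1 B X Y" "g \<in> hom1 B Y Z"
    then show "F1 (fun_comp G F) (g \<cdot>\<^bsub>B\<^esub> f) = F1 (fun_comp G F) g \<cdot>\<^bsub>D\<^esub> F1 (fun_comp G F) f"
      using F.F1_cmp F.F1_hom G.F1_cmp[of "F1 F f" "F0 F X" "F0 F Y" "F1 F g" "F0 F Z"] by (simp add: fun_comp_def)
  next
    fix a b f f' g g' X Y Z
    assume "a \<in> hom2 B f f'" "b \<in> hom2 B g g'" "f \<in> hom1 B X Y" "g \<in> hom1 B Y Z"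
    then show "F2 (fun_comp G F) (b \<star>\<^bsub>B\<^esub> a) = F2 (fun_comp G F) b \<star>\<^bsub>D\<^esub> F2 (fun_comp G F) a"
      using F.F2_hc F.F2_hom F.F1_hom G.F2_hc[of "F2 F a" "F1 F f" "F1 F f'" "F2 F b" "F1 F g" "F1 F g'" "F0 F X" "F0 F Y" "F0 F Z"]
      by (simp add: fun_comp_def)
  next
    fix a b f g h
    assume "a \<in> hom2 B f g" "b \<in> hom2 B g h"
    then show "F2 (fun_comp G F) (b \<bullet>\<^bsub>B\<^esub> a) = F2 (fun_comp G F) b \<bullet>\<^bsub>D\<^esub> F2 (fun_comp G F) a"
      using F.F2_vc F.F2_hom G.F2_vc[of "F2 F a" "F1 F f" "F1 F g" "F2 F b" "F1 F h"] by (simp add: fun_comp_def)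
  qed (auto simp: fun_comp_def hom1_def hom2_def F.F1_one G.F1_one F.F2_idc G.F2_idc)
qed

lemma fun_id_simps [simp]: "F0 fun_id = (\<lambda>X. X)" "F1 fun_id = (\<lambda>X. X)" "F2 fun_id = (\<lambda>X. X)"
  by (simp_all add: fun_id_def)

lemma fun_comp_simps [simp]: "F0 (fun_comp G F) X = F0 G (F0 F X)" "F1 (fun_comp G F) f = F1 G (F1 F f)"
    "F2 (fun_comp G F) a = F2 G (F2 F a)"
  by (simp_all add: fun_comp_def)

lemma fun_comp_id [simp]: "fun_comp fun_id F = F" "fun_comp F fun_id = F"
  unfolding fun_comp_def by simp_all

section \<open>Monadicity over a locally full sub-2-category\<close>

text \<open>The objects \<open>obs\<close> and 1-cells \<open>ars\<close> span a locally full sub-2-category \<open>D\<close> through which \<open>T\<close> factors.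
  The hypotheses \<open>counit\<close> and \<open>extend\<close> say that restriction along \<open>\<eta> X\<close> is an equivalence
  from \<open>D(T X, Y)\<close> to \<open>C(X, Y)\<close>: \<open>extend\<close> is full faithfulness, and \<open>a \<cdot> T f\<close>, for \<open>a\<close> a counit, is a
  preimage of \<open>f\<close>. The hypotheses \<open>unital_ars\<close>, \<open>cancel_ars\<close> and \<open>replete_ars\<close> recognise \<open>D\<close> inside \<open>C\<close>: they put the
  structure maps of pseudoalgebras and the 1-cells underlying pseudomorphisms into \<open>D\<close>.\<close>

locale lax_reflection = sub_two_category C obs ars + two_monad C T \<eta> \<mu>
  for C :: "('o, 'm, 'c) twocat" (structure) and obs and ars and T and \<eta> and \<mu> +
  assumes T_obs: "X \<in> Ob C \<Longrightarrow> F0 T X \<in> obs"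
    and T_ars: "f \<in> Ar C \<Longrightarrow> F1 T f \<in> ars"
    and mult_ars: "X \<in> Ob C \<Longrightarrow> \<mu> X \<in> ars"
    and counit: "Y \<in> obs \<Longrightarrow> \<exists>a u. a \<in> ars \<and> Dm C a = F0 T Y \<and> Cd C a = Y
        \<and> iso2 C u \<and> Src C u = One C Y \<and> Trg C u = a \<cdot> \<eta> Y"
    and extend: "X \<in> Ob C \<Longrightarrow> g \<in> ars \<Longrightarrow> g' \<in> ars \<Longrightarrow> Dm C g = F0 T X \<Longrightarrow> Dm C g' = F0 T X
        \<Longrightarrow> Cd C g = Cd C g' \<Longrightarrow> c \<in> Ce C \<Longrightarrow> Src C c = g \<cdot> \<eta> X \<Longrightarrow> Trg C c = g' \<cdot> \<eta> X
        \<Longrightarrow> \<exists>!b. b \<in> Ce C \<and> Src C b = g \<and> Trg C b = g' \<and> b \<lhd> \<eta> X = c"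
    and unital_ars: "X \<in> Ob C \<Longrightarrow> a \<in> Ar C \<Longrightarrow> Dm C a = F0 T X \<Longrightarrow> Cd C a = X
        \<Longrightarrow> iso2 C u \<Longrightarrow> Src C u = One C X \<Longrightarrow> Trg C u = a \<cdot> \<eta> X \<Longrightarrow> a \<in> ars"
    and cancel_ars: "f \<in> Ar C \<Longrightarrow> Dm C f \<in> obs \<Longrightarrow> Cd C f \<in> obs \<Longrightarrow> a \<in> ars
        \<Longrightarrow> Dm C a = F0 T (Dm C f) \<Longrightarrow> Cd C a = Dm C f
        \<Longrightarrow> iso2 C u \<Longrightarrow> Src C u = One C (Dm C f) \<Longrightarrow> Trg C u = a \<cdot> \<eta> (Dm C f)
        \<Longrightarrow> f \<cdot> a \<in> ars \<Longrightarrow> f \<in> ars"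
    and replete_ars: "iso2 C t \<Longrightarrow> Src C t \<in> ars \<Longrightarrow> Trg C t \<in> ars"
begin

lemma eta_bd [simp]: "X \<in> Ob C \<Longrightarrow> \<eta> X \<in> Ar C" "X \<in> Ob C \<Longrightarrow> Dm C (\<eta> X) = X"
    "X \<in> Ob C \<Longrightarrow> Cd C (\<eta> X) = F0 T X"
  using unit.n_hom[of X] by (auto simp: hom1_def)

lemma mu_bd [simp]: "X \<in> Ob C \<Longrightarrow> \<mu> X \<in> Ar C" "X \<in> Ob C \<Longrightarrow> Dm C (\<mu> X) = F0 T (F0 T X)"
    "X \<in> Ob C \<Longrightarrow> Cd C (\<mu> X) = F0 T X"
  using mult.n_hom[of X] by (auto simp: hom1_def)

lemma eta_nat: "f \<in> Ar C \<Longrightarrow> X = Dm C f \<Longrightarrow> F1 T f \<cdot> \<eta> X = \<eta> (Cd C f) \<cdot> f"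
  using unit.n_nat1[of f X "Cd C f"] by (simp add: hom1_def)

lemma eta_nat2: "a \<in> Ce C \<Longrightarrow> X = Dm C (Src C a) \<Longrightarrow> F2 T a \<lhd> \<eta> X = \<eta> (Cd C (Src C a)) \<rhd> a"
  using unit.n_nat2[of a "Src C a" "Trg C a" X "Cd C (Src C a)"] by (simp add: hom1_def hom2_def)

text \<open>This reduces each coherence axiom below to a computation after whiskering with \<open>\<eta>\<close>, where the
  unit axioms determine all the structure 2-cells.\<close>

lemma ext_unique:
  assumes "X \<in> Ob C" "b \<in> Ce C" "b' \<in> Ce C" "Src C b' = Src C b" "Trg C b' = Trg C b"
    "Src C b \<in> ars" "Trg C b \<in> ars" "Dm C (Src C b) = F0 T X" "b \<lhd> \<eta> X = b' \<lhd> \<eta> X"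
  shows "b = b'"
proof -
  have "b \<lhd> \<eta> X \<in> Ce C" "Src C (b \<lhd> \<eta> X) = Src C b \<cdot> \<eta> X" "Trg C (b \<lhd> \<eta> X) = Trg C b \<cdot> \<eta> X"
    using assms by auto
  moreover have "Dm C (Trg C b) = F0 T X" "Cd C (Src C b) = Cd C (Trg C b)" using assms by auto
  ultimately show ?thesis using extend[of X "Src C b" "Trg C b" "b \<lhd> \<eta> X"] assms by metis
qed

lemma ext_iso:
  assumes X: "X \<in> Ob C" and b: "b \<in> Ce C" "Src C b \<in> ars" "Trg C b \<in> ars" "Dm C (Src C b) = F0 T X"
    and iso: "iso2 C (b \<lhd> \<eta> X)"
  shows "iso2 C b"
proof -
  have d: "Dm C (Trg C b) = F0 T X" using b by simp
  note [simp] = X b d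
  obtain c where c: "c \<in> Ce C" "Src C c = Trg C b \<cdot> \<eta> X" "Trg C c = Src C b \<cdot> \<eta> X"
    "c \<bullet> b \<lhd> \<eta> X = IdC C (Src C b \<cdot> \<eta> X)" "b \<lhd> \<eta> X \<bullet> c = IdC C (Trg C b \<cdot> \<eta> X)"
    using iso by (elim iso2E) simp
  obtain b' where b': "b' \<in> Ce C" "Src C b' = Trg C b" "Trg C b' = Src C b" "b' \<lhd> \<eta> X = c"
    using extend[of X "Trg C b" "Src C b" c] c by auto
  have "b' \<bullet> b = IdC C (Src C b)" "b \<bullet> b' = IdC C (Trg C b)"
    by (rule ext_unique[of X]; insert b' c ars_Ar; simp add: rwhisk_vc)+
  then show ?thesis using b' by (intro iso2I[of _ b']) auto
qed

end

subsection \<open>Pseudoalgebras from their unit\<close>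

text \<open>The part of a pseudoalgebra that determines the rest. Its associator is constructed from the unit, or, when
  given, is shown to satisfy all axioms as soon as it satisfies one of the unit axioms.\<close>

locale unital_algebra = lax_reflection C obs ars T \<eta> \<mu>
  for C :: "('o, 'm, 'c) twocat" (structure) and obs and ars and T and \<eta> and \<mu> +
  fixes A :: "('o, 'm, 'c) psalg"
  assumes carr_Ob [simp]: "carr A \<in> Ob C"
    and str_Ar [simp]: "str A \<in> Ar C"
    and str_Dm [simp]: "Dm C (str A) = F0 T (carr A)" and str_Cd [simp]: "Cd C (str A) = carr A"
    and unt_iso2: "iso2 C (unt A)"
    and unt_Src [simp]: "Src C (unt A) = One C (carr A)"
    and unt_Trg [simp]: "Trg C (unt A) = str A \<cdot> \<eta> (carr A)"
begin

lemma unt_Ce [simp]: "unt A \<in> Ce C"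
  using unt_iso2 by (rule iso2_Ce)

lemma str_ars: "str A \<in> ars"
  using unital_ars[OF carr_Ob str_Ar str_Dm str_Cd unt_iso2 unt_Src unt_Trg] .

lemma carr_obs: "carr A \<in> obs"
  using ars_Cd[OF str_ars] by simp

lemma unit_inverse:
  obtains u' where "u' \<in> Ce C" "Src C u' = str A \<cdot> \<eta> (carr A)" "Trg C u' = One C (carr A)"
    "u' \<bullet> unt A = IdC C (One C (carr A))" "unt A \<bullet> u' = IdC C (str A \<cdot> \<eta> (carr A))"
  using unt_iso2 by (elim iso2E) simp

lemma str_Tstr_ars: "str A \<cdot> F1 T (str A) \<in> ars" "str A \<cdot> \<mu> (carr A) \<in> ars"
  by (rule cmp_ars; simp add: str_ars T_ars mult_ars)+

lemma str_cmp_eta: "str A \<cdot> F1 T (str A) \<cdot> \<eta> (F0 T (carr A)) = str A \<cdot> \<eta> (carr A) \<cdot> str A"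
    "str A \<cdot> \<mu> (carr A) \<cdot> \<eta> (F0 T (carr A)) = str A"
  using eta_nat[of "str A"] mult_unit[of "carr A"] by (simp_all add: cmp_asc[symmetric])

text \<open>The unit axiom prescribes the restriction of the associator along \<open>\<eta>\<close>, namely the inverse of
  \<open>unt A\<close> whiskered with \<open>str A\<close>, and every restriction extends.\<close>

lemma asc_exists:
  obtains s where "s \<in> Ce C" "Src C s = str A \<cdot> F1 T (str A)" "Trg C s = str A \<cdot> \<mu> (carr A)"
    "s \<lhd> \<eta> (F0 T (carr A)) \<bullet> unt A \<lhd> str A = IdC C (str A)"
proof -
  obtain u' where u' [simp]: "u' \<in> Ce C" "Src C u' = str A \<cdot> \<eta> (carr A)" "Trg C u' = One C (carr A)"
    "u' \<bullet> unt A = IdC C (One C (carr A))" "unt A \<bullet> u' = IdC C (str A \<cdot> \<eta> (carr A))"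
    by (rule unit_inverse)
  obtain s where "s \<in> Ce C" "Src C s = str A \<cdot> F1 T (str A)" "Trg C s = str A \<cdot> \<mu> (carr A)"
      "s \<lhd> \<eta> (F0 T (carr A)) = u' \<lhd> str A"
    using extend[of "F0 T (carr A)" "str A \<cdot> F1 T (str A)" "str A \<cdot> \<mu> (carr A)" "u' \<lhd> str A"]
      str_Tstr_ars by (auto simp: str_cmp_eta)
  moreover have "u' \<lhd> str A \<bullet> unt A \<lhd> str A = IdC C (str A)"
    by (simp add: rwhisk_vc[symmetric])
  ultimately show ?thesis using that by simp
qed

context
  assumes asc_Ce [simp]: "asc A \<in> Ce C"
    and asc_Src [simp]: "Src C (asc A) = str A \<cdot> F1 T (str A)"
    and asc_Trg [simp]: "Trg C (asc A) = str A \<cdot> \<mu> (carr A)"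
    and asc_unt: "asc A \<lhd> \<eta> (F0 T (carr A)) \<bullet> unt A \<lhd> str A = IdC C (str A)"
begin

lemma asc_eta:
  assumes [simp]: "u' \<in> Ce C" "Src C u' = str A \<cdot> \<eta> (carr A)" "Trg C u' = One C (carr A)"
    and "u' \<bullet> unt A = IdC C (One C (carr A))"
  shows "asc A \<lhd> \<eta> (F0 T (carr A)) = u' \<lhd> str A"
proof (rule iso2_epi[of "unt A \<lhd> str A"])
  show "asc A \<lhd> \<eta> (F0 T (carr A)) \<bullet> unt A \<lhd> str A = u' \<lhd> str A \<bullet> unt A \<lhd> str A"
    using asc_unt assms(4) by (simp add: rwhisk_vc[symmetric])
qed (simp_all add: iso2_rwhisk unt_iso2 str_cmp_eta)

lemma asc_iso2: "iso2 C (asc A)"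
proof -
  obtain u' where u' [simp]: "u' \<in> Ce C" "Src C u' = str A \<cdot> \<eta> (carr A)" "Trg C u' = One C (carr A)"
    "u' \<bullet> unt A = IdC C (One C (carr A))" "unt A \<bullet> u' = IdC C (str A \<cdot> \<eta> (carr A))"
    by (rule unit_inverse)
  have "iso2 C u'" by (intro iso2I[of _ "unt A"]) auto
  then have "iso2 C (u' \<lhd> str A)" by (rule iso2_rwhisk) auto
  then show ?thesis
    using asc_eta[of u'] ext_iso[of "F0 T (carr A)" "asc A"] str_Tstr_ars by simp
qed

text \<open>Both sides start at \<open>T (T (T X))\<close>. After whiskering with \<open>\<eta>\<close> and moving \<open>\<eta>\<close> through \<open>T\<close> by naturality,
  each side is a composite of the associator \<open>s\<close> and of the inverse \<open>u'\<close> of the unit, in the two possible orders;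
  they agree by interchange.\<close>

lemma asc_pentagon:
  "asc A \<lhd> F1 T (\<mu> (carr A)) \<bullet> str A \<rhd> F2 T (asc A)
     = asc A \<lhd> \<mu> (F0 T (carr A)) \<bullet> asc A \<lhd> F1 T (F1 T (str A))" (is "?L = ?R")
proof -
  let ?X = "carr A" and ?a = "str A" and ?s = "asc A"
  let ?N = "\<eta> (F0 T (F0 T ?X))"
  obtain u' where u' [simp]: "u' \<in> Ce C" "Src C u' = str A \<cdot> \<eta> (carr A)" "Trg C u' = One C (carr A)"
    "u' \<bullet> unt A = IdC C (One C (carr A))" "unt A \<bullet> u' = IdC C (str A \<cdot> \<eta> (carr A))"
    by (rule unit_inverse)
  note s = asc_eta[OF u'(1-4)]
  have n1: "F1 T (\<mu> ?X) \<cdot> ?N = \<eta> (F0 T ?X) \<cdot> \<mu> ?X" using eta_nat[of "\<mu> ?X"] by simp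
  have n2: "F1 T (F1 T ?a) \<cdot> ?N = \<eta> (F0 T ?X) \<cdot> F1 T ?a" using eta_nat[of "F1 T ?a"] by simp
  have n3: "F2 T ?s \<lhd> ?N = \<eta> ?X \<rhd> ?s" using eta_nat2[of ?s] by simp
  have e1: "F1 T ?a \<cdot> F1 T (\<mu> ?X) = F1 T (?a \<cdot> \<mu> ?X)" "F1 T ?a \<cdot> F1 T (F1 T ?a) = F1 T (?a \<cdot> F1 T ?a)"
    by (simp_all add: T.F1_Cmp)
  have e2: "\<mu> ?X \<cdot> F1 T (F1 T ?a) = F1 T ?a \<cdot> \<mu> (F0 T ?X)"
    using mult.n_nat1[of ?a "F0 T ?X" ?X] by (simp add: hom1_def)
  have t: "?a \<cdot> F1 T ?a \<cdot> F1 T (\<mu> ?X) = ?a \<cdot> F1 T (?a \<cdot> \<mu> ?X)"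
    "?a \<cdot> F1 T ?a \<cdot> F1 T (F1 T ?a) = ?a \<cdot> F1 T (?a \<cdot> F1 T ?a)"
    "?a \<cdot> \<mu> ?X \<cdot> F1 T (F1 T ?a) = ?a \<cdot> F1 T ?a \<cdot> \<mu> (F0 T ?X)"
    "?a \<cdot> \<mu> ?X \<cdot> F1 T (\<mu> ?X) = ?a \<cdot> \<mu> ?X \<cdot> \<mu> (F0 T ?X)"
    by (simp_all add: cmp_asc[symmetric] e1 e2 mult_assoc)
  have "?L \<lhd> ?N = ?s \<lhd> (F1 T (\<mu> ?X) \<cdot> ?N) \<bullet> ?a \<rhd> (F2 T ?s \<lhd> ?N)"
    by (simp add: rwhisk_vc whisk_asc rwhisk_cmp t)
  also have "\<dots> = ?s \<lhd> \<eta> (F0 T ?X) \<lhd> \<mu> ?X \<bullet> (?a \<cdot> \<eta> ?X) \<rhd> ?s"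
    by (simp add: n1 n3 rwhisk_cmp lwhisk_cmp)
  also have "\<dots> = u' \<lhd> (?a \<cdot> \<mu> ?X) \<bullet> (?a \<cdot> \<eta> ?X) \<rhd> ?s"
    by (simp add: s rwhisk_cmp)
  also have "\<dots> = ?s \<bullet> u' \<lhd> (?a \<cdot> F1 T ?a)"
    using whisk_exchange[of ?s u'] by simp
  also have "\<dots> = ?s \<lhd> (\<mu> (F0 T ?X) \<cdot> ?N) \<bullet> ?s \<lhd> \<eta> (F0 T ?X) \<lhd> F1 T ?a"
    by (simp add: s rwhisk_cmp mult_unit)
  also have "\<dots> = ?s \<lhd> (\<mu> (F0 T ?X) \<cdot> ?N) \<bullet> ?s \<lhd> (F1 T (F1 T ?a) \<cdot> ?N)"
    by (simp add: n2 rwhisk_cmp)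
  also have "\<dots> = ?R \<lhd> ?N"
    by (simp add: rwhisk_vc rwhisk_cmp t)
  finally have eq: "?L \<lhd> ?N = ?R \<lhd> ?N" .
  have mem: "?a \<cdot> F1 T (?a \<cdot> F1 T ?a) \<in> ars" "?a \<cdot> \<mu> ?X \<cdot> \<mu> (F0 T ?X) \<in> ars"
    by (simp_all add: cmp_ars str_ars T_ars mult_ars str_Tstr_ars)
  show ?thesis
    by (rule ext_unique[of "F0 T (F0 T ?X)", OF _ _ _ _ _ _ _ _ eq]) (simp_all add: t mem)
qed

text \<open>After whiskering with \<open>\<eta>\<close> the left-hand side becomes, by interchange, the composite of the unit
  isomorphism with its inverse.\<close>

lemma asc_unt_T: "asc A \<lhd> F1 T (\<eta> (carr A)) \<bullet> str A \<rhd> F2 T (unt A) = IdC C (str A)" (is "?L = ?R")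
proof -
  let ?X = "carr A" and ?a = "str A" and ?s = "asc A" and ?u = "unt A"
  obtain u' where u' [simp]: "u' \<in> Ce C" "Src C u' = str A \<cdot> \<eta> (carr A)" "Trg C u' = One C (carr A)"
    "u' \<bullet> unt A = IdC C (One C (carr A))" "unt A \<bullet> u' = IdC C (str A \<cdot> \<eta> (carr A))"
    by (rule unit_inverse)
  note s = asc_eta[OF u'(1-4)]
  have n1: "F1 T (\<eta> ?X) \<cdot> \<eta> ?X = \<eta> (F0 T ?X) \<cdot> \<eta> ?X" using eta_nat[of "\<eta> ?X"] by simp
  have n3: "F2 T ?u \<lhd> \<eta> ?X = \<eta> ?X \<rhd> ?u" using eta_nat2[of ?u] by simp
  have o: "F1 T (One C ?X) = One C (F0 T ?X)" by (simp add: T.F1_one)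
  have t: "?a \<cdot> F1 T ?a \<cdot> F1 T (\<eta> ?X) = ?a \<cdot> F1 T (?a \<cdot> \<eta> ?X)" "?a \<cdot> \<mu> ?X \<cdot> F1 T (\<eta> ?X) = ?a"
    by (simp_all add: cmp_asc[symmetric] T.F1_Cmp mult_T_unit)
  have "?L \<lhd> \<eta> ?X = ?s \<lhd> (F1 T (\<eta> ?X) \<cdot> \<eta> ?X) \<bullet> ?a \<rhd> (F2 T ?u \<lhd> \<eta> ?X)"
    by (simp add: rwhisk_vc whisk_asc rwhisk_cmp t o)
  also have "\<dots> = ?s \<lhd> \<eta> (F0 T ?X) \<lhd> \<eta> ?X \<bullet> (?a \<cdot> \<eta> ?X) \<rhd> ?u"
    by (simp add: n1 n3 rwhisk_cmp lwhisk_cmp)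
  also have "\<dots> = u' \<lhd> (?a \<cdot> \<eta> ?X) \<bullet> (?a \<cdot> \<eta> ?X) \<rhd> ?u"
    by (simp add: s rwhisk_cmp)
  also have "\<dots> = ?u \<bullet> u'" using whisk_exchange[of ?u u'] by simp
  also have "\<dots> = ?R \<lhd> \<eta> ?X" by simp
  finally have eq: "?L \<lhd> \<eta> ?X = ?R \<lhd> \<eta> ?X" .
  show ?thesis
    by (rule ext_unique[of ?X, OF _ _ _ _ _ _ _ _ eq]) (simp_all add: t o str_ars)
qed

lemma pseudoalgebraI: "pseudoalgebra C T \<eta> \<mu> A"
  by unfold_locales
    (auto simp: hom1_def hom2_def asc_iso2 unt_iso2 asc_pentagon asc_unt_T asc_unt)

end

end

context lax_reflection
begin

lemma pseudoalgebra_unital: "pseudoalgebra C T \<eta> \<mu> A \<Longrightarrow> unital_algebra C obs ars T \<eta> \<mu> A"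
proof -
  assume "pseudoalgebra C T \<eta> \<mu> A"
  then interpret A: pseudoalgebra C T \<eta> \<mu> A .
  show ?thesis
    using A.carr_ob A.str_hom A.unt_hom A.unt_iso by unfold_locales (auto simp: hom1_def hom2_def)
qed

end

subsection \<open>Pseudomorphisms from their underlying 1-cell\<close>

locale algebra_pair = lax_reflection C obs ars T \<eta> \<mu> + A: pseudoalgebra C T \<eta> \<mu> A + B: pseudoalgebra C T \<eta> \<mu> B
  for C :: "('o, 'm, 'c) twocat" (structure) and obs and ars and T and \<eta> and \<mu> and A and B
begin

sublocale A: unital_algebra C obs ars T \<eta> \<mu> A
  by (rule pseudoalgebra_unital, rule A.pseudoalgebra_axioms)

sublocale B: unital_algebra C obs ars T \<eta> \<mu> B
  by (rule pseudoalgebra_unital, rule B.pseudoalgebra_axioms)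

lemma asc_bd [simp]: "asc A \<in> Ce C" "Src C (asc A) = str A \<cdot> F1 T (str A)" "Trg C (asc A) = str A \<cdot> \<mu> (carr A)"
    "asc B \<in> Ce C" "Src C (asc B) = str B \<cdot> F1 T (str B)" "Trg C (asc B) = str B \<cdot> \<mu> (carr B)"
  using A.asc_hom B.asc_hom by (auto simp: hom2_def)

context
  fixes f
  assumes f_ars: "f \<in> ars" and f_Dm [simp]: "Dm C f = carr A" and f_Cd [simp]: "Cd C f = carr B"
begin

lemma f_Ar [simp]: "f \<in> Ar C"
  using f_ars by (rule ars_Ar)

lemma bTf_fa_ars: "str B \<cdot> F1 T f \<in> ars" "f \<cdot> str A \<in> ars"
  by (simp_all add: cmp_ars f_ars A.str_ars B.str_ars T_ars)

lemma bTf_eta: "str B \<cdot> F1 T f \<cdot> \<eta> (carr A) = str B \<cdot> \<eta> (carr B) \<cdot> f"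
  using eta_nat[of f] by (simp add: cmp_asc[symmetric])

text \<open>The unit axiom prescribes the restriction of the square along \<open>\<eta>\<close>: remove the unit of \<open>B\<close>, then insert the
  unit of \<open>A\<close>.\<close>

lemma sq_exists:
  obtains s where "s \<in> Ce C" "Src C s = str B \<cdot> F1 T f" "Trg C s = f \<cdot> str A"
    "s \<lhd> \<eta> (carr A) \<bullet> unt B \<lhd> f = f \<rhd> unt A"
proof -
  obtain v where v [simp]: "v \<in> Ce C" "Src C v = str B \<cdot> \<eta> (carr B)" "Trg C v = One C (carr B)"
    "v \<bullet> unt B = IdC C (One C (carr B))" "unt B \<bullet> v = IdC C (str B \<cdot> \<eta> (carr B))"
    by (rule B.unit_inverse)
  obtain s where "s \<in> Ce C" "Src C s = str B \<cdot> F1 T f" "Trg C s = f \<cdot> str A"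
      "s \<lhd> \<eta> (carr A) = f \<rhd> unt A \<bullet> v \<lhd> f"
    using extend[of "carr A" "str B \<cdot> F1 T f" "f \<cdot> str A" "f \<rhd> unt A \<bullet> v \<lhd> f"]
      bTf_fa_ars by (auto simp: bTf_eta cmp_asc)
  moreover have "f \<rhd> unt A \<bullet> v \<lhd> f \<bullet> unt B \<lhd> f = f \<rhd> unt A"
    by (simp add: vc_asc[symmetric] rwhisk_vc[symmetric])
  ultimately show ?thesis using that by simp
qed

context
  fixes s
  assumes s_Ce [simp]: "s \<in> Ce C" and s_Src [simp]: "Src C s = str B \<cdot> F1 T f"
    and s_Trg [simp]: "Trg C s = f \<cdot> str A"
    and s_unt: "s \<lhd> \<eta> (carr A) \<bullet> unt B \<lhd> f = f \<rhd> unt A"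
begin

lemma sq_eta:
  assumes [simp]: "v \<in> Ce C" "Src C v = str B \<cdot> \<eta> (carr B)" "Trg C v = One C (carr B)"
    and v: "v \<bullet> unt B = IdC C (One C (carr B))"
  shows "s \<lhd> \<eta> (carr A) = f \<rhd> unt A \<bullet> v \<lhd> f"
proof (rule iso2_epi[of "unt B \<lhd> f"])
  have "f \<rhd> unt A \<bullet> v \<lhd> f \<bullet> unt B \<lhd> f = f \<rhd> unt A"
    by (simp add: vc_asc[symmetric] rwhisk_vc[symmetric] v)
  then show "s \<lhd> \<eta> (carr A) \<bullet> unt B \<lhd> f = f \<rhd> unt A \<bullet> v \<lhd> f \<bullet> unt B \<lhd> f"
    using s_unt by simp
qed (simp_all add: iso2_rwhisk B.unt_iso2 bTf_eta)

lemma sq_unique: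
  assumes "s' \<in> Ce C" "Src C s' = str B \<cdot> F1 T f" "Trg C s' = f \<cdot> str A"
    "s' \<lhd> \<eta> (carr A) \<bullet> unt B \<lhd> f = f \<rhd> unt A"
  shows "s' = s"
proof (rule ext_unique[of "carr A"])
  show "s' \<lhd> \<eta> (carr A) = s \<lhd> \<eta> (carr A)"
    by (rule iso2_epi[of "unt B \<lhd> f"]) (simp_all add: assms s_unt iso2_rwhisk B.unt_iso2 bTf_eta)
qed (use assms bTf_fa_ars in simp_all)

lemma sq_iso2: "iso2 C s"
proof -
  obtain v where v [simp]: "v \<in> Ce C" "Src C v = str B \<cdot> \<eta> (carr B)" "Trg C v = One C (carr B)"
    "v \<bullet> unt B = IdC C (One C (carr B))" "unt B \<bullet> v = IdC C (str B \<cdot> \<eta> (carr B))"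
    by (rule B.unit_inverse)
  have "iso2 C v" by (intro iso2I[of _ "unt B"]) auto
  then have "iso2 C (f \<rhd> unt A \<bullet> v \<lhd> f)"
    by (intro iso2_vc iso2_lwhisk iso2_rwhisk) (simp_all add: A.unt_iso2)
  then show ?thesis
    using sq_eta[of v] bTf_fa_ars ext_iso[of "carr A" s] by simp
qed

text \<open>After whiskering with \<open>\<eta>\<close> the associator of \<open>A\<close> becomes the inverse of the unit that the square has
  inserted, and cancels it. Both sides are left with the square preceded by the inverse \<open>v\<close> of the unit of \<open>B\<close>.\<close>

lemma sq_asc_coherence:
  "f \<rhd> asc A \<bullet> (s \<lhd> F1 T (str A) \<bullet> str B \<rhd> F2 T s) = s \<lhd> \<mu> (carr A) \<bullet> asc B \<lhd> F1 T (F1 T f)"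
  (is "?L = ?R")
proof -
  let ?X = "carr A" and ?a = "str A" and ?b = "str B" and ?Y = "carr B"
  let ?N = "\<eta> (F0 T ?X)"
  obtain u' where u' [simp]: "u' \<in> Ce C" "Src C u' = str A \<cdot> \<eta> (carr A)" "Trg C u' = One C (carr A)"
    "u' \<bullet> unt A = IdC C (One C (carr A))" "unt A \<bullet> u' = IdC C (str A \<cdot> \<eta> (carr A))"
    by (rule A.unit_inverse)
  obtain v where v [simp]: "v \<in> Ce C" "Src C v = str B \<cdot> \<eta> (carr B)" "Trg C v = One C (carr B)"
    "v \<bullet> unt B = IdC C (One C (carr B))" "unt B \<bullet> v = IdC C (str B \<cdot> \<eta> (carr B))"
    by (rule B.unit_inverse)
  have sA: "asc A \<lhd> ?N = u' \<lhd> ?a" by (rule A.asc_eta) (simp_all add: A.unt_coherence)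
  have sB: "asc B \<lhd> \<eta> (F0 T ?Y) = v \<lhd> ?b" by (rule B.asc_eta) (simp_all add: B.unt_coherence)
  note sf = sq_eta[OF v(1-4)]
  have n1: "F1 T ?a \<cdot> ?N = \<eta> ?X \<cdot> ?a" using eta_nat[of ?a] by simp
  have n2: "F1 T (F1 T f) \<cdot> ?N = \<eta> (F0 T ?Y) \<cdot> F1 T f" using eta_nat[of "F1 T f"] by simp
  have n3: "F2 T s \<lhd> ?N = \<eta> ?Y \<rhd> s" using eta_nat2[of s] by simp
  have m: "\<mu> ?Y \<cdot> F1 T (F1 T f) = F1 T f \<cdot> \<mu> ?X"
    using mult.n_nat1[of f ?X ?Y] by (simp add: hom1_def)
  have t: "?b \<cdot> F1 T f \<cdot> F1 T ?a = ?b \<cdot> F1 T (f \<cdot> ?a)" "?b \<cdot> F1 T ?b \<cdot> F1 T (F1 T f) = ?b \<cdot> F1 T (?b \<cdot> F1 T f)"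
    "f \<cdot> (?a \<cdot> F1 T ?a) = f \<cdot> ?a \<cdot> F1 T ?a" "f \<cdot> (?a \<cdot> \<mu> ?X) = f \<cdot> ?a \<cdot> \<mu> ?X"
    "?b \<cdot> \<mu> ?Y \<cdot> F1 T (F1 T f) = ?b \<cdot> F1 T f \<cdot> \<mu> ?X"
    by (simp_all add: cmp_asc[symmetric] T.F1_Cmp m)
  have t': "?b \<cdot> F1 T f \<cdot> \<eta> ?X = ?b \<cdot> \<eta> ?Y \<cdot> f" by (rule bTf_eta)
  have t'': "f \<cdot> (?a \<cdot> \<eta> ?X) = f \<cdot> ?a \<cdot> \<eta> ?X" "f \<cdot> ?a \<cdot> (\<eta> ?X \<cdot> ?a) = f \<cdot> ?a \<cdot> \<eta> ?X \<cdot> ?a"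
      "f \<cdot> ?a \<cdot> F1 T ?a \<cdot> ?N = f \<cdot> ?a \<cdot> \<eta> ?X \<cdot> ?a" "?b \<cdot> \<eta> ?Y \<cdot> (f \<cdot> ?a) = ?b \<cdot> \<eta> ?Y \<cdot> f \<cdot> ?a"
      "f \<cdot> ?a \<cdot> (F1 T ?a \<cdot> ?N) = f \<cdot> ?a \<cdot> \<eta> ?X \<cdot> ?a"
      "?b \<cdot> \<eta> ?Y \<cdot> (?b \<cdot> F1 T f) = ?b \<cdot> \<eta> ?Y \<cdot> ?b \<cdot> F1 T f"
    using n1 by (simp_all add: cmp_asc) (simp_all add: cmp_asc[symmetric] n1)
  have "?L \<lhd> ?N = f \<rhd> (asc A \<lhd> ?N) \<bullet> (s \<lhd> (F1 T ?a \<cdot> ?N) \<bullet> ?b \<rhd> (F2 T s \<lhd> ?N))"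
    by (simp add: rwhisk_vc whisk_asc rwhisk_cmp t)
  also have "s \<lhd> (F1 T ?a \<cdot> ?N) = s \<lhd> \<eta> ?X \<lhd> ?a"
    by (simp add: n1 rwhisk_cmp)
  also have "\<dots> = f \<rhd> (unt A \<lhd> ?a) \<bullet> v \<lhd> (f \<cdot> ?a)"
    by (simp add: sf rwhisk_vc rwhisk_cmp whisk_asc t'')
  also have "?b \<rhd> (F2 T s \<lhd> ?N) = (?b \<cdot> \<eta> ?Y) \<rhd> s"
    by (simp add: n3 lwhisk_cmp)
  also have "f \<rhd> (unt A \<lhd> ?a) \<bullet> v \<lhd> (f \<cdot> ?a) \<bullet> (?b \<cdot> \<eta> ?Y) \<rhd> s
      = f \<rhd> (unt A \<lhd> ?a) \<bullet> (v \<lhd> (f \<cdot> ?a) \<bullet> (?b \<cdot> \<eta> ?Y) \<rhd> s)"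
    by (rule vc_asc[symmetric]) (simp_all add: t'')
  also have "v \<lhd> (f \<cdot> ?a) \<bullet> (?b \<cdot> \<eta> ?Y) \<rhd> s = s \<bullet> v \<lhd> (?b \<cdot> F1 T f)"
    using whisk_exchange[of s v] by simp
  also have "f \<rhd> (asc A \<lhd> ?N) \<bullet> (f \<rhd> (unt A \<lhd> ?a) \<bullet> (s \<bullet> v \<lhd> (?b \<cdot> F1 T f)))
      = f \<rhd> (u' \<lhd> ?a \<bullet> unt A \<lhd> ?a) \<bullet> (s \<bullet> v \<lhd> (?b \<cdot> F1 T f))"
    by (simp add: sA vc_asc lwhisk_vc t'')
  also have "\<dots> = s \<bullet> v \<lhd> (?b \<cdot> F1 T f)"
    by (simp add: rwhisk_vc[symmetric])
  also have "\<dots> = s \<lhd> (\<mu> ?X \<cdot> ?N) \<bullet> asc B \<lhd> \<eta> (F0 T ?Y) \<lhd> F1 T f"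
    by (simp add: mult_unit sB rwhisk_cmp)
  also have "\<dots> = s \<lhd> (\<mu> ?X \<cdot> ?N) \<bullet> asc B \<lhd> (F1 T (F1 T f) \<cdot> ?N)"
    by (simp add: n2 rwhisk_cmp)
  also have "\<dots> = ?R \<lhd> ?N"
    by (simp add: rwhisk_vc rwhisk_cmp t)
  finally have eq: "?L \<lhd> ?N = ?R \<lhd> ?N" .
  have mem: "?b \<cdot> F1 T (?b \<cdot> F1 T f) \<in> ars" "f \<cdot> ?a \<cdot> \<mu> ?X \<in> ars"
    by (simp_all add: cmp_ars f_ars A.str_ars B.str_ars T_ars mult_ars)
  show ?thesis
    by (rule ext_unique[of "F0 T ?X", OF _ _ _ _ _ _ _ _ eq]) (simp_all add: t mem)
qed

lemma pseudomorphismI: "pseudomorphism C T \<eta> \<mu> \<lparr>pdom = A, pcod = B, und = f, sq = s\<rparr>"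
  using sq_asc_coherence s_unt sq_iso2 A.pseudoalgebra_axioms B.pseudoalgebra_axioms
  unfolding pseudomorphism_def pseudomorphism_axioms_def
  by (auto simp: hom1_def hom2_def)

end

end

end

lemma psmor_id_simps [simp]: "pdom (psmor_id C A) = A" "pcod (psmor_id C A) = A"
    "und (psmor_id C A) = One C (carr A)" "sq (psmor_id C A) = IdC C (str A)"
  by (simp_all add: psmor_id_def)

lemma psmor_comp_simps [simp]: "pdom (psmor_comp C T g f) = pdom f" "pcod (psmor_comp C T g f) = pcod g"
    "und (psmor_comp C T g f) = und g \<cdot>\<^bsub>C\<^esub> und f"
    "sq (psmor_comp C T g f) = und g \<rhd>\<^bsub>C\<^esub> sq f \<bullet>\<^bsub>C\<^esub> sq g \<lhd>\<^bsub>C\<^esub> F1 T (und f)"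
  by (simp_all add: psmor_comp_def)

lemma PsAlg_simps [simp]:
  "Ob (PsAlg C T \<eta> \<mu>) = {A. pseudoalgebra C T \<eta> \<mu> A}"
  "Ar (PsAlg C T \<eta> \<mu>) = {f. pseudomorphism C T \<eta> \<mu> f}" "Dm (PsAlg C T \<eta> \<mu>) = pdom" "Cd (PsAlg C T \<eta> \<mu>) = pcod"
  "Ce (PsAlg C T \<eta> \<mu>) = {t. pseudocell C T \<eta> \<mu> t}" "Src (PsAlg C T \<eta> \<mu>) = csrc" "Trg (PsAlg C T \<eta> \<mu>) = ctrg"
  "One (PsAlg C T \<eta> \<mu>) = psmor_id C" "Cmp (PsAlg C T \<eta> \<mu>) = psmor_comp C T"
  "IdC (PsAlg C T \<eta> \<mu>) f = \<lparr>csrc = f, ctrg = f, ucell = IdC C (und f)\<rparr>"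
  "VC (PsAlg C T \<eta> \<mu>) b a = \<lparr>csrc = csrc a, ctrg = ctrg b, ucell = ucell b \<bullet>\<^bsub>C\<^esub> ucell a\<rparr>"
  "HC (PsAlg C T \<eta> \<mu>) b a = \<lparr>csrc = psmor_comp C T (csrc b) (csrc a),
                   ctrg = psmor_comp C T (ctrg b) (ctrg a), ucell = ucell b \<star>\<^bsub>C\<^esub> ucell a\<rparr>"
  by (simp_all add: PsAlg_def)

context lax_reflection
begin

abbreviation (input) alg where "alg \<equiv> pseudoalgebra C T \<eta> \<mu>"
abbreviation (input) mor where "mor \<equiv> pseudomorphism C T \<eta> \<mu>"
abbreviation (input) cell where "cell \<equiv> pseudocell C T \<eta> \<mu>"

lemma alg_facts [simp]:
  assumes "alg A"
  shows "carr A \<in> Ob C" "str A \<in> Ar C" "Dm C (str A) = F0 T (carr A)" "Cd C (str A) = carr A"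
    "unt A \<in> Ce C" "Src C (unt A) = One C (carr A)" "Trg C (unt A) = str A \<cdot> \<eta> (carr A)"
    "carr A \<in> obs" "str A \<in> ars"
proof -
  interpret unital_algebra C obs ars T \<eta> \<mu> A by (rule pseudoalgebra_unital, rule assms)
  show "carr A \<in> Ob C" "str A \<in> Ar C" "Dm C (str A) = F0 T (carr A)" "Cd C (str A) = carr A"
    "unt A \<in> Ce C" "Src C (unt A) = One C (carr A)" "Trg C (unt A) = str A \<cdot> \<eta> (carr A)"
    "carr A \<in> obs" "str A \<in> ars" by (simp_all add: carr_obs str_ars)
qed

lemma mor_algs:
  assumes "mor f" shows "alg (pdom f)" "alg (pcod f)"
proof -
  interpret pseudomorphism C T \<eta> \<mu> f by fact
  show "alg (pdom f)" "alg (pcod f)"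
    by (rule dom.pseudoalgebra_axioms, rule cod.pseudoalgebra_axioms)
qed

text \<open>The last claim is the one with content: the square makes the composite of the structure map with \<open>und f\<close> isomorphic to a
  composite of 1-cells in \<open>ars\<close>, and a structure map with invertible unit can be cancelled.\<close>

lemma mor_facts [simp]:
  assumes "mor f"
  shows "und f \<in> Ar C" "Dm C (und f) = carr (pdom f)" "Cd C (und f) = carr (pcod f)"
    "sq f \<in> Ce C" "Src C (sq f) = str (pcod f) \<cdot> F1 T (und f)" "Trg C (sq f) = und f \<cdot> str (pdom f)"
    "alg (pdom f)" "alg (pcod f)" "und f \<in> ars"
proof -
  interpret f: pseudomorphism C T \<eta> \<mu> f by fact
  note [simp] = mor_algs[OF assms]
  show f [simp]: "und f \<in> Ar C" "Dm C (und f) = carr (pdom f)" "Cd C (und f) = carr (pcod f)"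
    "sq f \<in> Ce C" "Src C (sq f) = str (pcod f) \<cdot> F1 T (und f)" "Trg C (sq f) = und f \<cdot> str (pdom f)"
    "alg (pdom f)" "alg (pcod f)"
    using f.und_hom f.sq_hom by (simp_all add: hom1_def hom2_def)
  have "str (pcod f) \<cdot> F1 T (und f) \<in> ars" by (rule cmp_ars) (simp_all add: T_ars)
  then have "und f \<cdot> str (pdom f) \<in> ars" using replete_ars[OF f.sq_iso] by simp
  then show "und f \<in> ars"
    using f.dom.unt_iso by (intro cancel_ars[of "und f" "str (pdom f)" "unt (pdom f)"]) simp_all
qed

lemma mor_sq_unt: "mor f \<Longrightarrow> sq f \<lhd> \<eta> (carr (pdom f)) \<bullet> unt (pcod f) \<lhd> und f = und f \<rhd> unt (pdom f)"
  by (rule pseudomorphism.sq_unt)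

lemma morI:
  assumes "alg (pdom f)" "alg (pcod f)" "und f \<in> ars" "Dm C (und f) = carr (pdom f)" "Cd C (und f) = carr (pcod f)"
    "sq f \<in> Ce C" "Src C (sq f) = str (pcod f) \<cdot> F1 T (und f)" "Trg C (sq f) = und f \<cdot> str (pdom f)"
    "sq f \<lhd> \<eta> (carr (pdom f)) \<bullet> unt (pcod f) \<lhd> und f = und f \<rhd> unt (pdom f)"
  shows "mor f"
proof -
  interpret A: pseudoalgebra C T \<eta> \<mu> "pdom f" by (rule assms(1))
  interpret B: pseudoalgebra C T \<eta> \<mu> "pcod f" by (rule assms(2))
  interpret algebra_pair C obs ars T \<eta> \<mu> "pdom f" "pcod f" ..
  show ?thesis using pseudomorphismI[OF assms(3-9)] by (cases f) simp
qed

lemma mor_eq: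
  assumes f: "mor f" "mor g" "pdom f = pdom g" "pcod f = pcod g" "und f = und g"
  shows "f = g"
proof -
  interpret A: pseudoalgebra C T \<eta> \<mu> "pdom f" using f by simp
  interpret B: pseudoalgebra C T \<eta> \<mu> "pcod f" using f by simp
  interpret algebra_pair C obs ars T \<eta> \<mu> "pdom f" "pcod f" ..
  have "sq g = sq f"
    by (rule sq_unique[of "und f"])
      (insert f mor_facts[OF f(1)] mor_facts[OF f(2)] mor_sq_unt[OF f(1)] mor_sq_unt[OF f(2)], simp_all)
  then show ?thesis using f by (cases f, cases g) simp
qed

text \<open>A 1-cell of \<open>ars\<close> between carriers underlies exactly one pseudomorphism: existence is \<open>sq_exists\<close>,
  uniqueness is \<open>mor_eq\<close>.\<close>

definition lift where
  "lift A B f = (THE F. mor F \<and> pdom F = A \<and> pcod F = B \<and> und F = f)"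

lemma lift [simp]:
  assumes "alg A" "alg B" "f \<in> ars" "Dm C f = carr A" "Cd C f = carr B"
  shows "mor (lift A B f)" "pdom (lift A B f) = A" "pcod (lift A B f) = B" "und (lift A B f) = f"
proof -
  interpret A: pseudoalgebra C T \<eta> \<mu> A by (rule assms)
  interpret B: pseudoalgebra C T \<eta> \<mu> B by (rule assms)
  interpret algebra_pair C obs ars T \<eta> \<mu> A B ..
  obtain s where s: "s \<in> Ce C" "Src C s = str B \<cdot> F1 T f" "Trg C s = f \<cdot> str A"
    "s \<lhd> \<eta> (carr A) \<bullet> unt B \<lhd> f = f \<rhd> unt A"
    by (rule sq_exists[OF assms(3-5)])
  let ?F = "\<lparr>pdom = A, pcod = B, und = f, sq = s\<rparr>"
  have F: "mor ?F" by (rule pseudomorphismI[OF assms(3-5) s])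
  have "lift A B f = ?F"
    unfolding lift_def by (rule the_equality) (use F in \<open>auto intro!: mor_eq\<close>)
  then show "mor (lift A B f)" "pdom (lift A B f) = A" "pcod (lift A B f) = B" "und (lift A B f) = f"
    using F by simp_all
qed

lemma mor_id [simp]: "alg A \<Longrightarrow> mor (psmor_id C A)"
  by (rule morI) (simp_all add: one_ars T.F1_one)

lemma mor_comp [simp]:
  assumes f [simp]: "mor f" and g [simp]: "mor g" and p: "pdom g = pcod f"
  shows "mor (psmor_comp C T g f)"
proof -
  let ?f = "und f" and ?g = "und g" and ?X = "carr (pdom f)" and ?Y = "carr (pcod f)" and ?Z = "carr (pcod g)"
  let ?a = "str (pdom f)" and ?b = "str (pcod f)" and ?c = "str (pcod g)"
  let ?u = "unt (pdom f)" and ?v = "unt (pcod f)" and ?w = "unt (pcod g)"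
  have [simp]: "alg (pcod f)" using f by simp
  note [simp] = mor_facts(2)[OF g, unfolded p] mor_facts(6)[OF g, unfolded p]
  have ef: "h \<cdot> F1 T ?f \<cdot> \<eta> ?X = h \<cdot> \<eta> ?Y \<cdot> ?f" if "h \<in> Ar C" "Dm C h = F0 T ?Y" for h
    using that eta_nat[of ?f] by (simp add: cmp_asc[symmetric])
  have eg: "h \<cdot> F1 T ?g \<cdot> \<eta> ?Y = h \<cdot> \<eta> ?Z \<cdot> ?g" if "h \<in> Ar C" "Dm C h = F0 T ?Z" for h
    using that eta_nat[of ?g] by (simp add: cmp_asc[symmetric])
  have e: "F1 T ?f \<cdot> \<eta> ?X = \<eta> ?Y \<cdot> ?f" using eta_nat[of ?f] by simp
  note nf = cmp_asc ef eg e T.F1_Cmp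
  have u: "sq g \<lhd> \<eta> ?Y \<bullet> ?w \<lhd> ?g = ?g \<rhd> ?v"
    using mor_sq_unt[OF g] by (simp add: p)
  have "(?g \<rhd> sq f \<bullet> sq g \<lhd> F1 T ?f) \<lhd> \<eta> ?X \<bullet> ?w \<lhd> (?g \<cdot> ?f)
     = ?g \<rhd> (sq f \<lhd> \<eta> ?X) \<bullet> sq g \<lhd> (F1 T ?f \<cdot> \<eta> ?X) \<bullet> ?w \<lhd> (?g \<cdot> ?f)"
    by (simp add: rwhisk_vc rwhisk_cmp whisk_asc cmp_asc)
  also have "\<dots> = ?g \<rhd> (sq f \<lhd> \<eta> ?X) \<bullet> sq g \<lhd> \<eta> ?Y \<lhd> ?f \<bullet> ?w \<lhd> ?g \<lhd> ?f"
    by (simp add: e rwhisk_cmp)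
  also have "\<dots> = ?g \<rhd> (sq f \<lhd> \<eta> ?X) \<bullet> (sq g \<lhd> \<eta> ?Y \<bullet> ?w \<lhd> ?g) \<lhd> ?f"
    by (simp add: rwhisk_vc vc_asc nf)
  also have "\<dots> = ?g \<rhd> (sq f \<lhd> \<eta> ?X \<bullet> ?v \<lhd> ?f)"
    unfolding u by (simp add: lwhisk_vc whisk_asc nf)
  also have "\<dots> = (?g \<cdot> ?f) \<rhd> ?u"
    by (simp add: mor_sq_unt lwhisk_cmp)
  finally have eq: "(?g \<rhd> sq f \<bullet> sq g \<lhd> F1 T ?f) \<lhd> \<eta> ?X \<bullet> ?w \<lhd> (?g \<cdot> ?f) = (?g \<cdot> ?f) \<rhd> ?u" .
  have "?g \<cdot> ?f \<in> ars" by (rule cmp_ars) simp_all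
  then show ?thesis using eq by (intro morI) (simp_all add: nf p)
qed

lemma cell_facts [simp]:
  assumes "cell t"
  shows "mor (csrc t)" "mor (ctrg t)" "pdom (ctrg t) = pdom (csrc t)" "pcod (ctrg t) = pcod (csrc t)"
    "ucell t \<in> Ce C" "Src C (ucell t) = und (csrc t)" "Trg C (ucell t) = und (ctrg t)"
proof -
  interpret pseudocell C T \<eta> \<mu> t by fact
  show "mor (csrc t)" "mor (ctrg t)" "pdom (ctrg t) = pdom (csrc t)" "pcod (ctrg t) = pcod (csrc t)"
    "ucell t \<in> Ce C" "Src C (ucell t) = und (csrc t)" "Trg C (ucell t) = und (ctrg t)"
    using parallel ucell_hom src.pseudomorphism_axioms trg.pseudomorphism_axioms
    by (simp_all add: hom2_def)
qed

text \<open>Compatibility with the squares is an equation out of \<open>T X\<close>. Restricted along \<open>\<eta>\<close> the squares are composites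
  of units, past which the 2-cell slides by interchange.\<close>

lemma cellI:
  assumes f: "mor (csrc t)" and g: "mor (ctrg t)" and p: "pdom (ctrg t) = pdom (csrc t)" "pcod (ctrg t) = pcod (csrc t)"
    and t: "ucell t \<in> Ce C" "Src C (ucell t) = und (csrc t)" "Trg C (ucell t) = und (ctrg t)"
  shows "cell t"
proof -
  let ?A = "pdom (csrc t)" and ?B = "pcod (csrc t)" and ?f = "und (csrc t)" and ?g = "und (ctrg t)"
  let ?sf = "sq (csrc t)" and ?sg = "sq (ctrg t)" and ?t = "ucell t"
  let ?X = "carr ?A" and ?Y = "carr ?B" and ?a = "str ?A" and ?b = "str ?B"
  interpret A: pseudoalgebra C T \<eta> \<mu> ?A using f by simp
  interpret B: pseudoalgebra C T \<eta> \<mu> ?B using f by simp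
  interpret algebra_pair C obs ars T \<eta> \<mu> ?A ?B ..
  note [simp] = mor_facts[OF f] mor_facts[OF g, unfolded p] t
  have e: "F1 T ?f \<cdot> \<eta> ?X = \<eta> ?Y \<cdot> ?f" "F1 T ?g \<cdot> \<eta> ?X = \<eta> ?Y \<cdot> ?g"
    using eta_nat[of ?f] eta_nat[of ?g] by simp_all
  have n: "F2 T ?t \<lhd> \<eta> ?X = \<eta> ?Y \<rhd> ?t" using eta_nat2[of ?t] by simp
  obtain v where v [simp]: "v \<in> Ce C" "Src C v = ?b \<cdot> \<eta> ?Y" "Trg C v = One C ?Y"
    "v \<bullet> unt ?B = IdC C (One C ?Y)" "unt ?B \<bullet> v = IdC C (?b \<cdot> \<eta> ?Y)"
    by (rule B.unit_inverse)
  have sf: "?sf \<lhd> \<eta> ?X = ?f \<rhd> unt ?A \<bullet> v \<lhd> ?f"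
    by (rule sq_eta) (simp_all add: mor_sq_unt[OF f])
  have sg: "?sg \<lhd> \<eta> ?X = ?g \<rhd> unt ?A \<bullet> v \<lhd> ?g"
    by (rule sq_eta) (use mor_sq_unt[OF g] p in simp_all)
  have t1: "?b \<cdot> F1 T ?f \<cdot> \<eta> ?X = ?b \<cdot> \<eta> ?Y \<cdot> ?f" "?b \<cdot> F1 T ?g \<cdot> \<eta> ?X = ?b \<cdot> \<eta> ?Y \<cdot> ?g"
    by (simp_all add: cmp_asc[symmetric] e)
  have "(?sg \<bullet> ?b \<rhd> F2 T ?t) \<lhd> \<eta> ?X = ?sg \<lhd> \<eta> ?X \<bullet> (?b \<cdot> \<eta> ?Y) \<rhd> ?t"
    by (simp add: rwhisk_vc whisk_asc n lwhisk_cmp)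
  also have "\<dots> = ?g \<rhd> unt ?A \<bullet> (v \<lhd> ?g \<bullet> (?b \<cdot> \<eta> ?Y) \<rhd> ?t)"
    by (simp add: sg vc_asc cmp_asc)
  also have "v \<lhd> ?g \<bullet> (?b \<cdot> \<eta> ?Y) \<rhd> ?t = ?t \<bullet> v \<lhd> ?f"
    using whisk_exchange[of ?t v] by simp
  also have "?g \<rhd> unt ?A \<bullet> (?t \<bullet> v \<lhd> ?f) = ?g \<rhd> unt ?A \<bullet> ?t \<bullet> v \<lhd> ?f"
    by (simp add: vc_asc)
  also have "?g \<rhd> unt ?A \<bullet> ?t = ?t \<lhd> (?a \<cdot> \<eta> ?X) \<bullet> ?f \<rhd> unt ?A"
    using whisk_exchange[of "unt ?A" ?t] by simp
  also have "?t \<lhd> (?a \<cdot> \<eta> ?X) \<bullet> ?f \<rhd> unt ?A \<bullet> v \<lhd> ?f = ?t \<lhd> (?a \<cdot> \<eta> ?X) \<bullet> ?sf \<lhd> \<eta> ?X"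
    by (simp add: sf vc_asc cmp_asc)
  also have "\<dots> = (?t \<lhd> ?a \<bullet> ?sf) \<lhd> \<eta> ?X"
    by (simp add: rwhisk_vc rwhisk_cmp)
  finally have eq: "(?sg \<bullet> ?b \<rhd> F2 T ?t) \<lhd> \<eta> ?X = (?t \<lhd> ?a \<bullet> ?sf) \<lhd> \<eta> ?X" .
  have m: "?b \<cdot> F1 T ?f \<in> ars" "?g \<cdot> ?a \<in> ars"
    by (simp_all add: cmp_ars T_ars)
  have "?sg \<bullet> ?b \<rhd> F2 T ?t = ?t \<lhd> ?a \<bullet> ?sf"
    by (rule ext_unique[OF _ _ _ _ _ _ _ _ eq]) (simp_all add: m)
  then show ?thesis
    using f g p t unfolding pseudocell_def pseudocell_axioms_def by (simp add: hom2_def)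
qed

section \<open>The 2-category of pseudoalgebras and the comparison\<close>

lemma mor_comp_id [simp]: "mor f \<Longrightarrow> A = pdom f \<Longrightarrow> psmor_comp C T f (psmor_id C A) = f"
    "mor f \<Longrightarrow> A = pcod f \<Longrightarrow> psmor_comp C T (psmor_id C A) f = f"
  by (rule mor_eq; simp)+

lemma mor_comp_assoc: "mor f \<Longrightarrow> mor g \<Longrightarrow> mor h \<Longrightarrow> pdom g = pcod f \<Longrightarrow> pdom h = pcod g
    \<Longrightarrow> psmor_comp C T h (psmor_comp C T g f) = psmor_comp C T (psmor_comp C T h g) f"
  by (rule mor_eq) (simp_all add: cmp_asc)

lemma cell_idc [simp]: "mor f \<Longrightarrow> cell \<lparr>csrc = f, ctrg = f, ucell = IdC C (und f)\<rparr>"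
  by (rule cellI) simp_all

lemma cell_vc [simp]: "cell a \<Longrightarrow> cell b \<Longrightarrow> csrc b = ctrg a
    \<Longrightarrow> cell \<lparr>csrc = csrc a, ctrg = ctrg b, ucell = ucell b \<bullet> ucell a\<rparr>"
  by (rule cellI) (insert cell_facts[of a] cell_facts[of b], auto)

lemma cell_hc [simp]: "cell a \<Longrightarrow> cell b \<Longrightarrow> pdom (csrc b) = pcod (csrc a)
    \<Longrightarrow> cell \<lparr>csrc = psmor_comp C T (csrc b) (csrc a), ctrg = psmor_comp C T (ctrg b) (ctrg a),
          ucell = ucell b \<star> ucell a\<rparr>"
  by (rule cellI) simp_all

lemma two_category_PsAlg: "two_category (PsAlg C T \<eta> \<mu>)"
  by unfold_locales
    (auto simp: hom1_def hom2_def mor_comp_assoc cmp_asc vc_asc hc_asc hc_unit hc_idc_idc hc_vc)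

text \<open>The counit at \<open>Y\<close> is a structure map with an invertible unit, so it only lacks an associator.\<close>

lemma alg_exists:
  assumes "Y \<in> obs"
  shows "\<exists>A. alg A \<and> carr A = Y"
proof -
  obtain a u where au: "a \<in> ars" "Dm C a = F0 T Y" "Cd C a = Y"
    "iso2 C u" "Src C u = One C Y" "Trg C u = a \<cdot> \<eta> Y" using counit[OF assms] by blast
  have unital: "unital_algebra C obs ars T \<eta> \<mu> \<lparr>carr = Y, str = a, asc = s, unt = u\<rparr>" for s
    using au obs_Ob[OF assms] ars_Ar by unfold_locales auto
  interpret A: unital_algebra C obs ars T \<eta> \<mu> "\<lparr>carr = Y, str = a, asc = u, unt = u\<rparr>" by (rule unital)
  obtain s where s: "s \<in> Ce C" "Src C s = a \<cdot> F1 T a" "Trg C s = a \<cdot> \<mu> Y"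
    "s \<lhd> \<eta> (F0 T Y) \<bullet> u \<lhd> a = IdC C a" using A.asc_exists by auto
  let ?A = "\<lparr>carr = Y, str = a, asc = s, unt = u\<rparr>"
  interpret B: unital_algebra C obs ars T \<eta> \<mu> ?A by (rule unital)
  have "alg ?A" by (rule B.pseudoalgebraI) (simp_all add: s)
  then show ?thesis by (intro exI[of _ ?A]) simp
qed

definition some_alg where "some_alg Y = (SOME A. alg A \<and> carr A = Y)"

lemma some_alg [simp]: assumes "Y \<in> obs" shows "alg (some_alg Y)" "carr (some_alg Y) = Y"
  using someI_ex[OF alg_exists[OF assms]] unfolding some_alg_def by auto

definition comparison_functor where
  "comparison_functor = \<lparr>F0 = some_alg, F1 = (\<lambda>f. lift (some_alg (Dm C f)) (some_alg (Cd C f)) f),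
     F2 = (\<lambda>a. \<lparr>csrc = lift (some_alg (Dm C (Src C a))) (some_alg (Cd C (Src C a))) (Src C a),
                ctrg = lift (some_alg (Dm C (Src C a))) (some_alg (Cd C (Src C a))) (Trg C a), ucell = a\<rparr>)\<rparr>"

definition underlying where
  "underlying = \<lparr>F0 = carr, F1 = und, F2 = ucell\<rparr>"

lemma some_lift [simp]:
  assumes "f \<in> ars" "X = Dm C f" "Y = Cd C f"
  shows "mor (lift (some_alg X) (some_alg Y) f)" "pdom (lift (some_alg X) (some_alg Y) f) = some_alg X"
    "pcod (lift (some_alg X) (some_alg Y) f) = some_alg Y" "und (lift (some_alg X) (some_alg Y) f) = f"
  using assms ars_Dm ars_Cd by simp_all

lemma two_functor_comparison: "two_functor (full_sub C obs ars) (PsAlg C T \<eta> \<mu>) comparison_functor"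
proof -
  interpret D: two_category "full_sub C obs ars" by (rule two_category_full_sub)
  interpret P: two_category "PsAlg C T \<eta> \<mu>" by (rule two_category_PsAlg)
  have cell: "cell (F2 comparison_functor a)" if "a \<in> Ce C" "Src C a \<in> ars" "Trg C a \<in> ars" for a
    by (rule cellI) (use that in \<open>simp_all add: comparison_functor_def\<close>)
  have cmp: "F1 comparison_functor (g \<cdot> f) = psmor_comp C T (F1 comparison_functor g) (F1 comparison_functor f)"
    if "f \<in> ars" "g \<in> ars" "Dm C g = Cd C f" for f g
    by (rule mor_eq) (use that in \<open>simp_all add: comparison_functor_def cmp_ars ars_Ar\<close>)
  have one: "F1 comparison_functor (One C X) = psmor_id C (F0 comparison_functor X)" if "X \<in> obs" for X
    by (rule mor_eq) (use that in \<open>simp_all add: comparison_functor_def one_ars obs_Ob\<close>)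
  have lc: "lift (some_alg X) (some_alg Z) (g \<cdot> f)
      = psmor_comp C T (lift (some_alg Y) (some_alg Z) g) (lift (some_alg X) (some_alg Y) f)"
    if "f \<in> ars" "g \<in> ars" "Dm C f = X" "Cd C f = Y" "Dm C g = Y" "Cd C g = Z" for f g X Y Z
    using cmp[of f g] that by (simp add: comparison_functor_def ars_Ar)
  show ?thesis
  proof
    fix a f g assume "a \<in> hom2 (full_sub C obs ars) f g"
    then show "F2 comparison_functor a \<in> hom2 (PsAlg C T \<eta> \<mu>) (F1 comparison_functor f) (F1 comparison_functor g)"
      using cell[of a] by (auto simp: hom2_def) (auto simp: comparison_functor_def)
  next
    fix a b f f' g g' X Y Z
    assume "a \<in> hom2 (full_sub C obs ars) f f'" "b \<in> hom2 (full_sub C obs ars) g g'"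
      "f \<in> hom1 (full_sub C obs ars) X Y" "g \<in> hom1 (full_sub C obs ars) Y Z"
    then have *: "a \<in> Ce C" "Src C a = f" "Trg C a = f'" "b \<in> Ce C" "Src C b = g" "Trg C b = g'"
      "f \<in> ars" "f' \<in> ars" "g \<in> ars" "g' \<in> ars" "Dm C f = X" "Cd C f = Y" "Dm C g = Y" "Cd C g = Z"
      "f \<in> Ar C" "g \<in> Ar C" by (auto simp: hom2_def hom1_def ars_Ar)
    moreover have "Dm C f' = X" "Cd C f' = Y" "Dm C g' = Y" "Cd C g' = Z"
      using * ce_ar[of a] ce_ar[of b] by auto
    ultimately show "F2 comparison_functor (b \<star>\<^bsub>full_sub C obs ars\<^esub> a)
      = F2 comparison_functor b \<star>\<^bsub>PsAlg C T \<eta> \<mu>\<^esub> F2 comparison_functor a"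
      by (simp add: comparison_functor_def lc)
  qed (auto simp: hom1_def hom2_def one cmp ars_Ar; simp add: comparison_functor_def ars_Ar)+
qed

lemma two_functor_underlying: "two_functor (PsAlg C T \<eta> \<mu>) (full_sub C obs ars) underlying"
proof -
  interpret D: two_category "full_sub C obs ars" by (rule two_category_full_sub)
  interpret P: two_category "PsAlg C T \<eta> \<mu>" by (rule two_category_PsAlg)
  show ?thesis
    by unfold_locales (auto simp: hom1_def hom2_def underlying_def)
qed

lemma comparison_comparison_functor:
  "comparison C (full_sub C obs ars) T fun_id T \<eta> \<mu> comparison_functor"
proof -
  have asc: "asc A \<in> Ce C" "Src C (asc A) \<in> ars" "Trg C (asc A) \<in> ars" if A: "alg A" for A
  proof -
    interpret A: pseudoalgebra C T \<eta> \<mu> A by (rule A)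
    interpret unital_algebra C obs ars T \<eta> \<mu> A by (rule pseudoalgebra_unital, rule A)
    show "asc A \<in> Ce C" "Src C (asc A) \<in> ars" "Trg C (asc A) \<in> ars"
      using A.asc_hom str_Tstr_ars by (auto simp: hom2_def)
  qed
  have sq: "sq F \<in> Ce C" "Src C (sq F) \<in> ars" "Trg C (sq F) \<in> ars" if "mor F" for F
    using that by (simp_all add: cmp_ars T_ars)
  show ?thesis
    unfolding comparison_def
    by (auto simp: two_functor_comparison) (auto simp: comparison_functor_def hom1_def asc sq T_ars ars_Ar ars_Dm ars_Cd intro!: cmp_ars)
qed

text \<open>The comparison followed by \<open>underlying\<close> is the identity. In the other order, \<open>A\<close> and the structure chosen
  on its carrier are related by the pseudomorphisms over the identity in both directions, which are mutually inverse since pseudomorphisms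
  are determined by their underlying 1-cells.\<close>

lemma equivalence_comparison_functor:
  "two_equivalence (full_sub C obs ars) (PsAlg C T \<eta> \<mu>) comparison_functor"
proof -
  let ?D = "full_sub C obs ars" and ?P = "PsAlg C T \<eta> \<mu>"
  let ?v = "\<lambda>A. lift (some_alg (carr A)) A (One C (carr A))"
  let ?w = "\<lambda>A. lift A (some_alg (carr A)) (One C (carr A))"
  note KL = two_functor_comparison two_functor_underlying
  interpret D: two_category ?D by (rule two_category_full_sub)
  interpret P: two_category ?P by (rule two_category_PsAlg)
  interpret LK: two_functor ?D ?D "fun_comp underlying comparison_functor" by (rule two_functor_comp[OF KL])
  interpret KL: two_functor ?P ?P "fun_comp comparison_functor underlying" by (rule two_functor_comp[OF KL(2) KL(1)])
  interpret iP: two_functor ?P ?P fun_id by unfold_locales auto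
  interpret iD: two_functor ?D ?D fun_id by unfold_locales auto
  have "two_natural ?D ?D fun_id (fun_comp underlying comparison_functor) (One C)"
    by unfold_locales
      (auto simp: hom1_def hom2_def one_ars obs_Ob ars_Ar ars_Dm ars_Cd underlying_def, auto simp: comparison_functor_def obs_Ob ars_Ar)
  moreover have "\<forall>X \<in> Ob ?D. iso1 ?D (One C X)"
  proof
    fix X assume "X \<in> Ob ?D"
    then show "iso1 ?D (One C X)"
      unfolding iso1_def by (intro conjI bexI[of _ "One C X"]) (simp_all add: hom1_def one_ars obs_Ob)
  qed
  moreover have v: "mor (?v A)" "pdom (?v A) = some_alg (carr A)" "pcod (?v A) = A" "und (?v A) = One C (carr A)"
    "mor (?w A)" "pcod (?w A) = some_alg (carr A)" "pdom (?w A) = A" "und (?w A) = One C (carr A)" if "alg A" for A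
    using that by (simp_all add: one_ars)
  have nat: "psmor_comp C T f (?v A) = psmor_comp C T (?v B) (lift (some_alg (carr A)) (some_alg (carr B)) (und f))"
    if "mor f" "pdom f = A" "pcod f = B" for f A B
    by (rule mor_eq) (use that v in auto)
  have "two_natural ?P ?P (fun_comp comparison_functor underlying) fun_id ?v"
  proof
    fix f A B assume "f \<in> hom1 ?P A B"
    then show "F1 fun_id f \<cdot>\<^bsub>?P\<^esub> ?v A = ?v B \<cdot>\<^bsub>?P\<^esub> F1 (fun_comp comparison_functor underlying) f"
      using nat[of f A B] mor_facts[of f] by (auto simp: hom1_def comparison_functor_def underlying_def)
  next
    fix a f g A B assume "a \<in> hom2 ?P f g" "f \<in> hom1 ?P A B"
    then have a: "cell a" "csrc a = f" "ctrg a = g" "mor f" "mor g" "pdom f = A" "pcod f = B" "pdom g = A" "pcod g = B"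
      using cell_facts[of a] by (auto simp: hom2_def hom1_def)
    have m: "alg A" "alg B" using mor_facts[OF a(4)] a(6,7) by auto
    show "F2 fun_id a \<lhd>\<^bsub>?P\<^esub> ?v A = ?v B \<rhd>\<^bsub>?P\<^esub> F2 (fun_comp comparison_functor underlying) a"
      using a nat[of f A B] nat[of g A B] cell_facts[OF a(1)] m v(4)[of A] v(4)[of B]
      by (simp add: rwhisk_def lwhisk_def comparison_functor_def underlying_def hc_unit)
  qed (use v in \<open>auto simp: hom1_def comparison_functor_def underlying_def\<close>)
  moreover have "\<forall>A \<in> Ob ?P. iso1 ?P (?v A)"
  proof
    fix A assume "A \<in> Ob ?P"
    then have A: "alg A" by simp
    have "psmor_comp C T (?w A) (?v A) = psmor_id C (some_alg (carr A))" "psmor_comp C T (?v A) (?w A) = psmor_id C A"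
      by (rule mor_eq; use A v[OF A] in \<open>simp add: one_ars\<close>)+
    then show "iso1 ?P (?v A)"
      unfolding iso1_def using v[OF A] by (auto simp: hom1_def intro!: bexI[of _ "?w A"])
  qed
  ultimately show ?thesis
    unfolding two_equivalence_def two_natural_iso_def using KL by blast
qed

text \<open>The adjunction itself: a 1-cell \<open>f : X \<rightarrow> Y\<close> factors up to isomorphism as \<open>a \<cdot> T f \<cdot> \<eta> X\<close> with \<open>a\<close> a
  counit at \<open>Y\<close>, because \<open>T f \<cdot> \<eta> X = \<eta> Y \<cdot> f\<close>.\<close>

theorem two_monadic_full_sub: "two_monadic C (full_sub C obs ars) T fun_id T \<eta> \<mu>"
proof -
  let ?D = "full_sub C obs ars"
  have T: "two_functor C ?D T"
    by (rule two_functor_into) (simp_all add: T.two_functor_axioms T_obs T_ars)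
  have ess: "\<exists>g \<in> hom1 ?D (F0 T X) Y. \<exists>i \<in> hom2 C (g \<cdot> \<eta> X) f. iso2 C i"
    if X: "X \<in> Ob C" and Y: "Y \<in> obs" and f: "f \<in> hom1 C X Y" for X Y f
  proof -
    obtain a u where au: "a \<in> ars" "Dm C a = F0 T Y" "Cd C a = Y"
      "iso2 C u" "Src C u = One C Y" "Trg C u = a \<cdot> \<eta> Y" using counit[OF Y] by blast
    have [simp]: "f \<in> Ar C" "Dm C f = X" "Cd C f = Y" "a \<in> Ar C" "Dm C a = F0 T Y" "Cd C a = Y"
      "X \<in> Ob C" "Y \<in> Ob C" using f au X ars_Ar obs_Ob[OF Y] by (auto simp: hom1_def)
    have "iso2 C (u \<lhd> f)" using au by (intro iso2_rwhisk) simp_all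
    then obtain i where i: "i \<in> Ce C" "Src C i = a \<cdot> \<eta> Y \<cdot> f" "Trg C i = f"
      "i \<bullet> u \<lhd> f = IdC C f" "u \<lhd> f \<bullet> i = IdC C (a \<cdot> \<eta> Y \<cdot> f)"
      using au iso2_Ce[OF au(4)] by (elim iso2E) simp
    have "iso2 C i" using i au iso2_Ce[OF au(4)] by (intro iso2I[of i "u \<lhd> f"]) simp_all
    moreover have "a \<cdot> F1 T f \<cdot> \<eta> X = a \<cdot> \<eta> Y \<cdot> f"
      using eta_nat[of f X] by (simp add: cmp_asc[symmetric])
    moreover have "a \<cdot> F1 T f \<in> ars" by (rule cmp_ars) (simp_all add: au T_ars)
    ultimately show ?thesis
      using i by (intro bexI[of _ "a \<cdot> F1 T f"] bexI[of _ i]) (simp_all add: hom1_def hom2_def)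
  qed
  have ff: "\<exists>!b. b \<in> hom2 ?D g g' \<and> b \<lhd> \<eta> X = a"
    if X: "X \<in> Ob C" and g: "g \<in> hom1 ?D (F0 T X) Y" "g' \<in> hom1 ?D (F0 T X) Y"
      and a: "a \<in> hom2 C (g \<cdot> \<eta> X) (g' \<cdot> \<eta> X)" for X Y g g' a
  proof -
    have "(b \<in> hom2 ?D g g' \<and> b \<lhd> \<eta> X = a) \<longleftrightarrow> (b \<in> Ce C \<and> Src C b = g \<and> Trg C b = g' \<and> b \<lhd> \<eta> X = a)" for b
      using g by (auto simp: hom1_def hom2_def)
    then show ?thesis using extend[OF X, of g g' a] g a by (simp add: hom1_def hom2_def)
  qed
  have "pseudo_adjunction C ?D T fun_id \<eta>"
    unfolding pseudo_adjunction_def using ess ff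
    by (simp add: T two_functor_inclusion unit.two_natural_axioms)
  then have "induced_two_monad C ?D T fun_id T \<eta> \<mu>"
    unfolding induced_two_monad_def by (auto simp: two_monad_axioms hom1_def mult_ars)
  then show ?thesis
    unfolding two_monadic_def
    using comparison_comparison_functor equivalence_comparison_functor by blast
qed

end

section \<open>Calculus of relations in a relational doctrine\<close>

context relational_doctrine
begin

lemma HomD [dest]: "f \<in> Hom R X Y \<Longrightarrow> X \<in> Obj R" "f \<in> Hom R X Y \<Longrightarrow> Y \<in> Obj R"
  using Hom_Obj by auto

lemma RelD [dest]: "\<alpha> \<in> Rel R X Y \<Longrightarrow> X \<in> Obj R" "\<alpha> \<in> Rel R X Y \<Longrightarrow> Y \<in> Obj R"
  using Rel_Obj by auto

lemmas typing [simp] = Idn_Hom Comp_Hom Reix_Rel Diag_Rel Seq_Rel Conv_Rel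

lemmas units [simp] = Comp_Idn Idn_Comp Reix_Idn Diag_Seq Seq_Diag Conv_Diag Conv_Conv

lemma graph_Rel [simp]: "f \<in> Hom R X Y \<Longrightarrow> graph R X Y f \<in> Rel R X Y"
  unfolding graph_def by (rule Reix_Rel) auto

lemma Conv_Reix:
  assumes [simp]: "f \<in> Hom R X A" "g \<in> Hom R Y B" "\<alpha> \<in> Rel R A B"
  shows "Conv R X Y (Reix R X Y A B f g \<alpha>) = Reix R Y X B A g f (Conv R A B \<alpha>)"
proof (rule Leq_antisym)
  have "Leq R X Y (Conv R Y X (Reix R Y X B A g f (Conv R A B \<alpha>))) (Reix R X Y A B f g \<alpha>)"
    using Conv_lax[of g Y B f X A "Conv R A B \<alpha>"] by simp
  then show "Leq R Y X (Reix R Y X B A g f (Conv R A B \<alpha>)) (Conv R X Y (Reix R X Y A B f g \<alpha>))"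
    using Conv_mono[of "Conv R Y X (Reix R Y X B A g f (Conv R A B \<alpha>))" X Y] by simp
qed (simp_all add: Conv_lax)

text \<open>Reindexing is composition with graphs. The composite lies below by laxness of composition. For the other
  inequality, \<open>d \<le> R\<^bsub>f,f\<^esub>(d)\<close> and the right-hand side is the graph of \<open>f\<close> reindexed along \<open>id, f\<close>; composing
  the reindexed relation with it and using laxness again brings out the graph as an unreindexed factor, and likewise for \<open>g\<close>.\<close>

lemma Reix_graph:
  assumes f [simp]: "f \<in> Hom R X A" and g [simp]: "g \<in> Hom R Y B" and a [simp]: "\<alpha> \<in> Rel R A B"
  shows "Reix R X Y A B f g \<alpha>
    = Seq R X B Y (Seq R X A B (graph R X A f) \<alpha>) (Conv R Y B (graph R Y B g))" (is "?l = ?r")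
proof (rule Leq_antisym)
  have [simp]: "X \<in> Obj R" "Y \<in> Obj R" "A \<in> Obj R" "B \<in> Obj R" using HomD[OF f] HomD[OF g] by auto
  have G: "graph R X A f = Reix R X A A A f (Idn R A) (Diag R A)"
    "Conv R Y B (graph R Y B g) = Reix R B Y B B (Idn R B) g (Diag R B)"
    by (simp_all add: graph_def Conv_Reix)
  have "Leq R X B (Seq R X A B (graph R X A f) \<alpha>) (Reix R X B A B f (Idn R B) \<alpha>)"
    using Seq_lax[of f X A "Idn R A" A A "Idn R B" B B "Diag R A" \<alpha>] by (simp add: G)
  then have "Leq R X Y ?r (Seq R X B Y (Reix R X B A B f (Idn R B) \<alpha>) (Conv R Y B (graph R Y B g)))"
    by (intro Seq_mono) (simp_all add: Leq_refl)
  moreover have "Leq R X Y (Seq R X B Y (Reix R X B A B f (Idn R B) \<alpha>) (Conv R Y B (graph R Y B g))) ?l"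
    using Seq_lax[of f X A "Idn R B" B B g Y B \<alpha> "Diag R B"] by (simp add: G)
  ultimately show "Leq R X Y ?r ?l" by (rule Leq_trans[rotated 3]) simp_all
  let ?F = "Reix R X X X A (Idn R X) f (graph R X A f)"
  let ?G = "Reix R Y Y B Y g (Idn R Y) (Conv R Y B (graph R Y B g))"
  have "?F = Reix R X X A A f f (Diag R A)" "?G = Reix R Y Y B B g g (Diag R B)"
    by (simp_all add: G Reix_Comp[symmetric])
  then have F: "Leq R X X (Diag R X) ?F" "Leq R Y Y (Diag R Y) ?G" by (simp_all add: Diag_lax)
  have 1: "Leq R X Y ?l (Seq R X Y Y (Seq R X X Y ?F ?l) ?G)"
    using Seq_mono[of "Seq R X X Y (Diag R X) ?l" X Y "Seq R X X Y ?F ?l" "Diag R Y" Y ?G]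
      Seq_mono[of "Diag R X" X X ?F ?l Y ?l] F by (simp add: Leq_refl)
  have "Leq R X Y (Seq R X X Y ?F ?l) (Reix R X Y X B (Idn R X) g (Seq R X A B (graph R X A f) \<alpha>))"
    by (rule Seq_lax) simp_all
  then have 2: "Leq R X Y (Seq R X Y Y (Seq R X X Y ?F ?l) ?G)
      (Seq R X Y Y (Reix R X Y X B (Idn R X) g (Seq R X A B (graph R X A f) \<alpha>)) ?G)"
    by (intro Seq_mono) (simp_all add: Leq_refl)
  have 3: "Leq R X Y (Seq R X Y Y (Reix R X Y X B (Idn R X) g (Seq R X A B (graph R X A f) \<alpha>)) ?G)
      (Reix R X Y X Y (Idn R X) (Idn R Y) ?r)"
    by (rule Seq_lax) simp_all
  have "Leq R X Y ?l (Reix R X Y X Y (Idn R X) (Idn R Y) ?r)"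
    by (rule Leq_trans[OF _ _ _ Leq_trans[OF _ _ _ 1 2] 3]) simp_all
  then show "Leq R X Y ?l ?r" by simp
qed simp_all

text \<open>Kernels in this form are bounded below by \<open>\<rho>\<close> exactly when \<open>f\<close> maps \<open>\<rho>\<close> into equality, and they are
  computed by the functoriality of reindexing.\<close>

lemma kernel_Reix:
  assumes "f \<in> Hom R X W"
  shows "kernel R X W f = Reix R X X W W f f (Diag R W)"
proof -
  have "W \<in> Obj R" using assms by auto
  then show ?thesis using Reix_graph[of f X W f X W "Diag R W"] assms by (simp add: kernel_def)
qed

subsection \<open>Equality of arrows up to the doctrine\<close>

lemma approx_refl: "f \<in> Hom R X Y \<Longrightarrow> approx R X Y f f"
  unfolding approx_def by (rule Diag_lax)

lemma approx_sym:
  assumes f: "f \<in> Hom R X Y" and g: "g \<in> Hom R X Y" and "approx R X Y f g"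
  shows "approx R X Y g f"
proof -
  have [simp]: "X \<in> Obj R" "Y \<in> Obj R" using f by auto
  show ?thesis
    using Conv_mono[of "Diag R X" X X "Reix R X X Y Y f g (Diag R Y)"] assms
    by (simp add: approx_def Conv_Reix)
qed

lemma approx_trans:
  assumes f: "f \<in> Hom R X Y" and g: "g \<in> Hom R X Y" and h: "h \<in> Hom R X Y"
    and "approx R X Y f g" "approx R X Y g h"
  shows "approx R X Y f h"
proof -
  have [simp]: "X \<in> Obj R" "Y \<in> Obj R" using f by auto
  let ?m = "Seq R X X X (Reix R X X Y Y f g (Diag R Y)) (Reix R X X Y Y g h (Diag R Y))"
  have "Leq R X X (Diag R X) ?m"
    using Seq_mono[of "Diag R X" X X "Reix R X X Y Y f g (Diag R Y)" "Diag R X" X "Reix R X X Y Y g h (Diag R Y)"] assms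
    by (simp add: approx_def)
  moreover have "Leq R X X ?m (Reix R X X Y Y f h (Diag R Y))"
    using Seq_lax[of f X Y g X Y h X Y "Diag R Y" "Diag R Y"] assms by simp
  ultimately show ?thesis
    unfolding approx_def by (rule Leq_trans[rotated 3]) (use assms in simp_all)
qed

lemma approx_Comp:
  assumes f: "f \<in> Hom R X Y" "f' \<in> Hom R X Y" and g: "g \<in> Hom R Y Z" "g' \<in> Hom R Y Z"
    and a: "approx R X Y f f'" "approx R Y Z g g'"
  shows "approx R X Z (Comp R X Y Z g f) (Comp R X Y Z g' f')"
proof -
  have [simp]: "X \<in> Obj R" "Y \<in> Obj R" "Z \<in> Obj R" using f g by auto
  have "Leq R X X (Reix R X X Y Y f f' (Diag R Y)) (Reix R X X Y Y f f' (Reix R Y Y Z Z g g' (Diag R Z)))"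
    using f g a by (intro Reix_mono) (simp_all add: approx_def)
  then show ?thesis
    using f g a unfolding approx_def by (subst Reix_Comp) (auto intro: Leq_trans[rotated 3])
qed

text \<open>Since \<open>d \<le> R\<^bsub>f',f\<^esub>(d)\<close>, the relation on the left is below its composite with \<open>R\<^bsub>f',f\<^esub>(d)\<close>, and laxness
  of composition changes the leg \<open>f\<close> into \<open>f'\<close>; the other leg is changed in the same way.\<close>

lemma Reix_approx_le:
  assumes f: "f \<in> Hom R X A" "f' \<in> Hom R X A" and g: "g \<in> Hom R Y B" "g' \<in> Hom R Y B"
    and a: "approx R X A f' f" "approx R Y B g g'" and \<alpha>: "\<alpha> \<in> Rel R A B"
  shows "Leq R X Y (Reix R X Y A B f g \<alpha>) (Reix R X Y A B f' g' \<alpha>)"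
proof -
  have [simp]: "X \<in> Obj R" "Y \<in> Obj R" "A \<in> Obj R" "B \<in> Obj R" using f g by auto
  note [simp] = f g \<alpha>
  let ?a = "Reix R X Y A B f g \<alpha>" and ?l = "Reix R X X A A f' f (Diag R A)" and ?r = "Reix R Y Y B B g g' (Diag R B)"
  have "Leq R X Y ?a (Seq R X X Y ?l ?a)"
    using Seq_mono[of "Diag R X" X X ?l ?a Y ?a] a by (simp add: approx_def Leq_refl)
  moreover have "Leq R X Y (Seq R X X Y ?l ?a) (Reix R X Y A B f' g \<alpha>)"
    using Seq_lax[of f' X A f X A g Y B "Diag R A" \<alpha>] by simp
  moreover have "Leq R X Y (Reix R X Y A B f' g \<alpha>) (Seq R X Y Y (Reix R X Y A B f' g \<alpha>) ?r)"
    using Seq_mono[of "Reix R X Y A B f' g \<alpha>" X Y "Reix R X Y A B f' g \<alpha>" "Diag R Y" Y ?r] a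
    by (simp add: approx_def Leq_refl)
  moreover have "Leq R X Y (Seq R X Y Y (Reix R X Y A B f' g \<alpha>) ?r) (Reix R X Y A B f' g' \<alpha>)"
    using Seq_lax[of f' X A g Y B g' Y B \<alpha> "Diag R B"] by simp
  moreover have "Seq R X X Y ?l ?a \<in> Rel R X Y" "Seq R X Y Y (Reix R X Y A B f' g \<alpha>) ?r \<in> Rel R X Y"
    "?a \<in> Rel R X Y" "Reix R X Y A B f' g \<alpha> \<in> Rel R X Y" "Reix R X Y A B f' g' \<alpha> \<in> Rel R X Y" by simp_all
  ultimately show ?thesis by (meson Leq_trans)
qed

lemma Reix_approx:
  assumes "f \<in> Hom R X A" "f' \<in> Hom R X A" "g \<in> Hom R Y B" "g' \<in> Hom R Y B"
    "approx R X A f f'" "approx R Y B g g'" "\<alpha> \<in> Rel R A B"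
  shows "Reix R X Y A B f g \<alpha> = Reix R X Y A B f' g' \<alpha>"
  using assms by (intro Leq_antisym[of _ X Y] Reix_approx_le) (auto intro: approx_sym)

subsection \<open>Descent arrows\<close>

text \<open>A relation on the target of a descent arrow is recovered from its reindexing \<open>\<gamma>\<close> as \<open>\<Gamma>\<^sub>q\<^sup>\<bottom> ; \<gamma> ; \<Gamma>\<^sub>q'\<close>:
  the descent inequality bounds it above by this composite, and laxness bounds it below.\<close>

lemma descent_reflects:
  assumes q: "q \<in> Hom R X W" "descent R X W q" and q': "q' \<in> Hom R X' W'" "descent R X' W' q'"
    and a: "\<alpha> \<in> Rel R W W'" and b: "\<beta> \<in> Rel R W W'"
    and le: "Leq R X X' (Reix R X X' W W' q q' \<alpha>) (Reix R X X' W W' q q' \<beta>)"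
  shows "Leq R W W' \<alpha> \<beta>"
proof -
  have [simp]: "X \<in> Obj R" "W \<in> Obj R" "X' \<in> Obj R" "W' \<in> Obj R" using q q' by auto
  note [simp] = q(1) q'(1) a b
  let ?g = "graph R X W q" and ?g' = "graph R X' W' q'"
  let ?c = "Conv R X W ?g" and ?c' = "Conv R X' W' ?g'"
  let ?P = "\<lambda>\<gamma>. Seq R W X' W' (Seq R W X X' ?c (Reix R X X' W W' q q' \<gamma>)) ?g'"
  have G: "?g = Reix R X W W W q (Idn R W) (Diag R W)" "?c = Reix R W X W W (Idn R W) q (Diag R W)"
    "?g' = Reix R X' W' W' W' q' (Idn R W') (Diag R W')" by (simp_all add: graph_def Conv_Reix)
  have "?P \<alpha> = Seq R W W' W' (Seq R W W W' (Seq R W X W ?c ?g) \<alpha>) (Seq R W' X' W' ?c' ?g')"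
    by (simp add: Reix_graph Seq_assoc)
  moreover have "Leq R W W' (Seq R W W' W' (Seq R W W W' (Diag R W) \<alpha>) (Diag R W'))
       (Seq R W W' W' (Seq R W W W' (Seq R W X W ?c ?g) \<alpha>) (Seq R W' X' W' ?c' ?g'))"
    using q(2) q'(2) by (intro Seq_mono) (simp_all add: descent_def Leq_refl)
  ultimately have 1: "Leq R W W' \<alpha> (?P \<alpha>)" by simp
  have 2: "Leq R W W' (?P \<alpha>) (?P \<beta>)"
    using le by (intro Seq_mono) (simp_all add: Leq_refl)
  have "Leq R W X' (Seq R W X X' ?c (Reix R X X' W W' q q' \<beta>)) (Reix R W X' W W' (Idn R W) q' \<beta>)"
    using Seq_lax[of "Idn R W" W W q X W q' X' W' "Diag R W" \<beta>] unfolding G(2) by simp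
  then have 3: "Leq R W W' (?P \<beta>) (Seq R W X' W' (Reix R W X' W W' (Idn R W) q' \<beta>) ?g')"
    by (intro Seq_mono) (simp_all add: Leq_refl)
  have 4: "Leq R W W' (Seq R W X' W' (Reix R W X' W W' (Idn R W) q' \<beta>) ?g') \<beta>"
    using Seq_lax[of "Idn R W" W W q' X' W' "Idn R W'" W' W' \<beta> "Diag R W'"] unfolding G(3) by simp
  have "?P \<alpha> \<in> Rel R W W'" "?P \<beta> \<in> Rel R W W'" "Seq R W X' W' (Reix R W X' W W' (Idn R W) q' \<beta>) ?g' \<in> Rel R W W'"
    by simp_all
  then show ?thesis using 1 2 3 4 a b by (meson Leq_trans)
qed

lemma descent_inj:
  assumes "q \<in> Hom R X W" "descent R X W q" "q' \<in> Hom R X' W'" "descent R X' W' q'"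
    "\<alpha> \<in> Rel R W W'" "\<beta> \<in> Rel R W W'" "Reix R X X' W W' q q' \<alpha> = Reix R X X' W W' q q' \<beta>"
  shows "\<alpha> = \<beta>"
proof -
  have "Leq R X X' (Reix R X X' W W' q q' \<alpha>) (Reix R X X' W W' q q' \<beta>)"
    "Leq R X X' (Reix R X X' W W' q q' \<beta>) (Reix R X X' W W' q q' \<alpha>)"
    using assms by (simp_all add: Leq_refl)
  then show ?thesis
    using assms descent_reflects[OF assms(1-4)] by (intro Leq_antisym[of _ W W']) auto
qed

text \<open>\<open>R\<^bsub>h,h'\<^esub>(d)\<close> and \<open>R\<^bsub>h,h\<^esub>(d) \<ge> d\<close> have the same reindexing along \<open>q\<close>. Over an extensional doctrine
  descent arrows are therefore epimorphisms.\<close>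

lemma descent_epi:
  assumes q: "q \<in> Hom R X W" "descent R X W q" and h: "h \<in> Hom R W Z" "h' \<in> Hom R W Z"
    and eq: "Comp R X W Z h q = Comp R X W Z h' q"
  shows "approx R W Z h h'"
proof -
  have [simp]: "X \<in> Obj R" "W \<in> Obj R" "Z \<in> Obj R" using q h by auto
  have "Reix R X X W W q q (Reix R W W Z Z h h' (Diag R Z)) = Reix R X X W W q q (Reix R W W Z Z h h (Diag R Z))"
    using q h eq by (simp add: Reix_Comp[symmetric])
  then show ?thesis
    unfolding approx_def using q h
    by (intro descent_reflects[OF q q]) (simp_all add: Reix_mono Diag_lax)
qed

lemma graph_Comp:
  assumes [simp]: "f \<in> Hom R X Y" "g \<in> Hom R Y Z"
  shows "graph R X Z (Comp R X Y Z g f) = Seq R X Y Z (graph R X Y f) (graph R Y Z g)"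
proof -
  have [simp]: "X \<in> Obj R" "Y \<in> Obj R" "Z \<in> Obj R" using HomD[OF assms(1)] HomD[OF assms(2)] by auto
  have "graph R X Z (Comp R X Y Z g f) = Reix R X Z Y Z f (Idn R Z) (graph R Y Z g)"
    using Reix_Comp[of f X Y g Z "Idn R Z" Z Z "Idn R Z" Z "Diag R Z"] by (simp add: graph_def)
  also have "\<dots> = Seq R X Y Z (graph R X Y f) (graph R Y Z g)"
    by (subst Reix_graph) (simp_all add: graph_def)
  finally show ?thesis .
qed

lemma descent_Comp:
  assumes q: "q \<in> Hom R X Y" "descent R X Y q" and p: "p \<in> Hom R Y Z" "descent R Y Z p"
  shows "descent R X Z (Comp R X Y Z p q)"
proof -
  have [simp]: "X \<in> Obj R" "Y \<in> Obj R" "Z \<in> Obj R" using q p by auto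
  note [simp] = q(1) p(1)
  let ?g = "graph R X Y q" and ?h = "graph R Y Z p"
  have "Leq R Z Z (Seq R Z Y Z (Seq R Z Y Y (Conv R Y Z ?h) (Diag R Y)) ?h)
     (Seq R Z Y Z (Seq R Z Y Y (Conv R Y Z ?h) (Seq R Y X Y (Conv R X Y ?g) ?g)) ?h)"
    using q by (intro Seq_mono) (simp_all add: descent_def Leq_refl)
  then have "Leq R Z Z (Seq R Z Y Z (Conv R Y Z ?h) ?h)
     (Seq R Z X Z (Conv R X Z (graph R X Z (Comp R X Y Z p q))) (graph R X Z (Comp R X Y Z p q)))"
    by (simp add: graph_Comp Conv_Seq Seq_assoc)
  with p(2) show ?thesis
    unfolding descent_def by (rule Leq_trans[rotated 3]) simp_all
qed

end

subsection \<open>Isomorphisms and quotient arrows\<close>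

definition inverse_arrows :: "('o, 'a, 'r) doctrine \<Rightarrow> 'o \<Rightarrow> 'o \<Rightarrow> 'a \<Rightarrow> 'a \<Rightarrow> bool" where
  "inverse_arrows R X Y i j \<longleftrightarrow> i \<in> Hom R X Y \<and> j \<in> Hom R Y X
     \<and> Comp R X Y X j i = Idn R X \<and> Comp R Y X Y i j = Idn R Y"

lemma inverse_arrows_sym: "inverse_arrows R X Y i j \<Longrightarrow> inverse_arrows R Y X j i"
  unfolding inverse_arrows_def by auto

lemma inverse_arrowsD:
  assumes "inverse_arrows R X Y i j"
  shows "i \<in> Hom R X Y" "j \<in> Hom R Y X" "Comp R X Y X j i = Idn R X" "Comp R Y X Y i j = Idn R Y"
  using assms unfolding inverse_arrows_def by auto

context relational_doctrine
begin

lemma iso_cancel: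
  assumes ij: "inverse_arrows R X W i j" and h: "h \<in> Hom R W Z" "h' \<in> Hom R W Z"
    and eq: "Comp R X W Z h i = Comp R X W Z h' i"
  shows "h = h'"
proof -
  note I = inverse_arrowsD[OF ij]
  have "Comp R W X Z (Comp R X W Z k i) j = k" if k: "k \<in> Hom R W Z" for k
  proof -
    have "Comp R W X Z (Comp R X W Z k i) j = Comp R W W Z k (Comp R W X W i j)"
      by (rule Comp_assoc[symmetric]) (rule I k)+
    then show ?thesis using Comp_Idn[OF k] by (simp only: I)
  qed
  from this[OF h(1)] this[OF h(2)] eq show ?thesis by metis
qed

lemma iso_Diag:
  assumes "inverse_arrows R X Y i j"
  shows "Reix R X X Y Y i i (Diag R Y) = Diag R X"
proof (rule Leq_antisym)
  note ij [simp] = inverse_arrowsD[OF assms]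
  have [simp]: "X \<in> Obj R" "Y \<in> Obj R" using HomD[OF ij(1)] by auto
  have "Leq R X X (Reix R X X Y Y i i (Diag R Y)) (Reix R X X Y Y i i (Reix R Y Y X X j j (Diag R X)))"
    by (intro Reix_mono) (simp_all add: Diag_lax)
  then show "Leq R X X (Reix R X X Y Y i i (Diag R Y)) (Diag R X)"
    by (simp add: Reix_Comp[symmetric])
  show "Leq R X X (Diag R X) (Reix R X X Y Y i i (Diag R Y))" by (simp add: Diag_lax)
  show "Reix R X X Y Y i i (Diag R Y) \<in> Rel R X X" "Diag R X \<in> Rel R X X" by simp_all
qed

lemma iso_descent:
  assumes "inverse_arrows R X Y i j"
  shows "descent R X Y i"
proof -
  note ij [simp] = inverse_arrowsD[OF assms]
  have [simp]: "X \<in> Obj R" "Y \<in> Obj R" using HomD[OF ij(1)] by auto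
  have "Conv R X Y (graph R X Y i) = Reix R Y X Y Y (Idn R Y) i (Diag R Y)"
    by (simp add: graph_def Conv_Reix)
  also have "\<dots> = Reix R Y X X X j (Idn R X) (Reix R X X Y Y i i (Diag R Y))"
    by (simp add: Reix_Comp[symmetric])
  also have "\<dots> = graph R Y X j" using iso_Diag[OF assms] by (simp add: graph_def)
  finally have c: "Conv R X Y (graph R X Y i) = graph R Y X j" .
  then have "graph R X Y i = Conv R Y X (graph R Y X j)"
    by (metis Conv_Conv graph_Rel ij(1))
  then have "Seq R Y X Y (Conv R X Y (graph R X Y i)) (graph R X Y i) = kernel R Y X j"
    unfolding kernel_def c by simp
  then show ?thesis
    using iso_Diag[OF inverse_arrows_sym[OF assms]] by (simp add: descent_def kernel_Reix Leq_refl)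
qed

lemma eqrelD:
  assumes "eqrel R X \<rho>"
  shows "\<rho> \<in> Rel R X X" "X \<in> Obj R" "Leq R X X (Diag R X) \<rho>" "Conv R X X \<rho> = \<rho>" "Seq R X X X \<rho> \<rho> = \<rho>"
proof -
  show r [simp]: "\<rho> \<in> Rel R X X" and d: "Leq R X X (Diag R X) \<rho>" using assms by (auto simp: eqrel_def)
  show [simp]: "X \<in> Obj R" using RelD[OF r] by simp
  have "Leq R X X \<rho> (Conv R X X \<rho>)"
    using Conv_mono[of "Conv R X X \<rho>" X X \<rho>] assms by (simp add: eqrel_def)
  then show "Conv R X X \<rho> = \<rho>" using assms by (intro Leq_antisym) (simp_all add: eqrel_def)
  have "Leq R X X \<rho> (Seq R X X X \<rho> \<rho>)"
    using Seq_mono[of "Diag R X" X X \<rho> \<rho> X \<rho>] d by (simp add: Leq_refl)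
  then show "Seq R X X X \<rho> \<rho> = \<rho>" using assms by (intro Leq_antisym) (simp_all add: eqrel_def)
qed

lemma eqrel_Diag: "X \<in> Obj R \<Longrightarrow> eqrel R X (Diag R X)"
  by (simp add: eqrel_def Leq_refl)

lemma quotient_arrowI:
  assumes "q \<in> Hom R X W" "\<rho> \<in> Rel R X X" "Leq R X X \<rho> (Reix R X X W W q q (Diag R W))"
    "\<And>Z f. f \<in> Hom R X Z \<Longrightarrow> Leq R X X \<rho> (Reix R X X Z Z f f (Diag R Z))
        \<Longrightarrow> \<exists>h. h \<in> Hom R W Z \<and> f = Comp R X W Z h q"
    "\<And>Z h h'. h \<in> Hom R W Z \<Longrightarrow> h' \<in> Hom R W Z \<Longrightarrow> Comp R X W Z h q = Comp R X W Z h' q \<Longrightarrow> h = h'"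
  shows "quotient_arrow R X \<rho> W q"
  unfolding quotient_arrow_def
proof (intro conjI allI ballI impI)
  fix Z f assume f: "f \<in> Hom R X Z" and "Leq R X X \<rho> (kernel R X Z f)"
  then obtain h where "h \<in> Hom R W Z" "f = Comp R X W Z h q"
    using assms(4)[of f Z] by (auto simp: kernel_Reix)
  then show "\<exists>!h. h \<in> Hom R W Z \<and> f = Comp R X W Z h q" using assms(5)[of _ Z] by auto
qed (use assms in \<open>simp_all add: kernel_Reix\<close>)

lemma quotient_arrowD:
  assumes "quotient_arrow R X \<rho> W q"
  shows "q \<in> Hom R X W" "Leq R X X \<rho> (Reix R X X W W q q (Diag R W))"
proof -
  show "q \<in> Hom R X W" using assms by (simp add: quotient_arrow_def)
  then show "Leq R X X \<rho> (Reix R X X W W q q (Diag R W))" using assms by (simp add: quotient_arrow_def kernel_Reix)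
qed

lemma quotient_factor:
  assumes "quotient_arrow R X \<rho> W q" "f \<in> Hom R X Z" "Leq R X X \<rho> (Reix R X X Z Z f f (Diag R Z))"
  obtains h where "h \<in> Hom R W Z" "Comp R X W Z h q = f"
proof -
  have "\<exists>!h. h \<in> Hom R W Z \<and> f = Comp R X W Z h q"
    using assms by (simp add: quotient_arrow_def kernel_Reix)
  then show ?thesis using that by blast
qed

lemma quotient_le_kernel:
  assumes q: "quotient_arrow R X \<rho> W q" and r: "\<rho> \<in> Rel R X X" and h: "h \<in> Hom R W Z"
  shows "Leq R X X \<rho> (Reix R X X Z Z (Comp R X W Z h q) (Comp R X W Z h q) (Diag R Z))"
proof -
  note Q = quotient_arrowD[OF q]
  have [simp]: "X \<in> Obj R" "W \<in> Obj R" "Z \<in> Obj R" using HomD[OF Q(1)] HomD[OF h] by auto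
  have "Leq R X X (Reix R X X W W q q (Diag R W)) (Reix R X X W W q q (Reix R W W Z Z h h (Diag R Z)))"
    using Q h by (intro Reix_mono) (simp_all add: Diag_lax)
  then show ?thesis using Q h r by (subst Reix_Comp) (auto intro: Leq_trans[rotated 3])
qed

lemma quotient_epi:
  assumes q: "quotient_arrow R X \<rho> W q" and r: "\<rho> \<in> Rel R X X" and h: "h \<in> Hom R W Z" "h' \<in> Hom R W Z"
    and eq: "Comp R X W Z h q = Comp R X W Z h' q"
  shows "h = h'"
proof -
  have "Comp R X W Z h q \<in> Hom R X Z" using quotient_arrowD[OF q] h by auto
  then have "\<exists>!k. k \<in> Hom R W Z \<and> Comp R X W Z h q = Comp R X W Z k q"
    using q quotient_le_kernel[OF q r h(1)] by (simp add: quotient_arrow_def kernel_Reix)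
  then show ?thesis using h eq by metis
qed

lemma quotient_unique:
  assumes q: "quotient_arrow R X \<rho> W q" and p: "quotient_arrow R X \<rho> V p" and r: "\<rho> \<in> Rel R X X"
  obtains i j where "inverse_arrows R W V i j" "Comp R X W V i q = p"
proof -
  note Q = quotient_arrowD[OF q] and P = quotient_arrowD[OF p]
  obtain i where i: "i \<in> Hom R W V" "Comp R X W V i q = p" by (rule quotient_factor[OF q P])
  obtain j where j: "j \<in> Hom R V W" "Comp R X V W j p = q" by (rule quotient_factor[OF p Q])
  have [simp]: "W \<in> Obj R" "V \<in> Obj R" using HomD[OF i(1)] by auto
  have "Comp R W V W j i = Idn R W"
    by (rule quotient_epi[OF q r, where Z = W]) (use i j Q in \<open>simp_all add: Comp_assoc[symmetric]\<close>)
  moreover have "Comp R V W V i j = Idn R V"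
    by (rule quotient_epi[OF p r, where Z = V]) (use i j P in \<open>simp_all add: Comp_assoc[symmetric]\<close>)
  ultimately show ?thesis using that i j by (simp add: inverse_arrows_def)
qed

lemma quotient_Comp_iso:
  assumes q: "quotient_arrow R X \<rho> W q" and r: "\<rho> \<in> Rel R X X" and ij: "inverse_arrows R W V i j"
  shows "quotient_arrow R X \<rho> V (Comp R X W V i q)"
proof (rule quotient_arrowI)
  note Q = quotient_arrowD[OF q] and I = inverse_arrowsD[OF ij]
  note [simp] = Q(1) I
  show "Leq R X X \<rho> (Reix R X X V V (Comp R X W V i q) (Comp R X W V i q) (Diag R V))"
    by (rule quotient_le_kernel[OF q r]) simp
  fix Z
  { fix f assume f: "f \<in> Hom R X Z" "Leq R X X \<rho> (Reix R X X Z Z f f (Diag R Z))"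
    obtain h where h: "h \<in> Hom R W Z" "Comp R X W Z h q = f" by (rule quotient_factor[OF q f])
    have "Comp R X V Z (Comp R V W Z h j) (Comp R X W V i q)
        = Comp R X W Z (Comp R W V Z (Comp R V W Z h j) i) q"
      using h(1) by (intro Comp_assoc) simp_all
    also have "Comp R W V Z (Comp R V W Z h j) i = h" using h(1) by (simp add: Comp_assoc[symmetric])
    finally show "\<exists>h. h \<in> Hom R V Z \<and> f = Comp R X V Z h (Comp R X W V i q)"
      using h by (intro exI[of _ "Comp R V W Z h j"]) simp }
  fix h h' assume h: "h \<in> Hom R V Z" "h' \<in> Hom R V Z"
    "Comp R X V Z h (Comp R X W V i q) = Comp R X V Z h' (Comp R X W V i q)"
  have "Comp R W V Z h i = Comp R W V Z h' i"
  proof (rule quotient_epi[OF q r])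
    have "Comp R X W Z (Comp R W V Z k i) q = Comp R X V Z k (Comp R X W V i q)" if "k \<in> Hom R V Z" for k
      by (rule Comp_assoc[symmetric]) (rule Q I that)+
    from this[OF h(1)] this[OF h(2)] h(3)
    show "Comp R X W Z (Comp R W V Z h i) q = Comp R X W Z (Comp R W V Z h' i) q" by (simp only:)
  qed (rule Comp_Hom I h)+
  then show "h = h'" by (rule iso_cancel[OF ij h(1,2)])
qed (use quotient_arrowD[OF q] inverse_arrowsD[OF ij] r in simp_all)

lemma iso_quotient_Comp:
  assumes q: "quotient_arrow R X \<rho> W q" and r: "\<rho> \<in> Rel R X X" and ij: "inverse_arrows R Y X i j"
  shows "quotient_arrow R Y (Reix R Y Y X X i i \<rho>) W (Comp R Y X W q i)"
proof (rule quotient_arrowI)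
  note Q = quotient_arrowD[OF q] and I = inverse_arrowsD[OF ij]
  note [simp] = Q(1) I r
  have [simp]: "X \<in> Obj R" "Y \<in> Obj R" "W \<in> Obj R" using HomD[OF Q(1)] HomD[OF I(1)] by auto
  show "Leq R Y Y (Reix R Y Y X X i i \<rho>) (Reix R Y Y W W (Comp R Y X W q i) (Comp R Y X W q i) (Diag R W))"
    by (subst Reix_Comp) (simp_all add: Reix_mono Q)
  fix Z
  { fix f assume f: "f \<in> Hom R Y Z" "Leq R Y Y (Reix R Y Y X X i i \<rho>) (Reix R Y Y Z Z f f (Diag R Z))"
    have [simp]: "Z \<in> Obj R" using f by auto
    have "Leq R X X (Reix R X X Y Y j j (Reix R Y Y X X i i \<rho>)) (Reix R X X Y Y j j (Reix R Y Y Z Z f f (Diag R Z)))"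
      using f by (intro Reix_mono) simp_all
    then have "Leq R X X \<rho> (Reix R X X Z Z (Comp R X Y Z f j) (Comp R X Y Z f j) (Diag R Z))"
      using f by (simp add: Reix_Comp[symmetric])
    then obtain h where h: "h \<in> Hom R W Z" "Comp R X W Z h q = Comp R X Y Z f j"
      using quotient_factor[OF q, of "Comp R X Y Z f j" Z] f by auto
    have "Comp R Y W Z h (Comp R Y X W q i) = Comp R Y X Z (Comp R X Y Z f j) i"
      using h by (simp add: Comp_assoc)
    also have "\<dots> = f" using f by (simp add: Comp_assoc[symmetric])
    finally show "\<exists>h. h \<in> Hom R W Z \<and> f = Comp R Y W Z h (Comp R Y X W q i)" using h by auto }
  fix h h' assume h: "h \<in> Hom R W Z" "h' \<in> Hom R W Z"
    "Comp R Y W Z h (Comp R Y X W q i) = Comp R Y W Z h' (Comp R Y X W q i)"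
  then have "Comp R Y X Z (Comp R X W Z h q) i = Comp R Y X Z (Comp R X W Z h' q) i"
    by (simp add: Comp_assoc)
  then have "Comp R X W Z h q = Comp R X W Z h' q" using iso_cancel[OF ij, of "Comp R X W Z h q" Z "Comp R X W Z h' q"] h(1,2) by simp
  then show "h = h'" by (rule quotient_epi[OF q r h(1,2)])
qed (use quotient_arrowD[OF q] inverse_arrowsD[OF ij] r in simp_all)

text \<open>Only one quotient arrow of \<open>\<rho>\<close> is known to be effective and descent. Any other one differs from it by an
  isomorphism, which is itself a descent arrow and reindexes equality to equality.\<close>

lemma quotient_effective_descent:
  assumes R: "has_quotients R" and r: "eqrel R X \<rho>" and q: "quotient_arrow R X \<rho> W q"
  shows "Reix R X X W W q q (Diag R W) = \<rho>" "descent R X W q"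
proof -
  obtain V p where p: "quotient_arrow R X \<rho> V p" "effective R X \<rho> V p" "descent R X V p"
    using R r unfolding has_quotients_def by blast
  obtain i j where ij: "inverse_arrows R V W i j" "Comp R X V W i p = q"
    by (rule quotient_unique[OF p(1) q eqrelD(1)[OF r]])
  note P = quotient_arrowD[OF p(1)] and I = inverse_arrowsD[OF ij(1)]
  have [simp]: "W \<in> Obj R" "V \<in> Obj R" using HomD[OF I(1)] by auto
  have "Reix R X X W W q q (Diag R W) = Reix R X X V V p p (Reix R V V W W i i (Diag R W))"
    using P I by (simp add: ij(2)[symmetric] Reix_Comp)
  then show "Reix R X X W W q q (Diag R W) = \<rho>"
    using p(2) P(1) by (simp add: iso_Diag[OF ij(1)] effective_def kernel_Reix)
  show "descent R X W q"
    unfolding ij(2)[symmetric] using P I p(3) iso_descent[OF ij(1)] by (intro descent_Comp)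
qed

lemma iso_quotient:
  assumes ij: "inverse_arrows R X W i j"
  shows "quotient_arrow R X (Diag R X) W i"
proof (rule quotient_arrowI)
  note I [simp] = inverse_arrowsD[OF ij]
  have [simp]: "X \<in> Obj R" "W \<in> Obj R" using HomD[OF I(1)] by auto
  show "i \<in> Hom R X W" "Diag R X \<in> Rel R X X" "Leq R X X (Diag R X) (Reix R X X W W i i (Diag R W))"
    by (simp_all add: Diag_lax)
  fix Z
  { fix f assume "f \<in> Hom R X Z"
    then show "\<exists>h. h \<in> Hom R W Z \<and> f = Comp R X W Z h i"
      by (intro exI[of _ "Comp R W X Z f j"]) (simp add: Comp_assoc[symmetric]) }
  fix h h' assume "h \<in> Hom R W Z" "h' \<in> Hom R W Z" "Comp R X W Z h i = Comp R X W Z h' i"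
  then show "h = h'" by (rule iso_cancel[OF ij])
qed

lemma inverse_Idn: "X \<in> Obj R \<Longrightarrow> inverse_arrows R X X (Idn R X) (Idn R X)"
  by (simp add: inverse_arrows_def)

end

section \<open>The 2-category of relational doctrines\<close>

lemma RD_simps [simp]:
  "Ob RD = {R. relational_doctrine R}" "Ar RD = {F. rd_arrow F}" "Dm RD = Dom" "Cd RD = Cod"
  "Ce RD = {\<theta>. rd_cell \<theta>}" "Src RD = Sarr" "Trg RD = Tarr" "One RD = rd1_id" "Cmp RD = rd1_comp"
  "IdC RD = rd2_id" "VC RD = rd2_vcomp" "HC RD = rd2_hcomp"
  by (simp_all add: RD_def)

lemmas doctrine_simps [simp] = relational_doctrine.typing relational_doctrine.units
  relational_doctrine.Leq_refl relational_doctrine.Diag_lax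

lemma doctrine_HomD: "relational_doctrine R \<Longrightarrow> f \<in> Hom R X Y \<Longrightarrow> X \<in> Obj R"
    "relational_doctrine R \<Longrightarrow> f \<in> Hom R X Y \<Longrightarrow> Y \<in> Obj R"
  by (auto dest: relational_doctrine.HomD)

lemma doctrine_RelD: "relational_doctrine R \<Longrightarrow> \<alpha> \<in> Rel R X Y \<Longrightarrow> X \<in> Obj R"
    "relational_doctrine R \<Longrightarrow> \<alpha> \<in> Rel R X Y \<Longrightarrow> Y \<in> Obj R"
  by (auto dest: relational_doctrine.RelD)

lemma rd_arrow_doctrine [simp]: "rd_arrow F \<Longrightarrow> relational_doctrine (Dom F)" "rd_arrow F \<Longrightarrow> relational_doctrine (Cod F)"
  unfolding rd_arrow_def by auto

text \<open>The boundaries enter through equations among the premises, so that the rules rewrite terms whose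
  boundaries are given in another form.\<close>

lemma rd_arrow_simps [simp]:
  assumes "rd_arrow F"
  shows "X \<in> Obj (Dom F) \<Longrightarrow> Cod F = S \<Longrightarrow> omap F X \<in> Obj S"
    "f \<in> Hom (Dom F) X Y \<Longrightarrow> Cod F = S \<Longrightarrow> A = omap F X \<Longrightarrow> B = omap F Y \<Longrightarrow> amap F X Y f \<in> Hom S A B"
    "\<alpha> \<in> Rel (Dom F) X Y \<Longrightarrow> Cod F = S \<Longrightarrow> A = omap F X \<Longrightarrow> B = omap F Y \<Longrightarrow> rmap F X Y \<alpha> \<in> Rel S A B"
    "X \<in> Obj (Dom F) \<Longrightarrow> Dom F = R \<Longrightarrow> amap F X X (Idn R X) = Idn (Cod F) (omap F X)"
    "X \<in> Obj (Dom F) \<Longrightarrow> Dom F = R \<Longrightarrow> rmap F X X (Diag R X) = Diag (Cod F) (omap F X)"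
    "f \<in> Hom (Dom F) X Y \<Longrightarrow> g \<in> Hom (Dom F) Y Z \<Longrightarrow> Dom F = R
        \<Longrightarrow> amap F X Z (Comp R X Y Z g f)
          = Comp (Cod F) (omap F X) (omap F Y) (omap F Z) (amap F Y Z g) (amap F X Y f)"
    "f \<in> Hom (Dom F) X A' \<Longrightarrow> g \<in> Hom (Dom F) Y B' \<Longrightarrow> \<alpha> \<in> Rel (Dom F) A' B' \<Longrightarrow> Dom F = R
        \<Longrightarrow> rmap F X Y (Reix R X Y A' B' f g \<alpha>)
          = Reix (Cod F) (omap F X) (omap F Y) (omap F A') (omap F B')
              (amap F X A' f) (amap F Y B' g) (rmap F A' B' \<alpha>)"
    "\<alpha> \<in> Rel (Dom F) X Y \<Longrightarrow> \<beta> \<in> Rel (Dom F) Y Z \<Longrightarrow> Dom F = R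
        \<Longrightarrow> rmap F X Z (Seq R X Y Z \<alpha> \<beta>)
          = Seq (Cod F) (omap F X) (omap F Y) (omap F Z) (rmap F X Y \<alpha>) (rmap F Y Z \<beta>)"
    "\<alpha> \<in> Rel (Dom F) X Y \<Longrightarrow> Dom F = R
        \<Longrightarrow> rmap F Y X (Conv R X Y \<alpha>) = Conv (Cod F) (omap F X) (omap F Y) (rmap F X Y \<alpha>)"
  using assms by (auto simp: rd_arrow.omap_Obj rd_arrow.amap_Hom rd_arrow.rmap_Rel rd_arrow.amap_Idn
    rd_arrow.rmap_Diag rd_arrow.amap_Comp rd_arrow.rmap_Reix rd_arrow.rmap_Seq rd_arrow.rmap_Conv)

lemma rd_arrow_mono:
  "rd_arrow F \<Longrightarrow> \<alpha> \<in> Rel (Dom F) X Y \<Longrightarrow> \<beta> \<in> Rel (Dom F) X Y \<Longrightarrow> Leq (Dom F) X Y \<alpha> \<beta>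
    \<Longrightarrow> Leq (Cod F) (omap F X) (omap F Y) (rmap F X Y \<alpha>) (rmap F X Y \<beta>)"
  by (rule rd_arrow.rmap_mono)

lemma rd1_eqI:
  assumes F: "rd_arrow F" and G: "rd_arrow G" and eq: "Dom F = Dom G" "Cod F = Cod G"
    and o: "\<And>X. X \<in> Obj (Dom F) \<Longrightarrow> omap F X = omap G X"
    and a: "\<And>X Y f. f \<in> Hom (Dom F) X Y \<Longrightarrow> amap F X Y f = amap G X Y f"
    and r: "\<And>X Y \<alpha>. \<alpha> \<in> Rel (Dom F) X Y \<Longrightarrow> rmap F X Y \<alpha> = rmap G X Y \<alpha>"
  shows "F = G"
proof -
  interpret F: rd_arrow F by fact
  interpret G: rd_arrow G by fact
  have "omap F = omap G"
    by (rule extensionalityI[OF F.omap_ext]) (use eq o G.omap_ext in auto)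
  moreover have "amap F X Y = amap G X Y" for X Y
    by (rule extensionalityI[OF F.amap_ext]) (use eq a G.amap_ext in auto)
  moreover have "rmap F X Y = rmap G X Y" for X Y
    by (rule extensionalityI[OF F.rmap_ext]) (use eq r G.rmap_ext in auto)
  ultimately show ?thesis using eq by (intro rd1.equality ext) simp_all
qed

lemma rd_cell_arrow [simp]: "rd_cell \<theta> \<Longrightarrow> rd_arrow (Sarr \<theta>)" "rd_cell \<theta> \<Longrightarrow> rd_arrow (Tarr \<theta>)"
  unfolding rd_cell_def by auto

lemma rd_cell_simps [simp]:
  assumes "rd_cell \<theta>"
  shows "Dom (Tarr \<theta>) = Dom (Sarr \<theta>)" "Cod (Tarr \<theta>) = Cod (Sarr \<theta>)"
    "X \<in> Obj (Dom (Sarr \<theta>)) \<Longrightarrow> Cod (Sarr \<theta>) = S \<Longrightarrow> A = omap (Sarr \<theta>) X \<Longrightarrow> B = omap (Tarr \<theta>) X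
      \<Longrightarrow> cpt \<theta> X \<in> Hom S A B"
  using assms by (auto simp: rd_cell.same_Dom rd_cell.same_Cod rd_cell.cpt_Hom)

lemma rd2_eqI:
  assumes "rd_cell \<theta>" "rd_cell \<phi>" "Sarr \<theta> = Sarr \<phi>" "Tarr \<theta> = Tarr \<phi>"
    "\<And>X. X \<in> Obj (Dom (Sarr \<theta>)) \<Longrightarrow> cpt \<theta> X = cpt \<phi> X"
  shows "\<theta> = \<phi>"
proof -
  have "cpt \<theta> = cpt \<phi>"
    by (rule extensionalityI[OF rd_cell.cpt_ext[OF assms(1)]])
      (use rd_cell.cpt_ext[OF assms(2)] assms(3,5) in auto)
  then show ?thesis using assms by (intro rd2.equality) auto
qed

lemma rd1_id_simps [simp]: "Dom (rd1_id R) = R" "Cod (rd1_id R) = R"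
  "X \<in> Obj R \<Longrightarrow> omap (rd1_id R) X = X" "f \<in> Hom R X Y \<Longrightarrow> amap (rd1_id R) X Y f = f"
  "\<alpha> \<in> Rel R X Y \<Longrightarrow> rmap (rd1_id R) X Y \<alpha> = \<alpha>"
  by (simp_all add: rd1_id_def)

lemma rd1_comp_simps [simp]: "Dom (rd1_comp G F) = Dom F" "Cod (rd1_comp G F) = Cod G"
  "X \<in> Obj (Dom F) \<Longrightarrow> omap (rd1_comp G F) X = omap G (omap F X)"
  "f \<in> Hom (Dom F) X Y \<Longrightarrow> amap (rd1_comp G F) X Y f = amap G (omap F X) (omap F Y) (amap F X Y f)"
  "\<alpha> \<in> Rel (Dom F) X Y \<Longrightarrow> rmap (rd1_comp G F) X Y \<alpha> = rmap G (omap F X) (omap F Y) (rmap F X Y \<alpha>)"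
  by (simp_all add: rd1_comp_def)

lemma rd2_id_simps [simp]: "Sarr (rd2_id F) = F" "Tarr (rd2_id F) = F"
  "X \<in> Obj (Dom F) \<Longrightarrow> cpt (rd2_id F) X = Idn (Cod F) (omap F X)"
  by (simp_all add: rd2_id_def)

lemma rd2_vcomp_simps [simp]: "Sarr (rd2_vcomp \<phi> \<theta>) = Sarr \<theta>" "Tarr (rd2_vcomp \<phi> \<theta>) = Tarr \<phi>"
  "X \<in> Obj (Dom (Sarr \<theta>)) \<Longrightarrow> cpt (rd2_vcomp \<phi> \<theta>) X
    = Comp (Cod (Sarr \<theta>)) (omap (Sarr \<theta>) X) (omap (Tarr \<theta>) X) (omap (Tarr \<phi>) X) (cpt \<phi> X) (cpt \<theta> X)"
  by (simp_all add: rd2_vcomp_def)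

lemma rd2_hcomp_simps [simp]: "Sarr (rd2_hcomp \<phi> \<theta>) = rd1_comp (Sarr \<phi>) (Sarr \<theta>)"
  "Tarr (rd2_hcomp \<phi> \<theta>) = rd1_comp (Tarr \<phi>) (Tarr \<theta>)"
  "X \<in> Obj (Dom (Sarr \<theta>)) \<Longrightarrow> cpt (rd2_hcomp \<phi> \<theta>) X
    = Comp (Cod (Sarr \<phi>)) (omap (Sarr \<phi>) (omap (Sarr \<theta>) X))
         (omap (Sarr \<phi>) (omap (Tarr \<theta>) X)) (omap (Tarr \<phi>) (omap (Tarr \<theta>) X))
         (cpt \<phi> (omap (Tarr \<theta>) X))
         (amap (Sarr \<phi>) (omap (Sarr \<theta>) X) (omap (Tarr \<theta>) X) (cpt \<theta> X))"
  by (simp_all add: rd2_hcomp_def)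

lemma rd_arrow_id [simp]: "relational_doctrine R \<Longrightarrow> rd_arrow (rd1_id R)"
  unfolding rd_arrow_def rd_arrow_axioms_def
  by (auto simp: rd1_id_def doctrine_HomD doctrine_RelD dest: doctrine_HomD doctrine_RelD)

lemma rd_arrow_comp [simp]:
  assumes [simp]: "rd_arrow F" "rd_arrow G" "Dom G = Cod F"
  shows "rd_arrow (rd1_comp G F)"
proof -
  have [simp]: "relational_doctrine (Cod G)" by simp
  show ?thesis
    unfolding rd_arrow_def rd_arrow_axioms_def
  proof (intro conjI allI impI; (simp; fail)?)
    fix \<alpha> \<beta> X Y assume "\<alpha> \<in> Rel (Dom (rd1_comp G F)) X Y" "\<beta> \<in> Rel (Dom (rd1_comp G F)) X Y"
      "Leq (Dom (rd1_comp G F)) X Y \<alpha> \<beta>"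
    moreover from this have "X \<in> Obj (Dom F)" "Y \<in> Obj (Dom F)" by (auto dest: doctrine_RelD[rotated])
    ultimately show "Leq (Cod (rd1_comp G F)) (omap (rd1_comp G F) X) (omap (rd1_comp G F) Y)
        (rmap (rd1_comp G F) X Y \<alpha>) (rmap (rd1_comp G F) X Y \<beta>)"
      using rd_arrow_mono[of F \<alpha> X Y \<beta>] rd_arrow_mono[of G "rmap F X Y \<alpha>" "omap F X" "omap F Y" "rmap F X Y \<beta>"]
      by simp
  qed (auto simp: rd1_comp_def dest: doctrine_HomD[rotated] doctrine_RelD[rotated])
qed

lemma rd_cellI:
  assumes "rd_arrow F" "rd_arrow G" "Dom F = R" "Dom G = R" "Cod F = S" "Cod G = S"
    "Sarr \<theta> = F" "Tarr \<theta> = G" "cpt \<theta> \<in> extensional (Obj R)"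
    "\<And>X. X \<in> Obj R \<Longrightarrow> cpt \<theta> X \<in> Hom S (omap F X) (omap G X)"
    "\<And>X Y f. f \<in> Hom R X Y \<Longrightarrow> X \<in> Obj R \<Longrightarrow> Y \<in> Obj R
      \<Longrightarrow> Comp S (omap F X) (omap F Y) (omap G Y) (cpt \<theta> Y) (amap F X Y f)
          = Comp S (omap F X) (omap G X) (omap G Y) (amap G X Y f) (cpt \<theta> X)"
    "\<And>X Y \<alpha>. \<alpha> \<in> Rel R X Y \<Longrightarrow> X \<in> Obj R \<Longrightarrow> Y \<in> Obj R \<Longrightarrow> Leq S (omap F X) (omap F Y) (rmap F X Y \<alpha>)
         (Reix S (omap F X) (omap F Y) (omap G X) (omap G Y) (cpt \<theta> X) (cpt \<theta> Y) (rmap G X Y \<alpha>))"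
  shows "rd_cell \<theta>"
proof -
  interpret R: relational_doctrine R using assms by auto
  note nat = assms(11)[OF _ R.HomD] and lax = assms(12)[OF _ R.RelD]
  show ?thesis
    using assms(1-10) nat lax unfolding rd_cell_def rd_cell_axioms_def by auto
qed

lemma rd_cell_natural:
  assumes "rd_cell \<theta>" "f \<in> Hom R X Y" "Sarr \<theta> = F" "Tarr \<theta> = G" "Dom F = R" "Cod F = S"
  shows "Comp S (omap F X) (omap F Y) (omap G Y) (cpt \<theta> Y) (amap F X Y f)
       = Comp S (omap F X) (omap G X) (omap G Y) (amap G X Y f) (cpt \<theta> X)"
  using rd_cell.cpt_natural[OF assms(1), of f X Y] assms by auto

lemma rd_cell_lax:
  assumes "rd_cell \<theta>" "\<alpha> \<in> Rel R X Y" "Sarr \<theta> = F" "Tarr \<theta> = G" "Dom F = R" "Cod F = S"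
  shows "Leq S (omap F X) (omap F Y) (rmap F X Y \<alpha>)
         (Reix S (omap F X) (omap F Y) (omap G X) (omap G Y) (cpt \<theta> X) (cpt \<theta> Y) (rmap G X Y \<alpha>))"
  using rd_cell.cpt_lax[OF assms(1), of \<alpha> X Y] assms by auto

lemma rd_cell_id [simp]: "rd_arrow F \<Longrightarrow> rd_cell (rd2_id F)"
  by (rule rd_cellI[of F F "Dom F" "Cod F"]) (simp_all add: rd2_id_def)

lemma rd_cell_vcomp [simp]:
  assumes t [simp]: "rd_cell \<theta>" and p [simp]: "rd_cell \<phi>" and m: "Sarr \<phi> = Tarr \<theta>"
  shows "rd_cell (rd2_vcomp \<phi> \<theta>)"
proof -
  let ?R = "Dom (Sarr \<theta>)" and ?S = "Cod (Sarr \<theta>)"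
  let ?F = "Sarr \<theta>" and ?G = "Tarr \<theta>" and ?H = "Tarr \<phi>"
  have [simp]: "Dom ?H = ?R" "Cod ?H = ?S" "Dom (Sarr \<phi>) = ?R" "Cod (Sarr \<phi>) = ?S"
    "relational_doctrine ?S" "relational_doctrine ?R" using m by simp_all
  note [simp] = m
  interpret S: relational_doctrine ?S by simp
  show ?thesis
  proof (rule rd_cellI[of ?F ?H ?R ?S])
    fix X Y f assume f: "f \<in> Hom ?R X Y" and [simp]: "X \<in> Obj ?R" "Y \<in> Obj ?R"
    have "Comp ?S (omap ?F X) (omap ?F Y) (omap ?H Y) (cpt (rd2_vcomp \<phi> \<theta>) Y) (amap ?F X Y f)
      = Comp ?S (omap ?F X) (omap ?G Y) (omap ?H Y) (cpt \<phi> Y)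
         (Comp ?S (omap ?F X) (omap ?F Y) (omap ?G Y) (cpt \<theta> Y) (amap ?F X Y f))"
      using f by (simp add: S.Comp_assoc)
    also have "\<dots> = Comp ?S (omap ?F X) (omap ?G X) (omap ?H Y)
         (Comp ?S (omap ?G X) (omap ?G Y) (omap ?H Y) (cpt \<phi> Y) (amap ?G X Y f)) (cpt \<theta> X)"
      using f by (simp add: rd_cell_natural[OF t f] S.Comp_assoc)
    also have "\<dots> = Comp ?S (omap ?F X) (omap ?H X) (omap ?H Y) (amap ?H X Y f) (cpt (rd2_vcomp \<phi> \<theta>) X)"
      using f by (simp add: rd_cell_natural[OF p f m] S.Comp_assoc)
    finally show "Comp ?S (omap ?F X) (omap ?F Y) (omap ?H Y) (cpt (rd2_vcomp \<phi> \<theta>) Y) (amap ?F X Y f)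
      = Comp ?S (omap ?F X) (omap ?H X) (omap ?H Y) (amap ?H X Y f) (cpt (rd2_vcomp \<phi> \<theta>) X)" .
  next
    fix X Y \<alpha> assume a [simp]: "\<alpha> \<in> Rel ?R X Y" and [simp]: "X \<in> Obj ?R" "Y \<in> Obj ?R"
    have "Leq ?S (omap ?F X) (omap ?F Y)
      (Reix ?S (omap ?F X) (omap ?F Y) (omap ?G X) (omap ?G Y) (cpt \<theta> X) (cpt \<theta> Y) (rmap ?G X Y \<alpha>))
      (Reix ?S (omap ?F X) (omap ?F Y) (omap ?G X) (omap ?G Y) (cpt \<theta> X) (cpt \<theta> Y)
        (Reix ?S (omap ?G X) (omap ?G Y) (omap ?H X) (omap ?H Y) (cpt \<phi> X) (cpt \<phi> Y) (rmap ?H X Y \<alpha>)))"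
      using rd_cell_lax[OF p a m refl] by (intro S.Reix_mono) simp_all
    with rd_cell_lax[OF t a refl refl refl refl]
    have "Leq ?S (omap ?F X) (omap ?F Y) (rmap ?F X Y \<alpha>)
      (Reix ?S (omap ?F X) (omap ?F Y) (omap ?G X) (omap ?G Y) (cpt \<theta> X) (cpt \<theta> Y)
        (Reix ?S (omap ?G X) (omap ?G Y) (omap ?H X) (omap ?H Y) (cpt \<phi> X) (cpt \<phi> Y) (rmap ?H X Y \<alpha>)))"
      by (rule S.Leq_trans[rotated 3]) simp_all
    then show "Leq ?S (omap ?F X) (omap ?F Y) (rmap ?F X Y \<alpha>)
      (Reix ?S (omap ?F X) (omap ?F Y) (omap ?H X) (omap ?H Y) (cpt (rd2_vcomp \<phi> \<theta>) X)
        (cpt (rd2_vcomp \<phi> \<theta>) Y) (rmap ?H X Y \<alpha>))"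
      by (simp add: S.Reix_Comp)
  qed (simp_all add: rd2_vcomp_def)
qed

lemma rd_cell_hcomp [simp]:
  assumes t [simp]: "rd_cell \<theta>" and p [simp]: "rd_cell \<phi>" and m [simp]: "Dom (Sarr \<phi>) = Cod (Sarr \<theta>)"
  shows "rd_cell (rd2_hcomp \<phi> \<theta>)"
proof -
  let ?R = "Dom (Sarr \<theta>)" and ?S = "Cod (Sarr \<theta>)" and ?T = "Cod (Sarr \<phi>)"
  let ?F = "Sarr \<theta>" and ?F' = "Tarr \<theta>" and ?G = "Sarr \<phi>" and ?G' = "Tarr \<phi>"
  interpret T: relational_doctrine ?T by simp
  interpret S: relational_doctrine ?S by simp
  let ?c = "cpt (rd2_hcomp \<phi> \<theta>)"
  show ?thesis
  proof (rule rd_cellI[of "rd1_comp ?G ?F" "rd1_comp ?G' ?F'" ?R ?T])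
    fix X Y f assume f [simp]: "f \<in> Hom ?R X Y" and [simp]: "X \<in> Obj ?R" "Y \<in> Obj ?R"
    have n: "Comp ?T (omap ?G (omap ?F X)) (omap ?G (omap ?F Y)) (omap ?G (omap ?F' Y))
           (amap ?G (omap ?F Y) (omap ?F' Y) (cpt \<theta> Y)) (amap ?G (omap ?F X) (omap ?F Y) (amap ?F X Y f))
      = Comp ?T (omap ?G (omap ?F X)) (omap ?G (omap ?F' X)) (omap ?G (omap ?F' Y))
           (amap ?G (omap ?F' X) (omap ?F' Y) (amap ?F' X Y f)) (amap ?G (omap ?F X) (omap ?F' X) (cpt \<theta> X))"
      using arg_cong[OF rd_cell_natural[OF t f refl refl refl refl], of "amap ?G (omap ?F X) (omap ?F' Y)"] by simp
    have "Comp ?T (omap ?G (omap ?F X)) (omap ?G (omap ?F Y)) (omap ?G' (omap ?F' Y)) (?c Y)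
         (amap ?G (omap ?F X) (omap ?F Y) (amap ?F X Y f))
      = Comp ?T (omap ?G (omap ?F X)) (omap ?G (omap ?F' Y)) (omap ?G' (omap ?F' Y)) (cpt \<phi> (omap ?F' Y))
          (Comp ?T (omap ?G (omap ?F X)) (omap ?G (omap ?F Y)) (omap ?G (omap ?F' Y))
           (amap ?G (omap ?F Y) (omap ?F' Y) (cpt \<theta> Y)) (amap ?G (omap ?F X) (omap ?F Y) (amap ?F X Y f)))"
      by (simp add: T.Comp_assoc)
    also have "\<dots> = Comp ?T (omap ?G (omap ?F X)) (omap ?G (omap ?F' X)) (omap ?G' (omap ?F' Y))
          (Comp ?T (omap ?G (omap ?F' X)) (omap ?G (omap ?F' Y)) (omap ?G' (omap ?F' Y)) (cpt \<phi> (omap ?F' Y))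
            (amap ?G (omap ?F' X) (omap ?F' Y) (amap ?F' X Y f))) (amap ?G (omap ?F X) (omap ?F' X) (cpt \<theta> X))"
      unfolding n by (rule T.Comp_assoc) simp_all
    also have "Comp ?T (omap ?G (omap ?F' X)) (omap ?G (omap ?F' Y)) (omap ?G' (omap ?F' Y)) (cpt \<phi> (omap ?F' Y))
            (amap ?G (omap ?F' X) (omap ?F' Y) (amap ?F' X Y f))
       = Comp ?T (omap ?G (omap ?F' X)) (omap ?G' (omap ?F' X)) (omap ?G' (omap ?F' Y))
            (amap ?G' (omap ?F' X) (omap ?F' Y) (amap ?F' X Y f)) (cpt \<phi> (omap ?F' X))"
      by (rule rd_cell_natural[OF p _ refl refl m refl]) simp
    finally show "Comp ?T (omap (rd1_comp ?G ?F) X) (omap (rd1_comp ?G ?F) Y) (omap (rd1_comp ?G' ?F') Y) (?c Y)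
         (amap (rd1_comp ?G ?F) X Y f)
       = Comp ?T (omap (rd1_comp ?G ?F) X) (omap (rd1_comp ?G' ?F') X) (omap (rd1_comp ?G' ?F') Y)
         (amap (rd1_comp ?G' ?F') X Y f) (?c X)"
      by (simp add: T.Comp_assoc)
  next
    fix X Y \<alpha> assume a [simp]: "\<alpha> \<in> Rel ?R X Y" and [simp]: "X \<in> Obj ?R" "Y \<in> Obj ?R"
    let ?m = "Reix ?T (omap ?G (omap ?F X)) (omap ?G (omap ?F Y)) (omap ?G (omap ?F' X)) (omap ?G (omap ?F' Y))
           (amap ?G (omap ?F X) (omap ?F' X) (cpt \<theta> X)) (amap ?G (omap ?F Y) (omap ?F' Y) (cpt \<theta> Y))"
    have "Leq ?T (omap ?G (omap ?F X)) (omap ?G (omap ?F Y)) (rmap ?G (omap ?F X) (omap ?F Y) (rmap ?F X Y \<alpha>))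
        (?m (rmap ?G (omap ?F' X) (omap ?F' Y) (rmap ?F' X Y \<alpha>)))"
      using rd_arrow_mono[of ?G, OF _ _ _ rd_cell_lax[OF t a refl refl refl m[symmetric]]] by simp
    moreover have "Leq ?T (omap ?G (omap ?F X)) (omap ?G (omap ?F Y))
        (?m (rmap ?G (omap ?F' X) (omap ?F' Y) (rmap ?F' X Y \<alpha>)))
        (?m (Reix ?T (omap ?G (omap ?F' X)) (omap ?G (omap ?F' Y)) (omap ?G' (omap ?F' X)) (omap ?G' (omap ?F' Y))
              (cpt \<phi> (omap ?F' X)) (cpt \<phi> (omap ?F' Y)) (rmap ?G' (omap ?F' X) (omap ?F' Y) (rmap ?F' X Y \<alpha>))))"
      by (rule T.Reix_mono[OF _ _ _ _ rd_cell_lax[OF p _ refl refl m refl]]) simp_all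
    ultimately have "Leq ?T (omap ?G (omap ?F X)) (omap ?G (omap ?F Y)) (rmap ?G (omap ?F X) (omap ?F Y) (rmap ?F X Y \<alpha>))
        (?m (Reix ?T (omap ?G (omap ?F' X)) (omap ?G (omap ?F' Y)) (omap ?G' (omap ?F' X)) (omap ?G' (omap ?F' Y))
              (cpt \<phi> (omap ?F' X)) (cpt \<phi> (omap ?F' Y)) (rmap ?G' (omap ?F' X) (omap ?F' Y) (rmap ?F' X Y \<alpha>))))"
      by (rule T.Leq_trans[rotated 3]) simp_all
    then show "Leq ?T (omap (rd1_comp ?G ?F) X) (omap (rd1_comp ?G ?F) Y) (rmap (rd1_comp ?G ?F) X Y \<alpha>)
        (Reix ?T (omap (rd1_comp ?G ?F) X) (omap (rd1_comp ?G ?F) Y) (omap (rd1_comp ?G' ?F') X)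
          (omap (rd1_comp ?G' ?F') Y) (?c X) (?c Y) (rmap (rd1_comp ?G' ?F') X Y \<alpha>))"
      by (simp add: T.Reix_Comp)
  qed (simp_all add: rd2_hcomp_def)
qed

lemma rd1_comp_id [simp]: "rd_arrow F \<Longrightarrow> R = Dom F \<Longrightarrow> rd1_comp F (rd1_id R) = F"
    "rd_arrow F \<Longrightarrow> S = Cod F \<Longrightarrow> rd1_comp (rd1_id S) F = F"
  by (rule rd1_eqI; simp add: doctrine_HomD doctrine_RelD)+

lemma rd1_comp_assoc: "rd_arrow F \<Longrightarrow> rd_arrow G \<Longrightarrow> rd_arrow H \<Longrightarrow> Dom G = Cod F \<Longrightarrow> Dom H = Cod G
    \<Longrightarrow> rd1_comp H (rd1_comp G F) = rd1_comp (rd1_comp H G) F"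
  by (rule rd1_eqI) (simp_all add: doctrine_HomD doctrine_RelD)

lemma rd2_vcomp_id: "rd_cell a \<Longrightarrow> rd2_vcomp a (rd2_id (Sarr a)) = a" "rd_cell a \<Longrightarrow> rd2_vcomp (rd2_id (Tarr a)) a = a"
  by (rule rd2_eqI; simp)+

lemma rd2_vcomp_assoc:
  assumes [simp]: "rd_cell a" "rd_cell b" "rd_cell c" and m [simp]: "Sarr b = Tarr a" "Sarr c = Tarr b"
  shows "rd2_vcomp c (rd2_vcomp b a) = rd2_vcomp (rd2_vcomp c b) a"
proof (rule rd2_eqI)
  fix X assume "X \<in> Obj (Dom (Sarr (rd2_vcomp c (rd2_vcomp b a))))"
  then have [simp]: "X \<in> Obj (Dom (Sarr a))" by simp
  interpret S: relational_doctrine "Cod (Sarr a)" by simp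
  have [simp]: "Dom (Tarr b) = Dom (Sarr a)" "Cod (Tarr b) = Cod (Sarr a)"
    using rd_cell_simps(1,2)[of b] by (simp_all del: rd_cell_simps(1,2), simp_all)
  have "cpt b X \<in> Hom (Cod (Sarr a)) (omap (Tarr a) X) (omap (Tarr b) X)"
    "cpt c X \<in> Hom (Cod (Sarr a)) (omap (Tarr b) X) (omap (Tarr c) X)" by simp_all
  then show "cpt (rd2_vcomp c (rd2_vcomp b a)) X = cpt (rd2_vcomp (rd2_vcomp c b) a) X"
    by (simp add: S.Comp_assoc)
qed simp_all

lemma rd2_hcomp_one: "rd_cell a \<Longrightarrow> rd2_hcomp a (rd2_id (rd1_id (Dom (Sarr a)))) = a"
    "rd_cell a \<Longrightarrow> rd2_hcomp (rd2_id (rd1_id (Cod (Sarr a)))) a = a"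
  by (rule rd2_eqI; simp)+

lemma rd2_hcomp_id:
  "rd_arrow f \<Longrightarrow> rd_arrow g \<Longrightarrow> Dom g = Cod f \<Longrightarrow> rd2_hcomp (rd2_id g) (rd2_id f) = rd2_id (rd1_comp g f)"
  by (rule rd2_eqI) simp_all

lemma rd2_hcomp_assoc:
  assumes [simp]: "rd_cell a" "rd_cell b" "rd_cell c" "Dom (Sarr b) = Cod (Sarr a)" "Dom (Sarr c) = Cod (Sarr b)"
  shows "rd2_hcomp c (rd2_hcomp b a) = rd2_hcomp (rd2_hcomp c b) a"
proof (rule rd2_eqI)
  fix X assume "X \<in> Obj (Dom (Sarr (rd2_hcomp c (rd2_hcomp b a))))"
  then have [simp]: "X \<in> Obj (Dom (Sarr a))" by simp
  interpret S: relational_doctrine "Cod (Sarr c)" by simp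
  show "cpt (rd2_hcomp c (rd2_hcomp b a)) X = cpt (rd2_hcomp (rd2_hcomp c b) a) X"
    by (simp add: S.Comp_assoc)
qed (simp_all add: rd1_comp_assoc)

lemma rd2_interchange:
  assumes a [simp]: "rd_cell a" "rd_cell a'" "Sarr a' = Tarr a" and b [simp]: "rd_cell b" "rd_cell b'" "Sarr b' = Tarr b"
    and m [simp]: "Dom (Sarr b) = Cod (Sarr a)"
  shows "rd2_hcomp (rd2_vcomp b' b) (rd2_vcomp a' a) = rd2_vcomp (rd2_hcomp b' a') (rd2_hcomp b a)"
proof (rule rd2_eqI)
  have [simp]: "Dom (Tarr a') = Dom (Sarr a)" "Cod (Tarr a') = Cod (Sarr a)"
    "Dom (Tarr b') = Dom (Sarr b)" "Cod (Tarr b') = Cod (Sarr b)"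
    using rd_cell_simps(1,2)[of a'] rd_cell_simps(1,2)[of b'] by (simp_all del: rd_cell_simps(1,2), simp_all)
  fix X assume "X \<in> Obj (Dom (Sarr (rd2_hcomp (rd2_vcomp b' b) (rd2_vcomp a' a))))"
  then have X [simp]: "X \<in> Obj (Dom (Sarr a))" by simp
  let ?T = "Cod (Sarr b)" and ?F = "omap (Sarr a) X" and ?F' = "omap (Tarr a) X" and ?F'' = "omap (Tarr a') X"
  let ?G = "Sarr b" and ?G' = "Tarr b" and ?G'' = "Tarr b'"
  interpret T: relational_doctrine ?T by simp
  have [simp]: "cpt a X \<in> Hom (Cod (Sarr a)) ?F ?F'" "cpt a' X \<in> Hom (Cod (Sarr a)) ?F' ?F''"
    "cpt b ?F' \<in> Hom ?T (omap ?G ?F') (omap ?G' ?F')" "cpt b ?F'' \<in> Hom ?T (omap ?G ?F'') (omap ?G' ?F'')"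
    "cpt b' ?F'' \<in> Hom ?T (omap ?G' ?F'') (omap ?G'' ?F'')"
    "amap ?G ?F ?F' (cpt a X) \<in> Hom ?T (omap ?G ?F) (omap ?G ?F')"
    "amap ?G ?F' ?F'' (cpt a' X) \<in> Hom ?T (omap ?G ?F') (omap ?G ?F'')"
    "amap ?G' ?F' ?F'' (cpt a' X) \<in> Hom ?T (omap ?G' ?F') (omap ?G' ?F'')" by simp_all
  have n: "Comp ?T (omap ?G ?F') (omap ?G ?F'') (omap ?G' ?F'') (cpt b ?F'') (amap ?G ?F' ?F'' (cpt a' X))
       = Comp ?T (omap ?G ?F') (omap ?G' ?F') (omap ?G' ?F'') (amap ?G' ?F' ?F'' (cpt a' X)) (cpt b ?F')"
    by (rule rd_cell_natural[OF b(1) _ refl refl m refl]) simp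
  have "cpt (rd2_hcomp (rd2_vcomp b' b) (rd2_vcomp a' a)) X
     = Comp ?T (omap ?G ?F) (omap ?G' ?F'') (omap ?G'' ?F'') (cpt b' ?F'')
        (Comp ?T (omap ?G ?F) (omap ?G ?F') (omap ?G' ?F'')
          (Comp ?T (omap ?G ?F') (omap ?G ?F'') (omap ?G' ?F'') (cpt b ?F'') (amap ?G ?F' ?F'' (cpt a' X)))
          (amap ?G ?F ?F' (cpt a X)))"
    by (simp add: T.Comp_assoc)
  also have "\<dots> = cpt (rd2_vcomp (rd2_hcomp b' a') (rd2_hcomp b a)) X"
    unfolding n by (simp add: T.Comp_assoc)
  finally show "cpt (rd2_hcomp (rd2_vcomp b' b) (rd2_vcomp a' a)) X
     = cpt (rd2_vcomp (rd2_hcomp b' a') (rd2_hcomp b a)) X" .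
qed simp_all

theorem two_category_RD: "two_category RD"
  by unfold_locales
    (auto simp: hom1_def hom2_def rd1_comp_assoc rd2_vcomp_id rd2_vcomp_assoc rd2_hcomp_one rd2_hcomp_id
      rd2_hcomp_assoc rd2_interchange)

section \<open>Invertible 2-arrows and preservation of quotients\<close>

text \<open>The inverse 2-arrow supplies the reverse of the inequality that a 2-arrow satisfies on relations, so an
  invertible 2-arrow reindexes relations strictly.\<close>

lemma iso2_RD_D:
  assumes iso: "iso2 RD \<theta>"
  obtains \<psi> where "rd_cell \<theta>" "rd_cell \<psi>" "Sarr \<psi> = Tarr \<theta>" "Tarr \<psi> = Sarr \<theta>"
    "\<And>X. X \<in> Obj (Dom (Sarr \<theta>)) \<Longrightarrow> inverse_arrows (Cod (Sarr \<theta>)) (omap (Sarr \<theta>) X) (omap (Tarr \<theta>) X) (cpt \<theta> X) (cpt \<psi> X)"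
    "\<And>X Y \<alpha>. \<alpha> \<in> Rel (Dom (Sarr \<theta>)) X Y \<Longrightarrow> Reix (Cod (Sarr \<theta>)) (omap (Sarr \<theta>) X) (omap (Sarr \<theta>) Y)
       (omap (Tarr \<theta>) X) (omap (Tarr \<theta>) Y) (cpt \<theta> X) (cpt \<theta> Y) (rmap (Tarr \<theta>) X Y \<alpha>) = rmap (Sarr \<theta>) X Y \<alpha>"
proof -
  interpret RD: two_category RD by (rule two_category_RD)
  obtain \<psi> where p: "rd_cell \<psi>" "Sarr \<psi> = Tarr \<theta>" "Tarr \<psi> = Sarr \<theta>"
    "rd2_vcomp \<psi> \<theta> = rd2_id (Sarr \<theta>)" "rd2_vcomp \<theta> \<psi> = rd2_id (Tarr \<theta>)"
    using iso by (elim RD.iso2E) auto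
  have t [simp]: "rd_cell \<theta>" using RD.iso2_Ce[OF iso] by simp
  note [simp] = p(1-3)
  let ?F = "Sarr \<theta>" and ?G = "Tarr \<theta>" and ?R = "Dom (Sarr \<theta>)" and ?S = "Cod (Sarr \<theta>)"
  interpret S: relational_doctrine ?S by simp
  have inv: "inverse_arrows ?S (omap ?F X) (omap ?G X) (cpt \<theta> X) (cpt \<psi> X)" if [simp]: "X \<in> Obj ?R" for X
    using arg_cong[OF p(4), of "\<lambda>t. cpt t X"] arg_cong[OF p(5), of "\<lambda>t. cpt t X"]
    by (simp add: inverse_arrows_def)
  have "Reix ?S (omap ?F X) (omap ?F Y) (omap ?G X) (omap ?G Y) (cpt \<theta> X) (cpt \<theta> Y) (rmap ?G X Y \<alpha>)
      = rmap ?F X Y \<alpha>" (is "?l = ?r") if a [simp]: "\<alpha> \<in> Rel ?R X Y" for X Y \<alpha>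
  proof (rule S.Leq_antisym)
    have [simp]: "X \<in> Obj ?R" "Y \<in> Obj ?R" using doctrine_RelD[OF _ a] by simp_all
    note [simp] = inverse_arrowsD[OF inv]
    show "?l \<in> Rel ?S (omap ?F X) (omap ?F Y)" "?r \<in> Rel ?S (omap ?F X) (omap ?F Y)" by simp_all
    show "Leq ?S (omap ?F X) (omap ?F Y) ?r ?l" by (rule rd_cell_lax[OF t a refl refl refl refl])
    have "Leq ?S (omap ?G X) (omap ?G Y) (rmap ?G X Y \<alpha>)
        (Reix ?S (omap ?G X) (omap ?G Y) (omap ?F X) (omap ?F Y) (cpt \<psi> X) (cpt \<psi> Y) ?r)"
      by (rule rd_cell_lax[OF p(1)]) simp_all
    then have "Leq ?S (omap ?F X) (omap ?F Y) ?l
       (Reix ?S (omap ?F X) (omap ?F Y) (omap ?G X) (omap ?G Y) (cpt \<theta> X) (cpt \<theta> Y)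
        (Reix ?S (omap ?G X) (omap ?G Y) (omap ?F X) (omap ?F Y) (cpt \<psi> X) (cpt \<psi> Y) ?r))"
      by (intro S.Reix_mono) simp_all
    then show "Leq ?S (omap ?F X) (omap ?F Y) ?l ?r"
      by (simp add: S.Reix_Comp[symmetric])
  qed
  then show ?thesis using that[OF t p(1-3) inv] by blast
qed

text \<open>Naturality of the inverse components is automatic; the hypothesis \<open>le\<close> becomes, after reindexing along
  them, the inequality that a 2-arrow in the other direction needs.\<close>

lemma iso2_RD_I:
  assumes t [simp]: "rd_cell \<theta>"
    and inv: "\<And>X. X \<in> Obj (Dom (Sarr \<theta>))
      \<Longrightarrow> \<exists>j. inverse_arrows (Cod (Sarr \<theta>)) (omap (Sarr \<theta>) X) (omap (Tarr \<theta>) X) (cpt \<theta> X) j"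
    and le: "\<And>X Y \<alpha>. \<alpha> \<in> Rel (Dom (Sarr \<theta>)) X Y \<Longrightarrow> Leq (Cod (Sarr \<theta>)) (omap (Sarr \<theta>) X) (omap (Sarr \<theta>) Y)
       (Reix (Cod (Sarr \<theta>)) (omap (Sarr \<theta>) X) (omap (Sarr \<theta>) Y)
       (omap (Tarr \<theta>) X) (omap (Tarr \<theta>) Y) (cpt \<theta> X) (cpt \<theta> Y) (rmap (Tarr \<theta>) X Y \<alpha>)) (rmap (Sarr \<theta>) X Y \<alpha>)"
  shows "iso2 RD \<theta>"
proof -
  let ?F = "Sarr \<theta>" and ?G = "Tarr \<theta>" and ?R = "Dom (Sarr \<theta>)" and ?S = "Cod (Sarr \<theta>)"
  interpret RD: two_category RD by (rule two_category_RD)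
  interpret S: relational_doctrine ?S by simp
  interpret R: relational_doctrine ?R by simp
  define j where "j X = (SOME j. inverse_arrows ?S (omap ?F X) (omap ?G X) (cpt \<theta> X) j)" for X
  have j: "inverse_arrows ?S (omap ?F X) (omap ?G X) (cpt \<theta> X) (j X)" if "X \<in> Obj ?R" for X
    unfolding j_def by (rule someI_ex[OF inv[OF that]])
  note J [simp] = inverse_arrowsD[OF j]
  define \<psi> where "\<psi> = \<lparr>Sarr = ?G, Tarr = ?F, cpt = (\<lambda>X \<in> Obj ?R. j X)\<rparr>"
  have [simp]: "Sarr \<psi> = ?G" "Tarr \<psi> = ?F" "X \<in> Obj ?R \<Longrightarrow> cpt \<psi> X = j X" for X
    by (simp_all add: \<psi>_def)
  have p [simp]: "rd_cell \<psi>"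
  proof (rule rd_cellI[of ?G ?F ?R ?S])
    fix X Y f assume f [simp]: "f \<in> Hom ?R X Y" and [simp]: "X \<in> Obj ?R" "Y \<in> Obj ?R"
    have "Comp ?S (omap ?G X) (omap ?G Y) (omap ?F Y) (j Y) (amap ?G X Y f)
      = Comp ?S (omap ?G X) (omap ?G Y) (omap ?F Y) (j Y)
         (Comp ?S (omap ?G X) (omap ?F X) (omap ?G Y)
           (Comp ?S (omap ?F X) (omap ?G X) (omap ?G Y) (amap ?G X Y f) (cpt \<theta> X)) (j X))"
      by (simp add: S.Comp_assoc[symmetric])
    also have "Comp ?S (omap ?F X) (omap ?G X) (omap ?G Y) (amap ?G X Y f) (cpt \<theta> X)
       = Comp ?S (omap ?F X) (omap ?F Y) (omap ?G Y) (cpt \<theta> Y) (amap ?F X Y f)"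
      by (rule rd_cell_natural[OF t f refl refl refl refl, symmetric])
    also have "Comp ?S (omap ?G X) (omap ?F X) (omap ?G Y) \<dots> (j X)
       = Comp ?S (omap ?G X) (omap ?F Y) (omap ?G Y) (cpt \<theta> Y) (Comp ?S (omap ?G X) (omap ?F X) (omap ?F Y) (amap ?F X Y f) (j X))"
      by (rule S.Comp_assoc[symmetric]) simp_all
    also have "Comp ?S (omap ?G X) (omap ?G Y) (omap ?F Y) (j Y) \<dots>
       = Comp ?S (omap ?G X) (omap ?F X) (omap ?F Y) (amap ?F X Y f) (j X)"
      by (simp add: S.Comp_assoc)
    finally show "Comp ?S (omap ?G X) (omap ?G Y) (omap ?F Y) (cpt \<psi> Y) (amap ?G X Y f)
       = Comp ?S (omap ?G X) (omap ?F X) (omap ?F Y) (amap ?F X Y f) (cpt \<psi> X)" by simp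
  next
    fix X Y \<alpha> assume a [simp]: "\<alpha> \<in> Rel ?R X Y" and [simp]: "X \<in> Obj ?R" "Y \<in> Obj ?R"
    have "Leq ?S (omap ?G X) (omap ?G Y)
      (Reix ?S (omap ?G X) (omap ?G Y) (omap ?F X) (omap ?F Y) (j X) (j Y)
        (Reix ?S (omap ?F X) (omap ?F Y) (omap ?G X) (omap ?G Y) (cpt \<theta> X) (cpt \<theta> Y) (rmap ?G X Y \<alpha>)))
      (Reix ?S (omap ?G X) (omap ?G Y) (omap ?F X) (omap ?F Y) (j X) (j Y) (rmap ?F X Y \<alpha>))"
      using le[OF a] by (intro S.Reix_mono) simp_all
    then show "Leq ?S (omap ?G X) (omap ?G Y) (rmap ?G X Y \<alpha>)
      (Reix ?S (omap ?G X) (omap ?G Y) (omap ?F X) (omap ?F Y) (cpt \<psi> X) (cpt \<psi> Y) (rmap ?F X Y \<alpha>))"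
      by (simp add: S.Reix_Comp[symmetric])
  qed (simp_all add: \<psi>_def)
  have "rd2_vcomp \<psi> \<theta> = rd2_id ?F" "rd2_vcomp \<theta> \<psi> = rd2_id ?G" by (rule rd2_eqI; simp)+
  then show ?thesis by (intro RD.iso2I[of _ \<psi>]) simp_all
qed

lemma rd_arrow_eqrel:
  assumes F [simp]: "rd_arrow F" and r: "eqrel (Dom F) X \<rho>"
  shows "eqrel (Cod F) (omap F X) (rmap F X X \<rho>)"
proof -
  interpret R: relational_doctrine "Dom F" by simp
  note [simp] = R.eqrelD[OF r]
  have "Leq (Cod F) (omap F X) (omap F X) (rmap F X X (Diag (Dom F) X)) (rmap F X X \<rho>)"
    by (intro rd_arrow_mono) simp_all
  moreover have "Conv (Cod F) (omap F X) (omap F X) (rmap F X X \<rho>) = rmap F X X \<rho>"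
    using rd_arrow.rmap_Conv[OF F R.eqrelD(1)[OF r]] unfolding R.eqrelD(4)[OF r] by (rule sym)
  moreover have "Seq (Cod F) (omap F X) (omap F X) (omap F X) (rmap F X X \<rho>) (rmap F X X \<rho>) = rmap F X X \<rho>"
    using rd_arrow.rmap_Seq[OF F R.eqrelD(1)[OF r] R.eqrelD(1)[OF r]] unfolding R.eqrelD(5)[OF r] by (rule sym)
  ultimately show ?thesis by (simp add: eqrel_def)
qed

lemma rd_arrow_inverse:
  assumes [simp]: "rd_arrow F" and ij: "inverse_arrows (Dom F) X Y i j"
  shows "inverse_arrows (Cod F) (omap F X) (omap F Y) (amap F X Y i) (amap F Y X j)"
proof -
  note I [simp] = inverse_arrowsD[OF ij]
  interpret R: relational_doctrine "Dom F" by simp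
  have [simp]: "X \<in> Obj (Dom F)" "Y \<in> Obj (Dom F)" using R.HomD[OF I(1)] by auto
  have "amap F X X (Comp (Dom F) X Y X j i) = Idn (Cod F) (omap F X)"
    "amap F Y Y (Comp (Dom F) Y X Y i j) = Idn (Cod F) (omap F Y)" by (simp_all add: I(3,4) del: rd_arrow_simps(6))
  then show ?thesis by (simp add: inverse_arrows_def del: I(3,4))
qed

lemma rd_arrow_descent:
  assumes F [simp]: "rd_arrow F" and q [simp]: "q \<in> Hom (Dom F) X W" and d: "descent (Dom F) X W q"
  shows "descent (Cod F) (omap F X) (omap F W) (amap F X W q)"
proof -
  interpret R: relational_doctrine "Dom F" by simp
  have [simp]: "X \<in> Obj (Dom F)" "W \<in> Obj (Dom F)" using R.HomD[OF q] by auto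
  have g: "rmap F X W (graph (Dom F) X W q) = graph (Cod F) (omap F X) (omap F W) (amap F X W q)"
    by (simp add: graph_def)
  have "Leq (Cod F) (omap F W) (omap F W) (rmap F W W (Diag (Dom F) W))
     (rmap F W W (Seq (Dom F) W X W (Conv (Dom F) X W (graph (Dom F) X W q)) (graph (Dom F) X W q)))"
    using d by (intro rd_arrow_mono) (simp_all add: descent_def)
  then show ?thesis by (simp add: descent_def g)
qed

lemma preserves_quotientsD:
  "preserves_quotients F \<Longrightarrow> eqrel (Dom F) X \<rho> \<Longrightarrow> quotient_arrow (Dom F) X \<rho> W q
    \<Longrightarrow> quotient_arrow (Cod F) (omap F X) (rmap F X X \<rho>) (omap F W) (amap F X W q)"
  unfolding preserves_quotients_def by blast

lemma preserves_quotients_id: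
  assumes "relational_doctrine R"
  shows "preserves_quotients (rd1_id R)"
  unfolding preserves_quotients_def
proof (intro allI impI, elim conjE)
  interpret relational_doctrine R by fact
  fix X \<rho> W q assume "eqrel (Dom (rd1_id R)) X \<rho>" "quotient_arrow (Dom (rd1_id R)) X \<rho> W q"
  then have e: "eqrel R X \<rho>" and q: "quotient_arrow R X \<rho> W q" by simp_all
  have "W \<in> Obj R" using HomD[OF quotient_arrowD(1)[OF q]] by simp
  then show "quotient_arrow (Cod (rd1_id R)) (omap (rd1_id R) X) (rmap (rd1_id R) X X \<rho>)
     (omap (rd1_id R) W) (amap (rd1_id R) X W q)"
    using q eqrelD[OF e] quotient_arrowD[OF q] by simp
qed

lemma preserves_quotients_comp:
  assumes F [simp]: "rd_arrow F" "rd_arrow G" and m: "Dom G = Cod F" and P: "preserves_quotients F" "preserves_quotients G"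
  shows "preserves_quotients (rd1_comp G F)"
  unfolding preserves_quotients_def
proof (intro allI impI, elim conjE)
  fix X \<rho> W q assume e: "eqrel (Dom (rd1_comp G F)) X \<rho>" and q: "quotient_arrow (Dom (rd1_comp G F)) X \<rho> W q"
  interpret R: relational_doctrine "Dom F" by simp
  have e: "eqrel (Dom F) X \<rho>" and q: "quotient_arrow (Dom F) X \<rho> W q" using e q by simp_all
  have X: "X \<in> Obj (Dom F)" "\<rho> \<in> Rel (Dom F) X X" "q \<in> Hom (Dom F) X W" "W \<in> Obj (Dom F)"
    using R.eqrelD[OF e] R.quotient_arrowD[OF q] by auto
  have "quotient_arrow (Cod G) (omap G (omap F X)) (rmap G (omap F X) (omap F X) (rmap F X X \<rho>))
     (omap G (omap F W)) (amap G (omap F X) (omap F W) (amap F X W q))"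
    using preserves_quotientsD[OF P(2), of "omap F X" "rmap F X X \<rho>"] preserves_quotientsD[OF P(1) e q]
      rd_arrow_eqrel[OF F(1) e] m by simp
  then show "quotient_arrow (Cod (rd1_comp G F)) (omap (rd1_comp G F) X) (rmap (rd1_comp G F) X X \<rho>)
     (omap (rd1_comp G F) W) (amap (rd1_comp G F) X W q)"
    using X by simp
qed

text \<open>By naturality, \<open>G q\<close> is \<open>F q\<close> composed with an isomorphism on each side, and the isomorphism on the
  domain carries the relation along.\<close>

lemma preserves_quotients_iso:
  assumes iso: "iso2 RD \<theta>" and P: "preserves_quotients (Sarr \<theta>)"
  shows "preserves_quotients (Tarr \<theta>)"
proof -
  let ?F = "Sarr \<theta>" and ?G = "Tarr \<theta>" and ?R = "Dom (Sarr \<theta>)" and ?S = "Cod (Sarr \<theta>)"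
  obtain \<psi> where p: "rd_cell \<theta>" "rd_cell \<psi>" "Sarr \<psi> = Tarr \<theta>" "Tarr \<psi> = Sarr \<theta>"
    "\<And>X. X \<in> Obj ?R \<Longrightarrow> inverse_arrows ?S (omap ?F X) (omap ?G X) (cpt \<theta> X) (cpt \<psi> X)"
    "\<And>X Y \<alpha>. \<alpha> \<in> Rel ?R X Y \<Longrightarrow> Reix ?S (omap ?F X) (omap ?F Y)
       (omap ?G X) (omap ?G Y) (cpt \<theta> X) (cpt \<theta> Y) (rmap ?G X Y \<alpha>) = rmap ?F X Y \<alpha>"
    by (rule iso2_RD_D[OF iso]) blast
  note [simp] = p(1-4)
  interpret S: relational_doctrine ?S by simp
  interpret R: relational_doctrine ?R by simp
  show ?thesis
    unfolding preserves_quotients_def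
  proof (intro allI impI, elim conjE)
    fix X \<rho> W q assume "eqrel (Dom ?G) X \<rho>" "quotient_arrow (Dom ?G) X \<rho> W q"
    then have e: "eqrel ?R X \<rho>" and q: "quotient_arrow ?R X \<rho> W q" by simp_all
    have X [simp]: "X \<in> Obj ?R" "\<rho> \<in> Rel ?R X X" "q \<in> Hom ?R X W" "W \<in> Obj ?R"
      using R.eqrelD[OF e] R.quotient_arrowD[OF q] by auto
    note I = inverse_arrowsD[OF p(5)[of X], OF X(1)] and IW = inverse_arrowsD[OF p(5)[of W], OF X(4)]
    note [simp] = I IW
    have "quotient_arrow ?S (omap ?F X) (rmap ?F X X \<rho>) (omap ?G W)
       (Comp ?S (omap ?F X) (omap ?F W) (omap ?G W) (cpt \<theta> W) (amap ?F X W q))"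
      by (rule S.quotient_Comp_iso[OF preserves_quotientsD[OF P e q] _ p(5)]) simp_all
    then have "quotient_arrow ?S (omap ?F X) (rmap ?F X X \<rho>) (omap ?G W)
       (Comp ?S (omap ?F X) (omap ?G X) (omap ?G W) (amap ?G X W q) (cpt \<theta> X))"
      using rd_cell_natural[OF p(1) X(3) refl refl refl refl] by simp
    then have "quotient_arrow ?S (omap ?G X) (Reix ?S (omap ?G X) (omap ?G X) (omap ?F X) (omap ?F X) (cpt \<psi> X) (cpt \<psi> X)
         (rmap ?F X X \<rho>)) (omap ?G W)
       (Comp ?S (omap ?G X) (omap ?F X) (omap ?G W)
          (Comp ?S (omap ?F X) (omap ?G X) (omap ?G W) (amap ?G X W q) (cpt \<theta> X)) (cpt \<psi> X))"
      by (rule S.iso_quotient_Comp[OF _ _ inverse_arrows_sym[OF p(5)]]) simp_all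
    moreover have "Comp ?S (omap ?G X) (omap ?F X) (omap ?G W)
          (Comp ?S (omap ?F X) (omap ?G X) (omap ?G W) (amap ?G X W q) (cpt \<theta> X)) (cpt \<psi> X) = amap ?G X W q"
      by (simp add: S.Comp_assoc[symmetric])
    moreover have "Reix ?S (omap ?G X) (omap ?G X) (omap ?F X) (omap ?F X) (cpt \<psi> X) (cpt \<psi> X) (rmap ?F X X \<rho>) = rmap ?G X X \<rho>"
      by (subst p(6)[symmetric]) (simp_all add: S.Reix_Comp[symmetric])
    ultimately show "quotient_arrow (Cod ?G) (omap ?G X) (rmap ?G X X \<rho>) (omap ?G W) (amap ?G X W q)" by simp
  qed
qed

definition EQobs :: "('o, 'a, 'r) doctrine set" where
  "EQobs = {R. relational_doctrine R \<and> has_quotients R \<and> extensional_doctrine R}"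

definition EQars :: "('o, 'a, 'r) rd1 set" where
  "EQars = {F. rd_arrow F \<and> Dom F \<in> EQobs \<and> Cod F \<in> EQobs \<and> preserves_quotients F}"

lemma EQobsD: "R \<in> EQobs \<Longrightarrow> relational_doctrine R" "R \<in> EQobs \<Longrightarrow> has_quotients R"
    "R \<in> EQobs \<Longrightarrow> extensional_doctrine R"
  by (simp_all add: EQobs_def)

lemma EQarsD: "F \<in> EQars \<Longrightarrow> rd_arrow F" "F \<in> EQars \<Longrightarrow> Dom F \<in> EQobs" "F \<in> EQars \<Longrightarrow> Cod F \<in> EQobs"
    "F \<in> EQars \<Longrightarrow> preserves_quotients F"
  by (simp_all add: EQars_def)

lemma EQRD_full_sub: "EQRD = full_sub RD EQobs EQars"
  unfolding EQRD_def QRD_def full_sub_def EQars_def EQobs_def by (rule twocat.equality) auto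

lemma sub_two_category_EQRD: "sub_two_category RD EQobs EQars"
proof -
  interpret RD: two_category RD by (rule two_category_RD)
  show ?thesis
    by unfold_locales (auto simp: EQars_def EQobs_def preserves_quotients_id preserves_quotients_comp)
qed

lemma EQars_replete: "iso2 RD \<theta> \<Longrightarrow> Sarr \<theta> \<in> EQars \<Longrightarrow> Tarr \<theta> \<in> EQars"
  by (auto simp: EQars_def preserves_quotients_iso elim: iso2_RD_D)

section \<open>The extensional collapse\<close>

context relational_doctrine
begin

lemma cls:
  assumes f: "f \<in> Hom R X Y"
  shows cls_Hom [simp]: "cls R X Y f \<in> Hom R X Y" and approx_cls: "approx R X Y f (cls R X Y f)"
proof -
  have "\<exists>g. g \<in> {g \<in> Hom R X Y. approx R X Y f g}" using f approx_refl[OF f] by blast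
  from someI_ex[OF this] show "cls R X Y f \<in> Hom R X Y" "approx R X Y f (cls R X Y f)"
    unfolding cls_def by simp_all
qed

lemma cls_approx: "f \<in> Hom R X Y \<Longrightarrow> approx R X Y (cls R X Y f) f"
  by (rule approx_sym) (simp_all add: approx_cls)

lemma cls_eqI:
  assumes "f \<in> Hom R X Y" "g \<in> Hom R X Y" "approx R X Y f g"
  shows "cls R X Y f = cls R X Y g"
proof -
  have "{h \<in> Hom R X Y. approx R X Y f h} = {h \<in> Hom R X Y. approx R X Y g h}"
    using assms by (blast intro: approx_sym approx_trans)
  then show ?thesis by (simp add: cls_def)
qed

lemma cls_eq_iff: "f \<in> Hom R X Y \<Longrightarrow> g \<in> Hom R X Y \<Longrightarrow> cls R X Y f = cls R X Y g \<longleftrightarrow> approx R X Y f g"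
  using cls_eqI approx_cls cls_approx approx_trans by (metis cls_Hom)

lemma cls_cls [simp]: "f \<in> Hom R X Y \<Longrightarrow> cls R X Y (cls R X Y f) = cls R X Y f"
  by (rule cls_eqI) (simp_all add: cls_approx)

lemma Reix_cls [simp]: "f \<in> Hom R X A \<Longrightarrow> g \<in> Hom R Y B \<Longrightarrow> \<alpha> \<in> Rel R A B
    \<Longrightarrow> Reix R X Y A B (cls R X A f) (cls R Y B g) \<alpha> = Reix R X Y A B f g \<alpha>"
  by (rule Reix_approx) (simp_all add: cls_approx)

lemma cls_Comp_cls [simp]:
  assumes "f \<in> Hom R X Y" "g \<in> Hom R Y Z"
  shows "cls R X Z (Comp R X Y Z (cls R Y Z g) (cls R X Y f)) = cls R X Z (Comp R X Y Z g f)"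
    "cls R X Z (Comp R X Y Z (cls R Y Z g) f) = cls R X Z (Comp R X Y Z g f)"
    "cls R X Z (Comp R X Y Z g (cls R X Y f)) = cls R X Z (Comp R X Y Z g f)"
  by (rule cls_eqI; insert assms; simp add: approx_Comp cls_approx approx_refl)+

lemma E0_Hom: "f \<in> Hom (E0 R) X Y \<longleftrightarrow> f \<in> Hom R X Y \<and> cls R X Y f = f"
  by (auto simp: E0_def) (metis image_eqI)

end

lemma E0_simps [simp]: "Obj (E0 R) = Obj R" "Idn (E0 R) X = cls R X X (Idn R X)"
  "Comp (E0 R) X Y Z g f = cls R X Z (Comp R X Y Z g f)" "Rel (E0 R) = Rel R" "Leq (E0 R) = Leq R"
  "Reix (E0 R) = Reix R" "Diag (E0 R) = Diag R" "Seq (E0 R) = Seq R" "Conv (E0 R) = Conv R"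
  by (simp_all add: E0_def)

lemma approx_E0 [simp]: "approx (E0 R) = approx R"
  by (simp add: approx_def fun_eq_iff)

lemmas cls_simps [simp] = relational_doctrine.cls_Hom relational_doctrine.cls_cls relational_doctrine.Reix_cls
  relational_doctrine.cls_Comp_cls

lemma cls_E0 [simp]: "relational_doctrine R \<Longrightarrow> f \<in> Hom R X Y \<Longrightarrow> cls R X Y f \<in> Hom (E0 R) X Y"
  by (simp add: relational_doctrine.E0_Hom)

lemma Hom_E0_D: "relational_doctrine R \<Longrightarrow> f \<in> Hom (E0 R) X Y \<Longrightarrow> f \<in> Hom R X Y"
    "relational_doctrine R \<Longrightarrow> f \<in> Hom (E0 R) X Y \<Longrightarrow> cls R X Y f = f"
  by (simp_all add: relational_doctrine.E0_Hom)

lemma Hom_E0_Obj: "relational_doctrine R \<Longrightarrow> f \<in> Hom (E0 R) X Y \<Longrightarrow> X \<in> Obj R"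
    "relational_doctrine R \<Longrightarrow> f \<in> Hom (E0 R) X Y \<Longrightarrow> Y \<in> Obj R"
  by (auto dest: Hom_E0_D doctrine_HomD)

lemma doctrine_E0 [simp]:
  assumes "relational_doctrine R"
  shows "relational_doctrine (E0 R)"
proof -
  interpret relational_doctrine R by fact
  have ci: "cls R X Y (Comp R X X Y f (cls R X X (Idn R X))) = cls R X Y f"
     "cls R X Y (Comp R X Y Y (cls R Y Y (Idn R Y)) f) = cls R X Y f" if "f \<in> Hom R X Y" for f X Y
    using that HomD[OF that] by simp_all
  have rc: "Reix R X Y A B (cls R X A f) (cls R Y B g) \<alpha> = Reix R X Y A B f g \<alpha>"
    if "f \<in> Hom R X A" "g \<in> Hom R Y B" "\<alpha> \<in> Rel R A B" for f g X Y A B \<alpha> using that by simp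
  have ri: "Reix R X Y X Y (cls R X X (Idn R X)) (cls R Y Y (Idn R Y)) \<alpha> = \<alpha>" if "\<alpha> \<in> Rel R X Y" for X Y \<alpha>
    using that RelD[OF that] by simp
  show ?thesis
    by unfold_locales
      (auto simp: E0_Hom ci ri Comp_assoc Reix_mono Reix_Comp Diag_lax Seq_mono Seq_lax Conv_mono Conv_lax
        Seq_assoc Conv_Seq Leq_refl intro: Leq_trans Leq_antisym)
qed

lemma extensional_E0: "relational_doctrine R \<Longrightarrow> extensional_doctrine (E0 R)"
  unfolding extensional_doctrine_def by (auto simp: relational_doctrine.E0_Hom) (metis relational_doctrine.cls_eqI)

lemma E1_simps [simp]: "Dom (E1 F) = E0 (Dom F)" "Cod (E1 F) = E0 (Cod F)" "omap (E1 F) = omap F" "rmap (E1 F) = rmap F"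
  "f \<in> Hom (E0 (Dom F)) X Y \<Longrightarrow> amap (E1 F) X Y f = cls (Cod F) (omap F X) (omap F Y) (amap F X Y f)"
  by (simp_all add: E1_def)

text \<open>The relation \<open>\<approx>\<close> is defined from equality, reindexing and order, all of which 1-arrows preserve.\<close>

lemma rd_arrow_approx:
  assumes [simp]: "rd_arrow F" and f: "f \<in> Hom (Dom F) X Y" "g \<in> Hom (Dom F) X Y" and a: "approx (Dom F) X Y f g"
  shows "approx (Cod F) (omap F X) (omap F Y) (amap F X Y f) (amap F X Y g)"
proof -
  interpret R: relational_doctrine "Dom F" by simp
  have [simp]: "X \<in> Obj (Dom F)" "Y \<in> Obj (Dom F)" using f by auto
  have "Leq (Cod F) (omap F X) (omap F X) (rmap F X X (Diag (Dom F) X)) (rmap F X X (Reix (Dom F) X X Y Y f g (Diag (Dom F) Y)))"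
    using f a by (intro rd_arrow_mono) (simp_all add: approx_def)
  then show ?thesis using f by (simp add: approx_def)
qed

lemma cls_amap_cls [simp]:
  assumes [simp]: "rd_arrow F" "Dom F = R" "Cod F = S" "A = omap F X" "B = omap F Y" and f [simp]: "f \<in> Hom R X Y"
  shows "cls S A B (amap F X Y (cls R X Y f)) = cls S A B (amap F X Y f)"
proof -
  interpret R: relational_doctrine R using rd_arrow_doctrine[of F] by simp
  interpret S: relational_doctrine S using rd_arrow_doctrine[of F] by simp
  show ?thesis
    using rd_arrow_approx[of F "cls R X Y f" X Y f] R.cls_approx[OF f] by (intro S.cls_eqI) simp_all
qed

lemma rd_arrow_E1 [simp]:
  assumes [simp]: "rd_arrow F"
  shows "rd_arrow (E1 F)"
proof -
  interpret R: relational_doctrine "Dom F" by simp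
  interpret S: relational_doctrine "Cod F" by simp
  show ?thesis
    unfolding rd_arrow_def rd_arrow_axioms_def
    by (auto simp: R.E0_Hom rd_arrow_mono S.cls_cls rd_arrow.omap_ext rd_arrow.rmap_ext) (auto simp: E1_def)
qed

lemma E2_simps [simp]: "Sarr (E2 \<theta>) = E1 (Sarr \<theta>)" "Tarr (E2 \<theta>) = E1 (Tarr \<theta>)"
  "X \<in> Obj (Dom (Sarr \<theta>)) \<Longrightarrow> cpt (E2 \<theta>) X = cls (Cod (Sarr \<theta>)) (omap (Sarr \<theta>) X) (omap (Tarr \<theta>) X) (cpt \<theta> X)"
  by (simp_all add: E2_def)

lemma rd_cell_E2 [simp]:
  assumes t [simp]: "rd_cell \<theta>"
  shows "rd_cell (E2 \<theta>)"
proof -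
  let ?F = "Sarr \<theta>" and ?G = "Tarr \<theta>" and ?R = "Dom (Sarr \<theta>)" and ?S = "Cod (Sarr \<theta>)"
  interpret R: relational_doctrine ?R by simp
  interpret S: relational_doctrine ?S by simp
  show ?thesis
  proof (rule rd_cellI[of "E1 ?F" "E1 ?G" "E0 ?R" "E0 ?S"])
    fix X Y f assume "f \<in> Hom (E0 ?R) X Y" "X \<in> Obj (E0 ?R)" "Y \<in> Obj (E0 ?R)"
    then have [simp]: "f \<in> Hom (E0 ?R) X Y" "f \<in> Hom ?R X Y" "X \<in> Obj ?R" "Y \<in> Obj ?R" by (simp_all add: R.E0_Hom)
    show "Comp (E0 ?S) (omap (E1 ?F) X) (omap (E1 ?F) Y) (omap (E1 ?G) Y) (cpt (E2 \<theta>) Y) (amap (E1 ?F) X Y f) =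
       Comp (E0 ?S) (omap (E1 ?F) X) (omap (E1 ?G) X) (omap (E1 ?G) Y) (amap (E1 ?G) X Y f) (cpt (E2 \<theta>) X)"
      using rd_cell_natural[OF t _ refl refl refl refl, of f X Y] by simp
  next
    fix X Y \<alpha> assume "\<alpha> \<in> Rel (E0 ?R) X Y" "X \<in> Obj (E0 ?R)" "Y \<in> Obj (E0 ?R)"
    then have [simp]: "\<alpha> \<in> Rel ?R X Y" "X \<in> Obj ?R" "Y \<in> Obj ?R" by simp_all
    show "Leq (E0 ?S) (omap (E1 ?F) X) (omap (E1 ?F) Y) (rmap (E1 ?F) X Y \<alpha>)
        (Reix (E0 ?S) (omap (E1 ?F) X) (omap (E1 ?F) Y) (omap (E1 ?G) X) (omap (E1 ?G) Y)
          (cpt (E2 \<theta>) X) (cpt (E2 \<theta>) Y) (rmap (E1 ?G) X Y \<alpha>))"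
      using rd_cell_lax[OF t _ refl refl refl refl, of \<alpha> X Y] by simp
  qed (simp_all add: E2_def)
qed

lemma two_functor_Ef: "two_functor RD RD Ef"
proof -
  interpret RD: two_category RD by (rule two_category_RD)
  have 1: "E1 (rd1_id R) = rd1_id (E0 R)" if "relational_doctrine R" for R
  proof (rule rd1_eqI)
    fix X Y f assume "f \<in> Hom (Dom (E1 (rd1_id R))) X Y"
    then have "f \<in> Hom (E0 R) X Y" "f \<in> Hom R X Y" "cls R X Y f = f" "X \<in> Obj R" "Y \<in> Obj R"
      using that by (auto simp: Hom_E0_D dest: Hom_E0_D doctrine_HomD)
    then show "amap (E1 (rd1_id R)) X Y f = amap (rd1_id (E0 R)) X Y f" using that by simp
  qed (use that in simp_all)
  have 2: "E1 (rd1_comp G F) = rd1_comp (E1 G) (E1 F)" if [simp]: "rd_arrow F" "rd_arrow G" "Dom G = Cod F" for F G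
    by (rule rd1_eqI) (simp_all add: doctrine_RelD Hom_E0_D Hom_E0_Obj)
  have 3: "E2 (rd2_id F) = rd2_id (E1 F)" if [simp]: "rd_arrow F" for F
    by (rule rd2_eqI) simp_all
  have 4: "E2 (rd2_vcomp \<phi> \<theta>) = rd2_vcomp (E2 \<phi>) (E2 \<theta>)"
    if [simp]: "rd_cell \<theta>" "rd_cell \<phi>" "Sarr \<phi> = Tarr \<theta>" for \<theta> \<phi>
  proof (rule rd2_eqI)
    have [simp]: "Dom (Tarr \<phi>) = Dom (Sarr \<theta>)" "Cod (Tarr \<phi>) = Cod (Sarr \<theta>)"
      using rd_cell_simps(1,2)[of \<phi>] by (simp_all del: rd_cell_simps(1,2), simp_all)
    fix X assume "X \<in> Obj (Dom (Sarr (E2 (rd2_vcomp \<phi> \<theta>))))"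
    then have [simp]: "X \<in> Obj (Dom (Sarr \<theta>))" by simp
    have "cpt \<phi> X \<in> Hom (Cod (Sarr \<theta>)) (omap (Tarr \<theta>) X) (omap (Tarr \<phi>) X)" by simp
    then show "cpt (E2 (rd2_vcomp \<phi> \<theta>)) X = cpt (rd2_vcomp (E2 \<phi>) (E2 \<theta>)) X" by simp
  qed simp_all
  have 5: "E2 (rd2_hcomp \<phi> \<theta>) = rd2_hcomp (E2 \<phi>) (E2 \<theta>)"
    if [simp]: "rd_cell \<theta>" "rd_cell \<phi>" "Dom (Sarr \<phi>) = Cod (Sarr \<theta>)" for \<theta> \<phi>
    by (rule rd2_eqI) (simp_all add: 2)
  show ?thesis
    by unfold_locales (auto simp: hom1_def hom2_def Ef_def 1 2 3 4 5)
qed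

section \<open>The intensional quotient completion\<close>

locale pairing =
  fixes pr :: "'o \<times> 'r \<Rightarrow> 'o"
  assumes inj_pr: "inj pr"
begin

lemma ob_pr [simp]: "ob pr (pr (X, \<rho>)) = X" and eqv_pr [simp]: "eqv pr (pr (X, \<rho>)) = \<rho>"
  using inj_pr by (simp_all add: ob_def eqv_def)

lemma pr_qObj [simp]:
  "relational_doctrine R \<Longrightarrow> pr (X, \<rho>) \<in> qObj pr R \<longleftrightarrow> eqrel R X \<rho>"
  using inj_pr by (auto simp: qObj_def dest: injD relational_doctrine.eqrelD)

lemma qObjD:
  assumes "P \<in> qObj pr R"
  shows "ob pr P \<in> Obj R" "eqrel R (ob pr P) (eqv pr P)" "pr (ob pr P, eqv pr P) = P"
  using assms by (auto simp: qObj_def)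

end

lemma Q0_simps [simp]: "Obj (Q0 pr R) = qObj pr R" "Idn (Q0 pr R) P = Idn R (ob pr P)"
  "Comp (Q0 pr R) P Q S = Comp R (ob pr P) (ob pr Q) (ob pr S)" "Leq (Q0 pr R) P Q = Leq R (ob pr P) (ob pr Q)"
  "Reix (Q0 pr R) P Q A B = Reix R (ob pr P) (ob pr Q) (ob pr A) (ob pr B)" "Diag (Q0 pr R) P = eqv pr P"
  "Seq (Q0 pr R) P Q S = Seq R (ob pr P) (ob pr Q) (ob pr S)" "Conv (Q0 pr R) P Q = Conv R (ob pr P) (ob pr Q)"
  by (simp_all add: Q0_def)

lemma Q0_Hom: "f \<in> Hom (Q0 pr R) P Q \<longleftrightarrow> f \<in> Hom R (ob pr P) (ob pr Q) \<and> P \<in> qObj pr R \<and> Q \<in> qObj pr R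
    \<and> Leq R (ob pr P) (ob pr P) (eqv pr P) (Reix R (ob pr P) (ob pr P) (ob pr Q) (ob pr Q) f f (eqv pr Q))"
  by (simp add: Q0_def)

context relational_doctrine
begin

lemma le_trans:
  "Leq R X Y \<alpha> \<beta> \<Longrightarrow> Leq R X Y \<beta> \<gamma> \<Longrightarrow> \<alpha> \<in> Rel R X Y \<Longrightarrow> \<beta> \<in> Rel R X Y \<Longrightarrow> \<gamma> \<in> Rel R X Y \<Longrightarrow> Leq R X Y \<alpha> \<gamma>"
  by (rule Leq_trans)

lemma eqrel_absorb:
  assumes e: "eqrel R X \<rho>" and a [simp]: "\<alpha> \<in> Rel R X Y" and le: "Leq R X Y (Seq R X X Y \<rho> \<alpha>) \<alpha>"
  shows "Seq R X X Y \<rho> \<alpha> = \<alpha>"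
proof (rule Leq_antisym[OF _ _ le])
  show "Leq R X Y \<alpha> (Seq R X X Y \<rho> \<alpha>)"
    using Seq_mono[of "Diag R X" X X \<rho> \<alpha> Y \<alpha>] eqrelD[OF e] by (simp add: Leq_refl)
qed (use eqrelD[OF e] in simp_all)

lemma absorb_eqrel:
  assumes e: "eqrel R Y \<sigma>" and a [simp]: "\<alpha> \<in> Rel R X Y" and le: "Leq R X Y (Seq R X Y Y \<alpha> \<sigma>) \<alpha>"
  shows "Seq R X Y Y \<alpha> \<sigma> = \<alpha>"
proof (rule Leq_antisym[OF _ _ le])
  show "Leq R X Y \<alpha> (Seq R X Y Y \<alpha> \<sigma>)"
    using Seq_mono[of \<alpha> X Y \<alpha> "Diag R Y" Y \<sigma>] eqrelD[OF e] by (simp add: Leq_refl)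
qed (use eqrelD[OF e] in simp_all)

end

context pairing
begin

text \<open>Being closed under \<open>\<rho>\<^sup>\<bottom> ; _ ; \<sigma>\<close> amounts to absorbing \<open>\<rho>\<close> and \<open>\<sigma>\<close> separately, because both contain equality.
  In this equational form \<open>\<rho>\<close> is visibly the unit of composition at \<open>(X, \<rho>)\<close>.\<close>

lemma Q0_Rel:
  assumes "relational_doctrine R"
  shows "\<alpha> \<in> Rel (Q0 pr R) P Q \<longleftrightarrow> \<alpha> \<in> Rel R (ob pr P) (ob pr Q) \<and> P \<in> qObj pr R \<and> Q \<in> qObj pr R
    \<and> Seq R (ob pr P) (ob pr P) (ob pr Q) (eqv pr P) \<alpha> = \<alpha>
    \<and> Seq R (ob pr P) (ob pr Q) (ob pr Q) \<alpha> (eqv pr Q) = \<alpha>" (is "?l = ?r")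
proof
  interpret relational_doctrine R by fact
  let ?X = "ob pr P" and ?Y = "ob pr Q" and ?p = "eqv pr P" and ?s = "eqv pr Q"
  assume ?l
  then have a [simp]: "\<alpha> \<in> Rel R ?X ?Y" and P: "P \<in> qObj pr R" "Q \<in> qObj pr R"
    and le: "Leq R ?X ?Y (Seq R ?X ?Y ?Y (Seq R ?X ?X ?Y (Conv R ?X ?X ?p) \<alpha>) ?s) \<alpha>" by (auto simp: Q0_def)
  note e = qObjD(2)[OF P(1)] qObjD(2)[OF P(2)]
  note E [simp] = eqrelD[OF e(1)] eqrelD[OF e(2)]
  have le': "Leq R ?X ?Y (Seq R ?X ?Y ?Y (Seq R ?X ?X ?Y ?p \<alpha>) ?s) \<alpha>" using le by simp
  have "Leq R ?X ?Y (Seq R ?X ?X ?Y ?p \<alpha>) (Seq R ?X ?Y ?Y (Seq R ?X ?X ?Y ?p \<alpha>) ?s)"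
    using Seq_mono[of "Seq R ?X ?X ?Y ?p \<alpha>" ?X ?Y "Seq R ?X ?X ?Y ?p \<alpha>" "Diag R ?Y" ?Y ?s] by (simp add: Leq_refl)
  from le_trans[OF this le'] have 1: "Leq R ?X ?Y (Seq R ?X ?X ?Y ?p \<alpha>) \<alpha>" by simp
  have "Leq R ?X ?Y (Seq R ?X ?Y ?Y \<alpha> ?s) (Seq R ?X ?Y ?Y (Seq R ?X ?X ?Y ?p \<alpha>) ?s)"
    using Seq_mono[of "Diag R ?X" ?X ?X ?p \<alpha> ?Y \<alpha>] by (intro Seq_mono) (simp_all add: Leq_refl)
  from le_trans[OF this le'] have 2: "Leq R ?X ?Y (Seq R ?X ?Y ?Y \<alpha> ?s) \<alpha>" by simp
  show ?r using eqrel_absorb[OF e(1) a 1] absorb_eqrel[OF e(2) a 2] a P by simp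
next
  let ?X = "ob pr P" and ?Y = "ob pr Q"
  assume r: ?r
  then have "eqrel R ?X (eqv pr P)" using qObjD(2)[of P R] by simp
  from relational_doctrine.eqrelD[OF assms this] relational_doctrine.Leq_refl[OF assms] r show ?l by (simp add: Q0_def)
qed

text \<open>The operations are those of \<open>R\<close>, so apart from the units the work is in their typing: composites, converses and
  reindexings of relations that absorb the equivalence relations absorb them again.\<close>

lemma doctrine_Q0 [simp]:
  assumes "relational_doctrine R"
  shows "relational_doctrine (Q0 pr R)"
proof -
  interpret relational_doctrine R by fact
  have E: "eqv pr P \<in> Rel R (ob pr P) (ob pr P)" "ob pr P \<in> Obj R" "eqrel R (ob pr P) (eqv pr P)"
    "Leq R (ob pr P) (ob pr P) (Diag R (ob pr P)) (eqv pr P)" "Conv R (ob pr P) (ob pr P) (eqv pr P) = eqv pr P"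
    "Seq R (ob pr P) (ob pr P) (ob pr P) (eqv pr P) (eqv pr P) = eqv pr P" if "P \<in> qObj pr R" for P
    using qObjD[OF that] eqrelD[OF qObjD(2)[OF that]] by simp_all
  have Comp_Q: "Comp R (ob pr P) (ob pr Q) (ob pr S) g f \<in> Hom (Q0 pr R) P S"
    if f: "f \<in> Hom (Q0 pr R) P Q" and g: "g \<in> Hom (Q0 pr R) Q S" for P Q S f g
  proof -
    let ?l = "Reix R (ob pr P) (ob pr P) (ob pr Q) (ob pr Q) f f"
    have "Leq R (ob pr P) (ob pr P) (?l (eqv pr Q)) (?l (Reix R (ob pr Q) (ob pr Q) (ob pr S) (ob pr S) g g (eqv pr S)))"
      using f g by (intro Reix_mono) (simp_all add: Q0_Hom E)
    then have "Leq R (ob pr P) (ob pr P) (eqv pr P) (?l (Reix R (ob pr Q) (ob pr Q) (ob pr S) (ob pr S) g g (eqv pr S)))"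
      using f g by (rule_tac le_trans[of _ _ _ "?l (eqv pr Q)"]) (simp_all add: Q0_Hom E)
    then show ?thesis using f g by (simp add: Q0_Hom E Reix_Comp)
  qed
  have Reix_Q: "Reix R (ob pr P) (ob pr Q) (ob pr A) (ob pr B) f g \<alpha> \<in> Rel (Q0 pr R) P Q"
    if f: "f \<in> Hom (Q0 pr R) P A" and g: "g \<in> Hom (Q0 pr R) Q B" and a: "\<alpha> \<in> Rel (Q0 pr R) A B" for f g \<alpha> P Q A B
  proof -
    let ?X = "ob pr P" and ?Y = "ob pr Q" and ?A = "ob pr A" and ?B = "ob pr B"
    have q: "P \<in> qObj pr R" "Q \<in> qObj pr R" "A \<in> qObj pr R" "B \<in> qObj pr R"
      and [simp]: "f \<in> Hom R ?X ?A" "g \<in> Hom R ?Y ?B" "\<alpha> \<in> Rel R ?A ?B" using f g a by (auto simp: Q0_Hom Q0_Rel[OF assms])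
    note [simp] = q E(1,2)[OF q(1)] E(1,2)[OF q(2)] E(1,2)[OF q(3)] E(1,2)[OF q(4)]
    let ?r = "Reix R ?X ?Y ?A ?B f g \<alpha>"
    have "Leq R ?X ?Y (Seq R ?X ?X ?Y (eqv pr P) ?r) (Seq R ?X ?X ?Y (Reix R ?X ?X ?A ?A f f (eqv pr A)) ?r)"
      using f by (intro Seq_mono) (simp_all add: Leq_refl Q0_Hom)
    moreover have "Leq R ?X ?Y (Seq R ?X ?X ?Y (Reix R ?X ?X ?A ?A f f (eqv pr A)) ?r) ?r"
      using Seq_lax[of f ?X ?A f ?X ?A g ?Y ?B "eqv pr A" \<alpha>] a by (simp add: Q0_Rel[OF assms])
    ultimately have 1: "Leq R ?X ?Y (Seq R ?X ?X ?Y (eqv pr P) ?r) ?r" by (rule le_trans) simp_all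
    have "Leq R ?X ?Y (Seq R ?X ?Y ?Y ?r (eqv pr Q)) (Seq R ?X ?Y ?Y ?r (Reix R ?Y ?Y ?B ?B g g (eqv pr B)))"
      using g by (intro Seq_mono) (simp_all add: Leq_refl Q0_Hom)
    moreover have "Leq R ?X ?Y (Seq R ?X ?Y ?Y ?r (Reix R ?Y ?Y ?B ?B g g (eqv pr B))) ?r"
      using Seq_lax[of f ?X ?A g ?Y ?B g ?Y ?B \<alpha> "eqv pr B"] a by (simp add: Q0_Rel[OF assms])
    ultimately have 2: "Leq R ?X ?Y (Seq R ?X ?Y ?Y ?r (eqv pr Q)) ?r" by (rule le_trans) simp_all
    show ?thesis
      using eqrel_absorb[OF E(3)[OF q(1)] _ 1] absorb_eqrel[OF E(3)[OF q(2)] _ 2] by (simp add: Q0_Rel[OF assms])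
  qed
  have Conv_Q: "Conv R (ob pr P) (ob pr Q) \<alpha> \<in> Rel (Q0 pr R) Q P" if a: "\<alpha> \<in> Rel (Q0 pr R) P Q" for P Q \<alpha>
  proof -
    let ?X = "ob pr P" and ?Y = "ob pr Q"
    have q: "P \<in> qObj pr R" "Q \<in> qObj pr R" and [simp]: "\<alpha> \<in> Rel R ?X ?Y"
      and s: "Seq R ?X ?X ?Y (eqv pr P) \<alpha> = \<alpha>" "Seq R ?X ?Y ?Y \<alpha> (eqv pr Q) = \<alpha>" using a by (auto simp: Q0_Rel[OF assms])
    show ?thesis
      using Conv_Seq[of "eqv pr P" ?X ?X \<alpha> ?Y] Conv_Seq[of \<alpha> ?X ?Y "eqv pr Q" ?Y] E[OF q(1)] E[OF q(2)] q s
      by (simp add: Q0_Rel[OF assms])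
  qed
  have Seq_Q: "Seq R (ob pr P) (ob pr Q) (ob pr S) \<alpha> \<beta> \<in> Rel (Q0 pr R) P S"
    if "\<alpha> \<in> Rel (Q0 pr R) P Q" "\<beta> \<in> Rel (Q0 pr R) Q S" for P Q S \<alpha> \<beta>
    using that E by (auto simp: Q0_Rel[OF assms] Seq_assoc) (simp add: Seq_assoc[symmetric])
  have H: "f \<in> Hom R (ob pr P) (ob pr Q)" "P \<in> qObj pr R" "Q \<in> qObj pr R"
    "Leq R (ob pr P) (ob pr P) (eqv pr P) (Reix R (ob pr P) (ob pr P) (ob pr Q) (ob pr Q) f f (eqv pr Q))"
    if "f \<in> Hom (Q0 pr R) P Q" for f P Q using that by (simp_all add: Q0_Hom)
  have L: "\<alpha> \<in> Rel R (ob pr P) (ob pr Q)" "P \<in> qObj pr R" "Q \<in> qObj pr R"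
    "Seq R (ob pr P) (ob pr P) (ob pr Q) (eqv pr P) \<alpha> = \<alpha>" "Seq R (ob pr P) (ob pr Q) (ob pr Q) \<alpha> (eqv pr Q) = \<alpha>"
    if "\<alpha> \<in> Rel (Q0 pr R) P Q" for \<alpha> P Q using that by (simp_all add: Q0_Rel[OF assms])
  have I: "Idn R (ob pr P) \<in> Hom (Q0 pr R) P P" "eqv pr P \<in> Rel (Q0 pr R) P P" if "P \<in> qObj pr R" for P
    using that E[OF that] by (simp_all add: Q0_Hom Q0_Rel[OF assms] Leq_refl)
  show ?thesis
    by unfold_locales
      (auto simp: I Comp_Q Reix_Q Conv_Q Seq_Q E Leq_refl Seq_assoc
        dest: H L intro: Leq_trans[OF L(1) L(1) L(1)] Leq_antisym[OF L(1) L(1)] Comp_assoc[OF H(1) H(1) H(1)]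
        Reix_mono[OF H(1) H(1) L(1) L(1)] Reix_Comp[OF H(1) H(1) H(1) H(1) L(1)]
        Seq_mono[OF L(1) L(1) L(1) L(1)] Seq_lax[OF H(1) H(1) H(1) L(1) L(1)] Conv_mono[OF L(1) L(1)]
        Conv_lax[OF H(1) H(1) L(1)] Seq_assoc[OF L(1) L(1) L(1)] Conv_Seq[OF L(1) L(1)])
qed

lemmas Q0_typing = relational_doctrine.typing[OF doctrine_Q0, unfolded Q0_simps]

lemma Q0_HomD:
  assumes "f \<in> Hom (Q0 pr R) P Q"
  shows "f \<in> Hom R (ob pr P) (ob pr Q)" "P \<in> qObj pr R" "Q \<in> qObj pr R"
    "Leq R (ob pr P) (ob pr P) (eqv pr P) (Reix R (ob pr P) (ob pr P) (ob pr Q) (ob pr Q) f f (eqv pr Q))"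
  using assms by (simp_all add: Q0_Hom)

lemma Q0_RelD:
  assumes "relational_doctrine R" "\<alpha> \<in> Rel (Q0 pr R) P Q"
  shows "\<alpha> \<in> Rel R (ob pr P) (ob pr Q)" "P \<in> qObj pr R" "Q \<in> qObj pr R"
  using assms by (simp_all add: Q0_Rel)

text \<open>Absorbing \<open>\<rho>\<close> is no extra condition on an equivalence relation \<open>\<sigma>\<close> above \<open>\<rho>\<close>, as \<open>\<rho> ; \<sigma> \<le> \<sigma> ; \<sigma> \<le> \<sigma>\<close>.\<close>

lemma Q0_eqrel:
  assumes "relational_doctrine R"
  shows "eqrel (Q0 pr R) P \<sigma> \<longleftrightarrow> P \<in> qObj pr R \<and> eqrel R (ob pr P) \<sigma> \<and> Leq R (ob pr P) (ob pr P) (eqv pr P) \<sigma>"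
    (is "?l = ?r")
proof
  interpret relational_doctrine R by fact
  let ?X = "ob pr P"
  { assume l: ?l
    then have P: "P \<in> qObj pr R" and s [simp]: "\<sigma> \<in> Rel R ?X ?X" by (auto simp: eqrel_def Q0_Rel[OF assms])
    note E [simp] = eqrelD[OF qObjD(2)[OF P]]
    have le: "Leq R ?X ?X (eqv pr P) \<sigma>" using l by (simp add: eqrel_def)
    then have "Leq R ?X ?X (Diag R ?X) \<sigma>" by (rule le_trans[OF E(3)]) simp_all
    then show ?r using l le P by (simp add: eqrel_def) }
  assume r: ?r
  then have P: "P \<in> qObj pr R" and e: "eqrel R ?X \<sigma>" and le: "Leq R ?X ?X (eqv pr P) \<sigma>" by auto
  note [simp] = eqrelD[OF qObjD(2)[OF P]] eqrelD[OF e]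
  have "Leq R ?X ?X (Seq R ?X ?X ?X (eqv pr P) \<sigma>) (Seq R ?X ?X ?X \<sigma> \<sigma>)"
    "Leq R ?X ?X (Seq R ?X ?X ?X \<sigma> (eqv pr P)) (Seq R ?X ?X ?X \<sigma> \<sigma>)"
    using le by (intro Seq_mono; simp add: Leq_refl)+
  then have "Seq R ?X ?X ?X (eqv pr P) \<sigma> = \<sigma>" "Seq R ?X ?X ?X \<sigma> (eqv pr P) = \<sigma>"
    using eqrel_absorb[OF qObjD(2)[OF P], of \<sigma> ?X] absorb_eqrel[OF qObjD(2)[OF P], of \<sigma> ?X] by simp_all
  then show ?l using P e le by (simp add: eqrel_def Q0_Rel[OF assms] Leq_refl)
qed

lemma Q1_simps [simp]: "Dom (Q1 pr F) = Q0 pr (Dom F)" "Cod (Q1 pr F) = Q0 pr (Cod F)"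
  "P \<in> qObj pr (Dom F) \<Longrightarrow> omap (Q1 pr F) P = pr (omap F (ob pr P), rmap F (ob pr P) (ob pr P) (eqv pr P))"
  "f \<in> Hom (Q0 pr (Dom F)) P Q \<Longrightarrow> amap (Q1 pr F) P Q f = amap F (ob pr P) (ob pr Q) f"
  "\<alpha> \<in> Rel (Q0 pr (Dom F)) P Q \<Longrightarrow> rmap (Q1 pr F) P Q \<alpha> = rmap F (ob pr P) (ob pr Q) \<alpha>"
  by (simp_all add: Q1_def)

lemma rd_arrow_Q1 [simp]:
  assumes F [simp]: "rd_arrow F"
  shows "rd_arrow (Q1 pr F)"
proof -
  interpret R: relational_doctrine "Dom F" by simp
  interpret S: relational_doctrine "Cod F" by simp
  interpret RQ: relational_doctrine "Q0 pr (Dom F)" by simp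
  have H: "f \<in> Hom (Dom F) (ob pr P) (ob pr Q)" "P \<in> qObj pr (Dom F)" "Q \<in> qObj pr (Dom F)"
    if "f \<in> Hom (Q0 pr (Dom F)) P Q" for f P Q using Q0_HomD[OF that] by simp_all
  have L: "\<alpha> \<in> Rel (Dom F) (ob pr P) (ob pr Q)" "P \<in> qObj pr (Dom F)" "Q \<in> qObj pr (Dom F)"
    if "\<alpha> \<in> Rel (Q0 pr (Dom F)) P Q" for \<alpha> P Q using Q0_RelD[OF _ that] by simp_all
  have O: "pr (omap F (ob pr P), rmap F (ob pr P) (ob pr P) (eqv pr P)) \<in> qObj pr (Cod F)"
     "eqrel (Cod F) (omap F (ob pr P)) (rmap F (ob pr P) (ob pr P) (eqv pr P))" "ob pr P \<in> Obj (Dom F)"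
     "eqv pr P \<in> Rel (Dom F) (ob pr P) (ob pr P)"
    if "P \<in> qObj pr (Dom F)" for P
    using rd_arrow_eqrel[OF F qObjD(2)[OF that]] qObjD(1)[OF that] R.eqrelD[OF qObjD(2)[OF that]] by simp_all
  have hom: "amap (Q1 pr F) P Q f \<in> Hom (Q0 pr (Cod F)) (omap (Q1 pr F) P) (omap (Q1 pr F) Q)"
    if f: "f \<in> Hom (Q0 pr (Dom F)) P Q" for P Q f
  proof -
    note [simp] = H[OF f] O[OF H(2)[OF f]] O[OF H(3)[OF f]]
    have "Leq (Cod F) (omap F (ob pr P)) (omap F (ob pr P)) (rmap F (ob pr P) (ob pr P) (eqv pr P))
       (rmap F (ob pr P) (ob pr P) (Reix (Dom F) (ob pr P) (ob pr P) (ob pr Q) (ob pr Q) f f (eqv pr Q)))"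
      using Q0_HomD(4)[OF f] by (intro rd_arrow_mono) simp_all
    then show ?thesis using f O(1)[OF H(2)[OF f]] O(1)[OF H(3)[OF f]] by (simp add: Q0_Hom)
  qed
  have rel: "rmap (Q1 pr F) P Q \<alpha> \<in> Rel (Q0 pr (Cod F)) (omap (Q1 pr F) P) (omap (Q1 pr F) Q)"
    if a: "\<alpha> \<in> Rel (Q0 pr (Dom F)) P Q" for P Q \<alpha>
  proof -
    note l [simp] = L[OF a] O(3,4)[OF L(2)[OF a]] O(3,4)[OF L(3)[OF a]]
    have "rmap F (ob pr P) (ob pr Q) (Seq (Dom F) (ob pr P) (ob pr P) (ob pr Q) (eqv pr P) \<alpha>) = rmap F (ob pr P) (ob pr Q) \<alpha>"
      "rmap F (ob pr P) (ob pr Q) (Seq (Dom F) (ob pr P) (ob pr Q) (ob pr Q) \<alpha> (eqv pr Q)) = rmap F (ob pr P) (ob pr Q) \<alpha>"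
      using a by (simp_all add: Q0_Rel del: rd_arrow_simps)
    then show ?thesis using a O(1)[OF L(2)[OF a]] O(1)[OF L(3)[OF a]] by (simp add: Q0_Rel)
  qed
  show ?thesis
    unfolding rd_arrow_def rd_arrow_axioms_def
  proof (intro conjI allI impI; (simp; fail)?)
    show "omap (Q1 pr F) \<in> extensional (Obj (Dom (Q1 pr F)))" "amap (Q1 pr F) X Y \<in> extensional (Hom (Dom (Q1 pr F)) X Y)"
      "rmap (Q1 pr F) X Y \<in> extensional (Rel (Dom (Q1 pr F)) X Y)" for X Y
      by (simp_all add: Q1_def)
  qed (use hom rel in \<open>auto simp: O H L rd_arrow_mono Q0_typing\<close>)
qed

lemma Q2_simps [simp]: "Sarr (Q2 pr \<theta>) = Q1 pr (Sarr \<theta>)" "Tarr (Q2 pr \<theta>) = Q1 pr (Tarr \<theta>)"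
  "P \<in> qObj pr (Dom (Sarr \<theta>)) \<Longrightarrow> cpt (Q2 pr \<theta>) P = cpt \<theta> (ob pr P)"
  by (simp_all add: Q2_def)

lemma Q1_qObj [simp]: "rd_arrow F \<Longrightarrow> P \<in> qObj pr (Dom F) \<Longrightarrow> Cod F = S
    \<Longrightarrow> pr (omap F (ob pr P), rmap F (ob pr P) (ob pr P) (eqv pr P)) \<in> qObj pr S"
  using rd_arrow_simps(1)[of "Q1 pr F" P "Q0 pr S"] by simp

lemma Q1_eqrel [simp]: "rd_arrow F \<Longrightarrow> P \<in> qObj pr (Dom F) \<Longrightarrow> Cod F = S
    \<Longrightarrow> eqrel S (omap F (ob pr P)) (rmap F (ob pr P) (ob pr P) (eqv pr P))"
  using rd_arrow_eqrel[OF _ qObjD(2)] by auto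

lemma rd_cell_Q2 [simp]:
  assumes t [simp]: "rd_cell \<theta>"
  shows "rd_cell (Q2 pr \<theta>)"
proof -
  let ?F = "Sarr \<theta>" and ?G = "Tarr \<theta>" and ?R = "Dom (Sarr \<theta>)" and ?S = "Cod (Sarr \<theta>)"
  interpret R: relational_doctrine ?R by simp
  interpret S: relational_doctrine ?S by simp
  show ?thesis
  proof (rule rd_cellI[of "Q1 pr ?F" "Q1 pr ?G" "Q0 pr ?R" "Q0 pr ?S"])
    fix P assume "P \<in> Obj (Q0 pr ?R)"
    then have P [simp]: "P \<in> qObj pr ?R" by simp
    note [simp] = qObjD(1)[OF P] R.eqrelD[OF qObjD(2)[OF P]]
    show "cpt (Q2 pr \<theta>) P \<in> Hom (Q0 pr ?S) (omap (Q1 pr ?F) P) (omap (Q1 pr ?G) P)"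
      using rd_cell_lax[OF t _ refl refl refl refl, of "eqv pr P" "ob pr P" "ob pr P"]
        Q1_qObj[of ?G P ?S] Q1_qObj[of ?F P ?S] by (simp add: Q0_Hom)
  next
    fix P Q f assume f: "f \<in> Hom (Q0 pr ?R) P Q"
    then show "Comp (Q0 pr ?S) (omap (Q1 pr ?F) P) (omap (Q1 pr ?F) Q) (omap (Q1 pr ?G) Q) (cpt (Q2 pr \<theta>) Q) (amap (Q1 pr ?F) P Q f) =
       Comp (Q0 pr ?S) (omap (Q1 pr ?F) P) (omap (Q1 pr ?G) P) (omap (Q1 pr ?G) Q) (amap (Q1 pr ?G) P Q f) (cpt (Q2 pr \<theta>) P)"
      using rd_cell_natural[OF t Q0_HomD(1)[OF f] refl refl refl refl] Q0_HomD[OF f] by simp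
  next
    fix P Q \<alpha> assume a: "\<alpha> \<in> Rel (Q0 pr ?R) P Q"
    then show "Leq (Q0 pr ?S) (omap (Q1 pr ?F) P) (omap (Q1 pr ?F) Q) (rmap (Q1 pr ?F) P Q \<alpha>)
        (Reix (Q0 pr ?S) (omap (Q1 pr ?F) P) (omap (Q1 pr ?F) Q) (omap (Q1 pr ?G) P) (omap (Q1 pr ?G) Q)
          (cpt (Q2 pr \<theta>) P) (cpt (Q2 pr \<theta>) Q) (rmap (Q1 pr ?G) P Q \<alpha>))"
      using rd_cell_lax[OF t Q0_RelD(1)[OF _ a] refl refl refl refl] Q0_RelD[OF _ a] by simp
  qed (simp_all add: Q2_def)
qed

lemma two_functor_Qf: "two_functor RD RD (Qf pr)"
proof -
  interpret RD: two_category RD by (rule two_category_RD)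
  have [simp]: "ob pr P \<in> Obj R" "eqv pr P \<in> Rel R (ob pr P) (ob pr P)" "pr (ob pr P, eqv pr P) = P"
    if "P \<in> qObj pr R" "relational_doctrine R" for R and P
    using qObjD[OF that(1)] relational_doctrine.eqrelD[OF that(2)] by auto
  have 1: "Q1 pr (rd1_id R) = rd1_id (Q0 pr R)" if [simp]: "relational_doctrine R" for R
    by (rule rd1_eqI) (auto dest: Q0_HomD(1) Q0_RelD(1)[OF that])
  have 2: "Q1 pr (rd1_comp G F) = rd1_comp (Q1 pr G) (Q1 pr F)" if [simp]: "rd_arrow F" "rd_arrow G" "Dom G = Cod F" for F G
  proof (rule rd1_eqI)
    fix P Q f assume f: "f \<in> Hom (Dom (Q1 pr (rd1_comp G F))) P Q"
    then have [simp]: "f \<in> Hom (Q0 pr (Dom F)) P Q" by simp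
    have "amap F (ob pr P) (ob pr Q) f = amap (Q1 pr F) P Q f" by simp
    moreover have "amap (Q1 pr F) P Q f \<in> Hom (Q0 pr (Cod F)) (omap (Q1 pr F) P) (omap (Q1 pr F) Q)"
      by (rule rd_arrow_simps(2)) simp_all
    ultimately show "amap (Q1 pr (rd1_comp G F)) P Q f = amap (rd1_comp (Q1 pr G) (Q1 pr F)) P Q f"
      using Q0_HomD[of f "Dom F" P Q] by simp
  next
    fix P Q \<alpha> assume "\<alpha> \<in> Rel (Dom (Q1 pr (rd1_comp G F))) P Q"
    then have a [simp]: "\<alpha> \<in> Rel (Q0 pr (Dom F)) P Q" by simp
    have "rmap (Q1 pr F) P Q \<alpha> \<in> Rel (Q0 pr (Cod F)) (omap (Q1 pr F) P) (omap (Q1 pr F) Q)"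
      by (rule rd_arrow_simps(3)) simp_all
    then show "rmap (Q1 pr (rd1_comp G F)) P Q \<alpha> = rmap (rd1_comp (Q1 pr G) (Q1 pr F)) P Q \<alpha>"
      using Q0_RelD[OF _ a] by simp
  qed simp_all
  have 3: "Q2 pr (rd2_id F) = rd2_id (Q1 pr F)" if [simp]: "rd_arrow F" for F
    by (rule rd2_eqI) simp_all
  have 4: "Q2 pr (rd2_vcomp \<phi> \<theta>) = rd2_vcomp (Q2 pr \<phi>) (Q2 pr \<theta>)"
    if [simp]: "rd_cell \<theta>" "rd_cell \<phi>" "Sarr \<phi> = Tarr \<theta>" for \<theta> \<phi>
  proof (rule rd2_eqI)
    have [simp]: "Dom (Tarr \<phi>) = Dom (Sarr \<theta>)" "Cod (Tarr \<phi>) = Cod (Sarr \<theta>)"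
      using rd_cell_simps(1,2)[of \<phi>] by (simp_all del: rd_cell_simps(1,2), simp_all)
    fix P assume "P \<in> Obj (Dom (Sarr (Q2 pr (rd2_vcomp \<phi> \<theta>))))"
    then have [simp]: "P \<in> qObj pr (Dom (Sarr \<theta>))" by simp
    show "cpt (Q2 pr (rd2_vcomp \<phi> \<theta>)) P = cpt (rd2_vcomp (Q2 pr \<phi>) (Q2 pr \<theta>)) P" by simp
  qed simp_all
  have 5: "Q2 pr (rd2_hcomp \<phi> \<theta>) = rd2_hcomp (Q2 pr \<phi>) (Q2 pr \<theta>)"
    if [simp]: "rd_cell \<theta>" "rd_cell \<phi>" "Dom (Sarr \<phi>) = Cod (Sarr \<theta>)" for \<theta> \<phi>
  proof (rule rd2_eqI)
    fix P assume "P \<in> Obj (Dom (Sarr (Q2 pr (rd2_hcomp \<phi> \<theta>))))"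
    then have [simp]: "P \<in> qObj pr (Dom (Sarr \<theta>))" by simp
    have "cpt (Q2 pr \<theta>) P \<in> Hom (Q0 pr (Cod (Sarr \<theta>))) (omap (Q1 pr (Sarr \<theta>)) P) (omap (Q1 pr (Tarr \<theta>)) P)"
      by (rule rd_cell_simps(3)) simp_all
    then show "cpt (Q2 pr (rd2_hcomp \<phi> \<theta>)) P = cpt (rd2_hcomp (Q2 pr \<phi>) (Q2 pr \<theta>)) P" by simp
  qed (simp_all add: 2)
  show ?thesis
    by unfold_locales (auto simp: hom1_def hom2_def Qf_def 1 2 3 4 5)
qed

end

section \<open>Quotients in the extensional quotient completion\<close>

text \<open>Quotient arrows of the same relation are isomorphic, so it is enough that one of them is preserved.\<close>

lemma preserves_quotientsI:
  assumes F [simp]: "rd_arrow F"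
    and ex: "\<And>X \<rho>. eqrel (Dom F) X \<rho> \<Longrightarrow> \<exists>W q. quotient_arrow (Dom F) X \<rho> W q
      \<and> quotient_arrow (Cod F) (omap F X) (rmap F X X \<rho>) (omap F W) (amap F X W q)"
  shows "preserves_quotients F"
  unfolding preserves_quotients_def
proof (intro allI impI, elim conjE)
  interpret R: relational_doctrine "Dom F" by simp
  interpret S: relational_doctrine "Cod F" by simp
  fix X \<rho> V p assume e: "eqrel (Dom F) X \<rho>" and p: "quotient_arrow (Dom F) X \<rho> V p"
  obtain W q where q: "quotient_arrow (Dom F) X \<rho> W q"
    and Fq: "quotient_arrow (Cod F) (omap F X) (rmap F X X \<rho>) (omap F W) (amap F X W q)"
    using ex[OF e] by blast
  note [simp] = R.eqrelD[OF e] R.quotient_arrowD(1)[OF q]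
  obtain i j where ij: "inverse_arrows (Dom F) W V i j" "Comp (Dom F) X W V i q = p"
    by (rule R.quotient_unique[OF q p]) simp_all
  have "quotient_arrow (Cod F) (omap F X) (rmap F X X \<rho>) (omap F V)
      (Comp (Cod F) (omap F X) (omap F W) (omap F V) (amap F W V i) (amap F X W q))"
    by (rule S.quotient_Comp_iso[OF Fq _ rd_arrow_inverse[OF F ij(1)]]) simp
  also have "Comp (Cod F) (omap F X) (omap F W) (omap F V) (amap F W V i) (amap F X W q) = amap F X V p"
    using inverse_arrowsD[OF ij(1)] by (simp add: ij(2)[symmetric])
  finally show "quotient_arrow (Cod F) (omap F X) (rmap F X X \<rho>) (omap F V) (amap F X V p)" .
qed

lemma eqrel_E0 [simp]: "eqrel (E0 R) = eqrel R"
  by (simp add: eqrel_def fun_eq_iff)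

context pairing
begin

abbreviation TD :: "('o, 'a, 'r) doctrine \<Rightarrow> ('o, 'a, 'r) doctrine" where "TD R \<equiv> E0 (Q0 pr R)"

lemma cls_Q_Comp [simp]:
  assumes "relational_doctrine R" "f \<in> Hom (Q0 pr R) P Q" "g \<in> Hom (Q0 pr R) Q S"
    "X = ob pr P" "Y = ob pr Q" "Z = ob pr S"
  shows "cls (Q0 pr R) P S (Comp R X Y Z (cls (Q0 pr R) Q S g) (cls (Q0 pr R) P Q f)) = cls (Q0 pr R) P S (Comp R X Y Z g f)"
    "cls (Q0 pr R) P S (Comp R X Y Z (cls (Q0 pr R) Q S g) f) = cls (Q0 pr R) P S (Comp R X Y Z g f)"
    "cls (Q0 pr R) P S (Comp R X Y Z g (cls (Q0 pr R) P Q f)) = cls (Q0 pr R) P S (Comp R X Y Z g f)"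
  using cls_simps(4-6)[of "Q0 pr R" f P Q g S] assms by simp_all

lemma Reix_Q_cls [simp]:
  assumes "relational_doctrine R" "f \<in> Hom (Q0 pr R) P A" "g \<in> Hom (Q0 pr R) Q B" "\<alpha> \<in> Rel (Q0 pr R) A B"
    "X = ob pr P" "Y = ob pr Q" "X' = ob pr A" "Y' = ob pr B"
  shows "Reix R X Y X' Y' (cls (Q0 pr R) P A f) (cls (Q0 pr R) Q B g) \<alpha> = Reix R X Y X' Y' f g \<alpha>"
  using cls_simps(3)[of "Q0 pr R" f P A g Q B \<alpha>] assms by simp

lemma cls_amap_Q [simp]:
  assumes F: "rd_arrow F" "Dom F = R" "Cod F = S" and f: "f \<in> Hom (Q0 pr R) P Q"
    and A: "A = pr (omap F (ob pr P), rmap F (ob pr P) (ob pr P) (eqv pr P))"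
    and B: "B = pr (omap F (ob pr Q), rmap F (ob pr Q) (ob pr Q) (eqv pr Q))"
    and X: "X = ob pr P" "Y = ob pr Q"
  shows "cls (Q0 pr S) A B (amap F X Y (cls (Q0 pr R) P Q f)) = cls (Q0 pr S) A B (amap F X Y f)"
proof -
  have "relational_doctrine R" using F rd_arrow_doctrine by auto
  then have "cls (Q0 pr R) P Q f \<in> Hom (Q0 pr R) P Q" using f by simp
  then show ?thesis
    using cls_amap_cls[of "Q1 pr F" "Q0 pr R" "Q0 pr S" A P B Q f] F f A B X Q0_HomD(2,3)[OF f] by simp
qed

text \<open>Arrows that agree over \<open>\<rho>, \<rho>'\<close> satisfy \<open>\<rho> \<le> R\<^bsub>f,g\<^esub>(\<rho>')\<close>. If \<open>f\<close> respects the coarser \<open>\<sigma>, \<sigma>'\<close>, then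
  \<open>\<sigma> \<le> \<sigma> ; \<rho> \<le> R\<^bsub>f,f\<^esub>(\<sigma>') ; R\<^bsub>f,g\<^esub>(\<sigma>') \<le> R\<^bsub>f,g\<^esub>(\<sigma>')\<close>, so \<open>g\<close> respects them too and agrees with \<open>f\<close> over them.\<close>

lemma coarsen:
  assumes R: "relational_doctrine R" and f: "f \<in> Hom (Q0 pr R) A B" "f \<in> Hom (Q0 pr R) A' B'"
    and o: "ob pr A' = ob pr A" "ob pr B' = ob pr B"
    and le: "Leq R (ob pr A) (ob pr A) (eqv pr A) (eqv pr A')" "Leq R (ob pr B) (ob pr B) (eqv pr B) (eqv pr B')"
    and g: "g \<in> Hom (Q0 pr R) A B" and a: "approx (Q0 pr R) A B f g"
  shows "g \<in> Hom (Q0 pr R) A' B'" "approx (Q0 pr R) A' B' f g"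
proof -
  interpret relational_doctrine R by fact
  let ?X = "ob pr A" and ?Y = "ob pr B" and ?r = "eqv pr A" and ?s = "eqv pr A'" and ?r' = "eqv pr B" and ?s' = "eqv pr B'"
  have q: "A \<in> qObj pr R" "A' \<in> qObj pr R" "B \<in> qObj pr R" "B' \<in> qObj pr R"
    and [simp]: "f \<in> Hom R ?X ?Y" "g \<in> Hom R ?X ?Y" using f g by (auto simp: Q0_Hom)
  have E: "eqrel R ?X ?r" "eqrel R ?X ?s" "eqrel R ?Y ?r'" "eqrel R ?Y ?s'"
    using qObjD(2)[OF q(1)] qObjD(2)[OF q(2)] qObjD(2)[OF q(3)] qObjD(2)[OF q(4)] o by simp_all
  note [simp] = eqrelD[OF E(1)] eqrelD[OF E(2)] eqrelD[OF E(3)] eqrelD[OF E(4)]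
  let ?R = "Reix R ?X ?X ?Y ?Y"
  have fg: "Leq R ?X ?X ?r (?R f g ?r')" using a by (simp add: approx_def)
  then have fg: "Leq R ?X ?X ?r (?R f g ?s')"
    using Reix_mono[of f ?X ?Y g ?X ?Y ?r' ?s'] le(2) by (rule_tac le_trans[of _ _ _ "?R f g ?r'"]) simp_all
  have ff: "Leq R ?X ?X ?s (?R f f ?s')" using f(2) o by (simp add: Q0_Hom)
  have "Leq R ?X ?X ?s (Seq R ?X ?X ?X ?s ?r)"
    using Seq_mono[of ?s ?X ?X ?s "Diag R ?X" ?X ?r] by (simp add: Leq_refl)
  moreover have "Leq R ?X ?X (Seq R ?X ?X ?X ?s ?r) (Seq R ?X ?X ?X (?R f f ?s') (?R f g ?s'))"
    using fg ff by (intro Seq_mono) simp_all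
  moreover have "Leq R ?X ?X (Seq R ?X ?X ?X (?R f f ?s') (?R f g ?s')) (?R f g ?s')"
    using Seq_lax[of f ?X ?Y f ?X ?Y g ?X ?Y ?s' ?s'] by simp
  ultimately have sfg: "Leq R ?X ?X ?s (?R f g ?s')"
    by (intro le_trans[of ?X ?X ?s "Seq R ?X ?X ?X ?s ?r" "?R f g ?s'"]
        le_trans[of ?X ?X "Seq R ?X ?X ?X ?s ?r" "Seq R ?X ?X ?X (?R f f ?s') (?R f g ?s')" "?R f g ?s'"]) simp_all
  then show "approx (Q0 pr R) A' B' f g" by (simp add: approx_def o)
  have sgf: "Leq R ?X ?X ?s (?R g f ?s')"
    using Conv_mono[OF _ _ sfg] by (simp add: Conv_Reix)
  have "Leq R ?X ?X (Seq R ?X ?X ?X ?s ?s) (Seq R ?X ?X ?X (?R g f ?s') (?R f g ?s'))"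
    by (rule Seq_mono[OF _ _ _ _ sgf sfg]) simp_all
  moreover have "Leq R ?X ?X (Seq R ?X ?X ?X (?R g f ?s') (?R f g ?s')) (?R g g ?s')"
    using Seq_lax[of g ?X ?Y f ?X ?Y g ?X ?Y ?s' ?s'] by simp
  ultimately have "Leq R ?X ?X (Seq R ?X ?X ?X ?s ?s) (?R g g ?s')"
    by (rule le_trans) simp_all
  then show "g \<in> Hom (Q0 pr R) A' B'" using q o by (simp add: Q0_Hom)
qed

text \<open>Codes of classes are chosen members, so the code of \<open>f\<close> changes with the equivalence relations; the code
  for the finer ones still represents the class for the coarser ones.\<close>

lemma cls_coarsen:
  assumes R: "relational_doctrine R" and f: "f \<in> Hom (Q0 pr R) A B" "f \<in> Hom (Q0 pr R) A' B'"
    and o: "ob pr A' = ob pr A" "ob pr B' = ob pr B"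
    and le: "Leq R (ob pr A) (ob pr A) (eqv pr A) (eqv pr A')" "Leq R (ob pr B) (ob pr B) (eqv pr B) (eqv pr B')"
  shows "cls (Q0 pr R) A B f \<in> Hom (Q0 pr R) A' B'" "cls (Q0 pr R) A' B' (cls (Q0 pr R) A B f) = cls (Q0 pr R) A' B' f"
proof -
  interpret Q: relational_doctrine "Q0 pr R" using R by simp
  note c = coarsen[OF R f o le Q.cls_Hom[OF f(1)] Q.approx_cls[OF f(1)]]
  show "cls (Q0 pr R) A B f \<in> Hom (Q0 pr R) A' B'" by (rule c(1))
  show "cls (Q0 pr R) A' B' (cls (Q0 pr R) A B f) = cls (Q0 pr R) A' B' f"
    by (rule sym, rule Q.cls_eqI[OF f(2) c])
qed

lemma Idn_Q0:
  assumes R: "relational_doctrine R" and e: "eqrel (Q0 pr R) P \<sigma>"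
  shows "Idn R (ob pr P) \<in> Hom (Q0 pr R) P (pr (ob pr P, \<sigma>))"
proof -
  interpret relational_doctrine R by fact
  have e: "P \<in> qObj pr R" "eqrel R (ob pr P) \<sigma>" "Leq R (ob pr P) (ob pr P) (eqv pr P) \<sigma>"
    using e R by (auto simp: Q0_eqrel)
  then show ?thesis using R eqrelD[OF e(2)] by (simp add: Q0_Hom)
qed

text \<open>An arrow out of \<open>(X, \<rho>)\<close> whose kernel contains \<open>\<sigma>\<close> is the same as an arrow out of \<open>(X, \<sigma>)\<close>, and by \<open>coarsen\<close> two
  arrows out of \<open>(X, \<sigma>)\<close> that agree over \<open>\<rho>\<close> agree over \<open>\<sigma>\<close>. The graph of \<open>[id]\<close> is \<open>\<sigma>\<close>, which is also
  equality on \<open>(X, \<sigma>)\<close>; effectiveness and descent follow at once.\<close>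

lemma canonical_quotient:
  assumes R: "relational_doctrine R" and e: "eqrel (Q0 pr R) P \<sigma>" and W: "W = pr (ob pr P, \<sigma>)"
    and q: "q = cls (Q0 pr R) P W (Idn R (ob pr P))"
  shows "quotient_arrow (TD R) P \<sigma> W q" "effective (TD R) P \<sigma> W q" "descent (TD R) P W q"
proof -
  note [simp] = R W
  interpret relational_doctrine R by fact
  interpret Q: relational_doctrine "Q0 pr R" by simp
  interpret T: relational_doctrine "TD R" by simp
  have P [simp]: "P \<in> qObj pr R" and s: "eqrel R (ob pr P) \<sigma>" "Leq R (ob pr P) (ob pr P) (eqv pr P) \<sigma>"
    using e by (auto simp: Q0_eqrel)
  note E [simp] = eqrelD[OF s(1)] Q.eqrelD(1)[OF e] s(1)
  have I [simp]: "Idn R (ob pr P) \<in> Hom (Q0 pr R) P (pr (ob pr P, \<sigma>))" by (rule Idn_Q0[OF R e])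
  have qT: "q \<in> Hom (TD R) P W" by (simp add: q)
  have sW [simp]: "\<sigma> \<in> Rel (Q0 pr R) (pr (ob pr P, \<sigma>)) (pr (ob pr P, \<sigma>))" by (simp add: Q0_Rel[OF R])
  have IW [simp]: "Idn R (ob pr P) \<in> Hom (Q0 pr R) (pr (ob pr P, \<sigma>)) (pr (ob pr P, \<sigma>))"
    by (simp add: Q0_Hom Leq_refl)
  have k: "Reix (TD R) P P W W q q (Diag (TD R) W) = \<sigma>" by (simp add: q)
  show "quotient_arrow (TD R) P \<sigma> W q"
  proof (rule T.quotient_arrowI[OF qT])
    show "\<sigma> \<in> Rel (TD R) P P" "Leq (TD R) P P \<sigma> (Reix (TD R) P P W W q q (Diag (TD R) W))"
      by (simp_all only: k) (simp_all add: Leq_refl)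
  next
    fix Z f assume f: "f \<in> Hom (TD R) P Z" "Leq (TD R) P P \<sigma> (Reix (TD R) P P Z Z f f (Diag (TD R) Z))"
    have fQ: "f \<in> Hom (Q0 pr R) P Z" "cls (Q0 pr R) P Z f = f" using f by (simp_all add: Q.E0_Hom)
    have fW: "f \<in> Hom (Q0 pr R) W Z" using f fQ by (simp add: Q0_Hom)
    have "f \<in> Hom R (ob pr P) (ob pr Z)" using fQ by (simp add: Q0_Hom)
    then have "f = Comp (TD R) P W Z (cls (Q0 pr R) W Z f) q" using fW fQ by (simp add: q)
    then show "\<exists>h. h \<in> Hom (TD R) W Z \<and> f = Comp (TD R) P W Z h q" using fW by (intro exI[of _ "cls (Q0 pr R) W Z f"]) simp
  next
    fix Z h h' assume h: "h \<in> Hom (TD R) W Z" "h' \<in> Hom (TD R) W Z" "Comp (TD R) P W Z h q = Comp (TD R) P W Z h' q"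
    have hQ: "h \<in> Hom (Q0 pr R) W Z" "h' \<in> Hom (Q0 pr R) W Z" "cls (Q0 pr R) W Z h = h" "cls (Q0 pr R) W Z h' = h'"
      using h by (simp_all add: Q.E0_Hom)
    have hR: "h \<in> Hom R (ob pr P) (ob pr Z)" "h' \<in> Hom R (ob pr P) (ob pr Z)" "Z \<in> qObj pr R" using hQ by (simp_all add: Q0_Hom)
    have hP: "h \<in> Hom (Q0 pr R) P Z" "h' \<in> Hom (Q0 pr R) P Z"
      using Q.Comp_Hom[OF I, of h Z] Q.Comp_Hom[OF I, of h' Z] hQ hR by simp_all
    have "cls (Q0 pr R) P Z h = cls (Q0 pr R) P Z h'" using h(3) hQ hR by (simp add: q)
    then have a: "approx (Q0 pr R) P Z h h'" using hP by (simp add: Q.cls_eq_iff)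
    have Z: "Leq R (ob pr Z) (ob pr Z) (eqv pr Z) (eqv pr Z)"
      using eqrelD[OF qObjD(2)[OF hR(3)]] by (simp add: Leq_refl)
    have "approx (Q0 pr R) W Z h h'"
      by (rule coarsen(2)[OF R hP(1) hQ(1) _ _ _ Z hP(2) a]) (simp_all add: s)
    then show "h = h'" using hQ Q.cls_eqI[of h W Z h'] by simp
  qed
  show "effective (TD R) P \<sigma> W q" using T.kernel_Reix[OF qT] k by (simp add: effective_def)
  have g: "graph (TD R) P W q = \<sigma>" by (simp add: graph_def q)
  show "descent (TD R) P W q" unfolding descent_def g by (simp add: Leq_refl)
qed

lemma TD_EQobs:
  assumes R: "relational_doctrine R"
  shows "TD R \<in> EQobs"
proof -
  have "has_quotients (TD R)"
    unfolding has_quotients_def eqrel_E0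
  proof (intro allI impI)
    fix P \<sigma> assume "eqrel (Q0 pr R) P \<sigma>"
    from canonical_quotient[OF R this refl refl]
    show "\<exists>W q. quotient_arrow (TD R) P \<sigma> W q \<and> effective (TD R) P \<sigma> W q \<and> descent (TD R) P W q" by blast
  qed
  then show ?thesis using R by (simp add: EQobs_def extensional_E0)
qed

text \<open>\<open>T F\<close> takes the canonical quotient \<open>[id]\<close> to the canonical quotient of the image relation.\<close>

lemma TD_arrow_EQars:
  assumes F [simp]: "rd_arrow F"
  shows "E1 (Q1 pr F) \<in> EQars"
proof -
  interpret R: relational_doctrine "Dom F" by simp
  interpret S: relational_doctrine "Cod F" by simp
  have "preserves_quotients (E1 (Q1 pr F))"
  proof (rule preserves_quotientsI)
    fix P \<sigma> assume "eqrel (Dom (E1 (Q1 pr F))) P \<sigma>"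
    then have e: "eqrel (Q0 pr (Dom F)) P \<sigma>" by simp
    let ?W = "pr (ob pr P, \<sigma>)" let ?q = "cls (Q0 pr (Dom F)) P ?W (Idn (Dom F) (ob pr P))"
    have [simp]: "P \<in> qObj pr (Dom F)" "eqrel (Dom F) (ob pr P) \<sigma>" using e by (auto simp: Q0_eqrel)
    have I [simp]: "Idn (Dom F) (ob pr P) \<in> Hom (Q0 pr (Dom F)) P ?W" by (rule Idn_Q0[OF _ e]) simp
    note [simp] = R.eqrelD(2)[OF \<open>eqrel (Dom F) (ob pr P) \<sigma>\<close>]
    have s [simp]: "\<sigma> \<in> Rel (Q0 pr (Dom F)) P P" using e by (simp add: eqrel_def)
    let ?P = "omap (E1 (Q1 pr F)) P" and ?s = "rmap (E1 (Q1 pr F)) P P \<sigma>"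
    have "eqrel (Cod (E1 (Q1 pr F))) ?P ?s" using rd_arrow_eqrel[of "E1 (Q1 pr F)" P \<sigma>] e by simp
    then have "eqrel (Q0 pr (Cod F)) ?P ?s" by simp
    then have c: "quotient_arrow (TD (Cod F)) ?P ?s (pr (ob pr ?P, ?s)) (cls (Q0 pr (Cod F)) ?P (pr (ob pr ?P, ?s)) (Idn (Cod F) (ob pr ?P)))"
      by (rule canonical_quotient[OF _ _ refl refl, rotated]) simp
    have "quotient_arrow (Cod (E1 (Q1 pr F))) ?P ?s (omap (E1 (Q1 pr F)) ?W) (amap (E1 (Q1 pr F)) P ?W ?q)"
      using c by simp
    moreover have "quotient_arrow (Dom (E1 (Q1 pr F))) P \<sigma> ?W ?q"
      using canonical_quotient(1)[OF _ e refl refl] by simp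
    ultimately show "\<exists>W q. quotient_arrow (Dom (E1 (Q1 pr F))) P \<sigma> W q \<and>
        quotient_arrow (Cod (E1 (Q1 pr F))) ?P ?s (omap (E1 (Q1 pr F)) W) (amap (E1 (Q1 pr F)) P W q)"
      by blast
  qed simp
  then show ?thesis by (simp add: EQars_def TD_EQobs)
qed

section \<open>The 2-monad\<close>

lemma T_eq_simps [simp]: "F0 (T_eq pr) R = TD R" "F1 (T_eq pr) F = E1 (Q1 pr F)" "F2 (T_eq pr) \<theta> = E2 (Q2 pr \<theta>)"
  by (simp_all add: T_eq_def T_e_def T_q_def Ef_def Qf_def)

lemma two_functor_T: "two_functor RD RD (T_eq pr)"
  unfolding T_eq_def T_e_def T_q_def by (rule two_functor_comp[OF two_functor_Qf two_functor_Ef])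

end

lemma rwhisk_RD_simps [simp]:
  assumes "rd_cell a" "rd_arrow F" "Cod F = Dom (Sarr a)"
  shows "Sarr (rwhisk RD a F) = rd1_comp (Sarr a) F" "Tarr (rwhisk RD a F) = rd1_comp (Tarr a) F"
    "X \<in> Obj (Dom F) \<Longrightarrow> cpt (rwhisk RD a F) X = cpt a (omap F X)" "rd_cell (rwhisk RD a F)"
  using assms by (simp_all add: rwhisk_def)

lemma lwhisk_RD_simps [simp]:
  assumes "rd_cell a" "rd_arrow G" "Dom G = Cod (Sarr a)"
  shows "Sarr (lwhisk RD G a) = rd1_comp G (Sarr a)" "Tarr (lwhisk RD G a) = rd1_comp G (Tarr a)"
    "X \<in> Obj (Dom (Sarr a)) \<Longrightarrow> cpt (lwhisk RD G a) X = amap G (omap (Sarr a) X) (omap (Tarr a) X) (cpt a X)"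
    "rd_cell (lwhisk RD G a)"
  using assms by (simp_all add: lwhisk_def)

context pairing
begin

subsection \<open>The unit\<close>

lemma eqrel_Diag_pairing [simp]: "relational_doctrine R \<Longrightarrow> X \<in> Obj R \<Longrightarrow> eqrel R X (Diag R X)"
  by (rule relational_doctrine.eqrel_Diag)

lemma rd_arrow_unit_q [simp]:
  assumes R [simp]: "relational_doctrine R"
  shows "rd_arrow (unit_q pr R)"
proof -
  interpret relational_doctrine R by fact
  show ?thesis
    unfolding rd_arrow_def rd_arrow_axioms_def
    by (auto simp: unit_q_def Q0_Hom Q0_Rel[OF R] Diag_lax Leq_refl)
qed

lemma rd_arrow_unit_e [simp]:
  assumes R [simp]: "relational_doctrine R"
  shows "rd_arrow (unit_e R)"
proof -
  interpret relational_doctrine R by fact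
  show ?thesis
    unfolding rd_arrow_def rd_arrow_axioms_def by (auto simp: unit_e_def)
qed

lemma unit_eq_simps [simp]:
  assumes [simp]: "relational_doctrine R"
  shows "Dom (unit_eq pr R) = R" "Cod (unit_eq pr R) = TD R" "rd_arrow (unit_eq pr R)"
    "X \<in> Obj R \<Longrightarrow> omap (unit_eq pr R) X = pr (X, Diag R X)"
    "f \<in> Hom R X Y \<Longrightarrow> amap (unit_eq pr R) X Y f = cls (Q0 pr R) (pr (X, Diag R X)) (pr (Y, Diag R Y)) f"
    "\<alpha> \<in> Rel R X Y \<Longrightarrow> rmap (unit_eq pr R) X Y \<alpha> = \<alpha>"
proof -
  interpret relational_doctrine R by fact
  have sel: "Dom (unit_q pr R) = R" "Cod (unit_q pr R) = Q0 pr R" "Dom (unit_e S) = S" "Cod (unit_e S) = E0 S" for S :: "('o, 'a, 'r) doctrine"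
    by (simp_all add: unit_q_def unit_e_def)
  show "Dom (unit_eq pr R) = R" "Cod (unit_eq pr R) = TD R" "rd_arrow (unit_eq pr R)"
    by (simp_all add: unit_eq_def sel)
  show "X \<in> Obj R \<Longrightarrow> omap (unit_eq pr R) X = pr (X, Diag R X)"
    by (simp add: unit_eq_def rd1_comp_def unit_q_def unit_e_def)
  show "f \<in> Hom R X Y \<Longrightarrow> amap (unit_eq pr R) X Y f = cls (Q0 pr R) (pr (X, Diag R X)) (pr (Y, Diag R Y)) f"
    by (auto simp: unit_eq_def rd1_comp_def unit_q_def unit_e_def Q0_Hom Diag_lax)
  show "\<alpha> \<in> Rel R X Y \<Longrightarrow> rmap (unit_eq pr R) X Y \<alpha> = \<alpha>"
    by (auto simp: unit_eq_def rd1_comp_def unit_q_def unit_e_def Q0_Rel)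
qed

lemma unit_Hom [simp]:
  "relational_doctrine R \<Longrightarrow> f \<in> Hom R X Y \<Longrightarrow> f \<in> Hom (Q0 pr R) (pr (X, Diag R X)) (pr (Y, Diag R Y))"
  by (simp add: Q0_Hom doctrine_HomD)

lemma unit_Rel [simp]:
  "relational_doctrine R \<Longrightarrow> \<alpha> \<in> Rel R X Y \<Longrightarrow> \<alpha> \<in> Rel (Q0 pr R) (pr (X, Diag R X)) (pr (Y, Diag R Y))"
  by (simp add: Q0_Rel doctrine_RelD)

lemma two_natural_unit: "two_natural RD RD fun_id (T_eq pr) (unit_eq pr)"
proof -
  interpret RD: two_category RD by (rule two_category_RD)
  interpret T: two_functor RD RD "T_eq pr" by (rule two_functor_T)
  interpret I: two_functor RD RD fun_id by unfold_locales auto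
  have n1: "rd1_comp (E1 (Q1 pr F)) (unit_eq pr R) = rd1_comp (unit_eq pr S) F"
    if F [simp]: "rd_arrow F" "Dom F = R" "Cod F = S" for F R S
  proof -
    have [simp]: "relational_doctrine R" "relational_doctrine S" using rd_arrow_doctrine[OF F(1)] by simp_all
    show ?thesis by (rule rd1_eqI) (simp_all add: doctrine_HomD doctrine_RelD)
  qed
  have n2: "rwhisk RD (E2 (Q2 pr a)) (unit_eq pr R) = lwhisk RD (unit_eq pr S) a"
    if a [simp]: "rd_cell a" "Dom (Sarr a) = R" "Cod (Sarr a) = S" for a R S
  proof -
    have [simp]: "relational_doctrine R" "relational_doctrine S"
      using rd_arrow_doctrine[OF rd_cell_arrow(1)[OF a(1)]] by simp_all
    show ?thesis by (rule rd2_eqI) (simp_all add: n1)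
  qed
  show ?thesis
    by unfold_locales (auto simp: hom1_def hom2_def n1 n2)
qed

subsection \<open>The multiplication\<close>

text \<open>\<open>((X, \<rho>), \<sigma>) \<mapsto> (X, \<sigma>)\<close>, the canonical quotient of \<open>(X, \<rho>)\<close> by \<open>\<sigma>\<close>.\<close>

abbreviation mm :: "'o \<Rightarrow> 'o" where "mm P \<equiv> pr (ob pr (ob pr P), eqv pr P)"

lemma mult_eq_sel [simp]: "Dom (mult_eq pr R) = TD (TD R)" "Cod (mult_eq pr R) = TD R"
  "P \<in> qObj pr (TD R) \<Longrightarrow> omap (mult_eq pr R) P = mm P"
  "f \<in> Hom (TD (TD R)) P Q \<Longrightarrow> amap (mult_eq pr R) P Q f = cls (Q0 pr R) (mm P) (mm Q) f"
  "\<alpha> \<in> Rel (Q0 pr (TD R)) P Q \<Longrightarrow> rmap (mult_eq pr R) P Q \<alpha> = \<alpha>"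
  by (simp_all add: mult_eq_def Let_def)

lemma mm_facts:
  assumes R: "relational_doctrine R" and P: "P \<in> qObj pr (TD R)"
  shows "ob pr P \<in> qObj pr R" "eqrel R (ob pr (ob pr P)) (eqv pr P)" "mm P \<in> qObj pr R"
    "Leq R (ob pr (ob pr P)) (ob pr (ob pr P)) (eqv pr (ob pr P)) (eqv pr P)"
  using qObjD(2)[OF P] R by (auto simp: Q0_eqrel)

text \<open>An arrow \<open>((X, \<rho>), \<sigma>) \<rightarrow> ((X', \<rho>'), \<sigma>')\<close> respects the inner and the outer relations; as a
  representative it is typed both between the inner pairs and between their quotients.\<close>

lemma Hom_TT:
  assumes R: "relational_doctrine R"
  shows "f \<in> Hom (Q0 pr (TD R)) P Q \<longleftrightarrow> f \<in> Hom (TD R) (ob pr P) (ob pr Q)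
    \<and> f \<in> Hom (Q0 pr R) (mm P) (mm Q) \<and> P \<in> qObj pr (TD R) \<and> Q \<in> qObj pr (TD R)"
  using mm_facts[OF R] R by (auto simp: Q0_Hom[of _ pr "TD R"] Q0_Hom[of f pr R "mm P" "mm Q"])
    (auto simp: Q0_Hom relational_doctrine.E0_Hom)

lemma Rel_TT:
  assumes R: "relational_doctrine R" and a: "\<alpha> \<in> Rel (Q0 pr (TD R)) P Q"
  shows "\<alpha> \<in> Rel (Q0 pr R) (mm P) (mm Q)"
  using a mm_facts(2)[OF R] R by (auto simp: Q0_Rel)

lemma approx_TT: "approx (Q0 pr (TD R)) P Q f g \<longleftrightarrow> approx (Q0 pr R) (mm P) (mm Q) f g"
  by (simp add: approx_def)

lemma cls_cls_TT [simp]: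
  assumes R [simp]: "relational_doctrine R" and f [simp]: "f \<in> Hom (Q0 pr (TD R)) P Q"
  shows "cls (Q0 pr R) (mm P) (mm Q) (cls (Q0 pr (TD R)) P Q f) = cls (Q0 pr R) (mm P) (mm Q) f"
proof -
  interpret Q: relational_doctrine "Q0 pr R" by simp
  interpret QT: relational_doctrine "Q0 pr (TD R)" by simp
  have "approx (Q0 pr R) (mm P) (mm Q) (cls (Q0 pr (TD R)) P Q f) f"
    using QT.cls_approx[OF f] by (simp add: approx_TT)
  moreover have "f \<in> Hom (Q0 pr R) (mm P) (mm Q)" "cls (Q0 pr (TD R)) P Q f \<in> Hom (Q0 pr R) (mm P) (mm Q)"
    using f QT.cls_Hom[OF f] unfolding Hom_TT[OF R] by simp_all
  ultimately show ?thesis by (intro Q.cls_eqI)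
qed

lemma cls_TT [simp]:
  assumes R [simp]: "relational_doctrine R" and P: "P \<in> qObj pr (TD R)" "Q \<in> qObj pr (TD R)"
    and f: "f \<in> Hom (Q0 pr R) (ob pr P) (ob pr Q)" "f \<in> Hom (Q0 pr R) (mm P) (mm Q)"
  shows "cls (Q0 pr R) (ob pr P) (ob pr Q) f \<in> Hom (Q0 pr (TD R)) P Q"
    "cls (Q0 pr R) (mm P) (mm Q) (cls (Q0 pr R) (ob pr P) (ob pr Q) f) = cls (Q0 pr R) (mm P) (mm Q) f"
  using cls_coarsen[OF R f] mm_facts[OF R P(1)] mm_facts[OF R P(2)] P f(1)
  by (simp_all add: Hom_TT[OF R])

lemma Hom_TT_D:
  assumes R [simp]: "relational_doctrine R" and f: "f \<in> Hom (TD (TD R)) P Q"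
  shows "f \<in> Hom (Q0 pr (TD R)) P Q" "f \<in> Hom (Q0 pr R) (ob pr P) (ob pr Q)" "f \<in> Hom (Q0 pr R) (mm P) (mm Q)"
    "P \<in> qObj pr (TD R)" "Q \<in> qObj pr (TD R)" "f \<in> Hom R (ob pr (ob pr P)) (ob pr (ob pr Q))"
proof -
  show 1: "f \<in> Hom (Q0 pr (TD R)) P Q" using Hom_E0_D[OF _ f] by simp
  then show 2: "f \<in> Hom (Q0 pr R) (ob pr P) (ob pr Q)" "f \<in> Hom (Q0 pr R) (mm P) (mm Q)"
    "P \<in> qObj pr (TD R)" "Q \<in> qObj pr (TD R)"
    by (auto simp: Hom_TT[OF R] relational_doctrine.E0_Hom)
  show "f \<in> Hom R (ob pr (ob pr P)) (ob pr (ob pr Q))" using 2 by (simp add: Q0_Hom)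
qed

lemma rd_arrow_mult [simp]:
  assumes R [simp]: "relational_doctrine R"
  shows "rd_arrow (mult_eq pr R)"
proof -
  let ?m = "mult_eq pr R"
  interpret relational_doctrine R by fact
  interpret Q: relational_doctrine "Q0 pr R" by simp
  interpret T: relational_doctrine "TD R" by simp
  interpret TT: relational_doctrine "TD (TD R)" by simp
  note mm = mm_facts[OF R] and H = Hom_TT_D[OF R]
  have I: "Idn R (ob pr (ob pr P)) \<in> Hom (Q0 pr R) (ob pr P) (ob pr P)" "Idn R (ob pr (ob pr P)) \<in> Hom (Q0 pr R) (mm P) (mm P)"
    if "P \<in> qObj pr (TD R)" for P
    using Q.Idn_Hom[of "ob pr P"] Q.Idn_Hom[of "mm P"] mm[OF that] by simp_all
  have C: "Comp R (ob pr (ob pr P)) (ob pr (ob pr Q)) (ob pr (ob pr S)) g f \<in> Hom (Q0 pr R) (ob pr P) (ob pr S)"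
    "Comp R (ob pr (ob pr P)) (ob pr (ob pr Q)) (ob pr (ob pr S)) g f \<in> Hom (Q0 pr R) (mm P) (mm S)"
    if "f \<in> Hom (TD (TD R)) P Q" "g \<in> Hom (TD (TD R)) Q S" for f g P Q S
    using Q.Comp_Hom[OF H(2)[OF that(1)] H(2)[OF that(2)]] Q.Comp_Hom[OF H(3)[OF that(1)] H(3)[OF that(2)]] by simp_all
  have TI: "cls (Q0 pr (TD R)) P P (cls (Q0 pr R) (ob pr P) (ob pr P) (Idn R (ob pr (ob pr P)))) \<in> Hom (TD (TD R)) P P"
    if "P \<in> qObj pr (TD R)" for P using TT.Idn_Hom[of P] that by simp
  have TC: "cls (Q0 pr (TD R)) P S (cls (Q0 pr R) (ob pr P) (ob pr S)
        (Comp R (ob pr (ob pr P)) (ob pr (ob pr Q)) (ob pr (ob pr S)) g f)) \<in> Hom (TD (TD R)) P S"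
    if "f \<in> Hom (TD (TD R)) P Q" "g \<in> Hom (TD (TD R)) Q S" for f g P Q S using TT.Comp_Hom[OF that] by simp
  have L: "P \<in> qObj pr (TD R)" "Q \<in> qObj pr (TD R)" "\<alpha> \<in> Rel (Q0 pr R) (mm P) (mm Q)"
    if "\<alpha> \<in> Rel (Q0 pr (TD R)) P Q" for \<alpha> P Q
    using that Rel_TT[OF R that] by (auto simp: Q0_Rel)
  have TR: "Reix R (ob pr (ob pr P)) (ob pr (ob pr Q)) (ob pr (ob pr A)) (ob pr (ob pr B)) f g \<alpha> \<in> Rel (Q0 pr (TD R)) P Q"
    if "f \<in> Hom (TD (TD R)) P A" "g \<in> Hom (TD (TD R)) Q B" "\<alpha> \<in> Rel (Q0 pr (TD R)) A B" for f g P Q A B \<alpha>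
    using TT.Reix_Rel[of f P A g Q B \<alpha>] that by simp
  have TDi: "eqv pr P \<in> Rel (Q0 pr (TD R)) P P" if "P \<in> qObj pr (TD R)" for P
    using TT.Diag_Rel[of P] that by simp
  have TS: "Seq R (ob pr (ob pr P)) (ob pr (ob pr Q)) (ob pr (ob pr S)) \<alpha> \<beta> \<in> Rel (Q0 pr (TD R)) P S"
    if "\<alpha> \<in> Rel (Q0 pr (TD R)) P Q" "\<beta> \<in> Rel (Q0 pr (TD R)) Q S" for \<alpha> \<beta> P Q S
    using TT.Seq_Rel[of \<alpha> P Q \<beta> S] that by simp
  have TV: "Conv R (ob pr (ob pr P)) (ob pr (ob pr Q)) \<alpha> \<in> Rel (Q0 pr (TD R)) Q P"
    if "\<alpha> \<in> Rel (Q0 pr (TD R)) P Q" for \<alpha> P Q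
    using TT.Conv_Rel[of \<alpha> P Q] that by simp
  show ?thesis
    unfolding rd_arrow_def rd_arrow_axioms_def
  proof (intro conjI allI impI)
    show "omap ?m \<in> extensional (Obj (Dom ?m))" "amap ?m X Y \<in> extensional (Hom (Dom ?m) X Y)"
      "rmap ?m X Y \<in> extensional (Rel (Dom ?m) X Y)" for X Y by (simp_all add: mult_eq_def Let_def)
    fix P assume "P \<in> Obj (Dom ?m)"
    then have P [simp]: "P \<in> qObj pr (TD R)" by simp
    show "omap ?m P \<in> Obj (Cod ?m)" using mm[OF P] by simp
    show "amap ?m P P (Idn (Dom ?m) P) = Idn (Cod ?m) (omap ?m P)" using TI[OF P] I[OF P] by simp
    show "rmap ?m P P (Diag (Dom ?m) P) = Diag (Cod ?m) (omap ?m P)" using TDi[OF P] by simp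
  next
    fix P Q f assume f: "f \<in> Hom (Dom ?m) P Q"
    then have f: "f \<in> Hom (TD (TD R)) P Q" by simp
    show "amap ?m P Q f \<in> Hom (Cod ?m) (omap ?m P) (omap ?m Q)" using f H[OF f] by simp
  next
    fix P Q S f g assume "f \<in> Hom (Dom ?m) P Q" "g \<in> Hom (Dom ?m) Q S"
    then have f: "f \<in> Hom (TD (TD R)) P Q" and g: "g \<in> Hom (TD (TD R)) Q S" by simp_all
    show "amap ?m P S (Comp (Dom ?m) P Q S g f) = Comp (Cod ?m) (omap ?m P) (omap ?m Q) (omap ?m S) (amap ?m Q S g) (amap ?m P Q f)"
      using TC[OF f g] C[OF f g] f g H[OF f] H[OF g] by simp
  next
    fix P Q A B f g \<alpha> assume "f \<in> Hom (Dom ?m) P A" "g \<in> Hom (Dom ?m) Q B" "\<alpha> \<in> Rel (Dom ?m) A B"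
    then have f: "f \<in> Hom (TD (TD R)) P A" and g: "g \<in> Hom (TD (TD R)) Q B" and a: "\<alpha> \<in> Rel (Q0 pr (TD R)) A B" by simp_all
    show "rmap ?m P Q (Reix (Dom ?m) P Q A B f g \<alpha>) =
       Reix (Cod ?m) (omap ?m P) (omap ?m Q) (omap ?m A) (omap ?m B) (amap ?m P A f) (amap ?m Q B g) (rmap ?m A B \<alpha>)"
      using TR[OF f g a] f g a H[OF f] H[OF g] L[OF a] by simp
  qed (use L TS TV in \<open>auto\<close>)
qed

lemma cls_cls_TT' [simp]:
  "relational_doctrine R \<Longrightarrow> f \<in> Hom (Q0 pr (TD R)) P Q \<Longrightarrow> A = mm P \<Longrightarrow> B = mm Q
    \<Longrightarrow> cls (Q0 pr R) A B (cls (Q0 pr (TD R)) P Q f) = cls (Q0 pr R) A B f"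
  by simp

lemmas cls_coarsen_simp [simp] = cls_coarsen(2)

lemma qObj_facts:
  assumes R: "relational_doctrine R" and P: "P \<in> qObj pr R"
  shows "ob pr P \<in> Obj R" "eqv pr P \<in> Rel R (ob pr P) (ob pr P)" "eqrel R (ob pr P) (eqv pr P)"
    "Leq R (ob pr P) (ob pr P) (Diag R (ob pr P)) (eqv pr P)" "pr (ob pr P, eqv pr P) = P"
    "eqv pr P \<in> Rel (Q0 pr R) P P" "eqrel (Q0 pr R) P (eqv pr P)" "Leq R (ob pr P) (ob pr P) (eqv pr P) (eqv pr P)"
proof -
  interpret relational_doctrine R by fact
  interpret Q: relational_doctrine "Q0 pr R" using R by simp
  show "ob pr P \<in> Obj R" "eqv pr P \<in> Rel R (ob pr P) (ob pr P)" "eqrel R (ob pr P) (eqv pr P)"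
    "Leq R (ob pr P) (ob pr P) (Diag R (ob pr P)) (eqv pr P)" "pr (ob pr P, eqv pr P) = P"
    "Leq R (ob pr P) (ob pr P) (eqv pr P) (eqv pr P)"
    using qObjD[OF P] eqrelD[OF qObjD(2)[OF P]] by (auto simp: Leq_refl)
  show "eqv pr P \<in> Rel (Q0 pr R) P P" "eqrel (Q0 pr R) P (eqv pr P)"
    using Q.Diag_Rel[of P] Q.eqrel_Diag[of P] P by simp_all
qed

text \<open>Both sides send \<open>f\<close> to the class of \<open>F f\<close> between the quotients; they differ by an intermediate choice of a
  representative between the inner pairs, removed by \<open>cls_coarsen\<close>.\<close>

lemma mult_nat1:
  assumes F [simp]: "rd_arrow F" "Dom F = R" "Cod F = S"
  shows "rd1_comp (E1 (Q1 pr F)) (mult_eq pr R) = rd1_comp (mult_eq pr S) (E1 (Q1 pr (E1 (Q1 pr F))))"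
proof -
  have R [simp]: "relational_doctrine R" and S [simp]: "relational_doctrine S" using rd_arrow_doctrine[OF F(1)] by simp_all
  have O: "omap (E1 (Q1 pr (E1 (Q1 pr F)))) P \<in> qObj pr (TD S)" if "P \<in> qObj pr (TD R)" for P
    using rd_arrow_simps(1)[of "E1 (Q1 pr (E1 (Q1 pr F)))" P "TD (TD S)"] that by simp
  have O': "omap (E1 (Q1 pr (E1 (Q1 pr F)))) P = pr (pr (omap F (ob pr (ob pr P)), rmap F (ob pr (ob pr P)) (ob pr (ob pr P)) (eqv pr (ob pr P))),
      rmap F (ob pr (ob pr P)) (ob pr (ob pr P)) (eqv pr P))" if P: "P \<in> qObj pr (TD R)" for P
    using P mm_facts[OF R P] qObj_facts(2)[OF _ P] by simp
  have H: "ob pr P \<in> qObj pr R" "P \<in> qObj pr (TD R)" "mm P \<in> qObj pr R" if "P \<in> qObj pr (TD R)" for P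
    using mm_facts[OF R that] that by simp_all
  show ?thesis
  proof (rule rd1_eqI)
    fix P assume "P \<in> Obj (Dom (rd1_comp (E1 (Q1 pr F)) (mult_eq pr R)))"
    then have P [simp]: "P \<in> qObj pr (TD R)" by simp
    show "omap (rd1_comp (E1 (Q1 pr F)) (mult_eq pr R)) P = omap (rd1_comp (mult_eq pr S) (E1 (Q1 pr (E1 (Q1 pr F))))) P"
      using mult_eq_sel(3)[OF O[OF P], unfolded O'[OF P]] O'[OF P] H[OF P] by simp
  next
    fix P Q f assume "f \<in> Hom (Dom (rd1_comp (E1 (Q1 pr F)) (mult_eq pr R))) P Q"
    then have f: "f \<in> Hom (TD (TD R)) P Q" by simp
    note D = Hom_TT_D[OF R f]
    let ?A = "omap (E1 (Q1 pr (E1 (Q1 pr F)))) P" and ?B = "omap (E1 (Q1 pr (E1 (Q1 pr F)))) Q"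
    let ?g = "amap F (ob pr (ob pr P)) (ob pr (ob pr Q)) f"
    have fT: "f \<in> Hom (TD R) (ob pr P) (ob pr Q)" using D(1) by (simp add: Hom_TT)
    have "amap (Q1 pr (E1 (Q1 pr F))) P Q f \<in> Hom (Q0 pr (TD S)) ?A ?B"
      by (rule rd_arrow_simps(2)) (use D in simp_all)
    also have 1: "amap (Q1 pr (E1 (Q1 pr F))) P Q f = cls (Q0 pr S) (omap (Q1 pr F) (ob pr P)) (omap (Q1 pr F) (ob pr Q)) ?g"
      using D fT by simp
    finally have 2: "cls (Q0 pr S) (omap (Q1 pr F) (ob pr P)) (omap (Q1 pr F) (ob pr Q)) ?g \<in> Hom (Q0 pr (TD S)) ?A ?B" .
    have 3: "?g \<in> Hom (Q0 pr S) (omap (Q1 pr F) (ob pr P)) (omap (Q1 pr F) (ob pr Q))"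
      "?g \<in> Hom (Q0 pr S) (omap (Q1 pr F) (mm P)) (omap (Q1 pr F) (mm Q))"
      using rd_arrow_simps(2)[of "Q1 pr F" f "ob pr P" "ob pr Q", OF _ _ refl refl refl]
        rd_arrow_simps(2)[of "Q1 pr F" f "mm P" "mm Q", OF _ _ refl refl refl] D H[OF D(4)] H[OF D(5)] by simp_all
    have o: "omap (Q1 pr F) (ob pr P) = pr (omap F (ob pr (ob pr P)), rmap F (ob pr (ob pr P)) (ob pr (ob pr P)) (eqv pr (ob pr P)))"
      "omap (Q1 pr F) (mm P) = pr (omap F (ob pr (ob pr P)), rmap F (ob pr (ob pr P)) (ob pr (ob pr P)) (eqv pr P))"
      if "P \<in> qObj pr (TD R)" for P using H[OF that] by simp_all
    have le: "Leq S (omap F (ob pr (ob pr P))) (omap F (ob pr (ob pr P)))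
       (rmap F (ob pr (ob pr P)) (ob pr (ob pr P)) (eqv pr (ob pr P))) (rmap F (ob pr (ob pr P)) (ob pr (ob pr P)) (eqv pr P))"
      if P: "P \<in> qObj pr (TD R)" for P
      using rd_arrow_mono[OF F(1), of "eqv pr (ob pr P)" "ob pr (ob pr P)" "ob pr (ob pr P)" "eqv pr P"] mm_facts[OF R P]
        qObj_facts[OF R H(1)[OF P]] relational_doctrine.eqrelD(1)[OF R mm_facts(2)[OF R P]] by simp
    have "amap (rd1_comp (mult_eq pr S) (E1 (Q1 pr (E1 (Q1 pr F))))) P Q f
      = amap (mult_eq pr S) ?A ?B (cls (Q0 pr (TD S)) ?A ?B (amap (Q1 pr (E1 (Q1 pr F))) P Q f))"
      using f by simp
    also have "\<dots> = cls (Q0 pr S) (mm ?A) (mm ?B) (cls (Q0 pr S) (omap (Q1 pr F) (ob pr P)) (omap (Q1 pr F) (ob pr Q)) ?g)"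
      unfolding 1 using 2 by simp
    also have "\<dots> = cls (Q0 pr S) (omap (Q1 pr F) (mm P)) (omap (Q1 pr F) (mm Q)) ?g"
      using 3 le[OF D(4)] le[OF D(5)] unfolding O'[OF D(4)] O'[OF D(5)] o[OF D(4)] o[OF D(5)] by simp
    also have "\<dots> = amap (rd1_comp (E1 (Q1 pr F)) (mult_eq pr R)) P Q f"
      using f D H[OF D(4)] H[OF D(5)] by simp
    finally show "amap (rd1_comp (E1 (Q1 pr F)) (mult_eq pr R)) P Q f = amap (rd1_comp (mult_eq pr S) (E1 (Q1 pr (E1 (Q1 pr F))))) P Q f"
      by simp
  next
    fix P Q \<alpha> assume "\<alpha> \<in> Rel (Dom (rd1_comp (E1 (Q1 pr F)) (mult_eq pr R))) P Q"
    then have a: "\<alpha> \<in> Rel (Q0 pr (TD R)) P Q" by simp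
    have P: "P \<in> qObj pr (TD R)" "Q \<in> qObj pr (TD R)" "\<alpha> \<in> Rel (Q0 pr R) (ob pr P) (ob pr Q)" using Q0_RelD[OF _ a] by simp_all
    have "rmap (Q1 pr (E1 (Q1 pr F))) P Q \<alpha> \<in> Rel (Q0 pr (TD S)) (omap (E1 (Q1 pr (E1 (Q1 pr F)))) P) (omap (E1 (Q1 pr (E1 (Q1 pr F)))) Q)"
      by (rule rd_arrow_simps(3)) (use a in simp_all)
    then show "rmap (rd1_comp (E1 (Q1 pr F)) (mult_eq pr R)) P Q \<alpha> = rmap (rd1_comp (mult_eq pr S) (E1 (Q1 pr (E1 (Q1 pr F))))) P Q \<alpha>"
      using a P Rel_TT[OF R a] by simp
  qed simp_all
qed

text \<open>Equality of classes of arrows between \<open>((X, \<rho>), \<sigma>)\<close> and \<open>((X', \<rho>'), \<sigma>')\<close> tests \<open>\<sigma>\<close> and \<open>\<sigma>'\<close> only, which are the relations of the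
  quotients.\<close>

lemma mult_faithful:
  assumes R [simp]: "relational_doctrine R" and f: "f \<in> Hom (TD (TD R)) P Q" and g: "g \<in> Hom (TD (TD R)) P Q"
    and eq: "amap (mult_eq pr R) P Q f = amap (mult_eq pr R) P Q g"
  shows "f = g"
proof -
  interpret Q: relational_doctrine "Q0 pr R" by simp
  interpret QT: relational_doctrine "Q0 pr (TD R)" by simp
  note F = Hom_TT_D[OF R f] and G = Hom_TT_D[OF R g]
  have "approx (Q0 pr R) (mm P) (mm Q) f g" using eq f g F G by (simp add: Q.cls_eq_iff)
  then have "approx (Q0 pr (TD R)) P Q f g" by (simp only: approx_TT)
  then have "cls (Q0 pr (TD R)) P Q f = cls (Q0 pr (TD R)) P Q g" using QT.cls_eqI[OF F(1) G(1)] by simp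
  then show ?thesis using Hom_E0_D(2)[OF _ f] Hom_E0_D(2)[OF _ g] by simp
qed

lemma mult_nat2:
  assumes a [simp]: "rd_cell a" "Dom (Sarr a) = R" "Cod (Sarr a) = S"
  shows "rwhisk RD (E2 (Q2 pr a)) (mult_eq pr R) = lwhisk RD (mult_eq pr S) (E2 (Q2 pr (E2 (Q2 pr a))))"
proof (rule rd2_eqI)
  have R [simp]: "relational_doctrine R" and S [simp]: "relational_doctrine S"
    using rd_arrow_doctrine[OF rd_cell_arrow(1)[OF a(1)]] by simp_all
  have [simp]: "Dom (Tarr a) = R" "Cod (Tarr a) = S" using a by simp_all
  fix P assume "P \<in> Obj (Dom (Sarr (rwhisk RD (E2 (Q2 pr a)) (mult_eq pr R))))"
  then have P [simp]: "P \<in> qObj pr (TD R)" by simp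
  let ?F = "E1 (Q1 pr (E1 (Q1 pr (Sarr a))))" and ?G = "E1 (Q1 pr (E1 (Q1 pr (Tarr a))))"
  let ?A = "omap ?F P" and ?B = "omap ?G P" and ?c = "cpt a (ob pr (ob pr P))"
  let ?k = "cls (Q0 pr S) (omap (Q1 pr (Sarr a)) (ob pr P)) (omap (Q1 pr (Tarr a)) (ob pr P)) ?c"
  have m: "ob pr P \<in> qObj pr R" "mm P \<in> qObj pr R" "ob pr (ob pr P) \<in> Obj R" using mm_facts[OF R P] qObjD(1)[of "ob pr P" R] by simp_all
  have "cpt (Q2 pr (E2 (Q2 pr a))) P \<in> Hom (Q0 pr (TD S)) ?A ?B"
    by (rule rd_cell_simps(3)) simp_all
  also have "cpt (Q2 pr (E2 (Q2 pr a))) P = ?k" using m by simp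
  finally have k: "?k \<in> Hom (Q0 pr (TD S)) ?A ?B" .
  have c: "?c \<in> Hom (Q0 pr S) (omap (Q1 pr (Sarr a)) (ob pr P)) (omap (Q1 pr (Tarr a)) (ob pr P))"
    "?c \<in> Hom (Q0 pr S) (omap (Q1 pr (Sarr a)) (mm P)) (omap (Q1 pr (Tarr a)) (mm P))"
    using rd_cell_simps(3)[of "Q2 pr a" "ob pr P", OF _ _ refl refl refl] rd_cell_simps(3)[of "Q2 pr a" "mm P", OF _ _ refl refl refl] m
    by simp_all
  have o: "omap (Q1 pr F) (ob pr P) = pr (omap F (ob pr (ob pr P)), rmap F (ob pr (ob pr P)) (ob pr (ob pr P)) (eqv pr (ob pr P)))"
      "omap (Q1 pr F) (mm P) = pr (omap F (ob pr (ob pr P)), rmap F (ob pr (ob pr P)) (ob pr (ob pr P)) (eqv pr P))"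
      "mm (omap (E1 (Q1 pr (E1 (Q1 pr F)))) P) = omap (Q1 pr F) (mm P)"
      "Leq S (omap F (ob pr (ob pr P))) (omap F (ob pr (ob pr P)))
       (rmap F (ob pr (ob pr P)) (ob pr (ob pr P)) (eqv pr (ob pr P))) (rmap F (ob pr (ob pr P)) (ob pr (ob pr P)) (eqv pr P))"
    if F: "rd_arrow F" "Dom F = R" "Cod F = S" for F
    using F m qObj_facts(2)[OF _ P] rd_arrow_mono[OF F(1), of "eqv pr (ob pr P)" "ob pr (ob pr P)" "ob pr (ob pr P)" "eqv pr P"] mm_facts[OF R P]
        qObj_facts[OF R m(1)] relational_doctrine.eqrelD(1)[OF R mm_facts(2)[OF R P]] by simp_all
  have "cpt (lwhisk RD (mult_eq pr S) (E2 (Q2 pr (E2 (Q2 pr a))))) P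
     = amap (mult_eq pr S) ?A ?B (cls (Q0 pr (TD S)) ?A ?B (cpt (Q2 pr (E2 (Q2 pr a))) P))" by simp
  also have "\<dots> = cls (Q0 pr S) (mm ?A) (mm ?B) ?k" using k m by simp
  also have "\<dots> = cls (Q0 pr S) (omap (Q1 pr (Sarr a)) (mm P)) (omap (Q1 pr (Tarr a)) (mm P)) ?c"
  proof -
    have F: "rd_arrow (Sarr a)" "rd_arrow (Tarr a)" by simp_all
    show ?thesis
      unfolding o(3)[OF F(1) a(2,3)] o(3)[OF F(2) \<open>Dom (Tarr a) = R\<close> \<open>Cod (Tarr a) = S\<close>]
      using c o(1,2,4)[OF F(1) a(2,3)] o(1,2,4)[OF F(2) \<open>Dom (Tarr a) = R\<close> \<open>Cod (Tarr a) = S\<close>]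
      by (intro cls_coarsen(2)[OF S]) simp_all
  qed
  also have "\<dots> = cpt (rwhisk RD (E2 (Q2 pr a)) (mult_eq pr R)) P" using m by simp
  finally show "cpt (rwhisk RD (E2 (Q2 pr a)) (mult_eq pr R)) P = cpt (lwhisk RD (mult_eq pr S) (E2 (Q2 pr (E2 (Q2 pr a))))) P" by simp
next
  have R [simp]: "relational_doctrine R" and S [simp]: "relational_doctrine S"
    using rd_arrow_doctrine[OF rd_cell_arrow(1)[OF a(1)]] by simp_all
  have [simp]: "Dom (Tarr a) = R" "Cod (Tarr a) = S" using a by simp_all
  show "rd_cell (rwhisk RD (E2 (Q2 pr a)) (mult_eq pr R))" "rd_cell (lwhisk RD (mult_eq pr S) (E2 (Q2 pr (E2 (Q2 pr a)))))"
   "Sarr (rwhisk RD (E2 (Q2 pr a)) (mult_eq pr R)) = Sarr (lwhisk RD (mult_eq pr S) (E2 (Q2 pr (E2 (Q2 pr a)))))"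
   "Tarr (rwhisk RD (E2 (Q2 pr a)) (mult_eq pr R)) = Tarr (lwhisk RD (mult_eq pr S) (E2 (Q2 pr (E2 (Q2 pr a)))))"
    by (simp_all add: mult_nat1)
qed

lemma two_natural_mult: "two_natural RD RD (fun_comp (T_eq pr) (T_eq pr)) (T_eq pr) (mult_eq pr)"
proof -
  interpret T: two_functor RD RD "T_eq pr" by (rule two_functor_T)
  interpret TT: two_functor RD RD "fun_comp (T_eq pr) (T_eq pr)" by (rule two_functor_comp[OF two_functor_T two_functor_T])
  show ?thesis
    by unfold_locales (auto simp: hom1_def hom2_def mult_nat1 mult_nat2)
qed

lemma mult_unit_eq:
  assumes R [simp]: "relational_doctrine R"
  shows "rd1_comp (mult_eq pr R) (unit_eq pr (TD R)) = rd1_id (TD R)"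
proof (rule rd1_eqI)
  fix P Q f assume "f \<in> Hom (Dom (rd1_comp (mult_eq pr R) (unit_eq pr (TD R)))) P Q"
  then have f: "f \<in> Hom (TD R) P Q" by simp
  then have P: "P \<in> qObj pr R" "Q \<in> qObj pr R" using Hom_E0_Obj[OF _ f] by simp_all
  have h: "f \<in> Hom (Q0 pr (TD R)) (pr (P, eqv pr P)) (pr (Q, eqv pr Q))"
    using unit_Hom[of "TD R" f P Q] f by simp
  show "amap (rd1_comp (mult_eq pr R) (unit_eq pr (TD R))) P Q f = amap (rd1_id (TD R)) P Q f"
    using f P h qObj_facts[OF R P(1)] qObj_facts[OF R P(2)] Hom_E0_D[OF _ f] by simp
next
  fix P assume "P \<in> Obj (Dom (rd1_comp (mult_eq pr R) (unit_eq pr (TD R))))"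
  then have P: "P \<in> qObj pr R" by simp
  then show "omap (rd1_comp (mult_eq pr R) (unit_eq pr (TD R))) P = omap (rd1_id (TD R)) P"
    using qObj_facts[OF R P] by simp
next
  fix P Q \<alpha> assume "\<alpha> \<in> Rel (Dom (rd1_comp (mult_eq pr R) (unit_eq pr (TD R)))) P Q"
  then have a: "\<alpha> \<in> Rel (TD R) P Q" by simp
  then have P: "P \<in> qObj pr R" "Q \<in> qObj pr R" using Q0_RelD[OF R, of \<alpha> P Q] by simp_all
  show "rmap (rd1_comp (mult_eq pr R) (unit_eq pr (TD R))) P Q \<alpha> = rmap (rd1_id (TD R)) P Q \<alpha>"
    using a P unit_Rel[of "TD R" \<alpha> P Q] by simp
qed simp_all

lemma mult_T_unit_eq:
  assumes R [simp]: "relational_doctrine R"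
  shows "rd1_comp (mult_eq pr R) (E1 (Q1 pr (unit_eq pr R))) = rd1_id (TD R)"
proof (rule rd1_eqI)
  let ?F = "E1 (Q1 pr (unit_eq pr R))"
  have F: "rd_arrow ?F" "rd_arrow (Q1 pr (unit_eq pr R))" by simp_all
  have o: "omap ?F P = pr (pr (ob pr P, Diag R (ob pr P)), eqv pr P)" "pr (pr (ob pr P, Diag R (ob pr P)), eqv pr P) \<in> qObj pr (TD R)"
    "omap (Q1 pr (unit_eq pr R)) P = pr (pr (ob pr P, Diag R (ob pr P)), eqv pr P)"
    if P: "P \<in> qObj pr R" for P
    using rd_arrow_simps(1)[OF F(1), of P "TD (TD R)"] P qObj_facts[OF R P] by simp_all
  { fix P assume "P \<in> Obj (Dom (rd1_comp (mult_eq pr R) ?F))"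
    then have P: "P \<in> qObj pr R" by simp
    then show "omap (rd1_comp (mult_eq pr R) ?F) P = omap (rd1_id (TD R)) P"
      using qObj_facts[OF R P] o[OF P] by simp }
  { fix P Q f assume "f \<in> Hom (Dom (rd1_comp (mult_eq pr R) ?F)) P Q"
    then have f: "f \<in> Hom (TD R) P Q" by simp
    then have P: "P \<in> qObj pr R" "Q \<in> qObj pr R" using Hom_E0_Obj[OF _ f] by simp_all
    have fR: "f \<in> Hom (Q0 pr R) P Q" "cls (Q0 pr R) P Q f = f" "f \<in> Hom R (ob pr P) (ob pr Q)"
      using Hom_E0_D[OF _ f] by (simp_all add: Q0_Hom)
    let ?k = "cls (Q0 pr R) (pr (ob pr P, Diag R (ob pr P))) (pr (ob pr Q, Diag R (ob pr Q))) f"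
    have "amap (Q1 pr (unit_eq pr R)) P Q f \<in> Hom (Q0 pr (TD R)) (omap (Q1 pr (unit_eq pr R)) P) (omap (Q1 pr (unit_eq pr R)) Q)"
      by (rule rd_arrow_simps(2)[OF F(2)]) (use fR in simp_all)
    then have h: "?k \<in> Hom (Q0 pr (TD R)) (pr (pr (ob pr P, Diag R (ob pr P)), eqv pr P)) (pr (pr (ob pr Q, Diag R (ob pr Q)), eqv pr Q))"
      using fR o[OF P(1)] o[OF P(2)] by simp
    show "amap (rd1_comp (mult_eq pr R) ?F) P Q f = amap (rd1_id (TD R)) P Q f"
      using f fR h o[OF P(1)] o[OF P(2)] qObj_facts[OF R P(1)] qObj_facts[OF R P(2)] by simp }
  { fix P Q \<alpha> assume "\<alpha> \<in> Rel (Dom (rd1_comp (mult_eq pr R) ?F)) P Q"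
    then have a: "\<alpha> \<in> Rel (Q0 pr R) P Q" by simp
    then have P: "P \<in> qObj pr R" "Q \<in> qObj pr R" "\<alpha> \<in> Rel R (ob pr P) (ob pr Q)" using Q0_RelD[OF R, of \<alpha> P Q] by simp_all
    have "rmap (Q1 pr (unit_eq pr R)) P Q \<alpha> \<in> Rel (Q0 pr (TD R)) (omap (Q1 pr (unit_eq pr R)) P) (omap (Q1 pr (unit_eq pr R)) Q)"
      by (rule rd_arrow_simps(3)[OF F(2)]) (use a in simp_all)
    then show "rmap (rd1_comp (mult_eq pr R) ?F) P Q \<alpha> = rmap (rd1_id (TD R)) P Q \<alpha>"
      using a P o[OF P(1)] o[OF P(2)] by simp }
qed simp_all

lemma mult_assoc_eq:
  assumes R [simp]: "relational_doctrine R"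
  shows "rd1_comp (mult_eq pr R) (E1 (Q1 pr (mult_eq pr R))) = rd1_comp (mult_eq pr R) (mult_eq pr (TD R))"
proof (rule rd1_eqI)
  let ?F = "E1 (Q1 pr (mult_eq pr R))"
  have TR [simp]: "relational_doctrine (TD R)" by simp
  have F: "rd_arrow ?F" "rd_arrow (Q1 pr (mult_eq pr R))" by simp_all
  have o: "omap ?F P = pr (mm (ob pr P), eqv pr P)" "pr (mm (ob pr P), eqv pr P) \<in> qObj pr (TD R)"
    "omap (Q1 pr (mult_eq pr R)) P = pr (mm (ob pr P), eqv pr P)" "mm P \<in> qObj pr (TD R)"
    if P: "P \<in> qObj pr (TD (TD R))" for P
    using rd_arrow_simps(1)[OF F(1), of P "TD (TD R)"] P mm_facts[OF TR P]
      relational_doctrine.eqrelD(1)[OF _ qObjD(2)[OF P]] by simp_all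
  { fix P assume "P \<in> Obj (Dom (rd1_comp (mult_eq pr R) ?F))"
    then have P: "P \<in> qObj pr (TD (TD R))" by simp
    then show "omap (rd1_comp (mult_eq pr R) ?F) P = omap (rd1_comp (mult_eq pr R) (mult_eq pr (TD R))) P"
      using o[OF P] by simp }
  { fix P Q f assume "f \<in> Hom (Dom (rd1_comp (mult_eq pr R) ?F)) P Q"
    then have f: "f \<in> Hom (TD (TD (TD R))) P Q" by simp
    note D = Hom_TT_D[OF TR f]
    have f1: "f \<in> Hom (TD (TD R)) (ob pr P) (ob pr Q)" using D(1) by (simp add: Q0_Hom[of f pr "TD (TD R)"])
    note D1 = Hom_TT_D[OF R f1]
    have f2: "f \<in> Hom (Q0 pr R) (mm (mm P)) (mm (mm Q))" using D(3) by (simp only: Hom_TT[OF R])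
    let ?k = "cls (Q0 pr R) (mm (ob pr P)) (mm (ob pr Q)) f"
    have "amap (Q1 pr (mult_eq pr R)) P Q f \<in> Hom (Q0 pr (TD R)) (omap (Q1 pr (mult_eq pr R)) P) (omap (Q1 pr (mult_eq pr R)) Q)"
      by (rule rd_arrow_simps(2)[OF F(2)]) (use D in simp_all)
    then have k: "?k \<in> Hom (Q0 pr (TD R)) (pr (mm (ob pr P), eqv pr P)) (pr (mm (ob pr Q), eqv pr Q))"
      using D(1) f1 o[OF D(4)] o[OF D(5)] by simp
    have le: "Leq R (ob pr (ob pr (ob pr P))) (ob pr (ob pr (ob pr P))) (eqv pr (ob pr P)) (eqv pr P)" if "P \<in> qObj pr (TD (TD R))" for P
      using mm_facts(4)[OF TR that] by simp
    show "amap (rd1_comp (mult_eq pr R) ?F) P Q f = amap (rd1_comp (mult_eq pr R) (mult_eq pr (TD R))) P Q f"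
      using f f1 f2 k D D1 o[OF D(4)] o[OF D(5)] le[OF D(4)] le[OF D(5)] by simp }
  { fix P Q \<alpha> assume "\<alpha> \<in> Rel (Dom (rd1_comp (mult_eq pr R) ?F)) P Q"
    then have a: "\<alpha> \<in> Rel (Q0 pr (TD (TD R))) P Q" by simp
    then have P: "P \<in> qObj pr (TD (TD R))" "Q \<in> qObj pr (TD (TD R))" "\<alpha> \<in> Rel (Q0 pr (TD R)) (ob pr P) (ob pr Q)" using Q0_RelD[OF _ a] by simp_all
    have "rmap (Q1 pr (mult_eq pr R)) P Q \<alpha> \<in> Rel (Q0 pr (TD R)) (omap (Q1 pr (mult_eq pr R)) P) (omap (Q1 pr (mult_eq pr R)) Q)"
      by (rule rd_arrow_simps(3)[OF F(2)]) (use a in simp_all)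
    then show "rmap (rd1_comp (mult_eq pr R) ?F) P Q \<alpha> = rmap (rd1_comp (mult_eq pr R) (mult_eq pr (TD R))) P Q \<alpha>"
      using a P o[OF P(1)] o[OF P(2)] Rel_TT[OF TR a] by simp }
qed simp_all

lemma two_monad_T: "two_monad RD (T_eq pr) (unit_eq pr) (mult_eq pr)"
proof -
  interpret T: two_functor RD RD "T_eq pr" by (rule two_functor_T)
  show ?thesis
    unfolding two_monad_def two_monad_axioms_def
    by (auto simp: two_functor_T two_natural_unit two_natural_mult mult_unit_eq mult_T_unit_eq mult_assoc_eq)
qed

section \<open>Lax idempotence\<close>

text \<open>The component at \<open>(X, \<rho>)\<close> is the identity of \<open>X\<close> read as an arrow \<open>((X, d), \<rho>) \<rightarrow> ((X, \<rho>), \<rho>)\<close>,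
  with one \<open>cls\<close> for each of the two completions.\<close>

definition Lam :: "('o, 'a, 'r) doctrine \<Rightarrow> ('o, 'a, 'r) rd2" where
  "Lam R = \<lparr>Sarr = E1 (Q1 pr (unit_eq pr R)), Tarr = unit_eq pr (TD R),
     cpt = (\<lambda>P \<in> qObj pr R. cls (Q0 pr (TD R)) (pr (pr (ob pr P, Diag R (ob pr P)), eqv pr P)) (pr (P, eqv pr P))
       (cls (Q0 pr R) (pr (ob pr P, Diag R (ob pr P))) P (Idn R (ob pr P))))\<rparr>"

lemma Lam_sel [simp]: "Sarr (Lam R) = E1 (Q1 pr (unit_eq pr R))" "Tarr (Lam R) = unit_eq pr (TD R)"
  by (simp_all add: Lam_def)

text \<open>The multiplication sends both ends of the component to \<open>(X, \<rho>)\<close>. By \<open>mult_faithful\<close> the component is the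
  only arrow between these ends that it sends to the identity, which is all that the laws below use.\<close>

lemma Lam_cpt:
  assumes R [simp]: "relational_doctrine R" and P: "P \<in> qObj pr R"
  shows "cpt (Lam R) P \<in> Hom (TD (TD R)) (omap (E1 (Q1 pr (unit_eq pr R))) P) (omap (unit_eq pr (TD R)) P)"
    "amap (mult_eq pr R) (omap (E1 (Q1 pr (unit_eq pr R))) P) (omap (unit_eq pr (TD R)) P) (cpt (Lam R) P) = Idn (TD R) P"
proof -
  let ?H = "pr (ob pr P, Diag R (ob pr P))" let ?I = "Idn R (ob pr P)"
  let ?A = "pr (?H, eqv pr P)" and ?B = "pr (P, eqv pr P)" let ?k = "cls (Q0 pr R) ?H P ?I"
  interpret relational_doctrine R by fact
  interpret Q: relational_doctrine "Q0 pr R" by simp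
  note F [simp] = qObj_facts[OF R P] and P [simp] = P
  have o: "omap (E1 (Q1 pr (unit_eq pr R))) P = ?A" "omap (unit_eq pr (TD R)) P = ?B"
    by simp_all
  have I: "?I \<in> Hom (Q0 pr R) ?H P" "?I \<in> Hom (Q0 pr R) P P"
    using Q.Idn_Hom[of P] by (simp_all add: Q0_Hom)
  have k: "?k \<in> Hom (Q0 pr R) P P" "cls (Q0 pr R) P P ?k = cls (Q0 pr R) P P ?I"
    by (rule cls_coarsen[OF R I]; simp)+
  have A: "?A \<in> qObj pr (TD R)" by (simp add: Q0_eqrel)
  have B: "?B \<in> qObj pr (TD R)" by simp
  have kk: "?k \<in> Hom (Q0 pr (TD R)) ?A ?B"
    using k I A B by (simp add: Hom_TT)
  show "cpt (Lam R) P \<in> Hom (TD (TD R)) (omap (E1 (Q1 pr (unit_eq pr R))) P) (omap (unit_eq pr (TD R)) P)"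
    unfolding o using kk by (simp add: Lam_def)
  show "amap (mult_eq pr R) (omap (E1 (Q1 pr (unit_eq pr R))) P) (omap (unit_eq pr (TD R)) P) (cpt (Lam R) P) = Idn (TD R) P"
    unfolding o using kk A B k by (simp add: Lam_def)
qed

lemma mult_unit_maps:
  assumes R [simp]: "relational_doctrine R"
  shows "f \<in> Hom (TD R) P Q \<Longrightarrow> amap (mult_eq pr R) (omap (E1 (Q1 pr (unit_eq pr R))) P) (omap (E1 (Q1 pr (unit_eq pr R))) Q)
       (amap (E1 (Q1 pr (unit_eq pr R))) P Q f) = f"
    "f \<in> Hom (TD R) P Q \<Longrightarrow> amap (mult_eq pr R) (omap (unit_eq pr (TD R)) P) (omap (unit_eq pr (TD R)) Q)
       (amap (unit_eq pr (TD R)) P Q f) = f"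
    "P \<in> qObj pr R \<Longrightarrow> omap (mult_eq pr R) (omap (E1 (Q1 pr (unit_eq pr R))) P) = P"
    "P \<in> qObj pr R \<Longrightarrow> omap (mult_eq pr R) (omap (unit_eq pr (TD R)) P) = P"
  using arg_cong[OF mult_T_unit_eq[OF R], of "\<lambda>F. amap F P Q f"] arg_cong[OF mult_unit_eq[OF R], of "\<lambda>F. amap F P Q f"]
    arg_cong[OF mult_T_unit_eq[OF R], of "\<lambda>F. omap F P"] arg_cong[OF mult_unit_eq[OF R], of "\<lambda>F. omap F P"]
  by (simp_all add: rd1_comp_def rd1_id_def)

text \<open>Naturality is tested after the multiplication, which turns both \<open>T \<eta>\<close> and \<open>\<eta> T\<close> into the identity 1-arrow
  and the components into identities. As the multiplication is the identity on relations, it also shows that reindexing along the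
  components changes no relation.\<close>

lemma rd_cell_Lam [simp]:
  assumes R [simp]: "relational_doctrine R"
  shows "rd_cell (Lam R)"
proof -
  let ?F = "E1 (Q1 pr (unit_eq pr R))" and ?G = "unit_eq pr (TD R)" and ?m = "mult_eq pr R"
  interpret T: relational_doctrine "TD R" by simp
  interpret TT: relational_doctrine "TD (TD R)" by simp
  have F: "rd_arrow ?F" "Dom ?F = TD R" "Cod ?F = TD (TD R)" and G: "rd_arrow ?G" "Dom ?G = TD R" "Cod ?G = TD (TD R)"
    and m: "rd_arrow ?m" "Dom ?m = TD (TD R)" "Cod ?m = TD R" by simp_all
  note L = Lam_cpt[OF R] and M = mult_unit_maps[OF R]
  show ?thesis
  proof (rule rd_cellI[OF F(1) G(1) F(2) G(2) F(3) G(3)])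
    show "cpt (Lam R) \<in> extensional (Obj (TD R))" by (simp add: Lam_def)
    fix P assume "P \<in> Obj (TD R)"
    then show "cpt (Lam R) P \<in> Hom (TD (TD R)) (omap ?F P) (omap ?G P)" using L(1)[of P] by simp
  next
    fix P Q f assume f: "f \<in> Hom (TD R) P Q" and P: "P \<in> Obj (TD R)" "Q \<in> Obj (TD R)"
    have q: "P \<in> qObj pr R" "Q \<in> qObj pr R" using P by simp_all
    have t: "amap ?F P Q f \<in> Hom (TD (TD R)) (omap ?F P) (omap ?F Q)" "amap ?G P Q f \<in> Hom (TD (TD R)) (omap ?G P) (omap ?G Q)"
      using rd_arrow.amap_Hom[OF F(1)] rd_arrow.amap_Hom[OF G(1)] f F(2,3) G(2,3) by metis+
    show "Comp (TD (TD R)) (omap ?F P) (omap ?F Q) (omap ?G Q) (cpt (Lam R) Q) (amap ?F P Q f) =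
       Comp (TD (TD R)) (omap ?F P) (omap ?G P) (omap ?G Q) (amap ?G P Q f) (cpt (Lam R) P)"
    proof (rule mult_faithful[OF R])
      show "Comp (TD (TD R)) (omap ?F P) (omap ?F Q) (omap ?G Q) (cpt (Lam R) Q) (amap ?F P Q f) \<in> Hom (TD (TD R)) (omap ?F P) (omap ?G Q)"
       "Comp (TD (TD R)) (omap ?F P) (omap ?G P) (omap ?G Q) (amap ?G P Q f) (cpt (Lam R) P) \<in> Hom (TD (TD R)) (omap ?F P) (omap ?G Q)"
        by (rule TT.Comp_Hom, use t L(1) q in blast, use t L(1) q in blast)+
      have "amap ?m (omap ?F P) (omap ?G Q) (Comp (TD (TD R)) (omap ?F P) (omap ?F Q) (omap ?G Q) (cpt (Lam R) Q) (amap ?F P Q f)) = f"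
        using rd_arrow.amap_Comp[OF m(1), unfolded m, OF t(1) L(1)[OF q(2)]]
        unfolding M(1)[OF f] L(2)[OF q(2)] M(3)[OF q(1)] M(3)[OF q(2)] M(4)[OF q(2)] using T.Idn_Comp[OF f] by simp
      moreover have "amap ?m (omap ?F P) (omap ?G Q) (Comp (TD (TD R)) (omap ?F P) (omap ?G P) (omap ?G Q) (amap ?G P Q f) (cpt (Lam R) P)) = f"
        using rd_arrow.amap_Comp[OF m(1), unfolded m, OF L(1)[OF q(1)] t(2)]
        unfolding M(2)[OF f] L(2)[OF q(1)] M(3)[OF q(1)] M(4)[OF q(1)] M(4)[OF q(2)] using T.Comp_Idn[OF f] by simp
      ultimately show "amap ?m (omap ?F P) (omap ?G Q) (Comp (TD (TD R)) (omap ?F P) (omap ?F Q) (omap ?G Q) (cpt (Lam R) Q) (amap ?F P Q f))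
         = amap ?m (omap ?F P) (omap ?G Q) (Comp (TD (TD R)) (omap ?F P) (omap ?G P) (omap ?G Q) (amap ?G P Q f) (cpt (Lam R) P))"
        by simp
    qed
  next
    fix P Q \<alpha> assume a: "\<alpha> \<in> Rel (TD R) P Q" and P: "P \<in> Obj (TD R)" "Q \<in> Obj (TD R)"
    have q: "P \<in> qObj pr R" "Q \<in> qObj pr R" using P by simp_all
    have aR: "\<alpha> \<in> Rel R (ob pr P) (ob pr Q)" using a Q0_RelD(1)[OF R] by simp
    have ra: "rmap ?F P Q \<alpha> = \<alpha>" "rmap ?G P Q \<alpha> = \<alpha>" using a aR by simp_all
    have aG: "\<alpha> \<in> Rel (TD (TD R)) (omap ?G P) (omap ?G Q)"
      using rd_arrow.rmap_Rel[OF G(1), unfolded G, OF a] ra by simp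
    have aF: "\<alpha> \<in> Rel (TD (TD R)) (omap ?F P) (omap ?F Q)"
      using rd_arrow.rmap_Rel[OF F(1), unfolded F, OF a] ra by simp
    let ?x = "Reix (TD (TD R)) (omap ?F P) (omap ?F Q) (omap ?G P) (omap ?G Q) (cpt (Lam R) P) (cpt (Lam R) Q) \<alpha>"
    have x: "?x \<in> Rel (TD (TD R)) (omap ?F P) (omap ?F Q)"
      using TT.Reix_Rel[OF L(1)[OF q(1)] L(1)[OF q(2)] aG] .
    have mi: "rmap ?m A B \<beta> = \<beta>" if "\<beta> \<in> Rel (TD (TD R)) A B" for A B \<beta> using that by simp
    have "?x = \<alpha>"
      using rd_arrow.rmap_Reix[OF m(1), unfolded m, OF L(1)[OF q(1)] L(1)[OF q(2)] aG]
      unfolding mi[OF x] mi[OF aG] L(2)[OF q(1)] L(2)[OF q(2)] M(3)[OF q(1)] M(4)[OF q(1)] M(3)[OF q(2)] M(4)[OF q(2)]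
      using T.Reix_Idn[OF a] by simp
    then show "Leq (TD (TD R)) (omap ?F P) (omap ?F Q) (rmap ?F P Q \<alpha>)
       (Reix (TD (TD R)) (omap ?F P) (omap ?F Q) (omap ?G P) (omap ?G Q) (cpt (Lam R) P) (cpt (Lam R) Q) (rmap ?G P Q \<alpha>))"
      unfolding ra using TT.Leq_refl[OF aF] by simp
  qed simp_all
qed

lemma lax_idempotent_T: "lax_idempotent RD (T_eq pr) (unit_eq pr) (mult_eq pr)"
proof -
  interpret M: two_monad RD "T_eq pr" "unit_eq pr" "mult_eq pr" by (rule two_monad_T)
  have un: "rd1_comp (E1 (Q1 pr F)) (unit_eq pr R) = rd1_comp (unit_eq pr S) F"
    if "rd_arrow F" "Dom F = R" "Cod F = S" for F R S
    using M.unit.n_nat1[of F R S] that by (simp add: hom1_def)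
  have Tc: "E1 (Q1 pr (rd1_comp G F)) = rd1_comp (E1 (Q1 pr G)) (E1 (Q1 pr F))"
    if "rd_arrow F" "rd_arrow G" "Dom G = Cod F" for F G
    using M.T.F1_Cmp[of F G] that by simp
  have nat: "lwhisk RD (E1 (Q1 pr (E1 (Q1 pr F)))) (Lam R) = rwhisk RD (Lam S) (E1 (Q1 pr F))"
    if F: "rd_arrow F" "Dom F = R" "Cod F = S" for F R S
  proof (rule rd2_eqI)
    note [simp] = F
    have R [simp]: "relational_doctrine R" and S [simp]: "relational_doctrine S" using rd_arrow_doctrine[OF F(1)] by simp_all
    let ?TF = "E1 (Q1 pr F)" let ?TTF = "E1 (Q1 pr ?TF)"
    show s: "Sarr (lwhisk RD ?TTF (Lam R)) = Sarr (rwhisk RD (Lam S) ?TF)" "Tarr (lwhisk RD ?TTF (Lam R)) = Tarr (rwhisk RD (Lam S) ?TF)"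
      using un[OF F] by (simp_all add: Tc[symmetric] un)
    show c: "rd_cell (lwhisk RD ?TTF (Lam R))" "rd_cell (rwhisk RD (Lam S) ?TF)" by simp_all
    fix P assume "P \<in> Obj (Dom (Sarr (lwhisk RD ?TTF (Lam R))))"
    then have P: "P \<in> qObj pr R" by simp
    have TF: "rd_arrow ?TF" "Dom ?TF = TD R" "Cod ?TF = TD S" and TTF: "rd_arrow ?TTF" "Dom ?TTF = TD (TD R)" "Cod ?TTF = TD (TD S)"
      by simp_all
    let ?FP = "omap ?TF P" let ?A = "omap (E1 (Q1 pr (unit_eq pr S))) ?FP" and ?B = "omap (unit_eq pr (TD S)) ?FP"
    let ?AR = "omap (E1 (Q1 pr (unit_eq pr R))) P" and ?BR = "omap (unit_eq pr (TD R)) P"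
    have FP: "?FP \<in> qObj pr S" using rd_arrow.omap_Obj[OF TF(1), unfolded TF, of P] P by simp
    have A0: "omap ?TTF ?AR = ?A" "omap ?TTF ?BR = ?B"
      using arg_cong[OF s(1), of "\<lambda>F. omap F P"] arg_cong[OF s(2), of "\<lambda>F. omap F P"] P by (simp_all add: rd1_comp_def)
    note L0 = Lam_cpt[OF R P] and L1 = Lam_cpt[OF S FP]
    have h: "amap ?TTF ?AR ?BR (cpt (Lam R) P) \<in> Hom (TD (TD S)) ?A ?B"
      using rd_arrow.amap_Hom[OF TTF(1), unfolded TTF, OF L0(1)] unfolding A0 .
    have "amap ?TTF ?AR ?BR (cpt (Lam R) P) = cpt (Lam S) ?FP"
    proof (rule mult_faithful[OF S h L1(1)])
      have "amap (mult_eq pr S) ?A ?B (amap ?TTF ?AR ?BR (cpt (Lam R) P))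
         = amap (rd1_comp (mult_eq pr S) ?TTF) ?AR ?BR (cpt (Lam R) P)"
        using L0(1) by (simp only: rd1_comp_simps TTF A0)
      also have "\<dots> = amap (rd1_comp ?TF (mult_eq pr R)) ?AR ?BR (cpt (Lam R) P)"
        using mult_nat1[OF F] by simp
      also have "\<dots> = amap ?TF P P (Idn (TD R) P)"
        using L0 mult_unit_maps(3,4)[OF R P] by (simp only: rd1_comp_simps mult_eq_sel(1))
      also have "\<dots> = Idn (TD S) ?FP"
        using rd_arrow.amap_Idn[OF TF(1), unfolded TF, of P] P by simp
      finally show "amap (mult_eq pr S) ?A ?B (amap ?TTF ?AR ?BR (cpt (Lam R) P)) = amap (mult_eq pr S) ?A ?B (cpt (Lam S) ?FP)"
        using L1(2) by simp
    qed
    moreover have "cpt (lwhisk RD ?TTF (Lam R)) P = amap ?TTF ?AR ?BR (cpt (Lam R) P)"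
      by (subst lwhisk_RD_simps(3)) (use P in simp_all)
    moreover have "cpt (rwhisk RD (Lam S) ?TF) P = cpt (Lam S) ?FP"
      by (subst rwhisk_RD_simps(3)) (use P in simp_all)
    ultimately show "cpt (lwhisk RD ?TTF (Lam R)) P = cpt (rwhisk RD (Lam S) ?TF) P"
      by (simp only:)
  qed
  have u: "rwhisk RD (Lam R) (unit_eq pr R) = rd2_id (rd1_comp (unit_eq pr (TD R)) (unit_eq pr R))"
    if R [simp]: "relational_doctrine R" for R
  proof (rule rd2_eqI)
    show s: "Sarr (rwhisk RD (Lam R) (unit_eq pr R)) = Sarr (rd2_id (rd1_comp (unit_eq pr (TD R)) (unit_eq pr R)))"
      using un[of "unit_eq pr R" R "TD R"] by simp
    fix X assume "X \<in> Obj (Dom (Sarr (rwhisk RD (Lam R) (unit_eq pr R))))"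
    then have X: "X \<in> Obj R" by simp
    let ?P = "omap (unit_eq pr R) X"
    interpret T: relational_doctrine "TD (TD R)" by simp
    have P: "?P \<in> qObj pr R" using X by simp
    have o: "omap (E1 (Q1 pr (unit_eq pr R))) ?P = omap (unit_eq pr (TD R)) ?P"
      using arg_cong[OF s, of "\<lambda>F. omap F X"] X by (simp add: rd1_comp_def)
    have q: "omap (unit_eq pr (TD R)) ?P \<in> Obj (TD (TD R))" using rd_arrow.omap_Obj[of "unit_eq pr (TD R)" ?P] P by simp
    let ?Q = "omap (unit_eq pr (TD R)) ?P"
    have i: "amap (mult_eq pr R) ?Q ?Q (Idn (TD (TD R)) ?Q) = Idn (TD R) ?P"
      using rd_arrow.amap_Idn[OF rd_arrow_mult[OF R], unfolded mult_eq_sel(1,2), OF q]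
      unfolding mult_unit_maps(4)[OF R P] .
    have "cpt (Lam R) ?P = Idn (TD (TD R)) ?Q"
      using mult_faithful[OF R Lam_cpt(1)[OF R P, unfolded o] T.Idn_Hom[OF q]] Lam_cpt(2)[OF R P, unfolded o] i by metis
    then show "cpt (rwhisk RD (Lam R) (unit_eq pr R)) X = cpt (rd2_id (rd1_comp (unit_eq pr (TD R)) (unit_eq pr R))) X"
      using X by simp
  qed simp_all
  have m: "lwhisk RD (mult_eq pr R) (Lam R) = rd2_id (rd1_id (TD R))" if R [simp]: "relational_doctrine R" for R
  proof (rule rd2_eqI)
    fix P assume "P \<in> Obj (Dom (Sarr (lwhisk RD (mult_eq pr R) (Lam R))))"
    then have P: "P \<in> qObj pr R" by simp
    then show "cpt (lwhisk RD (mult_eq pr R) (Lam R)) P = cpt (rd2_id (rd1_id (TD R))) P"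
      using Lam_cpt(2)[OF R P] by simp
  qed (simp_all add: mult_T_unit_eq mult_unit_eq)
  show ?thesis
    unfolding lax_idempotent_def using two_monad_T nat u m
    by (auto simp: hom1_def hom2_def intro!: exI[of _ Lam])
qed

end

section \<open>Structures with invertible unit\<close>

text \<open>The part of a pseudoalgebra from which membership in EQRD follows: \<open>\<theta> : 1 \<Rightarrow> a \<eta>\<close> turns the
  quotients that \<open>T R\<close> has into quotients of \<open>R\<close>.\<close>

locale unital_structure = pairing pr
  for pr :: "'o \<times> 'r \<Rightarrow> 'o" +
  fixes R :: "('o, 'a, 'r) doctrine" and a :: "('o, 'a, 'r) rd1" and \<theta> :: "('o, 'a, 'r) rd2"
  assumes R [simp]: "relational_doctrine R"
    and a [simp]: "rd_arrow a" "Dom a = TD R" "Cod a = R"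
    and iso: "iso2 RD \<theta>" and src: "Sarr \<theta> = rd1_id R" and trg: "Tarr \<theta> = rd1_comp a (unit_eq pr R)"
begin

abbreviation eta where "eta X \<equiv> pr (X, Diag R X)"
abbreviation u where "u \<equiv> cpt \<theta>"
abbreviation aeta where "aeta X \<equiv> omap a (eta X)"

lemma unit_iso:
  obtains v where "\<And>X. X \<in> Obj R \<Longrightarrow> inverse_arrows R X (aeta X) (u X) (v X)"
    "\<And>X Y \<alpha>. \<alpha> \<in> Rel R X Y \<Longrightarrow> Reix R X Y (aeta X) (aeta Y) (u X) (u Y) (rmap a (eta X) (eta Y) \<alpha>) = \<alpha>"
    "\<And>X Y f. f \<in> Hom R X Y \<Longrightarrow> Comp R X Y (aeta Y) (u Y) f
      = Comp R X (aeta X) (aeta Y) (amap a (eta X) (eta Y) (cls (Q0 pr R) (eta X) (eta Y) f)) (u X)"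
proof -
  interpret relational_doctrine R by (rule R)
  obtain \<psi> where p: "rd_cell \<theta>" "rd_cell \<psi>" "Sarr \<psi> = Tarr \<theta>" "Tarr \<psi> = Sarr \<theta>"
    "\<And>X. X \<in> Obj (Dom (Sarr \<theta>)) \<Longrightarrow> inverse_arrows (Cod (Sarr \<theta>)) (omap (Sarr \<theta>) X) (omap (Tarr \<theta>) X) (cpt \<theta> X) (cpt \<psi> X)"
    "\<And>X Y \<alpha>. \<alpha> \<in> Rel (Dom (Sarr \<theta>)) X Y \<Longrightarrow> Reix (Cod (Sarr \<theta>)) (omap (Sarr \<theta>) X) (omap (Sarr \<theta>) Y)
       (omap (Tarr \<theta>) X) (omap (Tarr \<theta>) Y) (cpt \<theta> X) (cpt \<theta> Y) (rmap (Tarr \<theta>) X Y \<alpha>) = rmap (Sarr \<theta>) X Y \<alpha>"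
    by (rule iso2_RD_D[OF iso]) blast
  show ?thesis
  proof (rule that[of "cpt \<psi>"])
    show "inverse_arrows R X (aeta X) (u X) (cpt \<psi> X)" if "X \<in> Obj R" for X
      using p(5)[of X] that by (simp add: src trg)
    show "Reix R X Y (aeta X) (aeta Y) (u X) (u Y) (rmap a (eta X) (eta Y) \<alpha>) = \<alpha>" if "\<alpha> \<in> Rel R X Y" for X Y \<alpha>
      using p(6)[of \<alpha> X Y] that RelD[OF that] by (simp add: src trg)
    show "Comp R X Y (aeta Y) (u Y) f
      = Comp R X (aeta X) (aeta Y) (amap a (eta X) (eta Y) (cls (Q0 pr R) (eta X) (eta Y) f)) (u X)"
      if "f \<in> Hom R X Y" for X Y f
      using rd_cell_natural[OF p(1), of f R X Y, OF _ src trg] that HomD[OF that] by simp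
  qed
qed

text \<open>Arrows equal up to \<open>\<approx>\<close> have the same image under the unit, hence under \<open>a \<eta>\<close>, and \<open>a \<eta> \<cong> 1\<close> is faithful.\<close>

lemma extensional_R: "extensional_doctrine R"
  unfolding extensional_doctrine_def
proof (intro allI ballI impI)
  interpret relational_doctrine R by (rule R)
  interpret Q: relational_doctrine "Q0 pr R" by simp
  fix X Y f g assume f: "f \<in> Hom R X Y" and g: "g \<in> Hom R X Y" and fg: "approx R X Y f g"
  obtain v where v: "\<And>X. X \<in> Obj R \<Longrightarrow> inverse_arrows R X (aeta X) (u X) (v X)"
    "\<And>X Y f. f \<in> Hom R X Y \<Longrightarrow> Comp R X Y (aeta Y) (u Y) f
      = Comp R X (aeta X) (aeta Y) (amap a (eta X) (eta Y) (cls (Q0 pr R) (eta X) (eta Y) f)) (u X)"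
    by (rule unit_iso) blast
  have O: "X \<in> Obj R" "Y \<in> Obj R" using f by auto
  note I [simp] = inverse_arrowsD[OF v(1)[OF O(2)]]
  have "cls (Q0 pr R) (eta X) (eta Y) f = cls (Q0 pr R) (eta X) (eta Y) g"
    by (rule Q.cls_eqI) (use f g fg in \<open>simp_all add: approx_def\<close>)
  then have e: "Comp R X Y (aeta Y) (u Y) f = Comp R X Y (aeta Y) (u Y) g" using v(2) f g by simp
  have c: "Comp R X (aeta Y) Y (v Y) (Comp R X Y (aeta Y) (u Y) h) = h" if "h \<in> Hom R X Y" for h
    using Comp_assoc[OF that I(1,2)] that by simp
  show "f = g" using c[OF f] c[OF g] e by metis
qed

text \<open>In \<open>T R\<close> the arrow \<open>[id] : \<eta> X \<rightarrow> P\<close> is the quotient by \<open>\<rho>\<close>, for \<open>P = (X, \<rho>)\<close>. Its image under \<open>a\<close>, precomposed with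
  the unit isomorphism \<open>X \<cong> a (\<eta> X)\<close>, will be a quotient of \<open>X\<close> by \<open>\<rho>\<close> in \<open>R\<close>.\<close>

definition quo where
  "quo P = Comp R (ob pr P) (aeta (ob pr P)) (omap a P) (amap a (eta (ob pr P)) P (cls (Q0 pr R) (eta (ob pr P)) P (Idn R (ob pr P))))
     (u (ob pr P))"

lemma canonical:
  assumes P: "P \<in> qObj pr R"
  shows "quotient_arrow (TD R) (eta (ob pr P)) (eqv pr P) P (cls (Q0 pr R) (eta (ob pr P)) P (Idn R (ob pr P)))"
    "descent (TD R) (eta (ob pr P)) P (cls (Q0 pr R) (eta (ob pr P)) P (Idn R (ob pr P)))"
    "cls (Q0 pr R) (eta (ob pr P)) P (Idn R (ob pr P)) \<in> Hom (TD R) (eta (ob pr P)) P"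
    "Idn R (ob pr P) \<in> Hom (Q0 pr R) (eta (ob pr P)) P"
    "eqrel (Q0 pr R) (eta (ob pr P)) (eqv pr P)"
proof -
  note F = qObj_facts[OF R P]
  show e: "eqrel (Q0 pr R) (eta (ob pr P)) (eqv pr P)" using F by (simp add: Q0_eqrel)
  show c: "quotient_arrow (TD R) (eta (ob pr P)) (eqv pr P) P (cls (Q0 pr R) (eta (ob pr P)) P (Idn R (ob pr P)))"
    "descent (TD R) (eta (ob pr P)) P (cls (Q0 pr R) (eta (ob pr P)) P (Idn R (ob pr P)))"
    using canonical_quotient[OF R e refl refl] F by simp_all
  show "cls (Q0 pr R) (eta (ob pr P)) P (Idn R (ob pr P)) \<in> Hom (TD R) (eta (ob pr P)) P"
    by (rule relational_doctrine.quotient_arrowD(1)[OF _ c(1)]) simp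
  show "Idn R (ob pr P) \<in> Hom (Q0 pr R) (eta (ob pr P)) P" using Idn_Q0[OF R e] F by simp
qed

lemma quo_Hom:
  assumes P: "P \<in> qObj pr R"
  shows "quo P \<in> Hom R (ob pr P) (omap a P)"
proof -
  interpret relational_doctrine R by (rule R)
  obtain v where v: "\<And>X. X \<in> Obj R \<Longrightarrow> inverse_arrows R X (aeta X) (u X) (v X)" by (rule unit_iso) blast
  show ?thesis
    unfolding quo_def
    by (rule Comp_Hom[OF inverse_arrowsD(1)[OF v]]) (use qObj_facts[OF R P] canonical(3)[OF P] in simp_all)
qed

lemma quo_descent:
  assumes P: "P \<in> qObj pr R"
  shows "descent R (ob pr P) (omap a P) (quo P)"
proof -
  interpret relational_doctrine R by (rule R)
  obtain v where v: "\<And>X. X \<in> Obj R \<Longrightarrow> inverse_arrows R X (aeta X) (u X) (v X)" by (rule unit_iso) blast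
  have X: "ob pr P \<in> Obj R" using qObj_facts[OF R P] by simp
  show ?thesis
    unfolding quo_def
    by (rule descent_Comp[OF inverse_arrowsD(1)[OF v[OF X]] iso_descent[OF v[OF X]]])
      (use rd_arrow_descent[OF a(1)] canonical(2,3)[OF P] in simp_all)
qed

text \<open>Reindexing along \<open>[id]\<close> leaves relations unchanged, and so does \<open>a \<eta>\<close> up to the unit isomorphism.
  For \<open>\<beta> = \<rho>\<close>, which is equality on \<open>P\<close>, this computes the kernel of \<open>quo P\<close>.\<close>

lemma Reix_quo:
  assumes P: "P \<in> qObj pr R" and b: "\<beta> \<in> Rel (TD R) P P"
  shows "Reix R (ob pr P) (ob pr P) (omap a P) (omap a P) (quo P) (quo P) (rmap a P P \<beta>) = \<beta>"
proof -
  interpret relational_doctrine R by (rule R)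
  obtain v where v: "\<And>X. X \<in> Obj R \<Longrightarrow> inverse_arrows R X (aeta X) (u X) (v X)"
    "\<And>X Y \<alpha>. \<alpha> \<in> Rel R X Y \<Longrightarrow> Reix R X Y (aeta X) (aeta Y) (u X) (u Y) (rmap a (eta X) (eta Y) \<alpha>) = \<alpha>"
    by (rule unit_iso) blast
  let ?X = "ob pr P"
  note F = qObj_facts[OF R P] and c = canonical(3,4)[OF P]
  note [simp] = inverse_arrowsD(1)[OF v(1)[OF F(1)]]
  have bR: "\<beta> \<in> Rel R ?X ?X" "\<beta> \<in> Rel (Q0 pr R) P P" using b Q0_RelD(1)[OF R] by simp_all
  let ?c = "cls (Q0 pr R) (eta ?X) P (Idn R ?X)"
  have "Reix R ?X ?X (omap a P) (omap a P) (quo P) (quo P) (rmap a P P \<beta>)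
     = Reix R ?X ?X (aeta ?X) (aeta ?X) (u ?X) (u ?X) (Reix R (aeta ?X) (aeta ?X) (omap a P) (omap a P) (amap a (eta ?X) P ?c) (amap a (eta ?X) P ?c) (rmap a P P \<beta>))"
    unfolding quo_def by (rule Reix_Comp) (use b c F in simp_all)
  also have "Reix R (aeta ?X) (aeta ?X) (omap a P) (omap a P) (amap a (eta ?X) P ?c) (amap a (eta ?X) P ?c) (rmap a P P \<beta>)
     = rmap a (eta ?X) (eta ?X) (Reix (TD R) (eta ?X) (eta ?X) P P ?c ?c \<beta>)"
    using b c by (simp del: E0_simps)
  also have "Reix (TD R) (eta ?X) (eta ?X) P P ?c ?c \<beta> = \<beta>"
    using c bR by simp
  finally show ?thesis using v(2)[OF bR(1)] by simp
qed

text \<open>An arrow \<open>f : X \<rightarrow> Z\<close> whose kernel contains \<open>\<rho>\<close> is an arrow \<open>P \<rightarrow> \<eta> Z\<close> of \<open>T R\<close>; its image under \<open>a\<close>, followed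
  by the inverse of \<open>Z \<cong> a (\<eta> Z)\<close>, is the factorisation. Uniqueness holds because \<open>quo P\<close> is a descent arrow and \<open>R\<close> is
  extensional.\<close>

lemma quo_quotient:
  assumes P: "P \<in> qObj pr R"
  shows "quotient_arrow R (ob pr P) (eqv pr P) (omap a P) (quo P)"
proof -
  interpret relational_doctrine R by (rule R)
  interpret T: relational_doctrine "TD R" by simp
  obtain v where v: "\<And>X. X \<in> Obj R \<Longrightarrow> inverse_arrows R X (aeta X) (u X) (v X)"
    "\<And>X Y f. f \<in> Hom R X Y \<Longrightarrow> Comp R X Y (aeta Y) (u Y) f
      = Comp R X (aeta X) (aeta Y) (amap a (eta X) (eta Y) (cls (Q0 pr R) (eta X) (eta Y) f)) (u X)"
    by (rule unit_iso) blast
  let ?X = "ob pr P" let ?c = "cls (Q0 pr R) (eta ?X) P (Idn R ?X)"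
  note F = qObj_facts[OF R P] and c = canonical[OF P]
  have aP: "omap a P \<in> Obj R" using P by simp
  have "eqv pr P \<in> Rel (TD R) P P" using F by simp
  moreover have "rmap a P P (eqv pr P) = Diag R (omap a P)"
    using rd_arrow.rmap_Diag[OF a(1), unfolded a, of P] P by simp
  ultimately have k: "Reix R ?X ?X (omap a P) (omap a P) (quo P) (quo P) (Diag R (omap a P)) = eqv pr P"
    using Reix_quo[OF P, of "eqv pr P"] by simp
  show ?thesis
  proof (rule quotient_arrowI[OF quo_Hom[OF P]])
    show "eqv pr P \<in> Rel R ?X ?X" by (rule F)
    show "Leq R ?X ?X (eqv pr P) (Reix R ?X ?X (omap a P) (omap a P) (quo P) (quo P) (Diag R (omap a P)))"
      unfolding k by (rule F)
  next
    fix Z f assume f: "f \<in> Hom R ?X Z" and le: "Leq R ?X ?X (eqv pr P) (Reix R ?X ?X Z Z f f (Diag R Z))"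
    have Z: "Z \<in> Obj R" using f by auto
    have fP: "f \<in> Hom (Q0 pr R) P (eta Z)" using f le P Z by (simp add: Q0_Hom)
    let ?f = "cls (Q0 pr R) P (eta Z) f" and ?g = "cls (Q0 pr R) (eta ?X) (eta Z) f"
    have fT: "?f \<in> Hom (TD R) P (eta Z)" using fP by simp
    note I = inverse_arrowsD[OF v(1)[OF F(1)]] and IZ = inverse_arrowsD[OF v(1)[OF Z]]
    have "Comp (TD R) (eta ?X) P (eta Z) ?f ?c = ?g" using fP c(4) f by simp
    then have ac: "Comp R (aeta ?X) (omap a P) (aeta Z) (amap a P (eta Z) ?f) (amap a (eta ?X) P ?c) = amap a (eta ?X) (eta Z) ?g"
      using rd_arrow.amap_Comp[OF a(1), unfolded a, OF c(3) fT] by simp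
    have h: "amap a P (eta Z) ?f \<in> Hom R (omap a P) (aeta Z)" "amap a (eta ?X) P ?c \<in> Hom R (aeta ?X) (omap a P)"
      using rd_arrow.amap_Hom[OF a(1), unfolded a] fT c(3) by blast+
    have "Comp R ?X (omap a P) Z (Comp R (omap a P) (aeta Z) Z (v Z) (amap a P (eta Z) ?f)) (quo P)
       = Comp R ?X (aeta Z) Z (v Z) (Comp R ?X (omap a P) (aeta Z) (amap a P (eta Z) ?f) (quo P))"
      by (rule Comp_assoc[symmetric]) (rule quo_Hom[OF P] h IZ)+
    also have "Comp R ?X (omap a P) (aeta Z) (amap a P (eta Z) ?f) (quo P)
       = Comp R ?X (aeta ?X) (aeta Z) (amap a (eta ?X) (eta Z) ?g) (u ?X)"
      unfolding quo_def ac[symmetric] by (rule Comp_assoc) (rule h I)+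
    also have "\<dots> = Comp R ?X Z (aeta Z) (u Z) f" by (rule v(2)[OF f, symmetric])
    also have "Comp R ?X (aeta Z) Z (v Z) \<dots> = f"
      using Comp_assoc[OF f IZ(1,2)] Idn_Comp[OF f] IZ(3) by simp
    finally show "\<exists>h. h \<in> Hom R (omap a P) Z \<and> f = Comp R ?X (omap a P) Z h (quo P)"
      using Comp_Hom[OF h(1) IZ(2)] by (intro exI[of _ "Comp R (omap a P) (aeta Z) Z (v Z) (amap a P (eta Z) ?f)"]) simp
  next
    fix Z h h' assume h: "h \<in> Hom R (omap a P) Z" "h' \<in> Hom R (omap a P) Z"
      "Comp R ?X (omap a P) Z h (quo P) = Comp R ?X (omap a P) Z h' (quo P)"
    have "approx R (omap a P) Z h h'" by (rule descent_epi[OF quo_Hom[OF P] quo_descent[OF P] h])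
    then show "h = h'" using extensional_R h unfolding extensional_doctrine_def by blast
  qed
qed

lemma quo_effective:
  assumes P: "P \<in> qObj pr R"
  shows "effective R (ob pr P) (eqv pr P) (omap a P) (quo P)"
proof -
  interpret relational_doctrine R by (rule R)
  have "eqv pr P \<in> Rel (TD R) P P" using qObj_facts[OF R P] by simp
  moreover have "rmap a P P (eqv pr P) = Diag R (omap a P)"
    using rd_arrow.rmap_Diag[OF a(1), unfolded a, of P] P by simp
  ultimately show ?thesis
    using Reix_quo[OF P, of "eqv pr P"] by (simp add: effective_def kernel_Reix[OF quo_Hom[OF P]])
qed

lemma R_EQobs: "R \<in> EQobs"
proof -
  have "has_quotients R"
    unfolding has_quotients_def
  proof (intro allI impI)
    fix X \<rho> assume "eqrel R X \<rho>"
    then have "pr (X, \<rho>) \<in> qObj pr R" by simp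
    from quo_quotient[OF this] quo_effective[OF this] quo_descent[OF this]
    show "\<exists>W q. quotient_arrow R X \<rho> W q \<and> effective R X \<rho> W q \<and> descent R X W q" by auto
  qed
  then show ?thesis by (simp add: EQobs_def extensional_R)
qed

text \<open>It suffices to consider the canonical quotient \<open>[id] : (X, \<rho>) \<rightarrow> (X, \<sigma>)\<close>. Its image under \<open>a\<close>, precomposed with the
  quotient \<open>quo (X, \<rho>)\<close>, is the quotient \<open>quo (X, \<sigma>)\<close>. An arrow whose kernel contains the image of \<open>\<sigma>\<close> therefore
  factors after precomposition with \<open>quo (X, \<rho>)\<close>, which is an epimorphism.\<close>

lemma a_EQars: "a \<in> EQars"
proof -
  interpret relational_doctrine R by (rule R)
  interpret T: relational_doctrine "TD R" by simp
  have "preserves_quotients a"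
  proof (rule preserves_quotientsI[OF a(1)], unfold a)
    fix P \<sigma> assume "eqrel (TD R) P \<sigma>"
    then have e: "eqrel (Q0 pr R) P \<sigma>" by simp
    let ?X = "ob pr P" let ?W = "pr (?X, \<sigma>)" let ?q = "cls (Q0 pr R) P ?W (Idn R ?X)"
    have P: "P \<in> qObj pr R" and s: "eqrel R ?X \<sigma>" using e by (auto simp: Q0_eqrel)
    have W: "?W \<in> qObj pr R" using s by simp
    note q = canonical_quotient[OF R e refl refl]
    have qT: "?q \<in> Hom (TD R) P ?W" by (rule T.quotient_arrowD(1)[OF q(1)])
    have sT: "\<sigma> \<in> Rel (TD R) P P" using e by (simp add: eqrel_def)
    have k: "Reix (TD R) P P ?W ?W ?q ?q (Diag (TD R) ?W) = \<sigma>"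
      using q(2) T.kernel_Reix[OF qT] by (simp add: effective_def)
    have WT: "?W \<in> Obj (TD R)" using W by simp
    let ?aq = "amap a P ?W ?q"
    have aq: "?aq \<in> Hom R (omap a P) (omap a ?W)" using rd_arrow.amap_Hom[OF a(1), unfolded a, OF qT] .
    have ak: "Reix R (omap a P) (omap a P) (omap a ?W) (omap a ?W) ?aq ?aq (Diag R (omap a ?W)) = rmap a P P \<sigma>"
      using rd_arrow.rmap_Reix[OF a(1), unfolded a, OF qT qT T.Diag_Rel[OF WT]] k
        rd_arrow.rmap_Diag[OF a(1), unfolded a, OF WT] by simp
    have as: "rmap a P P \<sigma> \<in> Rel R (omap a P) (omap a P)" using rd_arrow.rmap_Rel[OF a(1), unfolded a, OF sT] .
    note cP = canonical[OF P] and cW = canonical[OF W] and QP = quo_quotient[OF P] quo_Hom[OF P]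
      and QW = quo_quotient[OF W] quo_Hom[OF W]
    obtain v where v: "\<And>X. X \<in> Obj R \<Longrightarrow> inverse_arrows R X (aeta X) (u X) (v X)" by (rule unit_iso) blast
    have X: "?X \<in> Obj R" using qObj_facts[OF R P] by simp
    have "Comp (TD R) (eta ?X) P ?W ?q (cls (Q0 pr R) (eta ?X) P (Idn R ?X)) = cls (Q0 pr R) (eta ?X) ?W (Idn R ?X)"
      using cP(4) Idn_Q0[OF R e] X by simp
    then have "Comp R (aeta ?X) (omap a P) (omap a ?W) ?aq (amap a (eta ?X) P (cls (Q0 pr R) (eta ?X) P (Idn R ?X)))
       = amap a (eta ?X) ?W (cls (Q0 pr R) (eta ?X) ?W (Idn R ?X))"
      using rd_arrow.amap_Comp[OF a(1), unfolded a, OF cP(3) qT] by simp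
    then have qq: "Comp R ?X (omap a P) (omap a ?W) ?aq (quo P) = quo ?W"
      using Comp_assoc[OF inverse_arrowsD(1)[OF v[OF X]] rd_arrow.amap_Hom[OF a(1), unfolded a, OF cP(3)] aq]
      by (simp add: quo_def)
    have rR: "eqv pr P \<in> Rel R ?X ?X" "\<sigma> \<in> Rel R ?X ?X" using qObj_facts[OF R P] eqrelD(1)[OF s] by simp_all
    have "quotient_arrow R (omap a P) (rmap a P P \<sigma>) (omap a ?W) ?aq"
    proof (rule quotient_arrowI[OF aq as])
      show "Leq R (omap a P) (omap a P) (rmap a P P \<sigma>) (Reix R (omap a P) (omap a P) (omap a ?W) (omap a ?W) ?aq ?aq (Diag R (omap a ?W)))"
        unfolding ak by (rule Leq_refl[OF as])
    next
      fix Z f assume f: "f \<in> Hom R (omap a P) Z" and le: "Leq R (omap a P) (omap a P) (rmap a P P \<sigma>) (Reix R (omap a P) (omap a P) Z Z f f (Diag R Z))"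
      have Z: "Z \<in> Obj R" using f by auto
      have fq: "Comp R ?X (omap a P) Z f (quo P) \<in> Hom R ?X Z" using f QP(2) by simp
      have "Leq R ?X ?X (Reix R ?X ?X (omap a P) (omap a P) (quo P) (quo P) (rmap a P P \<sigma>))
         (Reix R ?X ?X (omap a P) (omap a P) (quo P) (quo P) (Reix R (omap a P) (omap a P) Z Z f f (Diag R Z)))"
        by (rule Reix_mono[OF QP(2) QP(2) as _ le]) (use f Z in simp)
      then have "Leq R ?X ?X \<sigma> (Reix R ?X ?X Z Z (Comp R ?X (omap a P) Z f (quo P)) (Comp R ?X (omap a P) Z f (quo P)) (Diag R Z))"
        unfolding Reix_quo[OF P sT] using Reix_Comp[OF QP(2) f QP(2) f Diag_Rel[OF Z]] by simp
      then obtain h where h: "h \<in> Hom R (omap a ?W) Z" "Comp R ?X (omap a ?W) Z h (quo ?W) = Comp R ?X (omap a P) Z f (quo P)"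
        using quotient_factor[OF QW(1), of "Comp R ?X (omap a P) Z f (quo P)" Z] fq by auto
      have "Comp R (omap a P) (omap a ?W) Z h ?aq = f"
      proof (rule quotient_epi[OF QP(1) rR(1) _ f])
        show "Comp R ?X (omap a P) Z (Comp R (omap a P) (omap a ?W) Z h ?aq) (quo P) = Comp R ?X (omap a P) Z f (quo P)"
          using Comp_assoc[OF QP(2) aq h(1)] h(2) qq by simp
      qed (use h aq in simp)
      then show "\<exists>h. h \<in> Hom R (omap a ?W) Z \<and> f = Comp R (omap a P) (omap a ?W) Z h ?aq" using h by blast
    next
      fix Z h h' assume h: "h \<in> Hom R (omap a ?W) Z" "h' \<in> Hom R (omap a ?W) Z"
        "Comp R (omap a P) (omap a ?W) Z h ?aq = Comp R (omap a P) (omap a ?W) Z h' ?aq"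
      have "Comp R ?X (omap a ?W) Z h (quo ?W) = Comp R ?X (omap a ?W) Z h' (quo ?W)"
        using Comp_assoc[OF QP(2) aq h(1)] Comp_assoc[OF QP(2) aq h(2)] h(3) qq by simp
      then show "h = h'" using quotient_epi[OF QW(1), of h Z h'] rR h by simp
    qed
    then show "\<exists>W q. quotient_arrow (TD R) P \<sigma> W q \<and> quotient_arrow R (omap a P) (rmap a P P \<sigma>) (omap a W) (amap a P W q)"
      using q(1) by blast
  qed
  then show ?thesis by (simp add: EQars_def R_EQobs TD_EQobs)
qed

text \<open>The quotient \<open>quo (X, \<rho>)\<close> is \<open>a [id]\<close> up to the unit isomorphism, so its image under \<open>f\<close> is \<open>f a [id]\<close> up to
  an isomorphism, and \<open>[id]\<close> is a quotient in \<open>T R\<close>.\<close>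

lemma cancel:
  assumes f [simp]: "rd_arrow f" "Dom f = R" and fa: "preserves_quotients (rd1_comp f a)"
  shows "preserves_quotients f"
proof (rule preserves_quotientsI[OF f(1)], unfold f)
  interpret relational_doctrine R by (rule R)
  interpret S: relational_doctrine "Cod f" by simp
  fix X \<rho> assume e: "eqrel R X \<rho>"
  let ?P = "pr (X, \<rho>)"
  have P: "?P \<in> qObj pr R" using e by simp
  note E = eqrelD[OF e] and c = canonical[OF P, simplified] and Q = quo_quotient[OF P] quo_Hom[OF P]
  obtain v where v: "\<And>X. X \<in> Obj R \<Longrightarrow> inverse_arrows R X (aeta X) (u X) (v X)"
    "\<And>X Y \<alpha>. \<alpha> \<in> Rel R X Y \<Longrightarrow> Reix R X Y (aeta X) (aeta Y) (u X) (u Y) (rmap a (eta X) (eta Y) \<alpha>) = \<alpha>"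
    by (rule unit_iso) blast
  let ?c = "cls (Q0 pr R) (eta X) ?P (Idn R X)"
  have cT: "?c \<in> Hom (TD R) (eta X) ?P" using c by simp
  have ac: "amap a (eta X) ?P ?c \<in> Hom R (aeta X) (omap a ?P)" using rd_arrow.amap_Hom[OF a(1), unfolded a, OF cT] .
  have rT: "\<rho> \<in> Rel (TD R) (eta X) (eta X)" using c(5) by (simp add: eqrel_def)
  have ar: "rmap a (eta X) (eta X) \<rho> \<in> Rel R (aeta X) (aeta X)" using rd_arrow.rmap_Rel[OF a(1), unfolded a, OF rT] .
  note I = v(1)[OF E(2)]
  have "quotient_arrow (Cod (rd1_comp f a)) (omap (rd1_comp f a) (eta X)) (rmap (rd1_comp f a) (eta X) (eta X) \<rho>)
     (omap (rd1_comp f a) ?P) (amap (rd1_comp f a) (eta X) ?P ?c)"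
    by (rule preserves_quotientsD[OF fa]) (use c in simp_all)
  moreover have "omap (rd1_comp f a) (eta X) = omap f (aeta X)" "omap (rd1_comp f a) ?P = omap f (omap a ?P)"
    by (rule rd1_comp_simps(3), use P E in simp)+
  ultimately have "quotient_arrow (Cod f) (omap f (aeta X)) (rmap f (aeta X) (aeta X) (rmap a (eta X) (eta X) \<rho>))
     (omap f (omap a ?P)) (amap f (aeta X) (omap a ?P) (amap a (eta X) ?P ?c))"
    using rT cT by (simp del: E0_simps)
  then have "quotient_arrow (Cod f) (omap f X)
     (Reix (Cod f) (omap f X) (omap f X) (omap f (aeta X)) (omap f (aeta X)) (amap f X (aeta X) (u X)) (amap f X (aeta X) (u X))
       (rmap f (aeta X) (aeta X) (rmap a (eta X) (eta X) \<rho>)))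
     (omap f (omap a ?P)) (Comp (Cod f) (omap f X) (omap f (aeta X)) (omap f (omap a ?P))
        (amap f (aeta X) (omap a ?P) (amap a (eta X) ?P ?c)) (amap f X (aeta X) (u X)))"
    by (rule S.iso_quotient_Comp[OF _ _ rd_arrow_inverse[OF f(1), unfolded f, OF I]]) (use ar in simp)
  moreover have "Reix (Cod f) (omap f X) (omap f X) (omap f (aeta X)) (omap f (aeta X)) (amap f X (aeta X) (u X)) (amap f X (aeta X) (u X))
       (rmap f (aeta X) (aeta X) (rmap a (eta X) (eta X) \<rho>)) = rmap f X X \<rho>"
    using rd_arrow.rmap_Reix[OF f(1), unfolded f, OF inverse_arrowsD(1)[OF I] inverse_arrowsD(1)[OF I] ar] v(2)[OF E(1)] by simp
  moreover have "Comp (Cod f) (omap f X) (omap f (aeta X)) (omap f (omap a ?P))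
        (amap f (aeta X) (omap a ?P) (amap a (eta X) ?P ?c)) (amap f X (aeta X) (u X)) = amap f X (omap a ?P) (quo ?P)"
    using rd_arrow.amap_Comp[OF f(1), unfolded f, OF inverse_arrowsD(1)[OF I] ac] by (simp add: quo_def)
  ultimately have "quotient_arrow (Cod f) (omap f X) (rmap f X X \<rho>) (omap f (omap a ?P)) (amap f X (omap a ?P) (quo ?P))" by simp
  then show "\<exists>W q. quotient_arrow R X \<rho> W q \<and> quotient_arrow (Cod f) (omap f X) (rmap f X X \<rho>) (omap f W) (amap f X W q)"
    using Q by auto
qed

end

section \<open>The counit\<close>

context relational_doctrine
begin

lemma descent_Diag:
  assumes q [simp]: "q \<in> Hom R X W" and d: "descent R X W q"
  shows "Seq R W X W (Conv R X W (graph R X W q)) (graph R X W q) = Diag R W"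
proof (rule Leq_antisym)
  have [simp]: "X \<in> Obj R" "W \<in> Obj R" using HomD[OF q] by auto
  have c: "Conv R X W (graph R X W q) = Reix R W X W W (Idn R W) q (Diag R W)" by (simp add: graph_def Conv_Reix)
  show "Leq R W W (Seq R W X W (Conv R X W (graph R X W q)) (graph R X W q)) (Diag R W)"
    unfolding c unfolding graph_def
    using Seq_lax[of "Idn R W" W W q X W "Idn R W" W W "Diag R W" "Diag R W"] by simp
  show "Leq R W W (Diag R W) (Seq R W X W (Conv R X W (graph R X W q)) (graph R X W q))"
    using d by (simp add: descent_def)
  show "Seq R W X W (Conv R X W (graph R X W q)) (graph R X W q) \<in> Rel R W W" "Diag R W \<in> Rel R W W" by simp_all
qed

text \<open>Laxness of composition under reindexing becomes an equality when the middle leg is a descent arrow, since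
  then \<open>\<Gamma>\<^sub>p\<^sup>\<bottom> ; \<Gamma>\<^sub>p = d\<close>.\<close>

lemma descent_Seq:
  assumes q: "q \<in> Hom R X W" and p: "p \<in> Hom R Y V" "descent R Y V p" and r: "r \<in> Hom R Z U"
    and a: "\<alpha> \<in> Rel R W V" and b: "\<beta> \<in> Rel R V U"
  shows "Seq R X Y Z (Reix R X Y W V q p \<alpha>) (Reix R Y Z V U p r \<beta>) = Reix R X Z W U q r (Seq R W V U \<alpha> \<beta>)"
proof -
  note [simp] = q p(1) r a b
  have [simp]: "W \<in> Obj R" "V \<in> Obj R" "U \<in> Obj R" "Y \<in> Obj R" using RelD[OF a] RelD[OF b] HomD[OF p(1)] by auto
  let ?q = "graph R X W q" and ?p = "graph R Y V p" and ?r = "Conv R Z U (graph R Z U r)"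
  have "Seq R X Y V (Seq R X V Y (Seq R X W V ?q \<alpha>) (Conv R Y V ?p)) ?p = Seq R X W V ?q \<alpha>"
    using Seq_assoc[of "Seq R X W V ?q \<alpha>" X V "Conv R Y V ?p" Y ?p V] descent_Diag[OF p] by simp
  then show ?thesis by (simp add: Reix_graph Seq_assoc)
qed

text \<open>A relation that absorbs the kernels of \<open>q\<close> and \<open>p\<close> is the reindexing of \<open>\<Gamma>\<^sub>q\<^sup>\<bottom> ; \<alpha> ; \<Gamma>\<^sub>p\<close>.\<close>

lemma descent_lift:
  assumes q: "q \<in> Hom R X W" and p: "p \<in> Hom R Y V" and a: "\<alpha> \<in> Rel R X Y"
    and l: "Seq R X X Y (kernel R X W q) \<alpha> = \<alpha>" and r: "Seq R X Y Y \<alpha> (kernel R Y V p) = \<alpha>"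
  shows "\<exists>\<beta> \<in> Rel R W V. Reix R X Y W V q p \<beta> = \<alpha>"
proof (intro bexI)
  note [simp] = q p a
  have [simp]: "X \<in> Obj R" "Y \<in> Obj R" using RelD[OF a] by auto
  let ?q = "graph R X W q" and ?p = "graph R Y V p"
  let ?b = "Seq R W Y V (Seq R W X Y (Conv R X W ?q) \<alpha>) ?p"
  show "?b \<in> Rel R W V" by simp
  have "Reix R X Y W V q p ?b = Seq R X Y Y (Seq R X X Y (kernel R X W q) \<alpha>) (kernel R Y V p)"
    by (simp add: Reix_graph kernel_def Seq_assoc)
  then show "Reix R X Y W V q p ?b = \<alpha>" using l r by simp
qed

end

text \<open>The counit at \<open>S\<close>. For each \<open>P = (X, \<rho>)\<close> a quotient \<open>q P : X \<rightarrow> W P\<close> is chosen. Arrows and relations of \<open>T S\<close>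
  descend along these quotients, uniquely, to \<open>qa\<close> and \<open>qr\<close>. The equations that characterise these two also prove
  every law of the counit: both sides of a law have the same composite with, or reindexing along, the quotients.\<close>

locale chosen_quotients = pairing pr
  for pr :: "'o \<times> 'r \<Rightarrow> 'o" +
  fixes S :: "('o, 'a, 'r) doctrine"
  assumes S_EQobs: "S \<in> EQobs"
begin

lemma S [simp]: "relational_doctrine S"
  by (rule EQobsD(1)[OF S_EQobs])

sublocale relational_doctrine S by simp

definition Wq where
  "Wq P = (SOME Wq. quotient_arrow S (ob pr P) (eqv pr P) (fst Wq) (snd Wq))"

definition W where "W P = fst (Wq P)"
definition q where "q P = snd (Wq P)"

lemma q:
  assumes P: "P \<in> qObj pr S"
  shows q_quotient: "quotient_arrow S (ob pr P) (eqv pr P) (W P) (q P)"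
    and q_Hom: "q P \<in> Hom S (ob pr P) (W P)" and W_Obj: "W P \<in> Obj S"
    and q_kernel: "Reix S (ob pr P) (ob pr P) (W P) (W P) (q P) (q P) (Diag S (W P)) = eqv pr P"
    and q_descent: "descent S (ob pr P) (W P) (q P)"
proof -
  have "\<exists>V p. quotient_arrow S (ob pr P) (eqv pr P) V p"
    using qObjD(2)[OF P] EQobsD(2)[OF S_EQobs] unfolding has_quotients_def by blast
  then have "\<exists>Wq. quotient_arrow S (ob pr P) (eqv pr P) (fst Wq) (snd Wq)" by auto
  from someI_ex[OF this] show 1: "quotient_arrow S (ob pr P) (eqv pr P) (W P) (q P)"
    unfolding W_def q_def Wq_def .
  show "q P \<in> Hom S (ob pr P) (W P)" by (rule quotient_arrowD(1)[OF 1])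
  then show "W P \<in> Obj S" by auto
  show "Reix S (ob pr P) (ob pr P) (W P) (W P) (q P) (q P) (Diag S (W P)) = eqv pr P" "descent S (ob pr P) (W P) (q P)"
    by (rule quotient_effective_descent[OF EQobsD(2)[OF S_EQobs] qObjD(2)[OF P] 1])+
qed

text \<open>Extensionality of \<open>S\<close> enters here: it makes the descended arrow depend only on the class \<open>[f]\<close>.\<close>

lemma q_coequalizes:
  assumes f: "f \<in> Hom (Q0 pr S) P Q" and g: "g \<in> Hom (Q0 pr S) P Q" and fg: "approx (Q0 pr S) P Q f g"
  shows "Comp S (ob pr P) (ob pr Q) (W Q) (q Q) f = Comp S (ob pr P) (ob pr Q) (W Q) (q Q) g"
proof -
  note F = Q0_HomD[OF f] and G = Q0_HomD[OF g]
  note E = eqrelD[OF qObjD(2)[OF F(2)]] and Q = q[OF F(3)]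
  have h: "Comp S (ob pr P) (ob pr Q) (W Q) (q Q) f \<in> Hom S (ob pr P) (W Q)" "Comp S (ob pr P) (ob pr Q) (W Q) (q Q) g \<in> Hom S (ob pr P) (W Q)"
    using F(1) G(1) Q(2) by simp_all
  have "Reix S (ob pr P) (ob pr P) (W Q) (W Q) (Comp S (ob pr P) (ob pr Q) (W Q) (q Q) f) (Comp S (ob pr P) (ob pr Q) (W Q) (q Q) g) (Diag S (W Q))
      = Reix S (ob pr P) (ob pr P) (ob pr Q) (ob pr Q) f g (eqv pr Q)"
    unfolding Q(4)[symmetric] using Reix_Comp[OF F(1) Q(2) G(1) Q(2) Diag_Rel[OF Q(3)]] .
  moreover have "Leq S (ob pr P) (ob pr P) (Diag S (ob pr P)) (Reix S (ob pr P) (ob pr P) (ob pr Q) (ob pr Q) f g (eqv pr Q))"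
    using fg le_trans[OF E(3), of "Reix S (ob pr P) (ob pr P) (ob pr Q) (ob pr Q) f g (eqv pr Q)"] E F G eqrelD(1)[OF qObjD(2)[OF F(3)]]
    by (simp add: approx_def)
  ultimately have "approx S (ob pr P) (W Q) (Comp S (ob pr P) (ob pr Q) (W Q) (q Q) f) (Comp S (ob pr P) (ob pr Q) (W Q) (q Q) g)"
    by (simp add: approx_def)
  then show ?thesis using EQobsD(3)[OF S_EQobs] h unfolding extensional_doctrine_def by blast
qed

definition qa where
  "qa P Q f = (SOME h. h \<in> Hom S (W P) (W Q) \<and> Comp S (ob pr P) (W P) (W Q) h (q P) = Comp S (ob pr P) (ob pr Q) (W Q) (q Q) f)"

definition qr where
  "qr P Q \<alpha> = (SOME \<beta>. \<beta> \<in> Rel S (W P) (W Q) \<and> Reix S (ob pr P) (ob pr Q) (W P) (W Q) (q P) (q Q) \<beta> = \<alpha>)"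

lemma qa:
  assumes f: "f \<in> Hom (Q0 pr S) P Q"
  shows "qa P Q f \<in> Hom S (W P) (W Q)"
    "Comp S (ob pr P) (W P) (W Q) (qa P Q f) (q P) = Comp S (ob pr P) (ob pr Q) (W Q) (q Q) f"
proof -
  note F = Q0_HomD[OF f]
  note Q = q[OF F(3)]
  have "Comp S (ob pr P) (ob pr Q) (W Q) (q Q) f \<in> Hom S (ob pr P) (W Q)" using F Q by simp
  moreover have "Leq S (ob pr P) (ob pr P) (eqv pr P) (Reix S (ob pr P) (ob pr P) (W Q) (W Q)
      (Comp S (ob pr P) (ob pr Q) (W Q) (q Q) f) (Comp S (ob pr P) (ob pr Q) (W Q) (q Q) f) (Diag S (W Q)))"
    using F(4) unfolding Q(4)[symmetric] using Reix_Comp[OF F(1) Q(2) F(1) Q(2) Diag_Rel[OF Q(3)]] by simp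
  ultimately obtain h where "h \<in> Hom S (W P) (W Q)" "Comp S (ob pr P) (W P) (W Q) h (q P) = Comp S (ob pr P) (ob pr Q) (W Q) (q Q) f"
    using quotient_factor[OF q_quotient[OF F(2)]] by blast
  then have "\<exists>h. h \<in> Hom S (W P) (W Q) \<and> Comp S (ob pr P) (W P) (W Q) h (q P) = Comp S (ob pr P) (ob pr Q) (W Q) (q Q) f" by blast
  from someI_ex[OF this] show "qa P Q f \<in> Hom S (W P) (W Q)"
    "Comp S (ob pr P) (W P) (W Q) (qa P Q f) (q P) = Comp S (ob pr P) (ob pr Q) (W Q) (q Q) f" unfolding qa_def by simp_all
qed

lemma q_epi:
  assumes P: "P \<in> qObj pr S" and h: "h \<in> Hom S (W P) Z" "h' \<in> Hom S (W P) Z"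
    "Comp S (ob pr P) (W P) Z h (q P) = Comp S (ob pr P) (W P) Z h' (q P)"
  shows "h = h'"
  by (rule quotient_epi[OF q_quotient[OF P] eqrelD(1)[OF qObjD(2)[OF P]] h])

lemma qa_eqI:
  assumes f: "f \<in> Hom (Q0 pr S) P Q" and h: "h \<in> Hom S (W P) (W Q)"
    "Comp S (ob pr P) (W P) (W Q) h (q P) = Comp S (ob pr P) (ob pr Q) (W Q) (q Q) f"
  shows "qa P Q f = h"
  by (rule q_epi[OF Q0_HomD(2)[OF f] qa(1)[OF f] h(1) trans[OF qa(2)[OF f] h(2)[symmetric]]])

lemma qa_cls:
  assumes f: "f \<in> Hom (Q0 pr S) P Q"
  shows "qa P Q (cls (Q0 pr S) P Q f) = qa P Q f"
proof -
  interpret Q: relational_doctrine "Q0 pr S" by simp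
  note c = Q.cls_Hom[OF f] Q.cls_approx[OF f]
  show ?thesis
    by (rule qa_eqI[OF c(1) qa(1)[OF f]]) (use qa(2)[OF f] q_coequalizes[OF c(1) f c(2)] in simp)
qed

lemma qr:
  assumes a: "\<alpha> \<in> Rel (Q0 pr S) P Q"
  shows "qr P Q \<alpha> \<in> Rel S (W P) (W Q)" "Reix S (ob pr P) (ob pr Q) (W P) (W Q) (q P) (q Q) (qr P Q \<alpha>) = \<alpha>"
proof -
  note A = Q0_RelD[OF S a]
  have k: "kernel S (ob pr P) (W P) (q P) = eqv pr P" if "P \<in> qObj pr S" for P
    using kernel_Reix[OF q_Hom[OF that]] q_kernel[OF that] by simp
  have "\<exists>\<beta> \<in> Rel S (W P) (W Q). Reix S (ob pr P) (ob pr Q) (W P) (W Q) (q P) (q Q) \<beta> = \<alpha>"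
    by (rule descent_lift[OF q_Hom[OF A(2)] q_Hom[OF A(3)] A(1)]) (use a in \<open>simp_all add: k A Q0_Rel[OF S]\<close>)
  then have "\<exists>\<beta>. \<beta> \<in> Rel S (W P) (W Q) \<and> Reix S (ob pr P) (ob pr Q) (W P) (W Q) (q P) (q Q) \<beta> = \<alpha>" by blast
  from someI_ex[OF this] show "qr P Q \<alpha> \<in> Rel S (W P) (W Q)" "Reix S (ob pr P) (ob pr Q) (W P) (W Q) (q P) (q Q) (qr P Q \<alpha>) = \<alpha>"
    unfolding qr_def by simp_all
qed

lemma qr_eqI:
  assumes a: "\<alpha> \<in> Rel (Q0 pr S) P Q" and b: "\<beta> \<in> Rel S (W P) (W Q)"
    "Reix S (ob pr P) (ob pr Q) (W P) (W Q) (q P) (q Q) \<beta> = \<alpha>"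
  shows "qr P Q \<alpha> = \<beta>"
proof -
  note A = Q0_RelD[OF S a]
  show ?thesis
    by (rule descent_inj[OF q_Hom[OF A(2)] q_descent[OF A(2)] q_Hom[OF A(3)] q_descent[OF A(3)]]) (use qr[OF a] b in simp_all)
qed

definition counit_map :: "('o, 'a, 'r) rd1" where
  "counit_map = \<lparr>Dom = TD S, Cod = S, omap = (\<lambda>P \<in> qObj pr S. W P),
     amap = (\<lambda>P Q. \<lambda>f \<in> Hom (TD S) P Q. qa P Q f), rmap = (\<lambda>P Q. \<lambda>\<alpha> \<in> Rel (TD S) P Q. qr P Q \<alpha>)\<rparr>"

lemma counit_map_simps [simp]: "Dom counit_map = TD S" "Cod counit_map = S" "P \<in> qObj pr S \<Longrightarrow> omap counit_map P = W P"
  "f \<in> Hom (TD S) P Q \<Longrightarrow> amap counit_map P Q f = qa P Q f" "\<alpha> \<in> Rel (Q0 pr S) P Q \<Longrightarrow> rmap counit_map P Q \<alpha> = qr P Q \<alpha>"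
  by (simp_all add: counit_map_def)

lemma rd_arrow_counit [simp]: "rd_arrow counit_map"
proof -
  interpret Q: relational_doctrine "Q0 pr S" by simp
  interpret T: relational_doctrine "TD S" by simp
  have H: "f \<in> Hom (Q0 pr S) P Q" "P \<in> qObj pr S" "Q \<in> qObj pr S" "f \<in> Hom S (ob pr P) (ob pr Q)" if "f \<in> Hom (TD S) P Q" for f P Q
    using Hom_E0_D(1)[OF _ that] Q0_HomD[of f S P Q] by simp_all
  have L: "P \<in> qObj pr S" "Q \<in> qObj pr S" if "\<alpha> \<in> Rel (Q0 pr S) P Q" for \<alpha> P Q using Q0_RelD[OF S that] by simp_all
  show ?thesis
    unfolding rd_arrow_def rd_arrow_axioms_def
  proof (intro conjI allI impI)
    show "relational_doctrine (Dom counit_map)" "relational_doctrine (Cod counit_map)" by simp_all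
    show "omap counit_map \<in> extensional (Obj (Dom counit_map))" "amap counit_map X Y \<in> extensional (Hom (Dom counit_map) X Y)"
      "rmap counit_map X Y \<in> extensional (Rel (Dom counit_map) X Y)" for X Y by (simp_all add: counit_map_def)
    fix P assume "P \<in> Obj (Dom counit_map)"
    then have P: "P \<in> qObj pr S" by simp
    show "omap counit_map P \<in> Obj (Cod counit_map)" using P W_Obj by simp
    have I: "Idn S (ob pr P) \<in> Hom (Q0 pr S) P P" using Q.Idn_Hom[of P] P by simp
    have "qa P P (Idn S (ob pr P)) = Idn S (W P)"
      by (rule qa_eqI[OF I]) (use q[OF P] in simp_all)
    then show "amap counit_map P P (Idn (Dom counit_map) P) = Idn (Cod counit_map) (omap counit_map P)"
      using P I qa_cls[OF I] by simp
    have D: "eqv pr P \<in> Rel (Q0 pr S) P P" using Q.Diag_Rel[of P] P by simp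
    show "rmap counit_map P P (Diag (Dom counit_map) P) = Diag (Cod counit_map) (omap counit_map P)"
      using P D qr_eqI[OF D, of "Diag S (W P)"] q[OF P] by simp
  next
    fix P Q f assume "f \<in> Hom (Dom counit_map) P Q"
    then have f: "f \<in> Hom (TD S) P Q" by simp
    show "amap counit_map P Q f \<in> Hom (Cod counit_map) (omap counit_map P) (omap counit_map Q)"
      using f H[OF f] qa[of f P Q] by simp
  next
    fix P Q U f g assume "f \<in> Hom (Dom counit_map) P Q" "g \<in> Hom (Dom counit_map) Q U"
    then have f: "f \<in> Hom (TD S) P Q" and g: "g \<in> Hom (TD S) Q U" by simp_all
    note F = H[OF f] and G = H[OF g]
    have c: "Comp S (ob pr P) (ob pr Q) (ob pr U) g f \<in> Hom (Q0 pr S) P U" using Q.Comp_Hom[OF F(1) G(1)] by simp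
    have "qa P U (Comp S (ob pr P) (ob pr Q) (ob pr U) g f) = Comp S (W P) (W Q) (W U) (qa Q U g) (qa P Q f)"
    proof (rule qa_eqI[OF c])
      show "Comp S (W P) (W Q) (W U) (qa Q U g) (qa P Q f) \<in> Hom S (W P) (W U)" using qa[OF F(1)] qa[OF G(1)] by simp
      have "Comp S (ob pr P) (W P) (W U) (Comp S (W P) (W Q) (W U) (qa Q U g) (qa P Q f)) (q P)
         = Comp S (ob pr P) (W Q) (W U) (qa Q U g) (Comp S (ob pr P) (W P) (W Q) (qa P Q f) (q P))"
        by (rule Comp_assoc[symmetric]) (rule q_Hom F(2) qa(1) F(1) G(1))+
      also have "\<dots> = Comp S (ob pr P) (ob pr Q) (W U) (Comp S (ob pr Q) (W Q) (W U) (qa Q U g) (q Q)) f"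
        unfolding qa(2)[OF F(1)] by (rule Comp_assoc) (rule q_Hom F(3,4) qa(1) G(1))+
      also have "\<dots> = Comp S (ob pr P) (ob pr U) (W U) (q U) (Comp S (ob pr P) (ob pr Q) (ob pr U) g f)"
        unfolding qa(2)[OF G(1)] by (rule Comp_assoc[symmetric]) (rule q_Hom F(4) G(3,4))+
      finally show "Comp S (ob pr P) (W P) (W U) (Comp S (W P) (W Q) (W U) (qa Q U g) (qa P Q f)) (q P)
         = Comp S (ob pr P) (ob pr U) (W U) (q U) (Comp S (ob pr P) (ob pr Q) (ob pr U) g f)" .
    qed
    then show "amap counit_map P U (Comp (Dom counit_map) P Q U g f)
        = Comp (Cod counit_map) (omap counit_map P) (omap counit_map Q) (omap counit_map U) (amap counit_map Q U g) (amap counit_map P Q f)"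
      using f g F G T.Comp_Hom[OF f g] qa_cls[OF c] by simp
  next
    fix P Q \<alpha> assume "\<alpha> \<in> Rel (Dom counit_map) P Q"
    then have a: "\<alpha> \<in> Rel (Q0 pr S) P Q" by simp
    show "rmap counit_map P Q \<alpha> \<in> Rel (Cod counit_map) (omap counit_map P) (omap counit_map Q)" using a L[OF a] qr[OF a] by simp
    have c: "Conv S (ob pr P) (ob pr Q) \<alpha> \<in> Rel (Q0 pr S) Q P" using Q.Conv_Rel[OF a] by simp
    have "qr Q P (Conv S (ob pr P) (ob pr Q) \<alpha>) = Conv S (W P) (W Q) (qr P Q \<alpha>)"
      by (rule qr_eqI[OF c]) (use qr[OF a] Conv_Reix[OF q_Hom[OF L(1)[OF a]] q_Hom[OF L(2)[OF a]] qr(1)[OF a]] in simp_all)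
    then show "rmap counit_map Q P (Conv (Dom counit_map) P Q \<alpha>) = Conv (Cod counit_map) (omap counit_map P) (omap counit_map Q) (rmap counit_map P Q \<alpha>)"
      using a c L[OF a] by simp
  next
    fix \<alpha> \<beta> P Q assume "\<alpha> \<in> Rel (Dom counit_map) P Q" "\<beta> \<in> Rel (Dom counit_map) P Q" "Leq (Dom counit_map) P Q \<alpha> \<beta>"
    then have a: "\<alpha> \<in> Rel (Q0 pr S) P Q" and b: "\<beta> \<in> Rel (Q0 pr S) P Q" and le: "Leq S (ob pr P) (ob pr Q) \<alpha> \<beta>" by simp_all
    note P = L[OF a]
    have "Leq S (W P) (W Q) (qr P Q \<alpha>) (qr P Q \<beta>)"
      by (rule descent_reflects[OF q_Hom[OF P(1)] q_descent[OF P(1)] q_Hom[OF P(2)] q_descent[OF P(2)] qr(1)[OF a] qr(1)[OF b]])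
        (use qr(2)[OF a] qr(2)[OF b] le in simp)
    then show "Leq (Cod counit_map) (omap counit_map P) (omap counit_map Q) (rmap counit_map P Q \<alpha>) (rmap counit_map P Q \<beta>)"
      using a b P by simp
  next
    fix P Q U \<alpha> \<beta> assume "\<alpha> \<in> Rel (Dom counit_map) P Q" "\<beta> \<in> Rel (Dom counit_map) Q U"
    then have a: "\<alpha> \<in> Rel (Q0 pr S) P Q" and b: "\<beta> \<in> Rel (Q0 pr S) Q U" by simp_all
    note P = L[OF a] and U = L[OF b]
    have c: "Seq S (ob pr P) (ob pr Q) (ob pr U) \<alpha> \<beta> \<in> Rel (Q0 pr S) P U" using Q.Seq_Rel[OF a b] by simp
    have "qr P U (Seq S (ob pr P) (ob pr Q) (ob pr U) \<alpha> \<beta>) = Seq S (W P) (W Q) (W U) (qr P Q \<alpha>) (qr Q U \<beta>)"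
      by (rule qr_eqI[OF c])
        (use qr[OF a] qr[OF b] descent_Seq[OF q_Hom[OF P(1)] q_Hom[OF P(2)] q_descent[OF P(2)] q_Hom[OF U(2)] qr(1)[OF a] qr(1)[OF b]] in simp_all)
    then show "rmap counit_map P U (Seq (Dom counit_map) P Q U \<alpha> \<beta>)
       = Seq (Cod counit_map) (omap counit_map P) (omap counit_map Q) (omap counit_map U) (rmap counit_map P Q \<alpha>) (rmap counit_map Q U \<beta>)"
      using a b c P U by simp
  next
    fix P Q A B f g \<alpha> assume "f \<in> Hom (Dom counit_map) P A" "g \<in> Hom (Dom counit_map) Q B" "\<alpha> \<in> Rel (Dom counit_map) A B"
    then have f: "f \<in> Hom (TD S) P A" and g: "g \<in> Hom (TD S) Q B" and a: "\<alpha> \<in> Rel (Q0 pr S) A B" by simp_all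
    note F = H[OF f] and G = H[OF g] and A = q_Hom[OF L(1)[OF a]] q_Hom[OF L(2)[OF a]]
    have c: "Reix S (ob pr P) (ob pr Q) (ob pr A) (ob pr B) f g \<alpha> \<in> Rel (Q0 pr S) P Q" using Q.Reix_Rel[OF F(1) G(1) a] by simp
    have "qr P Q (Reix S (ob pr P) (ob pr Q) (ob pr A) (ob pr B) f g \<alpha>) = Reix S (W P) (W Q) (W A) (W B) (qa P A f) (qa Q B g) (qr A B \<alpha>)"
    proof (rule qr_eqI[OF c])
      show "Reix S (W P) (W Q) (W A) (W B) (qa P A f) (qa Q B g) (qr A B \<alpha>) \<in> Rel S (W P) (W Q)"
        using qa[OF F(1)] qa[OF G(1)] qr[OF a] by simp
      have "Reix S (ob pr P) (ob pr Q) (W P) (W Q) (q P) (q Q) (Reix S (W P) (W Q) (W A) (W B) (qa P A f) (qa Q B g) (qr A B \<alpha>))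
         = Reix S (ob pr P) (ob pr Q) (W A) (W B) (Comp S (ob pr P) (W P) (W A) (qa P A f) (q P)) (Comp S (ob pr Q) (W Q) (W B) (qa Q B g) (q Q)) (qr A B \<alpha>)"
        by (rule Reix_Comp[symmetric]) (rule q_Hom F(2) G(2) qa(1) F(1) G(1) qr(1) a)+
      also have "\<dots> = Reix S (ob pr P) (ob pr Q) (ob pr A) (ob pr B) f g (Reix S (ob pr A) (ob pr B) (W A) (W B) (q A) (q B) (qr A B \<alpha>))"
        unfolding qa(2)[OF F(1)] qa(2)[OF G(1)] by (rule Reix_Comp) (rule A F(4) G(4) qr(1) a)+
      finally show "Reix S (ob pr P) (ob pr Q) (W P) (W Q) (q P) (q Q) (Reix S (W P) (W Q) (W A) (W B) (qa P A f) (qa Q B g) (qr A B \<alpha>))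
         = Reix S (ob pr P) (ob pr Q) (ob pr A) (ob pr B) f g \<alpha>" unfolding qr(2)[OF a] .
    qed
    then show "rmap counit_map P Q (Reix (Dom counit_map) P Q A B f g \<alpha>)
       = Reix (Cod counit_map) (omap counit_map P) (omap counit_map Q) (omap counit_map A) (omap counit_map B)
           (amap counit_map P A f) (amap counit_map Q B g) (rmap counit_map A B \<alpha>)"
      using f g a c F G L[OF a] by simp
  qed
qed

text \<open>The quotient of \<open>X\<close> by equality is an isomorphism.\<close>

definition counit_iso :: "('o, 'a, 'r) rd2" where
  "counit_iso = \<lparr>Sarr = rd1_id S, Tarr = rd1_comp counit_map (unit_eq pr S), cpt = (\<lambda>X \<in> Obj S. q (pr (X, Diag S X)))\<rparr>"

lemma counit_iso: "iso2 RD counit_iso"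
proof -
  let ?F = "rd1_id S" and ?G = "rd1_comp counit_map (unit_eq pr S)"
  interpret Q: relational_doctrine "Q0 pr S" by simp
  have sel: "Sarr counit_iso = ?F" "Tarr counit_iso = ?G" "X \<in> Obj S \<Longrightarrow> cpt counit_iso X = q (pr (X, Diag S X))" for X
    by (simp_all add: counit_iso_def)
  have E: "pr (X, Diag S X) \<in> qObj pr S" if "X \<in> Obj S" for X using that by simp
  have o: "omap ?G X = W (pr (X, Diag S X))" if "X \<in> Obj S" for X using that by simp
  have r: "rmap ?G X Y \<alpha> = qr (pr (X, Diag S X)) (pr (Y, Diag S Y)) \<alpha>" if "\<alpha> \<in> Rel S X Y" for X Y \<alpha>
    using that RelD[OF that] by simp
  have R: "Reix S X Y (W (pr (X, Diag S X))) (W (pr (Y, Diag S Y))) (q (pr (X, Diag S X))) (q (pr (Y, Diag S Y)))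
      (qr (pr (X, Diag S X)) (pr (Y, Diag S Y)) \<alpha>) = \<alpha>" if "\<alpha> \<in> Rel S X Y" for X Y \<alpha>
    using qr(2)[OF unit_Rel[OF S that]] by simp
  have cell: "rd_cell counit_iso"
  proof (rule rd_cellI[of ?F ?G S S])
    fix X assume X: "X \<in> Obj S"
    then show "cpt counit_iso X \<in> Hom S (omap ?F X) (omap ?G X)" using q_Hom[OF E[OF X]] by (simp add: sel)
  next
    fix X Y f assume f: "f \<in> Hom S X Y" and X: "X \<in> Obj S" "Y \<in> Obj S"
    have fQ: "f \<in> Hom (Q0 pr S) (pr (X, Diag S X)) (pr (Y, Diag S Y))" using f by simp
    show "Comp S (omap ?F X) (omap ?F Y) (omap ?G Y) (cpt counit_iso Y) (amap ?F X Y f)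
        = Comp S (omap ?F X) (omap ?G X) (omap ?G Y) (amap ?G X Y f) (cpt counit_iso X)"
      using f X qa(2)[OF fQ] qa_cls[OF fQ] fQ by (simp add: sel)
  next
    fix X Y \<alpha> assume a: "\<alpha> \<in> Rel S X Y" and X: "X \<in> Obj S" "Y \<in> Obj S"
    then show "Leq S (omap ?F X) (omap ?F Y) (rmap ?F X Y \<alpha>)
       (Reix S (omap ?F X) (omap ?F Y) (omap ?G X) (omap ?G Y) (cpt counit_iso X) (cpt counit_iso Y) (rmap ?G X Y \<alpha>))"
      using R[OF a] by (simp add: sel r[OF a] o Leq_refl del: rd1_comp_simps)
  qed (simp_all add: counit_iso_def)
  show ?thesis
  proof (rule iso2_RD_I[OF cell])
    fix X assume "X \<in> Obj (Dom (Sarr counit_iso))"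
    then have X: "X \<in> Obj S" by (simp add: sel)
    have "quotient_arrow S X (Diag S X) (W (pr (X, Diag S X))) (q (pr (X, Diag S X)))" using q_quotient[OF E[OF X]] by simp
    from quotient_unique[OF iso_quotient[OF inverse_Idn[OF X]] this Diag_Rel[OF X]]
    obtain i j where ij: "inverse_arrows S X (W (pr (X, Diag S X))) i j" "Comp S X X (W (pr (X, Diag S X))) i (Idn S X) = q (pr (X, Diag S X))"
      by blast
    then have "i = q (pr (X, Diag S X))" using Comp_Idn[OF inverse_arrowsD(1)[OF ij(1)]] by simp
    then show "\<exists>j. inverse_arrows (Cod (Sarr counit_iso)) (omap (Sarr counit_iso) X) (omap (Tarr counit_iso) X) (cpt counit_iso X) j"
      using ij X by (auto simp: sel)
  next
    fix X Y \<alpha> assume "\<alpha> \<in> Rel (Dom (Sarr counit_iso)) X Y"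
    then have a: "\<alpha> \<in> Rel S X Y" by (simp add: sel)
    have X: "X \<in> Obj S" "Y \<in> Obj S" using RelD[OF a] by simp_all
    show "Leq (Cod (Sarr counit_iso)) (omap (Sarr counit_iso) X) (omap (Sarr counit_iso) Y)
       (Reix (Cod (Sarr counit_iso)) (omap (Sarr counit_iso) X) (omap (Sarr counit_iso) Y) (omap (Tarr counit_iso) X) (omap (Tarr counit_iso) Y)
         (cpt counit_iso X) (cpt counit_iso Y) (rmap (Tarr counit_iso) X Y \<alpha>)) (rmap (Sarr counit_iso) X Y \<alpha>)"
      using R[OF a] a X by (simp add: sel r[OF a] o Leq_refl del: rd1_comp_simps(3-5))
  qed
qed

end

section \<open>Extension of 2-arrows along the unit\<close>

context pairing
begin

text \<open>Every \<open>P = (X, \<rho>)\<close> is the quotient of \<open>\<eta> X\<close> by \<open>\<rho>\<close>, through \<open>[id]\<close>. As \<open>g\<close> preserves it, the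
  component at \<open>P\<close> is the only arrow \<open>b\<close> with \<open>b \<circ> g [id] = g' [id] \<circ> c\<^sub>X\<close>. Naturality and the inequality on
  relations hold after precomposition with, or reindexing along, the quotients \<open>g [id]\<close>, which are epimorphisms and descent
  arrows.\<close>

lemma extend_cell:
  assumes R [simp]: "relational_doctrine R" and g: "g \<in> EQars" and g': "g' \<in> EQars"
    and D: "Dom g = TD R" "Dom g' = TD R" and C: "Cod g = S" "Cod g' = S"
    and c [simp]: "rd_cell c" and cs: "Sarr c = rd1_comp g (unit_eq pr R)" and ct: "Tarr c = rd1_comp g' (unit_eq pr R)"
  shows "\<exists>!b. rd_cell b \<and> Sarr b = g \<and> Tarr b = g' \<and> rwhisk RD b (unit_eq pr R) = c"
proof -
  have G [simp]: "rd_arrow g" "rd_arrow g'" using g g' by (simp_all add: EQars_def)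
  note [simp] = D C
  have SE: "S \<in> EQobs" using g by (simp add: EQars_def)
  interpret R: relational_doctrine R by (rule R)
  interpret S: relational_doctrine S using EQobsD(1)[OF SE] .
  interpret T: relational_doctrine "TD R" by simp
  \<comment> \<open>\<open>h\<close> is the unit on objects and \<open>e P\<close> the quotient \<open>[id] : \<eta> X \<rightarrow> P\<close>.\<close>
  define h where "h X = pr (X, Diag R X)" for X
  define e where "e P = cls (Q0 pr R) (h (ob pr P)) P (Idn R (ob pr P))" for P
  have eq: "eqrel (TD R) (h (ob pr P)) (eqv pr P)" "quotient_arrow (TD R) (h (ob pr P)) (eqv pr P) P (e P)"
    "Idn R (ob pr P) \<in> Hom (Q0 pr R) (h (ob pr P)) P" "h (ob pr P) \<in> qObj pr R" if P: "P \<in> qObj pr R" for P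
  proof -
    note F = qObj_facts[OF R P]
    have 1: "eqrel (Q0 pr R) (h (ob pr P)) (eqv pr P)" using F by (simp add: Q0_eqrel h_def)
    then show "eqrel (TD R) (h (ob pr P)) (eqv pr P)" by simp
    show "quotient_arrow (TD R) (h (ob pr P)) (eqv pr P) P (e P)"
      using canonical_quotient(1)[OF R 1 refl refl] F by (simp add: e_def h_def)
    show "Idn R (ob pr P) \<in> Hom (Q0 pr R) (h (ob pr P)) P" using Idn_Q0[OF R 1] F by (simp add: h_def)
    show "h (ob pr P) \<in> qObj pr R" using F by (simp add: h_def)
  qed
  have eT: "e P \<in> Hom (TD R) (h (ob pr P)) P" if "P \<in> qObj pr R" for P by (rule T.quotient_arrowD(1)[OF eq(2)[OF that]])
  have rT: "eqv pr P \<in> Rel (TD R) (h (ob pr P)) (h (ob pr P))" if "P \<in> qObj pr R" for P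
    using eq(1)[OF that] by (simp add: eqrel_def)
  have ek: "Reix (TD R) (h (ob pr P)) (h (ob pr Q)) P Q (e P) (e Q) \<alpha> = \<alpha>" "\<alpha> \<in> Rel R (ob pr P) (ob pr Q)"
    if "P \<in> qObj pr R" "Q \<in> qObj pr R" "\<alpha> \<in> Rel (TD R) P Q" for P Q \<alpha>
    using eq(3)[OF that(1)] eq(3)[OF that(2)] that Q0_RelD(1)[OF R, of \<alpha> P Q] by (simp_all add: e_def h_def)
  \<comment> \<open>\<open>G0\<close> and \<open>G1\<close> are the images of \<open>e\<close> under \<open>g\<close> and \<open>g'\<close>; \<open>k P\<close> has to factor through \<open>G0 P\<close>.\<close>
  define G0 where "G0 P = amap g (h (ob pr P)) P (e P)" for P
  define G1 where "G1 P = amap g' (h (ob pr P)) P (e P)" for P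
  define k where "k P = Comp S (omap g (h (ob pr P))) (omap g' (h (ob pr P))) (omap g' P) (G1 P) (cpt c (ob pr P))" for P
  note am = rd_arrow.amap_Hom[OF G(1), unfolded D C] rd_arrow.amap_Hom[OF G(2), unfolded D C]
  note ac = rd_arrow.amap_Comp[OF G(1), unfolded D C] rd_arrow.amap_Comp[OF G(2), unfolded D C]
  note rr = rd_arrow.rmap_Rel[OF G(1), unfolded D C] rd_arrow.rmap_Rel[OF G(2), unfolded D C]
  note rx = rd_arrow.rmap_Reix[OF G(1), unfolded D C] rd_arrow.rmap_Reix[OF G(2), unfolded D C]
  have GH: "G0 P \<in> Hom S (omap g (h (ob pr P))) (omap g P)" "G1 P \<in> Hom S (omap g' (h (ob pr P))) (omap g' P)" if "P \<in> qObj pr R" for P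
    using am(1)[OF eT[OF that]] am(2)[OF eT[OF that]] by (simp_all add: G0_def G1_def)
  have Gq: "quotient_arrow S (omap g (h (ob pr P))) (rmap g (h (ob pr P)) (h (ob pr P)) (eqv pr P)) (omap g P) (G0 P)"
    "eqrel S (omap g (h (ob pr P))) (rmap g (h (ob pr P)) (h (ob pr P)) (eqv pr P))" if P: "P \<in> qObj pr R" for P
    using preserves_quotientsD[OF EQarsD(4)[OF g], unfolded D C, OF eq(1,2)[OF P]] rd_arrow_eqrel[OF G(1), unfolded D C, OF eq(1)[OF P]]
    by (simp_all add: G0_def)
  have Gd: "descent S (omap g (h (ob pr P))) (omap g P) (G0 P)" if "P \<in> qObj pr R" for P
    by (rule S.quotient_effective_descent(2)[OF EQobsD(2)[OF SE] Gq(2)[OF that] Gq(1)[OF that]])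
  have cH: "cpt c X \<in> Hom S (omap g (h X)) (omap g' (h X))" if "X \<in> Obj R" for X
    using rd_cell_simps(3)[OF c, of X S] that cs ct by (simp add: h_def)
  have cn: "Comp S (omap g (h X)) (omap g (h Y)) (omap g' (h Y)) (cpt c Y) (amap g (h X) (h Y) (cls (Q0 pr R) (h X) (h Y) f))
     = Comp S (omap g (h X)) (omap g' (h X)) (omap g' (h Y)) (amap g' (h X) (h Y) (cls (Q0 pr R) (h X) (h Y) f)) (cpt c X)"
    if "f \<in> Hom R X Y" for f X Y
    using rd_cell_natural[OF c, of f R X Y, OF _ cs ct, of S] that R.HomD[OF that] by (simp add: h_def)
  have cl: "Leq S (omap g (h X)) (omap g (h Y)) (rmap g (h X) (h Y) \<alpha>)
     (Reix S (omap g (h X)) (omap g (h Y)) (omap g' (h X)) (omap g' (h Y)) (cpt c X) (cpt c Y) (rmap g' (h X) (h Y) \<alpha>))"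
    if "\<alpha> \<in> Rel R X Y" for \<alpha> X Y
    using rd_cell_lax[OF c, of \<alpha> R X Y, OF _ cs ct, of S] that R.RelD[OF that] by (simp add: h_def)
  have kH: "k P \<in> Hom S (omap g (h (ob pr P))) (omap g' P)" if P: "P \<in> qObj pr R" for P
    unfolding k_def by (rule S.Comp_Hom[OF cH GH(2)[OF P]]) (rule qObj_facts[OF R P])
  have kR: "Leq S (omap g (h (ob pr P))) (omap g (h (ob pr Q))) (rmap g (h (ob pr P)) (h (ob pr Q)) \<alpha>)
      (Reix S (omap g (h (ob pr P))) (omap g (h (ob pr Q))) (omap g' P) (omap g' Q) (k P) (k Q) (rmap g' P Q \<alpha>))"
    if P: "P \<in> qObj pr R" and Q: "Q \<in> qObj pr R" and a: "\<alpha> \<in> Rel (TD R) P Q" for P Q \<alpha>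
  proof -
    have "Reix S (omap g (h (ob pr P))) (omap g (h (ob pr Q))) (omap g' P) (omap g' Q) (k P) (k Q) (rmap g' P Q \<alpha>)
      = Reix S (omap g (h (ob pr P))) (omap g (h (ob pr Q))) (omap g' (h (ob pr P))) (omap g' (h (ob pr Q))) (cpt c (ob pr P)) (cpt c (ob pr Q))
          (Reix S (omap g' (h (ob pr P))) (omap g' (h (ob pr Q))) (omap g' P) (omap g' Q) (G1 P) (G1 Q) (rmap g' P Q \<alpha>))"
      unfolding k_def by (rule S.Reix_Comp) (rule cH GH P Q rr a qObj_facts(1)[OF R])+
    also have "Reix S (omap g' (h (ob pr P))) (omap g' (h (ob pr Q))) (omap g' P) (omap g' Q) (G1 P) (G1 Q) (rmap g' P Q \<alpha>)
       = rmap g' (h (ob pr P)) (h (ob pr Q)) \<alpha>"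
      using rx(2)[OF eT[OF P] eT[OF Q] a] ek(1)[OF P Q a] by (simp add: G1_def)
    finally show ?thesis using cl[OF ek(2)[OF P Q a]] by simp
  qed
  \<comment> \<open>By \<open>kR\<close> for the relation \<open>\<rho>\<close> itself, the kernel of \<open>k P\<close> contains the relation that \<open>G0 P\<close> divides out.\<close>
  define b where "b P = (SOME x. x \<in> Hom S (omap g P) (omap g' P) \<and> Comp S (omap g (h (ob pr P))) (omap g P) (omap g' P) x (G0 P) = k P)" for P
  have b: "b P \<in> Hom S (omap g P) (omap g' P)" "Comp S (omap g (h (ob pr P))) (omap g P) (omap g' P) (b P) (G0 P) = k P"
    if P: "P \<in> qObj pr R" for P
  proof -
    have D: "eqv pr P \<in> Rel (TD R) P P" using qObj_facts[OF R P] by simp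
    have "rmap g' P P (eqv pr P) = Diag S (omap g' P)"
      using rd_arrow.rmap_Diag[OF G(2), unfolded D C, of P] P D by simp
    then have "Leq S (omap g (h (ob pr P))) (omap g (h (ob pr P))) (rmap g (h (ob pr P)) (h (ob pr P)) (eqv pr P))
      (Reix S (omap g (h (ob pr P))) (omap g (h (ob pr P))) (omap g' P) (omap g' P) (k P) (k P) (Diag S (omap g' P)))"
      using kR[OF P P D] by simp
    then have "\<exists>x. x \<in> Hom S (omap g P) (omap g' P) \<and> Comp S (omap g (h (ob pr P))) (omap g P) (omap g' P) x (G0 P) = k P"
      using S.quotient_factor[OF Gq(1)[OF P] kH[OF P]] by blast
    from someI_ex[OF this] show "b P \<in> Hom S (omap g P) (omap g' P)" "Comp S (omap g (h (ob pr P))) (omap g P) (omap g' P) (b P) (G0 P) = k P"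
      unfolding b_def by simp_all
  qed
  have epi: "x = y" if "P \<in> qObj pr R" "x \<in> Hom S (omap g P) Z" "y \<in> Hom S (omap g P) Z"
    "Comp S (omap g (h (ob pr P))) (omap g P) Z x (G0 P) = Comp S (omap g (h (ob pr P))) (omap g P) Z y (G0 P)" for P Z x y
    by (rule S.quotient_epi[OF Gq(1)[OF that(1)] S.eqrelD(1)[OF Gq(2)[OF that(1)]] that(2-4)])
  let ?b = "\<lparr>Sarr = g, Tarr = g', cpt = (\<lambda>P \<in> qObj pr R. b P)\<rparr>"
  have bc: "rd_cell ?b"
  proof (rule rd_cellI[of g g' "TD R" S])
    fix P assume "P \<in> Obj (TD R)"
    then show "cpt ?b P \<in> Hom S (omap g P) (omap g' P)" using b[of P] by simp
  next
    fix P Q f assume f: "f \<in> Hom (TD R) P Q" and "P \<in> Obj (TD R)" "Q \<in> Obj (TD R)"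
    then have P: "P \<in> qObj pr R" and Q: "Q \<in> qObj pr R" by simp_all
    let ?X = "ob pr P" and ?Y = "ob pr Q"
    have fQ: "f \<in> Hom (Q0 pr R) P Q" "f \<in> Hom R ?X ?Y" "cls (Q0 pr R) P Q f = f" using Hom_E0_D[OF _ f] by (simp_all add: Q0_Hom)
    let ?f = "cls (Q0 pr R) (h ?X) (h ?Y) f"
    have fh: "f \<in> Hom (Q0 pr R) (h ?X) (h ?Y)" using fQ by (simp add: h_def)
    then have fT: "?f \<in> Hom (TD R) (h ?X) (h ?Y)" by simp
    have "Comp R ?X ?X ?Y f (Idn R ?X) = Comp R ?X ?Y ?Y (Idn R ?Y) f" using fQ by simp
    moreover have "Comp (TD R) (h ?X) P Q f (e P) = cls (Q0 pr R) (h ?X) Q (Comp R ?X ?X ?Y f (Idn R ?X))"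
      using cls_Q_Comp(3)[OF R eq(3)[OF P] fQ(1) refl refl refl] by (simp add: e_def h_def)
    moreover have "Comp (TD R) (h ?X) (h ?Y) Q (e Q) ?f = cls (Q0 pr R) (h ?X) Q (Comp R ?X ?Y ?Y (Idn R ?Y) f)"
      using cls_Q_Comp(1)[OF R fh eq(3)[OF Q] refl refl refl] by (simp add: e_def h_def)
    ultimately have sq: "Comp (TD R) (h ?X) P Q f (e P) = Comp (TD R) (h ?X) (h ?Y) Q (e Q) ?f" by simp
    let ?g = "omap g" and ?g' = "omap g'"
    have s0: "Comp S (?g (h ?X)) (?g P) (?g Q) (amap g P Q f) (G0 P) = Comp S (?g (h ?X)) (?g (h ?Y)) (?g Q) (G0 Q) (amap g (h ?X) (h ?Y) ?f)"
      using ac(1)[OF eT[OF P] f] ac(1)[OF fT eT[OF Q]] sq by (simp add: G0_def del: E0_simps)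
    have s1: "Comp S (?g' (h ?X)) (?g' P) (?g' Q) (amap g' P Q f) (G1 P) = Comp S (?g' (h ?X)) (?g' (h ?Y)) (?g' Q) (G1 Q) (amap g' (h ?X) (h ?Y) ?f)"
      using ac(2)[OF eT[OF P] f] ac(2)[OF fT eT[OF Q]] sq by (simp add: G1_def del: E0_simps)
    note X = qObj_facts(1)[OF R P] qObj_facts(1)[OF R Q]
    note ty = b(1)[OF P] b(1)[OF Q] GH[OF P] GH[OF Q] am(1)[OF f] am(2)[OF f] am(1)[OF fT] am(2)[OF fT] cH[OF X(1)] cH[OF X(2)]
    have "Comp S (?g P) (?g Q) (?g' Q) (b Q) (amap g P Q f) = Comp S (?g P) (?g' P) (?g' Q) (amap g' P Q f) (b P)"
    proof (rule epi[OF P])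
      have "Comp S (?g (h ?X)) (?g P) (?g' Q) (Comp S (?g P) (?g Q) (?g' Q) (b Q) (amap g P Q f)) (G0 P)
          = Comp S (?g (h ?X)) (?g Q) (?g' Q) (b Q) (Comp S (?g (h ?X)) (?g P) (?g Q) (amap g P Q f) (G0 P))"
        by (rule S.Comp_assoc[symmetric]) (rule ty)+
      also have "\<dots> = Comp S (?g (h ?X)) (?g (h ?Y)) (?g' Q) (Comp S (?g (h ?Y)) (?g Q) (?g' Q) (b Q) (G0 Q)) (amap g (h ?X) (h ?Y) ?f)"
        unfolding s0 by (rule S.Comp_assoc) (rule ty)+
      also have "\<dots> = Comp S (?g (h ?X)) (?g' (h ?Y)) (?g' Q) (G1 Q) (Comp S (?g (h ?X)) (?g (h ?Y)) (?g' (h ?Y)) (cpt c ?Y) (amap g (h ?X) (h ?Y) ?f))"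
        unfolding b(2)[OF Q] k_def by (rule S.Comp_assoc[symmetric]) (rule ty)+
      also have "\<dots> = Comp S (?g (h ?X)) (?g' (h ?X)) (?g' Q) (Comp S (?g' (h ?X)) (?g' (h ?Y)) (?g' Q) (G1 Q) (amap g' (h ?X) (h ?Y) ?f)) (cpt c ?X)"
        unfolding cn[OF fQ(2)] by (rule S.Comp_assoc) (rule ty)+
      also have "\<dots> = Comp S (?g (h ?X)) (?g' P) (?g' Q) (amap g' P Q f) (Comp S (?g (h ?X)) (?g' (h ?X)) (?g' P) (G1 P) (cpt c ?X))"
        unfolding s1[symmetric] by (rule S.Comp_assoc[symmetric]) (rule ty)+
      also have "\<dots> = Comp S (?g (h ?X)) (?g P) (?g' Q) (Comp S (?g P) (?g' P) (?g' Q) (amap g' P Q f) (b P)) (G0 P)"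
        unfolding k_def[symmetric] b(2)[OF P, symmetric] by (rule S.Comp_assoc) (rule ty)+
      finally show "Comp S (?g (h ?X)) (?g P) (?g' Q) (Comp S (?g P) (?g Q) (?g' Q) (b Q) (amap g P Q f)) (G0 P)
          = Comp S (?g (h ?X)) (?g P) (?g' Q) (Comp S (?g P) (?g' P) (?g' Q) (amap g' P Q f) (b P)) (G0 P)" .
    qed (rule S.Comp_Hom ty)+
    then show "Comp S (?g P) (?g Q) (?g' Q) (cpt ?b Q) (amap g P Q f) = Comp S (?g P) (?g' P) (?g' Q) (amap g' P Q f) (cpt ?b P)"
      using P Q by simp
  next
    fix P Q \<alpha> assume a: "\<alpha> \<in> Rel (TD R) P Q" and "P \<in> Obj (TD R)" "Q \<in> Obj (TD R)"
    then have P: "P \<in> qObj pr R" and Q: "Q \<in> qObj pr R" by simp_all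
    let ?X = "ob pr P" and ?Y = "ob pr Q" let ?g = "omap g" and ?g' = "omap g'"
    let ?r = "Reix S (?g P) (?g Q) (?g' P) (?g' Q) (b P) (b Q) (rmap g' P Q \<alpha>)"
    have rS: "?r \<in> Rel S (?g P) (?g Q)" by (rule S.Reix_Rel[OF b(1)[OF P] b(1)[OF Q] rr(2)[OF a]])
    have "Reix S (?g (h ?X)) (?g (h ?Y)) (?g P) (?g Q) (G0 P) (G0 Q) (rmap g P Q \<alpha>) = rmap g (h ?X) (h ?Y) \<alpha>"
      using rx(1)[OF eT[OF P] eT[OF Q] a] ek(1)[OF P Q a] by (simp add: G0_def)
    moreover have "Reix S (?g (h ?X)) (?g (h ?Y)) (?g P) (?g Q) (G0 P) (G0 Q) ?r
        = Reix S (?g (h ?X)) (?g (h ?Y)) (?g' P) (?g' Q) (k P) (k Q) (rmap g' P Q \<alpha>)"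
      using S.Reix_Comp[OF GH(1)[OF P] b(1)[OF P] GH(1)[OF Q] b(1)[OF Q] rr(2)[OF a]] b(2)[OF P] b(2)[OF Q] by simp
    ultimately have "Leq S (?g P) (?g Q) (rmap g P Q \<alpha>) ?r"
      using kR[OF P Q a] S.descent_reflects[OF GH(1)[OF P] Gd[OF P] GH(1)[OF Q] Gd[OF Q] rr(1)[OF a] rS] by simp
    then show "Leq S (?g P) (?g Q) (rmap g P Q \<alpha>) (Reix S (?g P) (?g Q) (?g' P) (?g' Q) (cpt ?b P) (cpt ?b Q) (rmap g' P Q \<alpha>))"
      using P Q by simp
  qed simp_all
  have eh: "e (h X) = Idn (TD R) (h X)" "h X \<in> qObj pr R" "ob pr (h X) = X" if "X \<in> Obj R" for X
    using that by (simp_all add: e_def h_def)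
  have hG: "G0 (h X) = Idn S (omap g (h X))" "G1 (h X) = Idn S (omap g' (h X))" if "X \<in> Obj R" for X
    using rd_arrow.amap_Idn[OF G(1), unfolded D C, of "h X"] rd_arrow.amap_Idn[OF G(2), unfolded D C, of "h X"] eh[OF that]
    by (simp_all add: G0_def G1_def)
  \<comment> \<open>At \<open>\<eta> X\<close> the quotient \<open>e\<close> is the identity, so nothing is divided out and \<open>b\<close> is \<open>c\<close>.\<close>
  have bh: "b (h X) = cpt c X" if X: "X \<in> Obj R" for X
  proof -
    note bb = b[OF eh(2)[OF X], unfolded eh(3)[OF X]]
    have "b (h X) = k (h X)" using bb hG(1)[OF X] S.Comp_Idn[OF bb(1)] by simp
    also have "\<dots> = cpt c X" using hG(2)[OF X] eh(3)[OF X] S.Idn_Comp[OF cH[OF X]] by (simp add: k_def)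
    finally show ?thesis .
  qed
  have bw: "rwhisk RD ?b (unit_eq pr R) = c"
  proof (rule rd2_eqI)
    fix X assume "X \<in> Obj (Dom (Sarr (rwhisk RD ?b (unit_eq pr R))))"
    then have X: "X \<in> Obj R" using bc by simp
    show "cpt (rwhisk RD ?b (unit_eq pr R)) X = cpt c X"
      using bc X bh[OF X] eh(2)[OF X] by (simp add: h_def)
  qed (use bc cs ct in simp_all)
  show ?thesis
  proof (rule ex1I[of _ ?b])
    show "rd_cell ?b \<and> Sarr ?b = g \<and> Tarr ?b = g' \<and> rwhisk RD ?b (unit_eq pr R) = c" using bc bw by simp
  next
    fix d assume d: "rd_cell d \<and> Sarr d = g \<and> Tarr d = g' \<and> rwhisk RD d (unit_eq pr R) = c"
    have dc: "cpt d (h X) = cpt c X" if X: "X \<in> Obj R" for X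
    proof -
      have "cpt (rwhisk RD d (unit_eq pr R)) X = cpt d (omap (unit_eq pr R) X)"
        by (rule rwhisk_RD_simps(3)) (use d X in simp_all)
      then show ?thesis using d X by (simp add: h_def)
    qed
    show "d = ?b"
    proof (rule rd2_eqI)
      fix P assume "P \<in> Obj (Dom (Sarr d))"
      then have P: "P \<in> qObj pr R" using d by simp
      have dP: "cpt d P \<in> Hom S (omap g P) (omap g' P)" by (rule rd_cell_simps(3)) (use d P in simp_all)
      have "Comp S (omap g (h (ob pr P))) (omap g P) (omap g' P) (cpt d P) (G0 P) = k P"
        using rd_cell_natural[of d "e P" "TD R" "h (ob pr P)" P g g' S] d eT[OF P] dc[OF qObj_facts(1)[OF R P]] by (simp add: G0_def G1_def k_def)
      then have "cpt d P = b P" using epi[OF P dP b(1)[OF P]] b(2)[OF P] by simp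
      then show "cpt d P = cpt ?b P" using P by simp
    qed (use d bc in simp_all)
  qed
qed

section \<open>Monadicity of the extensional quotient completion\<close>

text \<open>The multiplication is itself a structure map with an invertible unit, namely an identity, so that
  \<open>a_EQars\<close> applies to it as well as to the counits and to the structure maps of pseudoalgebras.\<close>

lemma lax_reflection_EQRD: "lax_reflection (RD :: ('o, 'a, 'r) rdcat) EQobs EQars (T_eq pr) (unit_eq pr) (mult_eq pr)"
proof -
  interpret sub_two_category "RD :: ('o, 'a, 'r) rdcat" EQobs EQars by (rule sub_two_category_EQRD)
  interpret two_monad "RD :: ('o, 'a, 'r) rdcat" "T_eq pr" "unit_eq pr" "mult_eq pr" by (rule two_monad_T)
  have unital: "unital_structure pr X a u" if "X \<in> Ob RD" "a \<in> Ar RD" "Dm RD a = F0 (T_eq pr) X" "Cd RD a = X"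
    "iso2 RD u" "Src RD u = One RD X" "Trg RD u = a \<cdot>\<^bsub>RD\<^esub> unit_eq pr X" for X :: "('o, 'a, 'r) doctrine" and a u
    using that pairing_axioms by (simp add: unital_structure_def unital_structure_axioms_def)
  show ?thesis
  proof
    fix X :: "('o, 'a, 'r) doctrine" assume "X \<in> Ob RD"
    then have X: "relational_doctrine X" by simp
    show "F0 (T_eq pr) X \<in> EQobs" using TD_EQobs[OF X] by simp
    have "unital_structure pr X a u" if "rd_arrow a" "Dom a = TD X" "Cod a = X" "iso2 RD u" "Sarr u = rd1_id X"
       "Tarr u = rd1_comp a (unit_eq pr X)" for X :: "('o, 'a, 'r) doctrine" and a u
      using that rd_arrow_doctrine(2)[OF that(1)] pairing_axioms by (simp add: unital_structure_def unital_structure_axioms_def)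
    from this[of "mult_eq pr X" "TD X" "rd2_id (rd1_id (TD X))"]
    have "unital_structure pr (TD X) (mult_eq pr X) (rd2_id (rd1_id (TD X)))"
      using X iso2_idc[of "rd1_id (TD X)"] by (simp add: mult_unit_eq)
    then show "mult_eq pr X \<in> EQars" by (rule unital_structure.a_EQars)
  next
    fix f :: "('o, 'a, 'r) rd1" assume "f \<in> Ar RD"
    then show "F1 (T_eq pr) f \<in> EQars" using TD_arrow_EQars[of f] by simp
  next
    fix Y :: "('o, 'a, 'r) doctrine" assume Y: "Y \<in> EQobs"
    interpret chosen_quotients pr Y using Y by unfold_locales
    have i: "iso2 RD counit_iso" "Sarr counit_iso = rd1_id Y" "Tarr counit_iso = rd1_comp counit_map (unit_eq pr Y)"
      using counit_iso by (simp_all add: counit_iso_def)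
    have "unital_structure pr Y counit_map counit_iso" using i pairing_axioms by (simp add: unital_structure_def unital_structure_axioms_def)
    then have "counit_map \<in> EQars" by (rule unital_structure.a_EQars)
    then show "\<exists>a u. a \<in> EQars \<and> Dm RD a = F0 (T_eq pr) Y \<and> Cd RD a = Y
        \<and> iso2 RD u \<and> Src RD u = One RD Y \<and> Trg RD u = a \<cdot>\<^bsub>RD\<^esub> unit_eq pr Y"
      using i by (intro exI[of _ counit_map] exI[of _ counit_iso]) simp
  next
    fix X :: "('o, 'a, 'r) doctrine" and g g' c
    assume "X \<in> Ob RD" "g \<in> EQars" "g' \<in> EQars" "Dm RD g = F0 (T_eq pr) X" "Dm RD g' = F0 (T_eq pr) X"
      "Cd RD g = Cd RD g'" "c \<in> Ce RD" "Src RD c = g \<cdot>\<^bsub>RD\<^esub> unit_eq pr X" "Trg RD c = g' \<cdot>\<^bsub>RD\<^esub> unit_eq pr X"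
    then show "\<exists>!b. b \<in> Ce RD \<and> Src RD b = g \<and> Trg RD b = g' \<and> b \<lhd>\<^bsub>RD\<^esub> unit_eq pr X = c"
      using extend_cell[of X g g' "Cod g'" c] by simp
  next
    fix X :: "('o, 'a, 'r) doctrine" and a u assume "X \<in> Ob RD" "a \<in> Ar RD" "Dm RD a = F0 (T_eq pr) X" "Cd RD a = X"
    "iso2 RD u" "Src RD u = One RD X" "Trg RD u = a \<cdot>\<^bsub>RD\<^esub> unit_eq pr X"
    then show "a \<in> EQars" by (rule unital_structure.a_EQars[OF unital])
  next
    fix f :: "('o, 'a, 'r) rd1" and a u assume f: "f \<in> Ar RD" "Dm RD f \<in> EQobs" "Cd RD f \<in> EQobs" and a: "a \<in> EQars" "Dm RD a = F0 (T_eq pr) (Dm RD f)"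
      "Cd RD a = Dm RD f" and u: "iso2 RD u" "Src RD u = One RD (Dm RD f)" "Trg RD u = a \<cdot>\<^bsub>RD\<^esub> unit_eq pr (Dm RD f)"
      and fa: "f \<cdot>\<^bsub>RD\<^esub> a \<in> EQars"
    have "unital_structure pr (Dm RD f) a u"
      by (rule unital[OF _ _ a(2,3) u]) (use f EQarsD(1)[OF a(1)] in simp_all)
    then have "preserves_quotients f" by (rule unital_structure.cancel) (use f EQarsD(4)[OF fa] in simp_all)
    then show "f \<in> EQars" using f by (simp add: EQars_def)
  next
    fix t :: "('o, 'a, 'r) rd2" assume "iso2 RD t" "Src RD t \<in> EQars"
    then show "Trg RD t \<in> EQars" using EQars_replete[of t] by simp
  qed
qed

end

theorem corollary5p2:
  fixes pr :: "'o \<times> 'r \<Rightarrow> 'o"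
  assumes "inj pr"
  shows "lax_idempotent (RD :: ('o, 'a, 'r) rdcat) (T_eq pr) (unit_eq pr) (mult_eq pr)
    \<and> two_monadic (RD :: ('o, 'a, 'r) rdcat) EQRD (EQ pr) U_eq (T_eq pr) (unit_eq pr) (mult_eq pr)"
proof -
  interpret pairing pr using assms by unfold_locales
  have "EQ pr = (T_eq pr :: ('o, 'a, 'r) rdfun)" by (simp add: EQ_def T_eq_def T_e_def T_q_def)
  then show ?thesis
    using lax_idempotent_T lax_reflection.two_monadic_full_sub[OF lax_reflection_EQRD]
    by (simp add: EQRD_full_sub U_eq_def)
qed

end
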